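(* Let $D\subset\mathbb{R}^2$ be a simply connected bounded open domain with smooth boundary $\gamma=\partial D$ (a smooth simple closed plane curve) satisfying (A1) and (A2): (A1) the curvature $\kappa$ of $\gamma$ does not vanish identically on any nonempty open subset of $\gamma$, and every $p\in\gamma$ with $\kappa(p)=0$ is a simple inflection point; (A2) every straight line tangent to $\gamma$ is tangent to $\gamma$ to finite order, and is either tangent to $\gamma$ at at most two points, which are non-inflection points, or tangent to $\gamma$ at only one point, which is an inflection point. Let $\alpha>0$ and $\epsilon>0$ be constants, let $f=\alpha\chi_D$ where $\chi_D$ is the characteristic function of $D$, and let $$f_{MA}=\mathscr{R}^*\mathscr{I}^{-1}P_{MA},\qquad P_{MA}=-\ln\left(\frac{\sinh(\epsilon\,\mathscr{R}f)}{\epsilon\,\mathscr{R}f}\right).$$ Let $\mathscr{L}$ be the collection of lines $L$ which are either tangent to $\gamma$ at two non-inflection points, or tangent to $\gamma$ at only one inflection point. Then $$\operatorname{sing\,supp}(f_{MA})\subset\Big(\bigcup_{L\in\mathscr{L}}L\Big)\cup\partial D.$$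
   Context: The Radon transform of a function $f$ on $\mathbb{R}^2$ assigns to the line $\{x\in\mathbb{R}^2: x\cdot\theta=s\}$ ($s\in\mathbb{R}$, $\theta\in\mathbb{S}^1$) the integral $\mathscr{R}f(s,\theta)=\int_{x\cdot\theta=s}f\,d\mathcal{H}^1$. $\mathscr{R}^*$ is its adjoint, up to a multiplicative constant $\mathscr{R}^*g(x)=\int_0^\pi g(x\cdot\theta_\phi,\theta_\phi)\,d\phi$ with $\theta_\phi=(\cos\phi,\sin\phi)$. $\mathscr{I}^{-1}$ is the Riesz operator, a constant multiple of the Fourier multiplier $|D_s|$ in the variable $s$, normalized so that the filtered backprojection $\mathscr{R}^*\mathscr{I}^{-1}$ satisfies $\mathscr{R}^*\mathscr{I}^{-1}\mathscr{R}f=f$. The function $x\mapsto-\ln(\sinh(\epsilon x)/(\epsilon x))$ is extended smoothly by the value $0$ at $x=0$. A point $p\in\gamma$ is an inflection point if the signed curvature $\kappa$ of $\gamma$ vanishes at $p$ and changes sign across $p$. It is a simple inflection point if $\kappa$ vanishes exactly to first order at $p$; equivalently, after an affine (rigid) change of coordinates, $\gamma$ near $p=(0,0)$ is $\{(t,t^3h(t))\}$ with $h$ smooth and $h(0)\neq0$. *)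

theory Defs
  imports "HOL-Analysis.Analysis"
begin

section \<open>Smooth functions, distributions and singular supports\<close>

primrec cdiff_on :: "nat \<Rightarrow> 'a::real_normed_vector set \<Rightarrow> ('a \<Rightarrow> 'b::real_normed_vector) \<Rightarrow> bool" where
  "cdiff_on 0 U f \<longleftrightarrow> continuous_on U f"
| "cdiff_on (Suc k) U f \<longleftrightarrow>
     (\<forall>x\<in>U. f differentiable (at x)) \<and>
     (\<forall>v. cdiff_on k U (\<lambda>x. frechet_derivative f (at x) v))"

text \<open>The derivatives are taken with the unrestricted filter, so the set is meant to be open.\<close>

definition smooth_on :: "'a::real_normed_vector set \<Rightarrow> ('a \<Rightarrow> 'b::real_normed_vector) \<Rightarrow> bool" where
  "smooth_on U f \<longleftrightarrow> (\<forall>k. cdiff_on k U f)"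

definition test_function_on :: "'a::euclidean_space set \<Rightarrow> ('a \<Rightarrow> complex) \<Rightarrow> bool" where
  "test_function_on U \<psi> \<longleftrightarrow>
     smooth_on UNIV \<psi> \<and> compact (closure {x. \<psi> x \<noteq> 0}) \<and> closure {x. \<psi> x \<noteq> 0} \<subseteq> U"

text \<open>
  A distribution is represented by its action on test functions; the values of the functional on
  other functions are irrelevant.
\<close>

definition sing_supp :: "(('a::euclidean_space \<Rightarrow> complex) \<Rightarrow> complex) \<Rightarrow> 'a set" where
  "sing_supp T = - {x. \<exists>U g. open U \<and> x \<in> U \<and> smooth_on U g \<and>
     (\<forall>\<psi>. test_function_on U \<psi> \<longrightarrow> T \<psi> = (LINT y|lborel. g y * \<psi> y))}"


section \<open>Radon transform and filtered backprojection\<close>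

definition perp :: "real^2 \<Rightarrow> real^2" where
  "perp v = vector [- (v $ 2), v $ 1]"

definition dir :: "real \<Rightarrow> real^2" where
  "dir \<phi> = vector [cos \<phi>, sin \<phi>]"

text \<open>
  The one-dimensional Hausdorff measure on the line \<open>{x. x \<bullet> \<theta> = s}\<close> (with \<open>norm \<theta> = 1\<close>) is the
  arc length measure, i.e. the image of Lebesgue measure under a unit speed parametrization.
\<close>

definition line_measure :: "real \<Rightarrow> real^2 \<Rightarrow> (real^2) measure" where
  "line_measure s \<theta> = distr lborel borel (\<lambda>t. s *\<^sub>R \<theta> + t *\<^sub>R perp \<theta>)"

definition radon ::
  "(real^2 \<Rightarrow> 'b::{banach,second_countable_topology}) \<Rightarrow> real \<Rightarrow> real^2 \<Rightarrow> 'b" where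
  "radon f s \<theta> = (LINT x|line_measure s \<theta>. f x)"

definition backproj :: "(real \<Rightarrow> real^2 \<Rightarrow> complex) \<Rightarrow> real^2 \<Rightarrow> complex" where
  "backproj g x = (LINT \<phi>:{0..pi}|lborel. g (x \<bullet> dir \<phi>) (dir \<phi>))"

definition fourier :: "(real \<Rightarrow> complex) \<Rightarrow> real \<Rightarrow> complex" where
  "fourier h \<sigma> = (LINT s|lborel. cis (- (\<sigma> * s)) * h s)"

definition fourier_multiplier :: "(real \<Rightarrow> complex) \<Rightarrow> (real \<Rightarrow> complex) \<Rightarrow> real \<Rightarrow> complex" where
  "fourier_multiplier m h s =
     of_real (1 / (2 * pi)) * (LINT \<sigma>|lborel. m \<sigma> * fourier h \<sigma> * cis (\<sigma> * s))"

text \<open>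
  The Fourier slice theorem gives
  \<open>f(x) = (2\<pi>)\<^sup>-\<^sup>2 \<integral>\<^sub>0\<^sup>\<pi> \<integral> \<bar>\<sigma>\<bar> \<F>(\<R>f(\<cdot>,\<theta>\<^sub>\<phi>))(\<sigma>) exp(i \<sigma> x\<cdot>\<theta>\<^sub>\<phi>) d\<sigma> d\<phi>\<close>,
  so the filter that inverts the Radon transform together with \<^const>\<open>backproj\<close> is
  \<open>\<bar>D\<^sub>s\<bar> / (2\<pi>)\<close>.
\<close>

definition riesz :: "(real \<Rightarrow> real^2 \<Rightarrow> complex) \<Rightarrow> real \<Rightarrow> real^2 \<Rightarrow> complex" where
  "riesz h s \<theta> =
     of_real (1 / (2 * pi)) * fourier_multiplier (\<lambda>\<sigma>. of_real \<bar>\<sigma>\<bar>) (\<lambda>r. h r \<theta>) s"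

text \<open>
  Distributions on the space of lines act on the functions \<open>h(s,\<theta>)\<close> that are even, i.e.
  \<open>h(-s,-\<theta>) = h(s,\<theta>)\<close>, so half of the circle suffices in the pairing. The Riesz operator is
  symmetric for this pairing (\<open>\<bar>\<sigma>\<bar>\<close> is even in \<open>\<sigma>\<close>) and the backprojection is the transpose of the
  Radon transform; both are extended from functions to distributions by transposition.
\<close>

definition line_distr ::
  "(real \<Rightarrow> real^2 \<Rightarrow> complex) \<Rightarrow> (real \<Rightarrow> real^2 \<Rightarrow> complex) \<Rightarrow> complex" where
  "line_distr g h = (LINT \<phi>:{0..pi}|lborel. LINT s|lborel. g s (dir \<phi>) * h s (dir \<phi>))"

definition riesz_distr ::
  "((real \<Rightarrow> real^2 \<Rightarrow> complex) \<Rightarrow> complex) \<Rightarrow> (real \<Rightarrow> real^2 \<Rightarrow> complex) \<Rightarrow> complex" where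
  "riesz_distr u h = u (riesz h)"

definition backproj_distr ::
  "((real \<Rightarrow> real^2 \<Rightarrow> complex) \<Rightarrow> complex) \<Rightarrow> (real^2 \<Rightarrow> complex) \<Rightarrow> complex" where
  "backproj_distr u \<psi> = u (radon \<psi>)"

lemma line_coordinates_measure:
  assumes "norm \<theta> = 1"
  shows "distr lborel borel (\<lambda>(s, t). s *\<^sub>R \<theta> + t *\<^sub>R perp \<theta>) = (lborel :: (real^2) measure)"
proof -
  define T :: "real \<times> real \<Rightarrow> real^2" where "T = (\<lambda>(s, t). s *\<^sub>R \<theta> + t *\<^sub>R perp \<theta>)"
  define V :: "real \<times> real \<Rightarrow> real^2" where "V = (\<lambda>(s, t). vector [s, t])"
  define Q :: "real^2 \<Rightarrow> real^2" where "Q = (\<lambda>x. (x $ 1) *\<^sub>R \<theta> + (x $ 2) *\<^sub>R perp \<theta>)"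
  define R :: "real^2 \<Rightarrow> real^2" where "R = (\<lambda>x. vector [x \<bullet> \<theta>, x \<bullet> perp \<theta>])"
  have th: "\<theta> $ 1 * \<theta> $ 1 + \<theta> $ 2 * \<theta> $ 2 = 1"
    using assms by (simp add: norm_eq_1 inner_vec_def sum_2)
  have TQV: "T = Q \<circ> V"
    by (auto simp: T_def Q_def V_def fun_eq_iff)
  have a: "a * (\<theta> $ 1 * \<theta> $ 1) + a * (\<theta> $ 2 * \<theta> $ 2) = a" for a
    using th by (metis distrib_left mult.right_neutral)
  have QR: "Q (R x) = x" for x
    unfolding Q_def R_def vec_eq_iff forall_2 using a[of "x$1"] a[of "x$2"]
    by (simp add: perp_def inner_vec_def sum_2 algebra_simps)
  have RQ: "R (Q x) = x" for x
    unfolding Q_def R_def vec_eq_iff forall_2 using a[of "x$1"] a[of "x$2"]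
    by (simp add: perp_def inner_vec_def sum_2 algebra_simps)
  have linR: "linear R"
    by (auto simp: R_def linear_iff vec_eq_iff forall_2 inner_add_left)
  have nR: "norm (R x) = norm x" for x
  proof -
    have "R x \<bullet> R x = (x $ 1 * x $ 1 + x $ 2 * x $ 2) * (\<theta> $ 1 * \<theta> $ 1 + \<theta> $ 2 * \<theta> $ 2)"
      by (simp add: R_def perp_def inner_vec_def sum_2 algebra_simps)
    also have "\<dots> = x \<bullet> x" by (simp only: th) (simp add: inner_vec_def sum_2)
    finally show ?thesis by (simp add: norm_eq_sqrt_inner)
  qed
  have orth: "orthogonal_transformation R"
    by (simp add: orthogonal_transformation linR nR)
  have mV: "V \<in> borel_measurable borel"
  proof -
    have "V = (\<lambda>x. \<chi> i. if i = 1 then fst x else snd x)"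
      by (auto simp: V_def fun_eq_iff vec_eq_iff forall_2)
    moreover have "continuous_on UNIV (\<lambda>x::real \<times> real. (\<chi> i. if i = 1 then fst x else snd x)::real^2)"
    proof (intro continuous_on_vec_lambda)
      fix i :: 2
      show "continuous_on UNIV (\<lambda>x::real \<times> real. if i = 1 then fst x else snd x)"
        by (cases "i = 1") (auto intro: continuous_intros)
    qed
    ultimately show ?thesis by (simp add: borel_measurable_continuous_onI)
  qed
  have mQ: "Q \<in> borel_measurable borel"
    unfolding Q_def by (intro borel_measurable_continuous_onI continuous_intros)
  have mT: "T \<in> borel_measurable borel"
    unfolding TQV using measurable_comp[OF mV mQ] .
  have dV: "distr lborel borel V = lborel"
  proof (rule lborel_eqI[symmetric])
    fix l u :: "real^2"
    assume le: "\<And>b. b \<in> Basis \<Longrightarrow> l \<bullet> b \<le> u \<bullet> b"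
    have le': "l $ 1 \<le> u $ 1" "l $ 2 \<le> u $ 2"
      using le[of "axis 1 1"] le[of "axis 2 1"] by (auto simp: inner_axis axis_in_Basis_iff)
    have "V -` box l u = box (l $ 1, l $ 2) (u $ 1, u $ 2)"
    proof (rule set_eqI)
      fix p :: "real \<times> real"
      have "p \<in> V -` box l u \<longleftrightarrow> l $ 1 < fst p \<and> fst p < u $ 1 \<and> l $ 2 < snd p \<and> snd p < u $ 2"
        by (simp add: V_def mem_box_cart forall_2 case_prod_unfold)
      also have "\<dots> \<longleftrightarrow> p \<in> box (l $ 1, l $ 2) (u $ 1, u $ 2)"
        by (cases p) (auto simp: box_def Basis_prod_def)
      finally show "p \<in> V -` box l u \<longleftrightarrow> p \<in> box (l $ 1, l $ 2) (u $ 1, u $ 2)" .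
    qed
    then have "emeasure (distr lborel borel V) (box l u)
        = emeasure lborel (box (l $ 1, l $ 2) (u $ 1, u $ 2))"
      using mV by (simp add: emeasure_distr)
    also have "\<dots> = ennreal (\<Prod>b\<in>Basis. ((u $ 1, u $ 2) - (l $ 1, l $ 2)) \<bullet> b)"
      by (rule emeasure_lborel_box) (use le' in \<open>auto simp: Basis_prod_def\<close>)
    also have "(\<Prod>b\<in>Basis. ((u $ 1, u $ 2) - (l $ 1, l $ 2)) \<bullet> b) = (u $ 1 - l $ 1) * (u $ 2 - l $ 2)"
      by (simp add: Basis_prod_def prod.union_disjoint)
    also have "\<dots> = (\<Prod>b\<in>Basis. (u - l) \<bullet> b)"
    proof -
      have B: "(Basis :: (real^2) set) = {axis 1 1, axis 2 1}"
        by (auto simp: Basis_vec_def exhaust_2 UNIV_2)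
      have "axis 1 1 \<noteq> (axis 2 1 :: real^2)" by (simp add: axis_eq_axis)
      then show ?thesis unfolding B by (simp add: inner_axis)
    qed
    finally show "emeasure (distr lborel borel V) (box l u) = ennreal (\<Prod>b\<in>Basis. (u - l) \<bullet> b)" .
  qed simp
  have dQ: "distr lborel borel Q = lborel"
  proof (rule lborel_eqI[symmetric])
    fix l u :: "real^2"
    assume le: "\<And>b. b \<in> Basis \<Longrightarrow> l \<bullet> b \<le> u \<bullet> b"
    have pre: "Q -` box l u = R ` box l u"
      using QR RQ by (auto simp: image_iff) metis
    have ms: "Q -` box l u \<in> sets borel"
      using mQ by (metis borel_open measurable_sets_borel open_box)
    have lm: "box l u \<in> lmeasurable" by simp
    have im: "R ` box l u \<in> lmeasurable"
      using measurable_orthogonal_image[OF orth lm] .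
    have "emeasure (distr lborel borel Q) (box l u) = emeasure lborel (R ` box l u)"
      using mQ by (simp add: emeasure_distr pre)
    also have "\<dots> = emeasure lebesgue (R ` box l u)"
      using ms by (simp add: pre)
    also have "\<dots> = ennreal (measure lebesgue (R ` box l u))"
      by (rule emeasure_eq_ennreal_measure) (rule fmeasurableD2[OF im])
    also have "\<dots> = ennreal (measure lebesgue (box l u))"
      by (simp add: measure_orthogonal_image[OF orth lm])
    also have "\<dots> = ennreal (\<Prod>b\<in>Basis. (u - l) \<bullet> b)"
      using le by (simp add: measure_lborel_box)
    finally show "emeasure (distr lborel borel Q) (box l u) = ennreal (\<Prod>b\<in>Basis. (u - l) \<bullet> b)" .
  qed simp
  have "distr lborel borel T = distr (distr lborel borel V) borel Q"
    unfolding TQV using mV mQ by (simp add: distr_distr)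
  then show ?thesis by (simp add: dV dQ T_def)
qed

text \<open>The transposed backprojection extends the classical one:\<close>

lemma backproj_distr_line_distr:
  fixes g :: "real \<Rightarrow> real^2 \<Rightarrow> complex"
  assumes g: "continuous_on UNIV (\<lambda>(s, \<theta>). g s \<theta>)"
    and \<psi>: "continuous_on UNIV \<psi>" and K: "compact (closure {x. \<psi> x \<noteq> 0})"
  shows "backproj_distr (line_distr g) \<psi> = (LINT x|lborel. backproj g x * \<psi> x)"
proof -
  define K where "K = closure {x. \<psi> x \<noteq> 0}"
  have \<psi>K: "\<psi> x = 0" if "x \<notin> K" for x
    using that closure_subset[of "{x. \<psi> x \<noteq> 0}"] by (auto simp: K_def)
  have cK: "compact K" using K by (simp add: K_def)
  have ndir: "norm (dir \<phi>) = 1" for \<phi>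
    by (simp add: norm_eq_1 dir_def inner_vec_def sum_2 flip: power2_eq_square)
  have cdir: "continuous_on UNIV dir"
  proof -
    have "dir = (\<lambda>\<phi>. \<chi> i. if i = 1 then cos \<phi> else sin \<phi>)"
      by (auto simp: dir_def fun_eq_iff vec_eq_iff forall_2)
    moreover have "continuous_on UNIV (\<lambda>\<phi>::real. (\<chi> i. if i = 1 then cos \<phi> else sin \<phi>)::real^2)"
    proof (intro continuous_on_vec_lambda)
      fix i :: 2
      show "continuous_on UNIV (\<lambda>\<phi>::real. if i = 1 then cos \<phi> else sin \<phi>)"
        by (cases "i = 1") (auto intro: continuous_intros)
    qed
    ultimately show ?thesis by (simp only:)
  qed
  have dperp: "dir \<phi> \<bullet> dir \<phi> = 1" "perp (dir \<phi>) \<bullet> dir \<phi> = 0" for \<phi>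
    using ndir[of \<phi>] by (simp_all add: norm_eq_1 perp_def inner_vec_def sum_2)
  define H where "H x \<phi> = indicat_real {0..pi} \<phi> *\<^sub>R (g (x \<bullet> dir \<phi>) (dir \<phi>) * \<psi> x)" for x \<phi>
  have cG: "continuous_on UNIV (\<lambda>p::(real^2)\<times>real. g (fst p \<bullet> dir (snd p)) (dir (snd p)) * \<psi> (fst p))"
  proof -
    have "continuous_on UNIV (\<lambda>p::(real^2)\<times>real. (\<lambda>(s, \<theta>). g s \<theta>) (fst p \<bullet> dir (snd p), dir (snd p)))"
      by (rule continuous_on_compose2[OF g])
        (auto intro!: continuous_intros continuous_on_compose2[OF cdir])
    then show ?thesis
      by (auto intro!: continuous_intros continuous_on_compose2[OF \<psi>])
  qed
  have "integrable lborel (\<lambda>p. indicator (K \<times> {0..pi}) p *\<^sub>R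
      (g (fst p \<bullet> dir (snd p)) (dir (snd p)) * \<psi> (fst p)))"
    by (intro borel_integrable_compact compact_Times cK continuous_on_subset[OF cG]) auto
  also have "(\<lambda>p. indicator (K \<times> {0..pi}) p *\<^sub>R
      (g (fst p \<bullet> dir (snd p)) (dir (snd p)) * \<psi> (fst p))) = (\<lambda>(x, \<phi>). H x \<phi>)"
    by (auto simp: H_def fun_eq_iff \<psi>K indicator_def)
  finally have intH: "integrable (lborel \<Otimes>\<^sub>M lborel) (\<lambda>(x, \<phi>). H x \<phi>)"
    by (simp add: lborel_prod)
  have inner: "(LINT x|lborel. F (x \<bullet> dir \<phi>) * \<psi> x)
      = (LINT s|lborel. F s * radon \<psi> s (dir \<phi>))"
    if F: "continuous_on UNIV F" for F :: "real \<Rightarrow> complex" and \<phi>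
  proof -
    define T where "T = (\<lambda>(s, t). s *\<^sub>R dir \<phi> + t *\<^sub>R perp (dir \<phi>))"
    have cT: "continuous_on UNIV T"
      unfolding T_def case_prod_unfold by (intro continuous_intros)
    then have mT: "T \<in> borel_measurable borel" by (rule borel_measurable_continuous_onI)
    have dT: "distr lborel borel T = lborel"
      unfolding T_def by (rule line_coordinates_measure[OF ndir])
    have cFP: "continuous_on UNIV (\<lambda>x. F (x \<bullet> dir \<phi>) * \<psi> x)"
      by (intro continuous_intros continuous_on_compose2[OF F] \<psi>) auto
    then have mFP: "(\<lambda>x. F (x \<bullet> dir \<phi>) * \<psi> x) \<in> borel_measurable borel"
      by (rule borel_measurable_continuous_onI)
    have "integrable lborel (\<lambda>x. indicator K x *\<^sub>R (F (x \<bullet> dir \<phi>) * \<psi> x))"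
      by (intro borel_integrable_compact cK continuous_on_subset[OF cFP]) auto
    also have "(\<lambda>x. indicator K x *\<^sub>R (F (x \<bullet> dir \<phi>) * \<psi> x)) = (\<lambda>x. F (x \<bullet> dir \<phi>) * \<psi> x)"
      by (auto simp: fun_eq_iff indicator_def \<psi>K)
    finally have int: "integrable (distr lborel borel T) (\<lambda>x. F (x \<bullet> dir \<phi>) * \<psi> x)"
      by (simp add: dT)
    have Td: "T (s, t) \<bullet> dir \<phi> = s" for s t
      by (simp add: T_def inner_add_left dperp)
    have "(LINT x|lborel. F (x \<bullet> dir \<phi>) * \<psi> x)
        = (LINT x|distr lborel borel T. F (x \<bullet> dir \<phi>) * \<psi> x)"
      by (simp add: dT)
    also have "\<dots> = (LINT p|lborel. F (T p \<bullet> dir \<phi>) * \<psi> (T p))"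
      using mT mFP by (simp add: integral_distr)
    also have "\<dots> = (LINT p|(lborel \<Otimes>\<^sub>M lborel). F (T p \<bullet> dir \<phi>) * \<psi> (T p))"
      by (simp add: lborel_prod)
    also have "\<dots> = (LINT s|lborel. LINT t|lborel. F (T (s, t) \<bullet> dir \<phi>) * \<psi> (T (s, t)))"
    proof (rule lborel_pair.integral_fst'[symmetric])
      show "integrable (lborel \<Otimes>\<^sub>M lborel) (\<lambda>p. F (T p \<bullet> dir \<phi>) * \<psi> (T p))"
        using integrable_distr[of T lborel borel, OF _ int] mT by (simp add: lborel_prod)
    qed
    also have "\<dots> = (LINT s|lborel. F s * (LINT t|lborel. \<psi> (T (s, t))))"
      by (simp add: Td)
    also have "\<dots> = (LINT s|lborel. F s * radon \<psi> s (dir \<phi>))"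
    proof -
      have "(LINT t|lborel. \<psi> (T (s, t))) = radon \<psi> s (dir \<phi>)" for s
        unfolding radon_def line_measure_def T_def
        by (subst integral_distr)
          (auto intro!: borel_measurable_continuous_onI continuous_intros \<psi>)
      then show ?thesis by simp
    qed
    finally show ?thesis .
  qed
  have cg: "continuous_on UNIV (\<lambda>s. g s \<theta>)" for \<theta>
    using continuous_on_compose2[OF g continuous_on_Pair[OF continuous_on_id continuous_on_const]] by simp
  have "backproj_distr (line_distr g) \<psi>
      = (LINT \<phi>|lborel. indicator {0..pi} \<phi> *\<^sub>R (LINT x|lborel. g (x \<bullet> dir \<phi>) (dir \<phi>) * \<psi> x))"
    by (simp add: backproj_distr_def line_distr_def set_lebesgue_integral_def inner[OF cg])
  also have "\<dots> = (LINT \<phi>|lborel. LINT x|lborel. H x \<phi>)"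
    by (simp add: H_def)
  also have "\<dots> = (LINT x|lborel. LINT \<phi>|lborel. H x \<phi>)"
    by (rule lborel_pair.Fubini_integral[OF intH])
  also have "\<dots> = (LINT x|lborel. backproj g x * \<psi> x)"
  proof (rule Bochner_Integration.integral_cong)
    fix x
    have "(LINT \<phi>|lborel. H x \<phi>)
        = (LINT \<phi>|lborel. (indicator {0..pi} \<phi> *\<^sub>R g (x \<bullet> dir \<phi>) (dir \<phi>)) * \<psi> x)"
      by (simp only: H_def mult_scaleR_left)
    also have "\<dots> = backproj g x * \<psi> x"
      unfolding backproj_def set_lebesgue_integral_def by (rule integral_mult_left_zero)
    finally show "(LINT \<phi>|lborel. H x \<phi>) = backproj g x * \<psi> x" .
  qed simp
  finally show ?thesis .
qed

section \<open>The metal artifact\<close>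

definition log_sinhc :: "real \<Rightarrow> real \<Rightarrow> real" where
  "log_sinhc \<epsilon> x = (if x = 0 then 0 else - ln (sinh (\<epsilon> * x) / (\<epsilon> * x)))"

definition P_MA :: "real \<Rightarrow> (real^2 \<Rightarrow> real) \<Rightarrow> real \<Rightarrow> real^2 \<Rightarrow> real" where
  "P_MA \<epsilon> f s \<theta> = log_sinhc \<epsilon> (radon f s \<theta>)"

definition f_MA :: "real \<Rightarrow> (real^2 \<Rightarrow> real) \<Rightarrow> (real^2 \<Rightarrow> complex) \<Rightarrow> complex" where
  "f_MA \<epsilon> f = backproj_distr (riesz_distr (line_distr (\<lambda>s \<theta>. of_real (P_MA \<epsilon> f s \<theta>))))"


section \<open>Smooth closed plane curves\<close>

text \<open>
  A curve is given by a regular periodic parametrization \<open>c\<close> with minimal period \<open>l\<close>; a point of the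
  curve corresponds to exactly one parameter modulo \<open>l\<close>.
\<close>

abbreviation velocity :: "(real \<Rightarrow> real^2) \<Rightarrow> real \<Rightarrow> real^2" where
  "velocity c t \<equiv> vector_derivative c (at t)"

definition smooth_simple_closed_curve :: "(real \<Rightarrow> real^2) \<Rightarrow> real \<Rightarrow> bool" where
  "smooth_simple_closed_curve c l \<longleftrightarrow>
     l > 0 \<and> smooth_on UNIV c \<and> (\<forall>t. velocity c t \<noteq> 0) \<and>
     (\<forall>t. c (t + l) = c t) \<and> inj_on c {0..<l}"

definition curvature :: "(real \<Rightarrow> real^2) \<Rightarrow> real \<Rightarrow> real" where
  "curvature c t = (perp (velocity c t) \<bullet> velocity (velocity c) t) / norm (velocity c t) ^ 3"

definition inflection_at :: "(real \<Rightarrow> real^2) \<Rightarrow> real \<Rightarrow> bool" where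
  "inflection_at c t \<longleftrightarrow> curvature c t = 0 \<and>
     (\<exists>\<delta>>0. (\<forall>s\<in>{t-\<delta><..<t}. curvature c s < 0) \<and> (\<forall>s\<in>{t<..<t+\<delta>}. curvature c s > 0) \<or>
            (\<forall>s\<in>{t-\<delta><..<t}. curvature c s > 0) \<and> (\<forall>s\<in>{t<..<t+\<delta>}. curvature c s < 0))"

definition simple_inflection_at :: "(real \<Rightarrow> real^2) \<Rightarrow> real \<Rightarrow> bool" where
  "simple_inflection_at c t \<longleftrightarrow> inflection_at c t \<and> deriv (curvature c) t \<noteq> 0"

definition inflection_point :: "(real \<Rightarrow> real^2) \<Rightarrow> real^2 \<Rightarrow> bool" where
  "inflection_point c p \<longleftrightarrow> (\<exists>t. c t = p \<and> inflection_at c t)"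

definition tangent_line :: "(real \<Rightarrow> real^2) \<Rightarrow> real \<Rightarrow> (real^2) set" where
  "tangent_line c t = range (\<lambda>r. c t + r *\<^sub>R velocity c t)"

definition tangency_points :: "(real \<Rightarrow> real^2) \<Rightarrow> (real^2) set \<Rightarrow> (real^2) set" where
  "tangency_points c L = {c t | t. tangent_line c t = L}"

text \<open>
  Finite order of contact at \<open>c t\<close>: the distance of the curve from its tangent line there, up to sign
  and a positive constant factor, does not vanish to infinite order.
\<close>

definition finite_contact_at :: "(real \<Rightarrow> real^2) \<Rightarrow> real \<Rightarrow> bool" where
  "finite_contact_at c t \<longleftrightarrow>
     (\<exists>k. (deriv ^^ k) (\<lambda>s. (c s - c t) \<bullet> perp (velocity c t)) t \<noteq> 0)"

definition cond_A1 :: "(real \<Rightarrow> real^2) \<Rightarrow> bool" where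
  "cond_A1 c \<longleftrightarrow>
     (\<forall>V. openin (top_of_set (range c)) V \<and> V \<noteq> {} \<longrightarrow> (\<exists>t. c t \<in> V \<and> curvature c t \<noteq> 0)) \<and>
     (\<forall>t. curvature c t = 0 \<longrightarrow> simple_inflection_at c t)"

definition cond_A2 :: "(real \<Rightarrow> real^2) \<Rightarrow> bool" where
  "cond_A2 c \<longleftrightarrow>
     (\<forall>L. tangency_points c L \<noteq> {} \<longrightarrow>
        (\<forall>t. tangent_line c t = L \<longrightarrow> finite_contact_at c t) \<and>
        (finite (tangency_points c L) \<and> card (tangency_points c L) \<le> 2 \<and>
           (\<forall>p\<in>tangency_points c L. \<not> inflection_point c p) \<or>
         (\<exists>p. tangency_points c L = {p} \<and> inflection_point c p)))"

definition special_lines :: "(real \<Rightarrow> real^2) \<Rightarrow> (real^2) set set" where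
  "special_lines c = {L.
     (\<exists>p q. p \<noteq> q \<and> tangency_points c L = {p, q} \<and>
        \<not> inflection_point c p \<and> \<not> inflection_point c q) \<or>
     (\<exists>p. tangency_points c L = {p} \<and> inflection_point c p)}"

end

theory Submission
  imports Defs "HOL-Real_Asymp.Real_Asymp"
begin

text \<open>
  Let \<open>x0\<close> lie neither on \<open>\<partial>D\<close> nor on a special line. The Riesz operator has the kernel
  \<open>-2 / (s - x \<bullet> \<theta>)\<^sup>2\<close> away from the diagonal, so lines that stay away from \<open>x0\<close> contribute a
  smooth function near \<open>x0\<close>. Up to a constant, the lines \<open>(s, \<phi>)\<close> close to \<open>x0\<close> contribute
  the integral over \<open>\<sigma>\<close> of \<open>\<bar>\<sigma>\<bar> J(\<sigma>, x)\<close>, where \<open>J(\<sigma>, x)\<close> integrates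
  \<open>P\<^sub>M\<^sub>A exp(\<i> \<sigma> (s - x \<bullet> \<theta>))\<close> against a cutoff, and it suffices that \<open>J\<close>
  decays rapidly in \<open>\<sigma>\<close>, uniformly in \<open>x\<close>.

  A line through \<open>x0\<close> is tangent to \<open>\<partial>D\<close> in at most one point, and there to first order. Near
  it, use the coordinates \<open>(\<phi>, r)\<close> with \<open>s = h(\<phi>) + r\<close>, where \<open>s = h(\<phi>)\<close> is the tangent line of normal direction
  \<open>\<phi>\<close> at a point close to the tangency (without tangency, \<open>h\<close> describes the lines through some other
  point of the line). The chord length has a square root singularity in \<open>r\<close>, but for fixed \<open>r \<noteq> 0\<close> it is smooth
  in \<open>\<phi>\<close> with bounds uniform in \<open>r\<close>. The phase \<open>h(\<phi>) + r - x \<bullet> \<theta>\<close> has nonzero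
  derivative in \<open>\<phi>\<close>, because the point of tangency is not \<open>x0\<close>; hence repeated integration by parts in \<open>\<phi>\<close>
  gives the decay.
\<close>

text \<open>The logarithm is not linear, so \<open>P_MA\<close> is no sum of one singular term per
  tangency; all that survives is smoothness along a family of lines. One tangency of nonzero
  curvature admits such a family, its tangent lines and their parallels. Two tangencies would ask
  for two families with different slopes in \<phi>, and no single \<open>h\<close> serves both; at
  an inflection the tangency parameter is not a smooth function of \<phi>. These are the lines of
  \<open>special_lines\<close>. The slope of \<open>h\<close> at the tangent line is the position of
  the tangency along that line.

  The backprojection stops at the angles 0 and pi, and a sharp end would spoil the integrations by
  parts. Since (s, \<phi>) and (-s, \<phi> + pi) are the same line, the sharp cutoff can be traded
  for a smooth one. As \<open>f_MA\<close> is known only through its action on test functions, the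
  smooth density has to be reached by exchanging integrals. The majorant in \<sigma> comes first
  from the test function and then from the decay itself.\<close>

section \<open>Families of smooth functions with uniformly bounded derivatives\<close>

text \<open>Derivatives of order up to \<open>k\<close> are bounded on \<open>J\<close> uniformly
  over the index set. Nothing relates different indices, so a family that is singular in its index
  can still be tame. The derivative family is an existential witness rather than
  \<open>deriv\<close>, which lets each closure rule be proved by one induction. Because of the
  unrestricted filter \<open>at x\<close>, the set \<open>J\<close> is meant to be open.\<close>

primrec tame :: "nat \<Rightarrow> real set \<Rightarrow> 'i set \<Rightarrow> ('i \<Rightarrow> real \<Rightarrow> real) \<Rightarrow> bool" where
  "tame 0 J I u \<longleftrightarrow> (\<forall>i\<in>I. continuous_on J (u i)) \<and> (\<exists>C. \<forall>i\<in>I. \<forall>x\<in>J. \<bar>u i x\<bar> \<le> C)"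
| "tame (Suc k) J I u \<longleftrightarrow> (\<exists>C. \<forall>i\<in>I. \<forall>x\<in>J. \<bar>u i x\<bar> \<le> C) \<and>
     (\<exists>u'. (\<forall>i\<in>I. \<forall>x\<in>J. (u i has_field_derivative u' i x) (at x)) \<and> tame k J I u')"

lemma tame_bounded:
  assumes "tame k J I u"
  obtains C where "C > 0" "\<And>i x. i \<in> I \<Longrightarrow> x \<in> J \<Longrightarrow> \<bar>u i x\<bar> \<le> C"
proof -
  obtain C where C: "\<forall>i\<in>I. \<forall>x\<in>J. \<bar>u i x\<bar> \<le> C"
    using assms by (cases k) auto
  show ?thesis
    by (rule that[of "max C 1"]) (use C in force)+
qed

lemma tame_continuous: "tame k J I u \<Longrightarrow> i \<in> I \<Longrightarrow> continuous_on J (u i)"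
proof (cases k)
  case (Suc n)
  then show "tame k J I u \<Longrightarrow> i \<in> I \<Longrightarrow> continuous_on J (u i)"
    by (auto intro!: continuous_at_imp_continuous_on) (meson DERIV_isCont)
qed auto

lemma tame_0I:
  assumes "\<And>i. i \<in> I \<Longrightarrow> continuous_on J (u i)" "\<And>i x. i \<in> I \<Longrightarrow> x \<in> J \<Longrightarrow> \<bar>u i x\<bar> \<le> C"
  shows "tame 0 J I u"
  using assms by auto

lemma tame_SucI:
  assumes "\<And>i x. i \<in> I \<Longrightarrow> x \<in> J \<Longrightarrow> (u i has_field_derivative u' i x) (at x)"
    and "tame k J I u'" and "tame k' J I u"
  shows "tame (Suc k) J I u"
proof -
  obtain C where "\<And>i x. i \<in> I \<Longrightarrow> x \<in> J \<Longrightarrow> \<bar>u i x\<bar> \<le> C"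
    using tame_bounded[OF assms(3)] by metis
  then have "\<exists>C. \<forall>i\<in>I. \<forall>x\<in>J. \<bar>u i x\<bar> \<le> C" by blast
  then show ?thesis unfolding tame.simps using assms(1,2) by blast
qed

lemma tame_SucE:
  assumes "tame (Suc k) J I u"
  obtains u' where "\<And>i x. i \<in> I \<Longrightarrow> x \<in> J \<Longrightarrow> (u i has_field_derivative u' i x) (at x)" "tame k J I u'"
  using assms unfolding tame.simps by blast

lemma tame_SucD: "tame (Suc k) J I u \<Longrightarrow> tame k J I u"
proof (induction k arbitrary: u)
  case 0
  then show ?case using tame_continuous[OF 0] by auto
next
  case (Suc k)
  then obtain u' where "\<And>i x. i \<in> I \<Longrightarrow> x \<in> J \<Longrightarrow> (u i has_field_derivative u' i x) (at x)" "tame (Suc k) J I u'"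
    using tame_SucE by metis
  with Suc show ?case by (blast intro: tame_SucI)
qed

lemma tame_subset: "tame k J I u \<Longrightarrow> J' \<subseteq> J \<Longrightarrow> I' \<subseteq> I \<Longrightarrow> tame k J' I' u"
proof (induction k arbitrary: u)
  case 0
  then show ?case by (auto intro: continuous_on_subset) (meson subset_iff)
next
  case (Suc k)
  then show ?case by (simp, meson subset_iff)
qed

lemma tame_cong:
  assumes "open J" "\<And>i x. i \<in> I \<Longrightarrow> x \<in> J \<Longrightarrow> u i x = v i x"
  shows "tame k J I u \<longleftrightarrow> tame k J I v"
proof -
  have *: "tame k J I v" if hu: "tame k J I u" "\<And>i x. i \<in> I \<Longrightarrow> x \<in> J \<Longrightarrow> u i x = v i x" for u v
  proof (cases k)
    case 0
    then show ?thesis using that by (auto simp: that(2) cong: continuous_on_cong)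
  next
    case (Suc n)
    obtain u' where u': "\<And>i x. i \<in> I \<Longrightarrow> x \<in> J \<Longrightarrow> (u i has_field_derivative u' i x) (at x)" "tame n J I u'"
      using tame_SucE[OF hu(1)[unfolded Suc]] by blast
    have "(v i has_field_derivative u' i x) (at x)" if "i \<in> I" "x \<in> J" for i x
      using u'(1)[OF that] assms(1) \<open>x \<in> J\<close>
      by (rule has_field_derivative_transform_within_open) (use \<open>i \<in> I\<close> \<open>\<And>i x. i \<in> I \<Longrightarrow> x \<in> J \<Longrightarrow> u i x = v i x\<close> in auto)
    moreover have "\<exists>C. \<forall>i\<in>I. \<forall>x\<in>J. \<bar>v i x\<bar> \<le> C"
      using tame_bounded[OF that(1)] that(2) by metis
    ultimately show ?thesis
      using u'(2) unfolding Suc tame.simps by blast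
  qed
  from *[of u v] *[of v u] assms(2) show ?thesis by auto
qed

lemma tame_const: "(\<And>i. i \<in> I \<Longrightarrow> \<bar>f i\<bar> \<le> C) \<Longrightarrow> tame k J I (\<lambda>i x. f i)"
proof (induction k arbitrary: f C)
  case (Suc k)
  have "tame k J I (\<lambda>i x. 0)" by (rule Suc.IH[of _ 0]) auto
  moreover have "tame 0 J I (\<lambda>i x. f i)" using Suc(2) by (intro tame_0I[where C=C]) auto
  ultimately show ?case by (intro tame_SucI[of I J _ "\<lambda>i x. 0" k 0]) (simp_all del: tame.simps)
qed auto

lemma tame_ident: "bounded J \<Longrightarrow> tame k J I (\<lambda>i x. x)"
proof (cases k)
  case (Suc n)
  have "tame n J I (\<lambda>i x. 1)" by (rule tame_const) auto
  then show "bounded J \<Longrightarrow> tame k J I (\<lambda>i x. x)" unfolding Suc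
    by (auto intro!: exI[of _ "\<lambda>i x. 1"] simp: bounded_iff)
qed (auto simp: bounded_iff)

lemma tame_add: "tame k J I u \<Longrightarrow> tame k J I v \<Longrightarrow> tame k J I (\<lambda>i x. u i x + v i x)"
proof (induction k arbitrary: u v)
  case 0
  obtain C where C: "\<And>i x. i \<in> I \<Longrightarrow> x \<in> J \<Longrightarrow> \<bar>u i x\<bar> \<le> C" using tame_bounded[OF 0(1)] by metis
  obtain C' where C': "\<And>i x. i \<in> I \<Longrightarrow> x \<in> J \<Longrightarrow> \<bar>v i x\<bar> \<le> C'" using tame_bounded[OF 0(2)] by metis
  show ?case using 0
    by (intro tame_0I[where C="C+C'"])
      (auto simp: tame_continuous intro!: continuous_intros order_trans[OF abs_triangle_ineq add_mono[OF C C']])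
next
  case (Suc k)
  obtain C where C: "\<And>i x. i \<in> I \<Longrightarrow> x \<in> J \<Longrightarrow> \<bar>u i x\<bar> \<le> C" using tame_bounded[OF Suc(2)] by metis
  obtain C' where C': "\<And>i x. i \<in> I \<Longrightarrow> x \<in> J \<Longrightarrow> \<bar>v i x\<bar> \<le> C'" using tame_bounded[OF Suc(3)] by metis
  obtain u' where u': "\<And>i x. i \<in> I \<Longrightarrow> x \<in> J \<Longrightarrow> (u i has_field_derivative u' i x) (at x)" "tame k J I u'"
    using Suc(2) by (rule tame_SucE) metis
  obtain v' where v': "\<And>i x. i \<in> I \<Longrightarrow> x \<in> J \<Longrightarrow> (v i has_field_derivative v' i x) (at x)" "tame k J I v'"
    using Suc(3) by (rule tame_SucE) metis
  show ?case
    by (rule tame_SucI[of _ _ _ "\<lambda>i x. u' i x + v' i x" _ k])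
      (use u' v' Suc tame_SucD[OF Suc(2)] tame_SucD[OF Suc(3)] in \<open>auto intro!: derivative_eq_intros\<close>)
qed

lemma tame_mult: "tame k J I u \<Longrightarrow> tame k J I v \<Longrightarrow> tame k J I (\<lambda>i x. u i x * v i x)"
proof (induction k arbitrary: u v)
  case 0
  obtain C where C: "C > 0" "\<And>i x. i \<in> I \<Longrightarrow> x \<in> J \<Longrightarrow> \<bar>u i x\<bar> \<le> C" using tame_bounded[OF 0(1)] by metis
  obtain C' where C': "\<And>i x. i \<in> I \<Longrightarrow> x \<in> J \<Longrightarrow> \<bar>v i x\<bar> \<le> C'" using tame_bounded[OF 0(2)] by metis
  show ?case
  proof (rule tame_0I[where C="C*C'"])
    show "\<bar>u i x * v i x\<bar> \<le> C * C'" if "i \<in> I" "x \<in> J" for i x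
      unfolding abs_mult using C C' that by (intro mult_mono) force+
  qed (use 0 in \<open>auto intro!: continuous_intros\<close>)
next
  case (Suc k)
  obtain u' where u': "\<And>i x. i \<in> I \<Longrightarrow> x \<in> J \<Longrightarrow> (u i has_field_derivative u' i x) (at x)" "tame k J I u'"
    using Suc(2) by (rule tame_SucE) metis
  obtain v' where v': "\<And>i x. i \<in> I \<Longrightarrow> x \<in> J \<Longrightarrow> (v i has_field_derivative v' i x) (at x)" "tame k J I v'"
    using Suc(3) by (rule tame_SucE) metis
  show ?case
    by (rule tame_SucI[of _ _ _ "\<lambda>i x. u' i x * v i x + v' i x * u i x" _ k])
      (use u' v' Suc tame_SucD[OF Suc(2)] tame_SucD[OF Suc(3)] in \<open>auto intro!: derivative_eq_intros tame_add\<close>)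
qed

lemma tame_cmult: "tame k J I u \<Longrightarrow> tame k J I (\<lambda>i x. c * u i x)"
  by (intro tame_mult tame_const[where C="\<bar>c\<bar>"]) auto

lemma tame_minus: "tame k J I u \<Longrightarrow> tame k J I (\<lambda>i x. - u i x)"
  using tame_cmult[of k J I u "-1"] by simp

lemma tame_diff: "tame k J I u \<Longrightarrow> tame k J I v \<Longrightarrow> tame k J I (\<lambda>i x. u i x - v i x)"
  using tame_add[OF _ tame_minus, of k J I u v] by simp

lemma tame_inverse:
  assumes "m > 0" "\<And>i x. i \<in> I \<Longrightarrow> x \<in> J \<Longrightarrow> m \<le> \<bar>u i x\<bar>"
  shows "tame k J I u \<Longrightarrow> tame k J I (\<lambda>i x. 1 / u i x)"
proof (induction k)
  case 0
  have nz: "i \<in> I \<Longrightarrow> x \<in> J \<Longrightarrow> u i x \<noteq> 0" for i x using assms by force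
  show ?case
  proof (rule tame_0I[where C="1/m"])
    show "\<bar>1 / u i x\<bar> \<le> 1 / m" if "i \<in> I" "x \<in> J" for i x
      using assms(1) assms(2)[OF that] by (simp add: frac_le)
  qed (use 0 nz in \<open>auto intro!: continuous_intros\<close>)
next
  case (Suc k)
  have nz: "i \<in> I \<Longrightarrow> x \<in> J \<Longrightarrow> u i x \<noteq> 0" for i x using assms by force
  obtain u' where u': "\<And>i x. i \<in> I \<Longrightarrow> x \<in> J \<Longrightarrow> (u i has_field_derivative u' i x) (at x)" "tame k J I u'"
    using Suc(2) by (rule tame_SucE) metis
  have IH: "tame k J I (\<lambda>i x. 1 / u i x)" using Suc by (blast dest: tame_SucD)
  have d: "((\<lambda>x. 1 / u i x) has_field_derivative - (u' i x * (1 / u i x * (1 / u i x)))) (at x)"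
    if "i \<in> I" "x \<in> J" for i x
    using u'(1)[OF that] nz[OF that] by (auto intro!: derivative_eq_intros simp: field_simps)
  show ?case
    by (rule tame_SucI[OF d tame_minus[OF tame_mult[OF u'(2) tame_mult[OF IH IH]]] IH])
qed

lemma tame_divide:
  assumes "m > 0" "\<And>i x. i \<in> I \<Longrightarrow> x \<in> J \<Longrightarrow> m \<le> \<bar>v i x\<bar>" "tame k J I u" "tame k J I v"
  shows "tame k J I (\<lambda>i x. u i x / v i x)"
  using tame_mult[OF assms(3) tame_inverse[OF assms(1,2,4)]] by simp

text \<open>Turns a single function, indexed by \<open>unit\<close>, into a constant family, and a
  family in r into one over pairs (x, r).\<close>

lemma tame_reindex: "tame k J I u \<Longrightarrow> (\<And>j. j \<in> I' \<Longrightarrow> f j \<in> I) \<Longrightarrow> tame k J I' (\<lambda>j. u (f j))"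
proof (induction k arbitrary: u)
  case 0
  then show ?case by auto blast
next
  case (Suc k)
  obtain u' where u': "\<And>i x. i \<in> I \<Longrightarrow> x \<in> J \<Longrightarrow> (u i has_field_derivative u' i x) (at x)" "tame k J I u'"
    using Suc(2) by (rule tame_SucE) metis
  obtain C where C: "\<And>i x. i \<in> I \<Longrightarrow> x \<in> J \<Longrightarrow> \<bar>u i x\<bar> \<le> C" using tame_bounded[OF Suc(2)] by metis
  have "tame k J I' (\<lambda>j. u' (f j))" using Suc u' by blast
  moreover have "tame 0 J I' (\<lambda>j. u (f j))"
    using C Suc(3) tame_continuous[OF Suc(2)] by (intro tame_0I[where C=C]) auto
  ultimately show ?case using u' Suc(3) by (intro tame_SucI[of I' J _ "\<lambda>j. u' (f j)"]) blast+
qed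

text \<open>Glues families over different index sets, here the lines on the two sides of a tangent
  line. On an overlap the first family wins.\<close>

lemma tame_if:
  "tame k J I u \<Longrightarrow> tame k J I' v \<Longrightarrow> tame k J (I \<union> I') (\<lambda>i. if i \<in> I then u i else v i)"
proof (induction k arbitrary: u v)
  case 0
  obtain C where C: "\<And>i x. i \<in> I \<Longrightarrow> x \<in> J \<Longrightarrow> \<bar>u i x\<bar> \<le> C" using tame_bounded[OF 0(1)] by metis
  obtain C' where C': "\<And>i x. i \<in> I' \<Longrightarrow> x \<in> J \<Longrightarrow> \<bar>v i x\<bar> \<le> C'" using tame_bounded[OF 0(2)] by metis
  show ?case using 0 C C' by (intro tame_0I[where C="max C C'"]) (auto simp: le_max_iff_disj)
next
  case (Suc k)
  obtain u' where u': "\<And>i x. i \<in> I \<Longrightarrow> x \<in> J \<Longrightarrow> (u i has_field_derivative u' i x) (at x)" "tame k J I u'"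
    using Suc(2) by (rule tame_SucE) metis
  obtain v' where v': "\<And>i x. i \<in> I' \<Longrightarrow> x \<in> J \<Longrightarrow> (v i has_field_derivative v' i x) (at x)" "tame k J I' v'"
    using Suc(3) by (rule tame_SucE) metis
  show ?case
    by (rule tame_SucI[OF _ Suc.IH[OF u'(2) v'(2)] Suc.IH[OF tame_SucD tame_SucD, OF Suc(2,3)]])
      (use u' v' in auto)
qed

declare tame.simps [simp del]

text \<open>Phrased through \<open>tame\<close> so that the closure rules are inherited. Bounded
  intervals are used because \<open>tame\<close> demands bounded derivatives, and the
  \<open>unit\<close> index stands for a single function.\<close>

definition smooth1 :: "(real \<Rightarrow> real) \<Rightarrow> bool" where
  "smooth1 f \<longleftrightarrow> (\<forall>n a b. tame n {a<..<b} (UNIV :: unit set) (\<lambda>_. f))"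

lemma smooth1_tame:
  assumes "smooth1 f" "bounded J"
  shows "tame n J I (\<lambda>_. f)"
proof -
  obtain a where "\<And>x. x \<in> J \<Longrightarrow> \<bar>x\<bar> \<le> a" using assms(2) by (auto simp: bounded_iff)
  then have J: "J \<subseteq> {-(a+1)<..<a+1}" by (force simp: abs_le_iff)
  have "tame n {-(a+1)<..<a+1} UNIV (\<lambda>_::unit. f)"
    using assms(1) unfolding smooth1_def by (elim allE)
  then have "tame n J UNIV (\<lambda>_::unit. f)"
    by (rule tame_subset[OF _ J subset_refl])
  from tame_reindex[OF this, where f="\<lambda>_. ()"] show ?thesis by simp
qed

lemma smooth1_DERIV:
  assumes "smooth1 f" shows "(f has_field_derivative deriv f x) (at x)"
proof -
  have "tame (Suc 0) {x-1<..<x+1} (UNIV :: unit set) (\<lambda>_. f)"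
    using assms by (simp add: smooth1_def)
  then have "\<exists>f'. (f has_field_derivative f' () x) (at x)"
    by (rule tame_SucE) force
  then show ?thesis by (metis DERIV_imp_deriv)
qed

lemma smooth1_deriv:
  assumes "smooth1 f" shows "smooth1 (deriv f)"
  unfolding smooth1_def
proof (intro allI)
  fix n and a b :: real
  have "tame (Suc n) {a<..<b} (UNIV :: unit set) (\<lambda>_. f)"
    using assms by (simp add: smooth1_def)
  from tame_SucE[OF this] obtain f' where f': "\<And>i x. i \<in> UNIV \<Longrightarrow> x \<in> {a<..<b} \<Longrightarrow> (f has_field_derivative f' i x) (at x)"
      "tame n {a<..<b} (UNIV :: unit set) f'"
    by metis
  show "tame n {a<..<b} (UNIV :: unit set) (\<lambda>_. deriv f)"
    using f'(2) by (subst tame_cong[where v=f']) (auto intro!: DERIV_imp_deriv f'(1))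
qed

lemma smooth1_isCont: "smooth1 f \<Longrightarrow> isCont f x"
  using smooth1_DERIV DERIV_isCont by blast

lemma smooth1_continuous_on: "smooth1 f \<Longrightarrow> continuous_on A f"
  by (simp add: continuous_at_imp_continuous_on smooth1_isCont)

lemma continuous_bounded_on_interval:
  fixes f :: "real \<Rightarrow> real"
  assumes "continuous_on {a..b} f"
  obtains B where "\<And>x. x \<in> {a..b} \<Longrightarrow> \<bar>f x\<bar> \<le> B"
proof -
  have "bounded (f ` {a..b})"
    by (intro compact_imp_bounded compact_continuous_image assms) auto
  then show ?thesis using that unfolding bounded_iff by (metis imageI real_norm_def)
qed

text \<open>A property that passes from each function to its derivative yields derivatives of all
  orders, and each of them is continuous, hence bounded on compact intervals. Explicit functions are
  then treated by naming a class closed under differentiation.\<close>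

lemma smooth1_coinduct:
  assumes "P f" "\<And>f. P f \<Longrightarrow> \<exists>f'. P f' \<and> (\<forall>x. (f has_field_derivative f' x) (at x))"
  shows "smooth1 f"
  unfolding smooth1_def
proof (intro allI)
  fix n and a b :: real
  show "tame n {a<..<b} (UNIV :: unit set) (\<lambda>_. f)" using assms(1)
  proof (induction n arbitrary: f)
    case 0
    then have cont: "continuous_on A f" for A
      using assms(2) by (meson DERIV_isCont continuous_at_imp_continuous_on)
    from continuous_bounded_on_interval[OF cont, of a b]
    obtain C where "\<And>x. x \<in> {a..b} \<Longrightarrow> \<bar>f x\<bar> \<le> C" by blast
    with cont show ?case by (intro tame_0I[where C=C]) auto
  next
    case (Suc n)
    then obtain f' where f': "P f'" "\<And>x. (f has_field_derivative f' x) (at x)"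
      using assms(2) by blast
    then have cont: "continuous_on A f" for A
      by (meson DERIV_isCont continuous_at_imp_continuous_on)
    from continuous_bounded_on_interval[OF cont, of a b]
    obtain C where "\<And>x. x \<in> {a..b} \<Longrightarrow> \<bar>f x\<bar> \<le> C" by blast
    then have "tame 0 {a<..<b} (UNIV :: unit set) (\<lambda>_. f)"
      using cont by (intro tame_0I[where C=C]) auto
    then show ?case using f' Suc.IH[OF f'(1)] by (intro tame_SucI[where u'="\<lambda>_. f'"])
  qed
qed

text \<open>The derivative is f'(u) u', where f' is again smooth, so the induction leaves
  \<open>f\<close> arbitrary. At order 0 the uniform bound on \<open>u\<close> confines its values
  to a compact interval, on which \<open>f\<close> is bounded.\<close>

lemma tame_compose: "tame k J I u \<Longrightarrow> smooth1 f \<Longrightarrow> tame k J I (\<lambda>i x. f (u i x))"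
proof (induction k arbitrary: f)
  case 0
  obtain C where C: "\<And>i x. i \<in> I \<Longrightarrow> x \<in> J \<Longrightarrow> \<bar>u i x\<bar> \<le> C" using tame_bounded[OF 0(1)] by metis
  from continuous_bounded_on_interval[OF smooth1_continuous_on[OF 0(2)], of "-C" C]
  obtain B where "\<And>x. x \<in> {-C..C} \<Longrightarrow> \<bar>f x\<bar> \<le> B" by blast
  then show ?case
    using C tame_continuous[OF 0(1)]
    by (intro tame_0I[where C=B] continuous_on_compose2[OF smooth1_continuous_on[OF 0(2), of UNIV]])
      (force simp: abs_le_iff)+
next
  case (Suc k)
  obtain u' where u': "\<And>i x. i \<in> I \<Longrightarrow> x \<in> J \<Longrightarrow> (u i has_field_derivative u' i x) (at x)" "tame k J I u'"
    using Suc(2) by (rule tame_SucE) metis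
  have k: "tame k J I u" using Suc(2) by (rule tame_SucD)
  show ?case
    by (rule tame_SucI[OF DERIV_chain2[OF smooth1_DERIV[OF Suc(3)] u'(1)]
          tame_mult[OF Suc.IH[OF k smooth1_deriv[OF Suc(3)]] u'(2)] Suc.IH[OF k Suc(3)]])
qed

lemma smooth1I: "(\<And>n a b. tame n {a<..<b} (UNIV :: unit set) (\<lambda>_. f)) \<Longrightarrow> smooth1 f"
  by (simp add: smooth1_def)

lemma smooth1_const: "smooth1 (\<lambda>_. c)"
  by (intro smooth1I tame_const) auto

lemma smooth1_ident: "smooth1 (\<lambda>x. x)"
  by (intro smooth1I tame_ident) auto

lemma smooth1_add: "smooth1 f \<Longrightarrow> smooth1 g \<Longrightarrow> smooth1 (\<lambda>x. f x + g x)"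
  unfolding smooth1_def using tame_add[where u="\<lambda>_. f" and v="\<lambda>_. g"] by blast

lemma smooth1_mult: "smooth1 f \<Longrightarrow> smooth1 g \<Longrightarrow> smooth1 (\<lambda>x. f x * g x)"
  unfolding smooth1_def using tame_mult[where u="\<lambda>_. f" and v="\<lambda>_. g"] by blast

lemma smooth1_diff: "smooth1 f \<Longrightarrow> smooth1 g \<Longrightarrow> smooth1 (\<lambda>x. f x - g x)"
  unfolding smooth1_def using tame_diff[where u="\<lambda>_. f" and v="\<lambda>_. g"] by blast

lemma smooth1_compose: "smooth1 f \<Longrightarrow> smooth1 g \<Longrightarrow> smooth1 (\<lambda>x. f (g x))"
  by (rule smooth1I, rule tame_compose[where u="\<lambda>_. g"], rule smooth1_tame) auto

lemma smooth1_divide: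
  assumes f: "smooth1 f" and g: "smooth1 g" and nz: "\<And>x. g x \<noteq> 0"
  shows "smooth1 (\<lambda>x. f x / g x)"
proof (rule smooth1I)
  fix n and a b :: real
  show "tame n {a<..<b} (UNIV :: unit set) (\<lambda>_ x. f x / g x)"
  proof (cases "a \<le> b")
    case True
    have "continuous_on {a..b} (\<lambda>x. \<bar>g x\<bar>)"
      by (intro continuous_intros smooth1_continuous_on g)
    then obtain y where y: "y \<in> {a..b}" "\<And>x. x \<in> {a..b} \<Longrightarrow> \<bar>g y\<bar> \<le> \<bar>g x\<bar>"
      using continuous_attains_inf[of "{a..b}" "\<lambda>x. \<bar>g x\<bar>"] True by auto
    show ?thesis
      by (rule tame_divide[of "\<bar>g y\<bar>"]) (use y nz f g in \<open>auto simp: smooth1_def\<close>)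
  next
    case False
    then have "{a<..<b} = {}" by auto
    have "tame n {} UNIV u" for u :: "unit \<Rightarrow> real \<Rightarrow> real"
      by (induction n arbitrary: u) (auto simp: tame.simps)
    with \<open>{a<..<b} = {}\<close> show ?thesis by simp
  qed
qed

lemma smooth1_sin: "smooth1 sin" and smooth1_cos: "smooth1 cos"
proof -
  let ?P = "\<lambda>f::real \<Rightarrow> real. f \<in> {sin, cos, \<lambda>x. - sin x, \<lambda>x. - cos x}"
  have *: "\<exists>f'. ?P f' \<and> (\<forall>x. (f has_field_derivative f' x) (at x))" if hf: "?P f" for f
  proof -
    consider "f = sin" | "f = cos" | "f = (\<lambda>x. - sin x)" | "f = (\<lambda>x. - cos x)" using hf by (elim insertE emptyE)
    then show ?thesis
    proof cases
      case 1 show ?thesis unfolding 1 by (rule exI[of _ cos]) (auto intro!: derivative_eq_intros)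
    next
      case 2 show ?thesis unfolding 2 by (rule exI[of _ "\<lambda>x. - sin x"]) (auto intro!: derivative_eq_intros)
    next
      case 3 show ?thesis unfolding 3 by (rule exI[of _ "\<lambda>x. - cos x"]) (auto intro!: derivative_eq_intros)
    next
      case 4 show ?thesis unfolding 4 by (rule exI[of _ sin]) (auto intro!: derivative_eq_intros)
    qed
  qed
  show "smooth1 sin" by (rule smooth1_coinduct[of ?P, OF _ *]) auto
  show "smooth1 cos" by (rule smooth1_coinduct[of ?P, OF _ *]) auto
qed

text \<open>With \<open>q = 1\<close> and a derivative in place of \<open>f\<close>, the integral is
  a difference quotient between x and y, which thus stays smooth and bounded where x and y merge.
  The weight \<open>q\<close> is there because differentiation under the integral multiplies it by 1
  - t and by t.\<close>

lemma tame_Hadamard: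
  assumes J: "open J" "convex J"
  shows "tame k J I x \<Longrightarrow> tame k J I y \<Longrightarrow> smooth1 f \<Longrightarrow> continuous_on {0..1} q \<Longrightarrow>
    tame k J I (\<lambda>i p. integral {0..1} (\<lambda>t. q t * f (x i p + t * (y i p - x i p))))"
proof (induction k arbitrary: f q)
  case 0
  obtain C where C: "C > 0" "\<And>i p. i \<in> I \<Longrightarrow> p \<in> J \<Longrightarrow> \<bar>x i p\<bar> \<le> C" using tame_bounded[OF 0(1)] by metis
  obtain C' where C': "C' > 0" "\<And>i p. i \<in> I \<Longrightarrow> p \<in> J \<Longrightarrow> \<bar>y i p\<bar> \<le> C'" using tame_bounded[OF 0(2)] by metis
  \<comment> \<open>Contains the segment from x to y, since |x| \<le> C and |y - x| \<le> C +
    C'.\<close>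
  let ?K = "{-(2*C+C')..2*C+C'}"
  from continuous_bounded_on_interval[OF smooth1_continuous_on[OF 0(3)], of "-(2*C+C')" "2*C+C'"]
  obtain B where B: "\<And>z. z \<in> ?K \<Longrightarrow> \<bar>f z\<bar> \<le> B" by blast
  from continuous_bounded_on_interval[OF 0(4)]
  obtain B' where B': "\<And>z. z \<in> {0..1} \<Longrightarrow> \<bar>q z\<bar> \<le> B'" by blast
  have inK: "x i p + t * (y i p - x i p) \<in> ?K" if "i \<in> I" "p \<in> J" "t \<in> {0..1}" for i p t
  proof -
    have "\<bar>t * (y i p - x i p)\<bar> \<le> 1 * (C' + C)"
      unfolding abs_mult using C(2)[OF that(1,2)] C'(2)[OF that(1,2)] that(3) by (intro mult_mono) auto
    then show ?thesis using C(2)[OF that(1,2)] by (auto simp: abs_le_iff)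
  qed
  have cf: "continuous_on UNIV f" by (rule smooth1_continuous_on) fact
  show ?case
  proof (rule tame_0I[where C="B' * B"])
    fix i assume i: "i \<in> I"
    have "continuous_on (J \<times> cbox 0 1) (\<lambda>(p, t). q t * f (x i p + t * (y i p - x i p)))"
      unfolding case_prod_unfold
      by (intro continuous_intros continuous_on_compose2[OF 0(4)] continuous_on_compose2[OF cf]
          continuous_on_compose2[OF tame_continuous[OF 0(1) i]]
          continuous_on_compose2[OF tame_continuous[OF 0(2) i]]) auto
    from integral_continuous_on_param[OF this]
    show "continuous_on J (\<lambda>p. integral {0..1} (\<lambda>t. q t * f (x i p + t * (y i p - x i p))))" by simp
    fix p assume p: "p \<in> J"
    have "norm (integral {0..1} (\<lambda>t. q t * f (x i p + t * (y i p - x i p)))) \<le> B' * B * (1 - 0)"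
    proof (rule integral_bound)
      show "continuous_on {0..1} (\<lambda>t. q t * f (x i p + t * (y i p - x i p)))"
        by (intro continuous_intros continuous_on_compose2[OF 0(4)] continuous_on_compose2[OF cf]) auto
      show "norm (q t * f (x i p + t * (y i p - x i p))) \<le> B' * B" if "t \<in> {0..1}" for t
        unfolding real_norm_def abs_mult using B[OF inK[OF i p that]] B'[OF that]
        by (intro mult_mono) auto
    qed auto
    then show "\<bar>integral {0..1} (\<lambda>t. q t * f (x i p + t * (y i p - x i p)))\<bar> \<le> B' * B" by simp
  qed
next
  case (Suc k)
  have kx: "tame k J I x" and ky: "tame k J I y" using Suc by (auto dest: tame_SucD)
  obtain x' where x': "\<And>i p. i \<in> I \<Longrightarrow> p \<in> J \<Longrightarrow> (x i has_field_derivative x' i p) (at p)" "tame k J I x'"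
    using Suc(2) by (rule tame_SucE) metis
  obtain y' where y': "\<And>i p. i \<in> I \<Longrightarrow> p \<in> J \<Longrightarrow> (y i has_field_derivative y' i p) (at p)" "tame k J I y'"
    using Suc(3) by (rule tame_SucE) metis
  let ?H = "\<lambda>q f i p. integral {0..1} (\<lambda>t. q t * f (x i p + t * (y i p - x i p)) :: real)"
  have cf: "continuous_on UNIV f" "continuous_on UNIV (deriv f)"
    using Suc by (auto intro: smooth1_continuous_on smooth1_deriv)
  have q': "continuous_on {0..1} (\<lambda>t. (1 - t) * q t)" "continuous_on {0..1} (\<lambda>t. t * q t)"
    by (intro continuous_intros Suc(5))+
  have D: "(?H q f i has_field_derivative
      x' i p * ?H (\<lambda>t. (1 - t) * q t) (deriv f) i p + y' i p * ?H (\<lambda>t. t * q t) (deriv f) i p) (at p)"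
    if i: "i \<in> I" and p: "p \<in> J" for i p
  proof -
    note cx = tame_continuous[OF kx i] and cy = tame_continuous[OF ky i]
      and cx' = tame_continuous[OF x'(2) i] and cy' = tame_continuous[OF y'(2) i]
    let ?g = "\<lambda>p t. q t * (deriv f (x i p + t * (y i p - x i p)) * (x' i p + t * (y' i p - x' i p)))"
    have "(?H q f i has_field_derivative integral (cbox 0 1) (?g p)) (at p within J)"
      unfolding cbox_interval[symmetric]
    proof (rule leibniz_rule_field_derivative[OF _ _ _ p J(2)])
      fix p t :: real assume p: "p \<in> J"
      have "((\<lambda>p. x i p + t * (y i p - x i p)) has_real_derivative x' i p + t * (y' i p - x' i p)) (at p)"
        by (intro DERIV_add DERIV_cmult DERIV_diff x' y' i p)
      from DERIV_cmult[OF DERIV_chain2[OF smooth1_DERIV[OF Suc(4)] this], of "q t"]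
      show "((\<lambda>p. q t * f (x i p + t * (y i p - x i p))) has_real_derivative ?g p t) (at p within J)"
        by (rule has_field_derivative_at_within)
      show "(\<lambda>t. q t * f (x i p + t * (y i p - x i p))) integrable_on cbox 0 1"
        by (intro integrable_continuous continuous_intros continuous_on_compose2[OF cf(1)]) (use Suc(5) in auto)
    next
      show "continuous_on (J \<times> cbox 0 1) (\<lambda>(p, t). ?g p t)"
        unfolding case_prod_unfold
        by (intro continuous_intros continuous_on_compose2[OF Suc(5)] continuous_on_compose2[OF cf(2)]
          continuous_on_compose2[OF cx] continuous_on_compose2[OF cy]
          continuous_on_compose2[OF cx'] continuous_on_compose2[OF cy']) auto
    qed
    moreover have "integral (cbox 0 1) (?g p) =
        x' i p * ?H (\<lambda>t. (1 - t) * q t) (deriv f) i p + y' i p * ?H (\<lambda>t. t * q t) (deriv f) i p"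
    proof -
      have int: "(\<lambda>t. w t * deriv f (x i p + t * (y i p - x i p))) integrable_on {0..1}"
        if "continuous_on {0..1} w" for w
        by (intro integrable_continuous_interval continuous_intros continuous_on_compose2[OF cf(2)])
          (use that in auto)
      show ?thesis
        unfolding cbox_interval integral_mult_right[symmetric]
        by (subst integral_add[symmetric]; (intro integrable_on_mult_right int q')?)
          (auto intro!: integral_cong simp: algebra_simps)
    qed
    ultimately show ?thesis using at_within_open[OF p J(1)] by simp
  qed
  show ?case
    by (rule tame_SucI[OF D tame_add[OF
          tame_mult[OF x'(2) Suc.IH[OF kx ky smooth1_deriv[OF Suc(4)] q'(1)]]
          tame_mult[OF y'(2) Suc.IH[OF kx ky smooth1_deriv[OF Suc(4)] q'(2)]]]
          Suc.IH[OF kx ky Suc(4,5)]])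
qed

section \<open>Special smooth functions\<close>

text \<open>Polynomials in 1/x times the flat function exp(-1/x), extended by 0. The class contains
  the derivative of each member, p becoming X^2 (p - p'), so its members are smooth.\<close>

definition flat_exp :: "real poly \<Rightarrow> real \<Rightarrow> real" where
  "flat_exp p x = (if x > 0 then poly p (1/x) * exp (- (1/x)) else 0)"

lemma flat_exp_tendsto: "((\<lambda>x. poly p (1/x) * exp (- (1/x))) \<longlongrightarrow> 0) (at_right (0::real))"
proof -
  have "((\<lambda>y. poly p y * exp (- y)) \<longlongrightarrow> 0) (at_top :: real filter)"
  proof (induction p)
    case (pCons a p)
    have "((\<lambda>y::real. y ^ n * exp (-y)) \<longlongrightarrow> 0) at_top" for n
      by real_asymp
    have *: "((\<lambda>y. y * (poly q y * exp (- y))) \<longlongrightarrow> 0) (at_top :: real filter)" for q :: "real poly"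
    proof -
      have "((\<lambda>y. \<Sum>i\<le>degree q. coeff q i * (y ^ Suc i * exp (-y))) \<longlongrightarrow> (\<Sum>i\<le>degree q. coeff q i * 0)) (at_top :: real filter)"
        by (intro tendsto_sum tendsto_mult tendsto_const) real_asymp
      then show ?thesis
        by (simp add: poly_altdef sum_distrib_left sum_distrib_right algebra_simps)
    qed
    have "((\<lambda>y. a * exp (-y) + y * (poly p y * exp (- y))) \<longlongrightarrow> a * 0 + 0) (at_top :: real filter)"
      by (intro tendsto_add tendsto_mult tendsto_const *) real_asymp
    then show ?case by (simp add: algebra_simps)
  qed simp
  from filterlim_compose[OF this filterlim_inverse_at_top_right]
  show ?thesis by (simp add: inverse_eq_divide)
qed

lemma flat_exp_DERIV:
  "(flat_exp p has_field_derivative flat_exp ([:0, 0, 1:] * (p - pderiv p)) x) (at x)"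
proof -
  consider "x < 0" | "x = 0" | "x > 0" by linarith
  then show ?thesis
  proof cases
    case 1
    have "((\<lambda>_. 0) has_field_derivative 0) (at x)" by simp
    then have "(flat_exp p has_field_derivative 0) (at x)"
      by (rule has_field_derivative_transform_within_open[where S="{..<0}"])
        (use 1 in \<open>auto simp: flat_exp_def\<close>)
    then show ?thesis using 1 by (simp add: flat_exp_def)
  next
    case 2
    \<comment> \<open>From the right, the difference quotient at 0 is the expression with polynomial
      X p, which tends to 0.\<close>
    have r: "((\<lambda>x. flat_exp p x / x) \<longlongrightarrow> 0) (at_right 0)"
      by (rule Lim_transform_eventually[OF flat_exp_tendsto[of "[:0, 1:] * p"]])
        (auto simp: eventually_at_filter flat_exp_def)
    have l: "((\<lambda>x. flat_exp p x / x) \<longlongrightarrow> 0) (at_left 0)"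
      by (rule tendsto_eventually) (auto simp: eventually_at_filter flat_exp_def)
    have "((\<lambda>x. flat_exp p x / x) \<longlongrightarrow> 0) (at 0)"
      using r l by (simp add: filterlim_split_at)
    then have "(flat_exp p has_field_derivative 0) (at 0)"
      by (simp add: has_field_derivative_iff flat_exp_def)
    then show ?thesis using 2 by (simp add: flat_exp_def)
  next
    case 3
    have "((\<lambda>x. poly p (1/x) * exp (- (1/x))) has_field_derivative
        poly ([:0, 0, 1:] * (p - pderiv p)) (1/x) * exp (- (1/x))) (at x)"
      using 3 by (auto intro!: derivative_eq_intros poly_DERIV[THEN DERIV_chain2]
          simp: field_simps power2_eq_square)
    then have "(flat_exp p has_field_derivative
        poly ([:0, 0, 1:] * (p - pderiv p)) (1/x) * exp (- (1/x))) (at x)"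
      by (rule has_field_derivative_transform_within_open[where S="{0<..}"])
        (use 3 in \<open>auto simp: flat_exp_def\<close>)
    then show ?thesis using 3 by (simp add: flat_exp_def)
  qed
qed

lemma smooth1_flat_exp: "smooth1 (flat_exp p)"
  by (rule smooth1_coinduct[of "\<lambda>f. \<exists>p. f = flat_exp p"]) (use flat_exp_DERIV in blast)+

text \<open>The usual smooth transition from 0 to 1 across \<open>{0..\<rho>}\<close>. For \<rho> >
  0 the denominator is positive because x > 0 or \<rho> - x > 0. Differences of its translates are
  bumps whose sums telescope.\<close>

definition smooth_step :: "real \<Rightarrow> real \<Rightarrow> real" where
  "smooth_step \<rho> x = flat_exp 1 x / (flat_exp 1 x + flat_exp 1 (\<rho> - x))"

lemma
  assumes "\<rho> > 0"
  shows smooth1_smooth_step: "smooth1 (smooth_step \<rho>)"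
    and smooth_step_eq_0: "x \<le> 0 \<Longrightarrow> smooth_step \<rho> x = 0"
    and smooth_step_eq_1: "\<rho> \<le> x \<Longrightarrow> smooth_step \<rho> x = 1"
    and smooth_step_bounded: "\<bar>smooth_step \<rho> x\<bar> \<le> 1"
proof -
  have nn: "0 \<le> flat_exp 1 x" and pos: "0 < x \<Longrightarrow> 0 < flat_exp 1 x" for x
    by (auto simp: flat_exp_def)
  have P: "flat_exp 1 x + flat_exp 1 (\<rho> - x) > 0" for x
    using nn[of x] nn[of "\<rho> - x"] pos[of x] pos[of "\<rho> - x"] assms by (cases "x > 0") auto
  have "smooth1 (\<lambda>x. flat_exp 1 x / (flat_exp 1 x + flat_exp 1 (\<rho> - x)))"
  proof (intro smooth1_divide smooth1_add smooth1_flat_exp)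
    show "smooth1 (\<lambda>x. flat_exp 1 (\<rho> - x))"
      using smooth1_compose[OF smooth1_flat_exp smooth1_diff[OF smooth1_const smooth1_ident]] .
    show "flat_exp 1 x + flat_exp 1 (\<rho> - x) \<noteq> 0" for x using P[of x] by simp
  qed
  then show "smooth1 (smooth_step \<rho>)" by (simp add: smooth_step_def[abs_def])
  show "x \<le> 0 \<Longrightarrow> smooth_step \<rho> x = 0"
    by (simp add: smooth_step_def flat_exp_def)
  show "\<rho> \<le> x \<Longrightarrow> smooth_step \<rho> x = 1"
    using assms by (simp add: smooth_step_def flat_exp_def)
  show "\<bar>smooth_step \<rho> x\<bar> \<le> 1"
    using P[of x] nn[of x] nn[of "\<rho> - x"] by (simp add: smooth_step_def)
qed

lemma smooth1_power_series:
  fixes c :: "nat \<Rightarrow> real"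
  assumes "\<And>x. summable (\<lambda>n. c n * x ^ n)"
  shows "smooth1 (\<lambda>x. \<Sum>n. c n * x ^ n)"
proof (rule smooth1_coinduct[of "\<lambda>f. \<exists>c. f = (\<lambda>x. \<Sum>n. c n * x ^ n) \<and> (\<forall>x. summable (\<lambda>n. c n * x ^ n))"])
  show "\<exists>f'. (\<exists>c. f' = (\<lambda>x. \<Sum>n. c n * x ^ n) \<and> (\<forall>x::real. summable (\<lambda>n. c n * x ^ n)))
      \<and> (\<forall>x. (f has_real_derivative f' x) (at x))"
    if hf: "\<exists>c. f = (\<lambda>x. \<Sum>n. c n * x ^ n) \<and> (\<forall>x::real. summable (\<lambda>n. c n * x ^ n))" for f :: "real \<Rightarrow> real"
  proof -
    obtain c where f: "f = (\<lambda>x. \<Sum>n. c n * x ^ n)" and c: "\<And>x::real. summable (\<lambda>n. c n * x ^ n)"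
      using hf by blast
    have "(f has_real_derivative (\<Sum>n. diffs c n * x ^ n)) (at x)" for x
      unfolding f by (rule termdiffs_strong_converges_everywhere[OF c])
    moreover have "summable (\<lambda>n. diffs c n * x ^ n)" for x
      by (rule termdiff_converges_all[OF c])
    ultimately show ?thesis by blast
  qed
qed (use assms in blast)

definition sinhc :: "real \<Rightarrow> real" where
  "sinhc x = (if x = 0 then 1 else sinh x / x)"

lemma sinhc_ge_1: "sinhc x \<ge> 1"
proof -
  have *: "sinh x \<ge> x" if "x \<ge> 0" for x :: real
  proof -
    have "sinh 0 - 0 \<le> sinh x - (x :: real)"
    proof (rule DERIV_nonneg_imp_nondecreasing[OF that])
      show "\<exists>y'. ((\<lambda>x. sinh x - x) has_real_derivative y') (at t) \<and> 0 \<le> y'" for t :: real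
        by (rule exI[of _ "cosh t - 1"]) (auto intro!: derivative_eq_intros simp: cosh_real_ge_1)
    qed
    then show ?thesis by simp
  qed
  show ?thesis
  proof (cases "x > 0")
    case True
    then show ?thesis using *[of x] by (simp add: sinhc_def)
  next
    case False
    then show ?thesis using *[of "-x"] by (auto simp: sinhc_def field_simps)
  qed
qed

lemma smooth1_sinhc: "smooth1 sinhc"
proof -
  \<comment> \<open>The series of sinh divided by x: exponents drop by one, so even powers
    remain.\<close>
  define c :: "nat \<Rightarrow> real" where "c n = (if even n then 1 / fact (Suc n) else 0)" for n
  have s: "(\<lambda>n. c n * x ^ n) sums sinhc x" for x
  proof (cases "x = 0")
    case True
    have "(\<lambda>n. c n * 0 ^ n) sums (c 0)"
      using powser_sums_zero[of c] by simp
    then show ?thesis using True by (simp add: sinhc_def c_def)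
  next
    case False
    have "(\<lambda>n. if even n then 0 else x ^ n /\<^sub>R fact n) sums sinh x"
      by (rule sinh_converges)
    then have "(\<lambda>n. if even (Suc n) then 0 else x ^ Suc n /\<^sub>R fact (Suc n)) sums sinh x"
      by (subst sums_Suc_iff) simp
    from sums_divide[OF this, of x]
    have "(\<lambda>n. (if even (Suc n) then 0 else x ^ Suc n /\<^sub>R fact (Suc n)) / x) sums sinhc x"
      using False by (simp add: sinhc_def)
    also have "(\<lambda>n. (if even (Suc n) then 0 else x ^ Suc n /\<^sub>R fact (Suc n)) / x) = (\<lambda>n. c n * x ^ n)"
      using False by (auto simp: c_def fun_eq_iff divide_simps)
    finally show ?thesis .
  qed
  have "smooth1 (\<lambda>x. \<Sum>n. c n * x ^ n)"
    by (rule smooth1_power_series) (use s in \<open>blast intro: sums_summable\<close>)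
  also have "(\<lambda>x. \<Sum>n. c n * x ^ n) = sinhc"
    using s by (auto simp: sums_iff fun_eq_iff)
  finally show ?thesis .
qed

text \<open>\<open>sinhc\<close> is an everywhere convergent power series with values at least 1, so
  its logarithm is smooth; the prescribed value 0 at the origin is - ln 1.\<close>

lemma smooth1_log_sinhc: "smooth1 (log_sinhc \<epsilon>)"
proof (cases "\<epsilon> = 0")
  case True
  \<comment> \<open>Here the conventions \<open>0 / 0 = 0\<close> and \<open>ln 0 = 0\<close> make
    the function constant.\<close>
  then have "log_sinhc \<epsilon> = (\<lambda>_. 0)" by (auto simp: log_sinhc_def)
  then show ?thesis by (simp add: smooth1_const)
next
  case False
  have eq: "log_sinhc \<epsilon> = (\<lambda>x. - ln (sinhc (\<epsilon> * x)))"
    using False by (auto simp: log_sinhc_def sinhc_def fun_eq_iff)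
  define S where "S = (\<lambda>x. sinhc (\<epsilon> * x))"
  have S: "smooth1 S"
    unfolding S_def by (rule smooth1_compose[OF smooth1_sinhc smooth1_mult[OF smooth1_const smooth1_ident]])
  have S1: "S x \<ge> 1" for x by (simp add: S_def sinhc_ge_1)
  have D: "((\<lambda>x. - ln (S x)) has_real_derivative (0 - deriv S x) / S x) (at x)" for x
    using smooth1_DERIV[OF S, of x] S1[of x] by (auto intro!: derivative_eq_intros)
  have S': "smooth1 (\<lambda>x. (0 - deriv S x) / S x)"
    by (intro smooth1_divide smooth1_diff smooth1_const smooth1_deriv S) (use S1 in \<open>metis not_one_le_zero\<close>)
  have "smooth1 (\<lambda>x. - ln (S x))"
    by (rule smooth1_coinduct[of "\<lambda>f. f = (\<lambda>x. - ln (S x)) \<or> smooth1 f"])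
      (use D S' smooth1_DERIV smooth1_deriv in blast)+
  then show ?thesis by (simp add: eq S_def)
qed

section \<open>Oscillatory integrals\<close>

text \<open>Each integration by parts replaces the amplitude b by the derivative of b / y' and gains
  a factor 1/\<sigma>, so \<open>N\<close> steps use \<open>N\<close> derivatives. The bound is
  built from \<open>b\<close> and \<open>1 / y'\<close> alone, whence the uniformity in the index
  and in \<sigma>. The radii are nested: b lives within \<rho>, the integral runs over radius
  \<rho>', and differentiability holds within \<delta>. Boundary terms therefore vanish.\<close>

lemma oscillatory_decay:
  fixes b y y' :: "'i \<Rightarrow> real \<Rightarrow> real" and p \<rho> \<rho>' \<delta> :: real
  assumes "0 < \<rho>" "\<rho> < \<rho>'" "\<rho>' < \<delta>" and J: "J = {p - \<delta><..<p + \<delta>}"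
    and y: "\<And>i x. i \<in> I \<Longrightarrow> x \<in> J \<Longrightarrow> (y i has_field_derivative y' i x) (at x)"
    and nz: "\<And>i x. i \<in> I \<Longrightarrow> x \<in> J \<Longrightarrow> y' i x \<noteq> 0"
    and tame_y: "tame N J I (\<lambda>i x. 1 / y' i x)"
  shows "tame N J I b \<Longrightarrow> (\<And>i x. i \<in> I \<Longrightarrow> x \<in> J \<Longrightarrow> \<rho> < \<bar>x - p\<bar> \<Longrightarrow> b i x = 0) \<Longrightarrow>
    \<exists>C. \<forall>i\<in>I. \<forall>\<sigma>. \<bar>\<sigma>\<bar> ^ N * norm (integral {p - \<rho>'..p + \<rho>'} (\<lambda>x. of_real (b i x) * cis (\<sigma> * y i x))) \<le> C"
  using tame_y
proof (induction N arbitrary: b)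
  case 0
  obtain C where C: "C > 0" "\<And>i x. i \<in> I \<Longrightarrow> x \<in> J \<Longrightarrow> \<bar>b i x\<bar> \<le> C" using tame_bounded[OF 0(1)] by metis
  have sub: "{p - \<rho>'..p + \<rho>'} \<subseteq> J" using assms(1-3) by (auto simp: J)
  show ?case
  proof (intro exI ballI allI)
    fix i \<sigma> assume i: "i \<in> I"
    have cy: "continuous_on J (y i)"
      using y[OF i] by (meson DERIV_isCont continuous_at_imp_continuous_on)
    have "norm (integral {p - \<rho>'..p + \<rho>'} (\<lambda>x. of_real (b i x) * cis (\<sigma> * y i x))) \<le> C * ((p + \<rho>') - (p - \<rho>'))"
    proof (rule integral_bound)
      show "continuous_on {p - \<rho>'..p + \<rho>'} (\<lambda>x. of_real (b i x) * cis (\<sigma> * y i x))"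
        by (intro continuous_intros continuous_on_subset[OF tame_continuous[OF 0(1) i] sub] continuous_on_subset[OF cy sub])
      show "norm (of_real (b i x) * cis (\<sigma> * y i x)) \<le> C" if "x \<in> {p - \<rho>'..p + \<rho>'}" for x
        using C(2)[OF i, of x] sub that by (auto simp: norm_mult)
    qed (use assms in auto)
    then show "\<bar>\<sigma>\<bar> ^ 0 * norm (integral {p - \<rho>'..p + \<rho>'} (\<lambda>x. of_real (b i x) * cis (\<sigma> * y i x))) \<le> C * (2 * \<rho>')"
      by simp
  qed
next
  case (Suc N)
  let ?q = "\<lambda>i x. b i x * (1 / y' i x)"
  have tq: "tame (Suc N) J I ?q" by (rule tame_mult[OF Suc(2,4)])
  obtain q' where q': "\<And>i x. i \<in> I \<Longrightarrow> x \<in> J \<Longrightarrow> (?q i has_field_derivative q' i x) (at x)" "tame N J I q'"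
    using tq by (rule tame_SucE) metis
  \<comment> \<open>The new amplitude keeps the support of b, so the induction can continue.\<close>
  have q'0: "q' i x = 0" if i: "i \<in> I" and x: "x \<in> J" "\<rho> < \<bar>x - p\<bar>" for i x
  proof -
    have o: "open (J \<inter> {x. \<rho> < \<bar>x - p\<bar>})"
      unfolding J by (intro open_Int open_Collect_less continuous_intros)
    have d: "((\<lambda>_. 0) has_field_derivative 0) (at x)" by simp
    have "(?q i has_field_derivative 0) (at x)"
      by (rule has_field_derivative_transform_within_open[OF d o]) (use x Suc(3) i in auto)
    with q'(1)[OF i x(1)] show ?thesis by (rule DERIV_unique)
  qed
  obtain C where C: "\<And>i \<sigma>. i \<in> I \<Longrightarrow>
      \<bar>\<sigma>\<bar> ^ N * norm (integral {p - \<rho>'..p + \<rho>'} (\<lambda>x. of_real (q' i x) * cis (\<sigma> * y i x))) \<le> C"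
    using Suc.IH[OF q'(2) q'0 tame_SucD[OF Suc(4)]] by auto
  have sub: "{p - \<rho>'..p + \<rho>'} \<subseteq> J" using assms(1-3) by (auto simp: J)
  show ?case
  proof (intro exI[of _ C] ballI allI)
    fix i \<sigma> assume i: "i \<in> I"
    have cy: "continuous_on J (y i)"
      using y[OF i] by (meson DERIV_isCont continuous_at_imp_continuous_on)
    let ?A = "{p - \<rho>'..p + \<rho>'}"
    let ?e = "\<lambda>x. cis (\<sigma> * y i x)"
    have D: "((\<lambda>x. of_real (?q i x) * ?e x) has_vector_derivative
        of_real (q' i x) * ?e x + \<i> * of_real \<sigma> * (of_real (b i x) * ?e x)) (at x within ?A)"
      if "x \<in> ?A" for x
    proof -
      have xJ: "x \<in> J" using that sub by auto
      have 1: "((\<lambda>x. complex_of_real (?q i x)) has_vector_derivative of_real (q' i x)) (at x)"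
        by (rule has_vector_derivative_of_real[OF q'(1)[OF i xJ]])
      have 2: "((\<lambda>x. ?e x) has_vector_derivative (of_real (\<sigma> * y' i x) * (\<i> * ?e x))) (at x)"
      proof -
        have "((\<lambda>x. exp (\<i> * complex_of_real (\<sigma> * y i x))) has_vector_derivative
            (\<i> * of_real (\<sigma> * y' i x)) * exp (\<i> * complex_of_real (\<sigma> * y i x))) (at x)"
        proof -
          from has_vector_derivative_mult_right[OF has_vector_derivative_of_real[OF
              DERIV_cmult[OF y[OF i xJ], of \<sigma>]], of "\<i>"]
          have "((\<lambda>x. \<i> * complex_of_real (\<sigma> * y i x)) has_vector_derivative \<i> * of_real (\<sigma> * y' i x)) (at x)" .
          from field_vector_diff_chain_at[OF this DERIV_exp]
          show ?thesis by (simp add: o_def)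
        qed
        then show ?thesis by (simp add: cis_conv_exp mult_ac)
      qed
      have "y' i x \<noteq> 0" using nz i xJ by auto
      then have "((\<lambda>x. of_real (?q i x) * ?e x) has_vector_derivative
        of_real (q' i x) * ?e x + \<i> * of_real \<sigma> * (of_real (b i x) * ?e x)) (at x)"
        using has_vector_derivative_mult[OF 1 2] by (simp add: algebra_simps)
      then show ?thesis by (rule has_vector_derivative_at_within)
    qed
    have z: "b i (p - \<rho>') = 0" "b i (p + \<rho>') = 0"
      using Suc(3)[OF i, of "p - \<rho>'"] Suc(3)[OF i, of "p + \<rho>'"] assms(1-3) by (auto simp: J)
    have "((\<lambda>x. of_real (q' i x) * ?e x + \<i> * of_real \<sigma> * (of_real (b i x) * ?e x)) has_integral
        of_real (?q i (p + \<rho>')) * ?e (p + \<rho>') - of_real (?q i (p - \<rho>')) * ?e (p - \<rho>')) ?A"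
      by (rule fundamental_theorem_of_calculus[OF _ D]) (use assms in auto)
    then have "integral ?A (\<lambda>x. of_real (q' i x) * ?e x + \<i> * of_real \<sigma> * (of_real (b i x) * ?e x)) = 0"
      using z by (simp add: integral_unique)
    moreover have "(\<lambda>x. of_real (q' i x) * ?e x) integrable_on ?A" "(\<lambda>x. of_real (b i x) * ?e x) integrable_on ?A"
      by (intro integrable_continuous_interval continuous_intros continuous_on_subset[OF cy sub]
          continuous_on_subset[OF tame_continuous[OF q'(2) i] sub] continuous_on_subset[OF tame_continuous[OF Suc(2) i] sub])+
    ultimately have "integral ?A (\<lambda>x. of_real (q' i x) * ?e x) + \<i> * of_real \<sigma> * integral ?A (\<lambda>x. of_real (b i x) * ?e x) = 0"
      by (simp add: integral_add integrable_on_mult_right integral_mult_right)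
    then have "\<i> * of_real \<sigma> * integral ?A (\<lambda>x. of_real (b i x) * ?e x) = - integral ?A (\<lambda>x. of_real (q' i x) * ?e x)"
      by (simp add: eq_neg_iff_add_eq_0 add.commute)
    then have "norm (\<i> * of_real \<sigma> * integral ?A (\<lambda>x. of_real (b i x) * ?e x)) = norm (integral ?A (\<lambda>x. of_real (q' i x) * ?e x))"
      by (simp only: norm_minus_cancel)
    then have "\<bar>\<sigma>\<bar> * norm (integral ?A (\<lambda>x. of_real (b i x) * ?e x)) = norm (integral ?A (\<lambda>x. of_real (q' i x) * ?e x))"
      by (simp add: norm_mult)
    \<comment> \<open>No division by \<sigma> takes place, so \<sigma> = 0 is included.\<close>
    then have "\<bar>\<sigma>\<bar> ^ Suc N * norm (integral ?A (\<lambda>x. of_real (b i x) * ?e x))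
        = \<bar>\<sigma>\<bar> ^ N * norm (integral ?A (\<lambda>x. of_real (q' i x) * ?e x))"
      by (simp add: mult_ac)
    then show "\<bar>\<sigma>\<bar> ^ Suc N * norm (integral ?A (\<lambda>x. of_real (b i x) * ?e x)) \<le> C"
      using C[OF i] by metis
  qed
qed

section \<open>Roots depending on a parameter\<close>

lemma tame_deriv:
  assumes "tame (Suc n) J I u" "open J"
  shows "tame n J I (\<lambda>i. deriv (u i))"
proof -
  from tame_SucE[OF assms(1)] obtain u' where u': "\<And>i x. i \<in> I \<Longrightarrow> x \<in> J \<Longrightarrow> (u i has_field_derivative u' i x) (at x)"
      "tame n J I u'"
    by metis
  show ?thesis
    using u'(2) assms(2) by (subst tame_cong[where v=u']) (auto intro!: DERIV_imp_deriv u'(1))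
qed

lemma tame_DERIV:
  assumes "tame (Suc n) J I u" "i \<in> I" "x \<in> J"
  shows "(u i has_field_derivative deriv (u i) x) (at x)"
proof -
  from tame_SucE[OF assms(1)] obtain u' where "\<And>i x. i \<in> I \<Longrightarrow> x \<in> J \<Longrightarrow> (u i has_field_derivative u' i x) (at x)"
    by metis
  then show ?thesis using assms by (metis DERIV_imp_deriv)
qed

text \<open>The implicit function theorem for a given solution: \<tau> is not assumed continuous,
  only to be the unique zero near \<tau>1 for all nearby \<phi>. Since the t-derivative of
  \<open>G\<close> is nonzero, \<open>G\<close> changes sign at \<tau>1, and the intermediate value
  theorem keeps a zero close by. That zero must be \<tau>, which gives continuity; the mean value
  theorem in t then gives the derivative.\<close>

lemma implicit_root_DERIV:
  fixes g1 g2 k \<tau> :: "real \<Rightarrow> real" and \<tau>1 \<phi>1 d k' :: real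
  defines "G \<equiv> \<lambda>t \<phi>. g1 t * cos \<phi> + g2 t * sin \<phi> - k \<phi>"
  defines "G' \<equiv> \<lambda>t \<phi>. deriv g1 t * cos \<phi> + deriv g2 t * sin \<phi>"
  assumes g: "smooth1 g1" "smooth1 g2" and k: "(k has_field_derivative k') (at \<phi>1)"
    and "d > 0" and G0: "G \<tau>1 \<phi>1 = 0" and A: "G' \<tau>1 \<phi>1 \<noteq> 0"
    and uniq: "eventually (\<lambda>\<phi>. \<forall>t. \<bar>t - \<tau>1\<bar> < d \<and> G t \<phi> = 0 \<longrightarrow> t = \<tau> \<phi>) (nhds \<phi>1)"
  shows "(\<tau> has_field_derivative (k' - (g2 \<tau>1 * cos \<phi>1 - g1 \<tau>1 * sin \<phi>1)) / G' \<tau>1 \<phi>1) (at \<phi>1)"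
proof -
  have dG: "((\<lambda>t. G t \<phi>) has_field_derivative G' t \<phi>) (at t)" for t \<phi>
    unfolding G_def G'_def
    by (auto intro!: derivative_eq_intros smooth1_DERIV g)
  have \<tau>1: "\<tau>1 = \<tau> \<phi>1"
    using eventually_nhds_x_imp_x[OF uniq] G0 \<open>d > 0\<close> by auto
  have tk: "(k \<longlongrightarrow> k \<phi>1) (nhds \<phi>1)"
    using DERIV_isCont[OF k] by (simp add: continuous_within tendsto_nhds_iff)
  have tG: "((\<lambda>\<phi>. G t \<phi>) \<longlongrightarrow> G t \<phi>1) (nhds \<phi>1)" for t
    unfolding G_def by (intro tendsto_intros tk filterlim_ident)
  obtain e0 where e0: "e0 > 0" "\<And>e. 0 < e \<Longrightarrow> e < e0 \<Longrightarrow>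
      G (\<tau>1 - e) \<phi>1 < 0 \<and> 0 < G (\<tau>1 + e) \<phi>1 \<or> G (\<tau>1 + e) \<phi>1 < 0 \<and> 0 < G (\<tau>1 - e) \<phi>1"
  proof (cases "G' \<tau>1 \<phi>1 > 0")
    case True
    from DERIV_pos_inc_right[OF dG True] obtain d1 where "d1 > 0" "\<forall>h>0. h < d1 \<longrightarrow> G \<tau>1 \<phi>1 < G (\<tau>1 + h) \<phi>1" by auto
    moreover from DERIV_pos_inc_left[OF dG True] obtain d2 where "d2 > 0" "\<forall>h>0. h < d2 \<longrightarrow> G (\<tau>1 - h) \<phi>1 < G \<tau>1 \<phi>1" by auto
    ultimately show ?thesis using G0 by (intro that[of "min d1 d2"]) auto
  next
    case False
    then have False': "G' \<tau>1 \<phi>1 < 0" using A by simp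
    from DERIV_neg_dec_right[OF dG False'] obtain d1 where "d1 > 0" "\<forall>h>0. h < d1 \<longrightarrow> G \<tau>1 \<phi>1 > G (\<tau>1 + h) \<phi>1" by auto
    moreover from DERIV_neg_dec_left[OF dG False'] obtain d2 where "d2 > 0" "\<forall>h>0. h < d2 \<longrightarrow> G (\<tau>1 - h) \<phi>1 > G \<tau>1 \<phi>1" by auto
    ultimately show ?thesis using G0 by (intro that[of "min d1 d2"]) auto
  qed
  have near: "eventually (\<lambda>\<phi>. \<bar>\<tau> \<phi> - \<tau>1\<bar> < e \<and> G (\<tau> \<phi>) \<phi> = 0) (nhds \<phi>1)" if "e > 0" for e
  proof -
    define e' where "e' = min (min e d) e0 / 2"
    have e': "0 < e'" "e' < e0" "e' < e" "e' < d"
      using that e0 \<open>d > 0\<close> by (auto simp: e'_def min_def)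
    have "eventually (\<lambda>\<phi>. G (\<tau>1 - e') \<phi> < 0 \<and> 0 < G (\<tau>1 + e') \<phi> \<or> G (\<tau>1 + e') \<phi> < 0 \<and> 0 < G (\<tau>1 - e') \<phi>) (nhds \<phi>1)"
      using e0(2)[OF e'(1,2)]
    proof
      assume "G (\<tau>1 - e') \<phi>1 < 0 \<and> 0 < G (\<tau>1 + e') \<phi>1"
      with tG have "eventually (\<lambda>\<phi>. G (\<tau>1 - e') \<phi> < 0 \<and> 0 < G (\<tau>1 + e') \<phi>) (nhds \<phi>1)"
        by (intro eventually_conj) (auto dest: order_tendstoD)
      then show ?thesis by eventually_elim auto
    next
      assume "G (\<tau>1 + e') \<phi>1 < 0 \<and> 0 < G (\<tau>1 - e') \<phi>1"
      with tG have "eventually (\<lambda>\<phi>. G (\<tau>1 + e') \<phi> < 0 \<and> 0 < G (\<tau>1 - e') \<phi>) (nhds \<phi>1)"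
        by (intro eventually_conj) (auto dest: order_tendstoD)
      then show ?thesis by eventually_elim auto
    qed
    then show ?thesis using uniq
    proof eventually_elim
      case (elim \<phi>)
      have cont: "continuous_on S (\<lambda>t. G t \<phi>)" for S
        using dG by (meson DERIV_isCont continuous_at_imp_continuous_on)
      obtain t where t: "\<bar>t - \<tau>1\<bar> \<le> e'" "G t \<phi> = 0"
      proof -
        from elim(1) have "\<exists>t\<ge>\<tau>1 - e'. t \<le> \<tau>1 + e' \<and> G t \<phi> = 0"
        proof
          assume "G (\<tau>1 - e') \<phi> < 0 \<and> 0 < G (\<tau>1 + e') \<phi>"
          then show ?thesis using e' cont by (intro IVT') auto
        next
          assume "G (\<tau>1 + e') \<phi> < 0 \<and> 0 < G (\<tau>1 - e') \<phi>"
          then show ?thesis using e' cont by (intro IVT2') auto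
        qed
        then show ?thesis by (auto intro!: that simp: abs_le_iff)
      qed
      then have "t = \<tau> \<phi>" using elim(2) e' by auto
      then show ?case using t e' by auto
    qed
  qed
  have t\<tau>: "(\<tau> \<longlongrightarrow> \<tau>1) (nhds \<phi>1)"
    by (rule tendstoI) (use near in \<open>force simp: dist_real_def elim: eventually_mono\<close>)
  have "\<exists>\<xi>. \<bar>\<xi> - \<tau>1\<bar> \<le> \<bar>\<tau> \<phi> - \<tau>1\<bar> \<and> G (\<tau> \<phi>) \<phi> - G \<tau>1 \<phi> = (\<tau> \<phi> - \<tau>1) * G' \<xi> \<phi>" for \<phi>
  proof -
    consider "\<tau> \<phi> < \<tau>1" | "\<tau> \<phi> = \<tau>1" | "\<tau> \<phi> > \<tau>1" by linarith
    then show ?thesis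
    proof cases
      case 1
      from MVT2[OF 1 dG] obtain z where "\<tau> \<phi> < z" "z < \<tau>1" "G \<tau>1 \<phi> - G (\<tau> \<phi>) \<phi> = (\<tau>1 - \<tau> \<phi>) * G' z \<phi>" by auto
      then show ?thesis by (intro exI[of _ z]) (auto simp: algebra_simps)
    next
      case 3
      from MVT2[OF 3 dG] obtain z where "\<tau>1 < z" "z < \<tau> \<phi>" "G (\<tau> \<phi>) \<phi> - G \<tau>1 \<phi> = (\<tau> \<phi> - \<tau>1) * G' z \<phi>" by auto
      then show ?thesis by (intro exI[of _ z]) (auto simp: algebra_simps)
    qed auto
  qed
  \<comment> \<open>At a zero \<tau> \<phi> this reads - G \<tau>1 \<phi> = (\<tau> \<phi> -
    \<tau>1) G' (\<xi> \<phi>) \<phi>, an exact formula for the increment of \<tau>.\<close>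
  then obtain \<xi> where \<xi>: "\<And>\<phi>. \<bar>\<xi> \<phi> - \<tau>1\<bar> \<le> \<bar>\<tau> \<phi> - \<tau>1\<bar>" "\<And>\<phi>. G (\<tau> \<phi>) \<phi> - G \<tau>1 \<phi> = (\<tau> \<phi> - \<tau>1) * G' (\<xi> \<phi>) \<phi>"
    by metis
  have t\<xi>: "(\<xi> \<longlongrightarrow> \<tau>1) (nhds \<phi>1)"
  proof (rule tendstoI)
    fix e :: real assume "e > 0"
    from near[OF this] show "eventually (\<lambda>\<phi>. dist (\<xi> \<phi>) \<tau>1 < e) (nhds \<phi>1)"
      by eventually_elim (use \<xi>(1) in \<open>auto simp: dist_real_def intro: le_less_trans\<close>)
  qed
  have tG': "((\<lambda>\<phi>. G' (\<xi> \<phi>) \<phi>) \<longlongrightarrow> G' \<tau>1 \<phi>1) (nhds \<phi>1)"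
    unfolding G'_def
    by (intro tendsto_intros isCont_tendsto_compose[OF smooth1_isCont[OF smooth1_deriv[OF g(1)]] t\<xi>]
        isCont_tendsto_compose[OF smooth1_isCont[OF smooth1_deriv[OF g(2)]] t\<xi>] filterlim_ident)
  \<comment> \<open>The partial derivative of \<open>G\<close> in \<phi> at the base point.\<close>
  define B where "B = g2 \<tau>1 * cos \<phi>1 - g1 \<tau>1 * sin \<phi>1 - k'"
  have "((\<lambda>\<phi>. G \<tau>1 \<phi>) has_field_derivative B) (at \<phi>1)"
    unfolding G_def B_def by (auto intro!: derivative_eq_intros k)
  then have tB: "((\<lambda>\<phi>. G \<tau>1 \<phi> / (\<phi> - \<phi>1)) \<longlongrightarrow> B) (at \<phi>1)"
    using G0 by (simp add: has_field_derivative_iff)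
  have "((\<lambda>\<phi>. - (G \<tau>1 \<phi> / (\<phi> - \<phi>1)) / G' (\<xi> \<phi>) \<phi>) \<longlongrightarrow> - B / G' \<tau>1 \<phi>1) (at \<phi>1)"
    by (intro tendsto_intros tB A tendsto_mono[OF _ tG'] at_le) (simp add: at_within_def)
  moreover have "eventually (\<lambda>\<phi>. - (G \<tau>1 \<phi> / (\<phi> - \<phi>1)) / G' (\<xi> \<phi>) \<phi> = (\<tau> \<phi> - \<tau> \<phi>1) / (\<phi> - \<phi>1)) (at \<phi>1)"
  proof -
    have "eventually (\<lambda>\<phi>. G' (\<xi> \<phi>) \<phi> \<noteq> 0 \<and> G (\<tau> \<phi>) \<phi> = 0) (nhds \<phi>1)"
      using tendsto_imp_eventually_ne[OF tG' A] near[OF zero_less_one] by eventually_elim auto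
    then have "eventually (\<lambda>\<phi>. G' (\<xi> \<phi>) \<phi> \<noteq> 0 \<and> G (\<tau> \<phi>) \<phi> = 0) (at \<phi>1)"
      by (simp add: eventually_at_filter eventually_mono)
    moreover have "eventually (\<lambda>\<phi>. \<phi> \<noteq> \<phi>1) (at \<phi>1)" by (simp add: eventually_at_filter)
    ultimately show ?thesis
    proof eventually_elim
      case (elim \<phi>)
      have "- G \<tau>1 \<phi> = (\<tau> \<phi> - \<tau>1) * G' (\<xi> \<phi>) \<phi>" using \<xi>(2)[of \<phi>] elim by simp
      then have "- G \<tau>1 \<phi> / G' (\<xi> \<phi>) \<phi> = \<tau> \<phi> - \<tau>1" using elim by simp
      then show ?case using \<tau>1 by (simp add: divide_simps mult.commute)
    qed
  qed
  ultimately have "((\<lambda>\<phi>. (\<tau> \<phi> - \<tau> \<phi>1) / (\<phi> - \<phi>1)) \<longlongrightarrow> - B / G' \<tau>1 \<phi>1) (at \<phi>1)"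
    by (rule Lim_transform_eventually)
  moreover have "- B = k' - (g2 \<tau>1 * cos \<phi>1 - g1 \<tau>1 * sin \<phi>1)" by (simp add: B_def)
  ultimately show ?thesis by (simp add: has_field_derivative_iff)
qed

text \<open>Near the base point the t-derivative of \<open>T\<close> keeps its sign, so a zero
  exists and is unique in a window of fixed width \<open>b\<close>, uniformly in the shift r.
  Differentiating the equation expresses the derivative of \<tau> through \<tau> itself, so control
  of one order gives the next. The lemma serves for crossings with the curve and, applied to the
  velocity with k = 0, for the tangency parameter.\<close>

lemma transversal_root:
  fixes g1 g2 k :: "real \<Rightarrow> real" and t0 \<phi>0 b0 \<delta>0 :: real
  defines "T \<equiv> \<lambda>t \<phi>. g1 t * cos \<phi> + g2 t * sin \<phi>"
  assumes g: "smooth1 g1" "smooth1 g2"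
    and k: "\<And>n. tame n {\<phi>0 - \<delta>0<..<\<phi>0 + \<delta>0} (UNIV :: unit set) (\<lambda>_. k)"
    and pos: "\<delta>0 > 0" "b0 > 0"
    and T0: "T t0 \<phi>0 = k \<phi>0" and T': "deriv g1 t0 * cos \<phi>0 + deriv g2 t0 * sin \<phi>0 \<noteq> 0"
  obtains b \<delta> \<tau> where "0 < b" "b \<le> b0" "0 < \<delta>" "\<delta> \<le> \<delta>0"
    "\<And>r \<phi> t. \<bar>r\<bar> < \<delta> \<Longrightarrow> \<bar>\<phi> - \<phi>0\<bar> < \<delta> \<Longrightarrow> \<bar>t - t0\<bar> < b \<Longrightarrow> T t \<phi> = k \<phi> + r \<longleftrightarrow> t = \<tau> r \<phi>"
    "\<And>r \<phi>. \<bar>r\<bar> < \<delta> \<Longrightarrow> \<bar>\<phi> - \<phi>0\<bar> < \<delta> \<Longrightarrow> \<bar>\<tau> r \<phi> - t0\<bar> < b"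
    "\<And>e. e > 0 \<Longrightarrow> \<exists>\<delta>'>0. \<forall>r \<phi>. \<bar>r\<bar> < \<delta>' \<longrightarrow> \<bar>\<phi> - \<phi>0\<bar> < \<delta>' \<longrightarrow> \<bar>\<tau> r \<phi> - t0\<bar> < e"
    "\<And>n. tame n {\<phi>0 - \<delta><..<\<phi>0 + \<delta>} {r. \<bar>r\<bar> < \<delta>} \<tau>"
proof -
  define T' where "T' = (\<lambda>t \<phi>. deriv g1 t * cos \<phi> + deriv g2 t * sin \<phi>)"
  define A where "A = T' t0 \<phi>0"
  \<comment> \<open>Half of the base value: nearby, T' stays within \<open>m\<close> of
    \<open>A\<close>, hence has the sign of \<open>A\<close> and modulus above
    \<open>m\<close>.\<close>
  define m where "m = \<bar>A\<bar> / 2"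
  have A: "A \<noteq> 0" and m: "m > 0" using T' by (auto simp: A_def T'_def m_def)
  have dT: "((\<lambda>t. T t \<phi>) has_field_derivative T' t \<phi>) (at t)" for t \<phi>
    unfolding T_def T'_def by (auto intro!: derivative_eq_intros smooth1_DERIV g)
  have contT': "isCont (\<lambda>p. T' (fst p) (snd p)) (t0, \<phi>0)"
    unfolding T'_def
    by (intro continuous_intros isCont_o2[OF _ smooth1_isCont[OF smooth1_deriv[OF g(1)]]]
        isCont_o2[OF _ smooth1_isCont[OF smooth1_deriv[OF g(2)]]])
  then obtain e where e: "e > 0" "\<And>t \<phi>. dist (t, \<phi>) (t0, \<phi>0) < e \<Longrightarrow> \<bar>T' t \<phi> - A\<bar> < m"
    using m unfolding continuous_at_eps_delta A_def
    by (metis dist_real_def fst_conv snd_conv)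
  define b where "b = min b0 (e/4)"
  define \<delta>1 where "\<delta>1 = min \<delta>0 (e/4)"
  have b: "0 < b" "b \<le> b0" and \<delta>1: "0 < \<delta>1" "\<delta>1 \<le> \<delta>0" using pos e by (auto simp: b_def \<delta>1_def)
  have T'A: "\<bar>T' t \<phi> - A\<bar> < m" if "\<bar>t - t0\<bar> \<le> b" "\<bar>\<phi> - \<phi>0\<bar> < \<delta>1" for t \<phi>
  proof (rule e(2))
    have "dist (t, \<phi>) (t0, \<phi>0) \<le> \<bar>t - t0\<bar> + \<bar>\<phi> - \<phi>0\<bar>"
      by (simp add: dist_prod_def dist_real_def sqrt_sum_squares_le_sum_abs)
    then show "dist (t, \<phi>) (t0, \<phi>0) < e" using that e(1) by (auto simp: b_def \<delta>1_def)
  qed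
  have T'm: "sgn A * T' t \<phi> > m" if "\<bar>t - t0\<bar> \<le> b" "\<bar>\<phi> - \<phi>0\<bar> < \<delta>1" for t \<phi>
    using T'A[OF that] A by (auto simp: m_def sgn_if abs_if split: if_splits)
  have mono: "sgn A * (T t' \<phi> - T t \<phi>) > m * (t' - t)"
    if "t < t'" "\<bar>t - t0\<bar> \<le> b" "\<bar>t' - t0\<bar> \<le> b" "\<bar>\<phi> - \<phi>0\<bar> < \<delta>1" for t t' \<phi>
  proof -
    from MVT2[OF that(1) dT] obtain z where z: "t < z" "z < t'" "T t' \<phi> - T t \<phi> = (t' - t) * T' z \<phi>" by auto
    then have "\<bar>z - t0\<bar> \<le> b" using that by auto
    from T'm[OF this that(4)] have "(t' - t) * m < (t' - t) * (sgn A * T' z \<phi>)"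
      using that(1) by (intro mult_strict_left_mono) auto
    then show ?thesis using z(3) by (simp add: mult_ac)
  qed
  define J where "J = {\<phi>0 - \<delta>0<..<\<phi>0 + \<delta>0}"
  have dk: "(k has_field_derivative deriv k \<phi>) (at \<phi>)" if "\<phi> \<in> J" for \<phi>
    using tame_DERIV[OF k, of "()" \<phi>] that by (auto simp: J_def)
  have tk: "tame n J I (\<lambda>_. k)" "tame n J I (\<lambda>_. deriv k)" for n and I :: "real set"
    using tame_reindex[OF k[of n], of I "\<lambda>_. ()"] tame_reindex[OF tame_deriv[OF k[of "Suc n"]], of I "\<lambda>_. ()"]
    by (auto simp: J_def)
  \<comment> \<open>By the slope bound, an equation that fails at \<open>t0\<close> by less than
    \<open>m * e'\<close> has a solution within \<open>e'\<close> of \<open>t0\<close>. This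
    closeness is arranged for all small r and \<phi> - \<phi>0.\<close>
  have F: "\<exists>\<delta>'>0. \<delta>' \<le> \<delta>1 \<and> (\<forall>r \<phi>. \<bar>r\<bar> < \<delta>' \<longrightarrow> \<bar>\<phi> - \<phi>0\<bar> < \<delta>' \<longrightarrow> \<bar>T t0 \<phi> - k \<phi> - r\<bar> < m * e')"
    if "e' > 0" for e'
  proof -
    have "isCont k \<phi>0" using dk[of \<phi>0] pos by (auto simp: J_def intro: DERIV_isCont)
    then have "isCont (\<lambda>\<phi>. T t0 \<phi> - k \<phi>) \<phi>0" unfolding T_def by (intro continuous_intros)
    moreover have me: "m * e' / 2 > 0" using m that by simp
    ultimately obtain s where s: "s > 0" "\<And>\<phi>. \<bar>\<phi> - \<phi>0\<bar> < s \<Longrightarrow> \<bar>T t0 \<phi> - k \<phi>\<bar> < m * e' / 2"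
      using T0 unfolding continuous_at_eps_delta dist_real_def by (metis diff_0_right diff_self)
    show ?thesis
      by (rule exI[of _ "min (min s \<delta>1) (m * e' / 2)"]) (use s \<delta>1 me in \<open>force simp: abs_if split: if_splits\<close>)
  qed
  have ex: "\<exists>t. \<bar>t - t0\<bar> < e' \<and> T t \<phi> = k \<phi> + r"
    if "0 < e'" "e' \<le> b" "\<bar>\<phi> - \<phi>0\<bar> < \<delta>1" "\<bar>T t0 \<phi> - k \<phi> - r\<bar> < m * e'" for e' \<phi> r
  proof -
    have 1: "sgn A * (T (t0 + e') \<phi> - T t0 \<phi>) > m * e'" "sgn A * (T t0 \<phi> - T (t0 - e') \<phi>) > m * e'"
      using mono[of t0 "t0 + e'" \<phi>] mono[of "t0 - e'" t0 \<phi>] that by auto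
    have cont: "continuous_on S (\<lambda>t. T t \<phi>)" for S
      using dT by (meson DERIV_isCont continuous_at_imp_continuous_on)
    have "\<exists>t\<ge>t0 - e'. t \<le> t0 + e' \<and> T t \<phi> = k \<phi> + r \<and> t \<noteq> t0 - e' \<and> t \<noteq> t0 + e'"
    proof (cases "A > 0")
      case True
      then have *: "T (t0 - e') \<phi> < k \<phi> + r" "k \<phi> + r < T (t0 + e') \<phi>" using 1 that(4) by (auto simp: abs_if split: if_splits)
      have "\<exists>t\<ge>t0 - e'. t \<le> t0 + e' \<and> T t \<phi> = k \<phi> + r"
        using * that cont by (intro IVT') auto
      then show ?thesis using * by (metis less_irrefl)
    next
      case False
      then have *: "T (t0 + e') \<phi> < k \<phi> + r" "k \<phi> + r < T (t0 - e') \<phi>" using 1 A that(4) by (auto simp: abs_if sgn_if split: if_splits)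
      have "\<exists>t\<ge>t0 - e'. t \<le> t0 + e' \<and> T t \<phi> = k \<phi> + r"
        using * that cont by (intro IVT2') auto
      then show ?thesis using * by (metis less_irrefl)
    qed
    then show ?thesis by (force simp: abs_less_iff)
  qed
  have uniq: "t = t'" if "T t \<phi> = T t' \<phi>" "\<bar>t - t0\<bar> < b" "\<bar>t' - t0\<bar> < b" "\<bar>\<phi> - \<phi>0\<bar> < \<delta>1" for t t' \<phi>
  proof (rule ccontr)
    assume "t \<noteq> t'"
    then consider "t < t'" | "t' < t" by linarith
    then show False
    proof cases
      case 1
      then have "m * (t' - t) > 0" using m by simp
      then show False using mono[OF 1, of \<phi>] that by auto
    next
      case 2
      then have "m * (t - t') > 0" using m by simp
      then show False using mono[OF 2, of \<phi>] that by auto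
    qed
  qed
  define \<tau> where "\<tau> = (\<lambda>r \<phi>. THE t. \<bar>t - t0\<bar> < b \<and> T t \<phi> = k \<phi> + r)"
  have \<tau>: "\<bar>\<tau> r \<phi> - t0\<bar> < e'" "T (\<tau> r \<phi>) \<phi> = k \<phi> + r"
    if e': "0 < e'" "e' \<le> b" "\<bar>\<phi> - \<phi>0\<bar> < \<delta>1" "\<bar>T t0 \<phi> - k \<phi> - r\<bar> < m * e'" for e' \<phi> r
  proof -
    obtain t where t: "\<bar>t - t0\<bar> < e'" "T t \<phi> = k \<phi> + r" using ex[OF e'] by auto
    have "\<tau> r \<phi> = t"
      unfolding \<tau>_def
    proof (rule the_equality)
      show "\<bar>t - t0\<bar> < b \<and> T t \<phi> = k \<phi> + r" using t e' by simp
      then show "t' = t" if "\<bar>t' - t0\<bar> < b \<and> T t' \<phi> = k \<phi> + r" for t'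
        using uniq[of t' \<phi> t] that e' by simp
    qed
    then show "\<bar>\<tau> r \<phi> - t0\<bar> < e'" "T (\<tau> r \<phi>) \<phi> = k \<phi> + r" using t by auto
  qed
  obtain \<delta> where \<delta>: "\<delta> > 0" "\<delta> \<le> \<delta>1"
    "\<And>r \<phi>. \<bar>r\<bar> < \<delta> \<Longrightarrow> \<bar>\<phi> - \<phi>0\<bar> < \<delta> \<Longrightarrow> \<bar>T t0 \<phi> - k \<phi> - r\<bar> < m * b"
    using F[OF b(1)] by auto
  have near: "\<bar>\<tau> r \<phi> - t0\<bar> < b" and rt: "T (\<tau> r \<phi>) \<phi> = k \<phi> + r" if "\<bar>r\<bar> < \<delta>" "\<bar>\<phi> - \<phi>0\<bar> < \<delta>" for r \<phi>
    using \<tau>[OF b(1) order_refl _ \<delta>(3)[OF that]] that \<delta>(2) by auto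
  have root: "T t \<phi> = k \<phi> + r \<longleftrightarrow> t = \<tau> r \<phi>" if "\<bar>r\<bar> < \<delta>" "\<bar>\<phi> - \<phi>0\<bar> < \<delta>" "\<bar>t - t0\<bar> < b" for r \<phi> t
    using near[OF that(1,2)] rt[OF that(1,2)] uniq[of t \<phi> "\<tau> r \<phi>"] that \<delta>(2) by auto
  let ?J = "{\<phi>0 - \<delta><..<\<phi>0 + \<delta>}" and ?I = "{r. \<bar>r\<bar> < \<delta>}"
  have JJ: "?J \<subseteq> J" using \<delta> \<delta>1 by (auto simp: J_def)
  have D: "(\<tau> r has_field_derivative
      (deriv k \<phi> - (g2 (\<tau> r \<phi>) * cos \<phi> - g1 (\<tau> r \<phi>) * sin \<phi>)) /
      (deriv g1 (\<tau> r \<phi>) * cos \<phi> + deriv g2 (\<tau> r \<phi>) * sin \<phi>)) (at \<phi>)"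
    if r: "r \<in> ?I" and \<phi>: "\<phi> \<in> ?J" for r \<phi>
  \<comment> \<open>The radius \<open>d\<close> is the room left between the root and the edge of
    the window in which roots are unique.\<close>
  proof (rule implicit_root_DERIV[where k="\<lambda>\<phi>. k \<phi> + r" and d="b - \<bar>\<tau> r \<phi> - t0\<bar>", OF g])
    have rp: "\<bar>r\<bar> < \<delta>" "\<bar>\<phi> - \<phi>0\<bar> < \<delta>" using r \<phi> by (auto simp: abs_less_iff)
    show "((\<lambda>\<phi>. k \<phi> + r) has_real_derivative deriv k \<phi>) (at \<phi>)"
      using dk[of \<phi>] JJ \<phi> by (auto intro!: derivative_eq_intros)
    show "0 < b - \<bar>\<tau> r \<phi> - t0\<bar>" using near[OF rp] by simp
    show "g1 (\<tau> r \<phi>) * cos \<phi> + g2 (\<tau> r \<phi>) * sin \<phi> - (k \<phi> + r) = 0"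
      using rt[OF rp] by (simp add: T_def)
    show "deriv g1 (\<tau> r \<phi>) * cos \<phi> + deriv g2 (\<tau> r \<phi>) * sin \<phi> \<noteq> 0"
      using T'm[of "\<tau> r \<phi>" \<phi>] near[OF rp] rp \<delta>(2) m by (auto simp: T'_def)
    have "eventually (\<lambda>\<phi>. \<phi> \<in> ?J) (nhds \<phi>)"
      using \<phi> by (intro eventually_nhds_in_open) auto
    then show "\<forall>\<^sub>F x in nhds \<phi>. \<forall>t. \<bar>t - \<tau> r \<phi>\<bar> < b - \<bar>\<tau> r \<phi> - t0\<bar> \<and> g1 t * cos x + g2 t * sin x - (k x + r) = 0 \<longrightarrow> t = \<tau> r x"
    proof eventually_elim
      case (elim x)
      then have "\<bar>x - \<phi>0\<bar> < \<delta>" by (auto simp: abs_less_iff)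
      then show ?case using root[OF rp(1), of x] by (auto simp: T_def)
    qed
  qed
  have tame: "tame n ?J ?I \<tau>" for n
  proof (induction n)
    case 0
    show ?case
    proof (rule tame_0I[where C="\<bar>t0\<bar> + b"])
      show "continuous_on ?J (\<tau> r)" if "r \<in> ?I" for r
        using D[OF that] by (meson DERIV_isCont continuous_at_imp_continuous_on)
      show "\<bar>\<tau> r \<phi>\<bar> \<le> \<bar>t0\<bar> + b" if "r \<in> ?I" "\<phi> \<in> ?J" for r \<phi>
        using near[of r \<phi>] that by (auto simp: abs_less_iff)
    qed
  next
    case (Suc n)
    note tc = tame_compose[OF Suc] smooth1_tame[OF smooth1_cos] smooth1_tame[OF smooth1_sin]
    \<comment> \<open>\<open>D\<close> writes the derivative as a smooth expression in \<tau>,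
      \<phi> and k', which is tame of order n by induction.\<close>
    show ?case
    proof (rule tame_SucI[OF D _ Suc]; (assumption)?)
      show "tame n ?J ?I (\<lambda>r \<phi>. (deriv k \<phi> - (g2 (\<tau> r \<phi>) * cos \<phi> - g1 (\<tau> r \<phi>) * sin \<phi>)) /
          (deriv g1 (\<tau> r \<phi>) * cos \<phi> + deriv g2 (\<tau> r \<phi>) * sin \<phi>))"
      proof (rule tame_divide[OF m])
        show "m \<le> \<bar>deriv g1 (\<tau> r \<phi>) * cos \<phi> + deriv g2 (\<tau> r \<phi>) * sin \<phi>\<bar>" if "r \<in> ?I" "\<phi> \<in> ?J" for r \<phi>
        proof -
          have rp: "\<bar>r\<bar> < \<delta>" "\<bar>\<phi> - \<phi>0\<bar> < \<delta>" using that by (auto simp: abs_less_iff)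
          have "m < sgn A * T' (\<tau> r \<phi>) \<phi>" using T'm[of "\<tau> r \<phi>" \<phi>] near[OF rp] rp \<delta>(2) by auto
          also have "\<dots> \<le> \<bar>sgn A * T' (\<tau> r \<phi>) \<phi>\<bar>" by simp
          also have "\<dots> = \<bar>T' (\<tau> r \<phi>) \<phi>\<bar>" using A by (simp add: abs_mult abs_sgn_eq)
          finally show ?thesis by (simp add: T'_def)
        qed
        show "tame n ?J ?I (\<lambda>r \<phi>. deriv k \<phi> - (g2 (\<tau> r \<phi>) * cos \<phi> - g1 (\<tau> r \<phi>) * sin \<phi>))"
          by (intro tame_diff tame_mult tame_subset[OF tk(2) JJ subset_refl] tc g) auto
        show "tame n ?J ?I (\<lambda>r \<phi>. deriv g1 (\<tau> r \<phi>) * cos \<phi> + deriv g2 (\<tau> r \<phi>) * sin \<phi>)"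
          by (intro tame_add tame_mult tc g smooth1_deriv) auto
      qed
    qed
  qed
  have small: "\<exists>\<delta>'>0. \<forall>r \<phi>. \<bar>r\<bar> < \<delta>' \<longrightarrow> \<bar>\<phi> - \<phi>0\<bar> < \<delta>' \<longrightarrow> \<bar>\<tau> r \<phi> - t0\<bar> < e'" if "e' > 0" for e'
  proof -
    have "0 < min e' b" using that b by simp
    from F[OF this] obtain \<delta>' where "\<delta>' > 0" "\<delta>' \<le> \<delta>1"
      "\<And>r \<phi>. \<bar>r\<bar> < \<delta>' \<Longrightarrow> \<bar>\<phi> - \<phi>0\<bar> < \<delta>' \<Longrightarrow> \<bar>T t0 \<phi> - k \<phi> - r\<bar> < m * min e' b" by auto
    then show ?thesis using \<tau>(1)[OF \<open>0 < min e' b\<close>] by (intro exI[of _ \<delta>']) force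
  qed
  show ?thesis
    by (rule that[of b \<delta> \<tau>]) (use b \<delta> \<delta>1 root near small tame in auto)
qed

text \<open>The fundamental theorem of calculus along the segment from x to y. The factor
  \<open>1 *\<close> is kept to match the weight \<open>q\<close> of
  \<open>tame_Hadamard\<close>.\<close>

lemma Hadamard_quotient:
  assumes "smooth1 f"
  shows "f y - f x = (y - x) * integral {0..1} (\<lambda>t. 1 * deriv f (x + t * (y - x)))"
proof -
  have "((\<lambda>t. deriv f (x + t * (y - x)) * (y - x)) has_integral
      f (x + 1 * (y - x)) - f (x + 0 * (y - x))) {0..1}"
  proof (rule fundamental_theorem_of_calculus)
    fix t :: real
    have "((\<lambda>t. x + t * (y - x)) has_real_derivative (y - x)) (at t)"
      by (auto intro!: derivative_eq_intros)
    from DERIV_chain2[OF smooth1_DERIV[OF assms] this]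
    show "((\<lambda>t. f (x + t * (y - x))) has_vector_derivative deriv f (x + t * (y - x)) * (y - x)) (at t within {0..1})"
      by (simp add: has_real_derivative_iff_has_vector_derivative has_vector_derivative_at_within)
  qed simp
  from integral_unique[OF this] show ?thesis by (simp add: mult.commute)
qed

text \<open>
  For tangent lines the intersection parameter is not a smooth function of the line, but it is
  smooth along the family of lines at a fixed distance from the tangent lines: its derivative is a
  quotient of two expressions that both vanish to first order at the tangency parameter
  \<open>\<tau>0\<close>, and Hadamard's lemma removes the common factor.
\<close>

lemma tangent_half_root:
  fixes g1 g2 \<tau>0 :: "real \<Rightarrow> real" and t0 \<phi>0 b \<delta>1 m e w :: real
  defines "T \<equiv> \<lambda>t \<phi>. g1 t * cos \<phi> + g2 t * sin \<phi>"
  defines "T1 \<equiv> \<lambda>t \<phi>. deriv g1 t * cos \<phi> + deriv g2 t * sin \<phi>"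
  defines "T2 \<equiv> \<lambda>t \<phi>. deriv (deriv g1) t * cos \<phi> + deriv (deriv g2) t * sin \<phi>"
  assumes g: "smooth1 g1" "smooth1 g2"
    and pos: "b > 0" "\<delta>1 > 0" "m > 0" and e: "e = 1 \<or> e = -1" and s: "w = 1 \<or> w = -1"
    and T2: "\<And>t \<phi>. \<bar>t - t0\<bar> \<le> b \<Longrightarrow> \<bar>\<phi> - \<phi>0\<bar> < \<delta>1 \<Longrightarrow> m \<le> e * T2 t \<phi>"
    and tame0: "\<And>n. tame n {\<phi>0 - \<delta>1<..<\<phi>0 + \<delta>1} (UNIV :: unit set) (\<lambda>_. \<tau>0)"
    and \<tau>0: "\<And>\<phi>. \<bar>\<phi> - \<phi>0\<bar> < \<delta>1 \<Longrightarrow> \<bar>\<tau>0 \<phi> - t0\<bar> < b / 2" "\<And>\<phi>. \<bar>\<phi> - \<phi>0\<bar> < \<delta>1 \<Longrightarrow> T1 (\<tau>0 \<phi>) \<phi> = 0" "\<tau>0 \<phi>0 = t0"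
  obtains \<delta> \<tau> where
    "\<And>\<phi> t. \<bar>t - t0\<bar> \<le> b \<Longrightarrow> \<bar>\<phi> - \<phi>0\<bar> < \<delta>1 \<Longrightarrow> m / 2 * (t - \<tau>0 \<phi>)\<^sup>2 \<le> e * (T t \<phi> - T (\<tau>0 \<phi>) \<phi>)"
    "0 < \<delta>" "\<delta> \<le> \<delta>1"
    "\<And>r \<phi> t. 0 < e * r \<Longrightarrow> \<bar>r\<bar> < \<delta> \<Longrightarrow> \<bar>\<phi> - \<phi>0\<bar> < \<delta> \<Longrightarrow> \<bar>t - t0\<bar> < b \<Longrightarrow> 0 < w * (t - \<tau>0 \<phi>) \<Longrightarrow>
      T t \<phi> = T (\<tau>0 \<phi>) \<phi> + r \<longleftrightarrow> t = \<tau> r \<phi>"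
    "\<And>r \<phi>. 0 < e * r \<Longrightarrow> \<bar>r\<bar> < \<delta> \<Longrightarrow> \<bar>\<phi> - \<phi>0\<bar> < \<delta> \<Longrightarrow> \<bar>\<tau> r \<phi> - t0\<bar> < b \<and> 0 < w * (\<tau> r \<phi> - \<tau>0 \<phi>)"
    "\<And>e'. e' > 0 \<Longrightarrow> \<exists>\<delta>'>0. \<forall>r \<phi>. 0 < e * r \<longrightarrow> \<bar>r\<bar> < \<delta>' \<longrightarrow> \<bar>\<phi> - \<phi>0\<bar> < \<delta>' \<longrightarrow> \<bar>\<tau> r \<phi> - t0\<bar> < e'"
    "\<And>n. tame n {\<phi>0 - \<delta><..<\<phi>0 + \<delta>} {r. 0 < e * r \<and> \<bar>r\<bar> < \<delta>} \<tau>"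
proof -
  \<comment> \<open>The \<phi>-derivative of \<open>T\<close> at fixed t; for the boundary curve it
    is the position of the point along the line.\<close>
  define N where "N = (\<lambda>t \<phi>. g2 t * cos \<phi> - g1 t * sin \<phi>)"
  define k where "k = (\<lambda>\<phi>. T (\<tau>0 \<phi>) \<phi>)"
  define J where "J = {\<phi>0 - \<delta>1<..<\<phi>0 + \<delta>1}"
  have inJ: "\<phi> \<in> J \<longleftrightarrow> \<bar>\<phi> - \<phi>0\<bar> < \<delta>1" for \<phi> by (auto simp: J_def abs_less_iff)
  note g' = smooth1_deriv[OF g(1)] smooth1_deriv[OF g(2)]
  have dT: "((\<lambda>t. T t \<phi>) has_field_derivative T1 t \<phi>) (at t)" for t \<phi>
    unfolding T_def T1_def by (auto intro!: derivative_eq_intros smooth1_DERIV g)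
  have dT1: "((\<lambda>t. T1 t \<phi>) has_field_derivative T2 t \<phi>) (at t)" for t \<phi>
    unfolding T2_def T1_def by (auto intro!: derivative_eq_intros smooth1_DERIV g')
  have win: "\<bar>z - t0\<bar> \<le> b" if "\<bar>t - t0\<bar> \<le> b" "\<bar>t' - t0\<bar> \<le> b" "t \<le> z" "z \<le> t'" for z t t' :: real
    using that by (auto simp: abs_le_iff)
  have \<tau>0b: "\<bar>\<tau>0 \<phi> - t0\<bar> \<le> b" if "\<phi> \<in> J" for \<phi> using \<tau>0(1)[of \<phi>] that pos by (simp add: inJ)
  \<comment> \<open>\<open>e\<close> is the sign of the second derivative: e T1 vanishes at \<tau>0
    and grows with slope at least \<open>m\<close>.\<close>
  have T1_bd: "\<tau>0 \<phi> < t \<Longrightarrow> m * (t - \<tau>0 \<phi>) \<le> e * T1 t \<phi>" "t < \<tau>0 \<phi> \<Longrightarrow> e * T1 t \<phi> \<le> m * (t - \<tau>0 \<phi>)"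
    if t: "\<bar>t - t0\<bar> \<le> b" "\<phi> \<in> J" for t \<phi>
  proof -
    assume l: "\<tau>0 \<phi> < t"
    from MVT2[OF l dT1] obtain z where z: "\<tau>0 \<phi> < z" "z < t" "T1 t \<phi> - T1 (\<tau>0 \<phi>) \<phi> = (t - \<tau>0 \<phi>) * T2 z \<phi>" by auto
    have "m \<le> e * T2 z \<phi>" using T2[OF win[OF \<tau>0b[OF t(2)] t(1)]] z t by (auto simp: inJ)
    then have "(t - \<tau>0 \<phi>) * m \<le> (t - \<tau>0 \<phi>) * (e * T2 z \<phi>)" using l by (intro mult_left_mono) auto
    then show "m * (t - \<tau>0 \<phi>) \<le> e * T1 t \<phi>" using z(3) \<tau>0(2)[of \<phi>] t by (simp add: inJ mult_ac)
  next
    assume l: "t < \<tau>0 \<phi>"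
    from MVT2[OF l dT1] obtain z where z: "t < z" "z < \<tau>0 \<phi>" "T1 (\<tau>0 \<phi>) \<phi> - T1 t \<phi> = (\<tau>0 \<phi> - t) * T2 z \<phi>" by auto
    have "m \<le> e * T2 z \<phi>" using T2[OF win[OF t(1) \<tau>0b[OF t(2)]]] z t by (auto simp: inJ)
    then have "(\<tau>0 \<phi> - t) * m \<le> (\<tau>0 \<phi> - t) * (e * T2 z \<phi>)" using l by (intro mult_left_mono) auto
    also have "\<dots> = - (e * T1 t \<phi>)" using z(3) \<tau>0(2)[of \<phi>] t by (simp add: inJ) (metis mult.left_commute mult_minus_right)
    finally show "e * T1 t \<phi> \<le> m * (t - \<tau>0 \<phi>)" by (simp add: algebra_simps)
  qed
  have quad: "m / 2 * (t - \<tau>0 \<phi>)\<^sup>2 \<le> e * (T t \<phi> - T (\<tau>0 \<phi>) \<phi>)" if t: "\<bar>t - t0\<bar> \<le> b" "\<phi> \<in> J" for t \<phi>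
  proof -
    define f where "f = (\<lambda>t. e * T t \<phi> - m / 2 * (t - \<tau>0 \<phi>)\<^sup>2)"
    have df: "(f has_field_derivative e * T1 t \<phi> - m * (t - \<tau>0 \<phi>)) (at t)" for t
      unfolding f_def by (auto intro!: derivative_eq_intros dT)
    have "f (\<tau>0 \<phi>) \<le> f t"
    proof -
      consider "t < \<tau>0 \<phi>" | "t = \<tau>0 \<phi>" | "\<tau>0 \<phi> < t" by linarith
      then show ?thesis
      proof cases
        case 1
        from MVT2[OF 1 df] obtain z where z: "t < z" "z < \<tau>0 \<phi>"
          "f (\<tau>0 \<phi>) - f t = (\<tau>0 \<phi> - t) * (e * T1 z \<phi> - m * (z - \<tau>0 \<phi>))" by auto
        have "(\<tau>0 \<phi> - t) * (e * T1 z \<phi> - m * (z - \<tau>0 \<phi>)) \<le> 0"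
          using 1 T1_bd(2)[OF win[OF t(1) \<tau>0b[OF t(2)]] t(2)] z by (intro mult_nonneg_nonpos) auto
        then show ?thesis using z by simp
      next
        case 3
        from MVT2[OF 3 df] obtain z where z: "\<tau>0 \<phi> < z" "z < t"
          "f t - f (\<tau>0 \<phi>) = (t - \<tau>0 \<phi>) * (e * T1 z \<phi> - m * (z - \<tau>0 \<phi>))" by auto
        have "(t - \<tau>0 \<phi>) * (e * T1 z \<phi> - m * (z - \<tau>0 \<phi>)) \<ge> 0"
          using 3 T1_bd(1)[OF win[OF \<tau>0b[OF t(2)] t(1)] t(2)] z by (intro mult_nonneg_nonneg) auto
        then show ?thesis using z by simp
      qed simp
    qed
    then show ?thesis by (simp add: f_def algebra_simps)
  qed
  have T1_nz: "T1 t \<phi> \<noteq> 0" if "\<bar>t - t0\<bar> \<le> b" "\<phi> \<in> J" "t \<noteq> \<tau>0 \<phi>" for t \<phi>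
  proof -
    have "m * \<bar>t - \<tau>0 \<phi>\<bar> > 0" using pos that by simp
    then show ?thesis using T1_bd[OF that(1,2)] that(3) by (auto simp: abs_if not_less algebra_simps split: if_splits)
  qed
  have uniq: "t = t'" if "T t \<phi> = T t' \<phi>" "\<bar>t - t0\<bar> < b" "\<bar>t' - t0\<bar> < b" "\<phi> \<in> J"
    "0 < w * (t - \<tau>0 \<phi>)" "0 < w * (t' - \<tau>0 \<phi>)" for t t' \<phi>
  proof -
    have *: False if l: "t < t'" and h: "T t \<phi> = T t' \<phi>" "\<bar>t - t0\<bar> < b" "\<bar>t' - t0\<bar> < b" "\<phi> \<in> J"
      "0 < w * (t - \<tau>0 \<phi>)" "0 < w * (t' - \<tau>0 \<phi>)" for t t'
    proof -
      from MVT2[OF l dT] obtain z where z: "t < z" "z < t'" "T t' \<phi> - T t \<phi> = (t' - t) * T1 z \<phi>" by auto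
      have "z \<noteq> \<tau>0 \<phi>" using z s h by auto
      then have "T1 z \<phi> \<noteq> 0" using h z by (intro T1_nz win[of t t' z]) auto
      then show False using z h by simp
    qed
    show ?thesis using *[of t t'] *[of t' t] that by force
  qed
  \<comment> \<open>By \<open>quad\<close> the curve leaves its tangent line by at least m/2 d^2 at
    distance d from the tangency, so every smaller level |r| of the right sign is attained on the
    side selected by \<open>w\<close>.\<close>
  have ex: "\<exists>t. 0 < w * (t - \<tau>0 \<phi>) \<and> \<bar>t - \<tau>0 \<phi>\<bar> < d \<and> T t \<phi> = k \<phi> + r"
    if d: "0 < d" "d \<le> b / 2" and \<phi>: "\<phi> \<in> J" and r: "0 < e * r" "\<bar>r\<bar> < m / 2 * d\<^sup>2" for d \<phi> r
  proof -
    let ?f = "\<lambda>t. e * T t \<phi>"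
    have cont: "continuous_on S ?f" for S
      by (intro continuous_intros) (use dT in \<open>meson DERIV_isCont continuous_at_imp_continuous_on\<close>)
    have er: "e * r = \<bar>r\<bar>" using e r by auto
    have a: "?f (\<tau>0 \<phi>) < e * (k \<phi> + r)" using r by (simp add: k_def algebra_simps)
    have c: "e * (k \<phi> + r) < ?f (\<tau>0 \<phi> + w * d)"
    proof -
      have q: "m / 2 * (\<tau>0 \<phi> + w * d - \<tau>0 \<phi>)\<^sup>2 \<le> e * (T (\<tau>0 \<phi> + w * d) \<phi> - T (\<tau>0 \<phi>) \<phi>)"
        using \<tau>0(1)[of \<phi>] \<phi> s d by (intro quad) (auto simp: inJ abs_if split: if_splits)
      have "(\<tau>0 \<phi> + w * d - \<tau>0 \<phi>)\<^sup>2 = d\<^sup>2" using s by auto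
      from q[unfolded this] have "\<bar>r\<bar> < e * (T (\<tau>0 \<phi> + w * d) \<phi> - T (\<tau>0 \<phi>) \<phi>)" using r(2) by linarith
      then show ?thesis using er by (simp add: k_def right_diff_distrib distrib_left)
    qed
    have "\<exists>t. 0 \<le> w * (t - \<tau>0 \<phi>) \<and> \<bar>t - \<tau>0 \<phi>\<bar> \<le> d \<and> ?f t = e * (k \<phi> + r)"
      using s
    proof
      assume s1: "w = 1"
      have "\<exists>t\<ge>\<tau>0 \<phi>. t \<le> \<tau>0 \<phi> + d \<and> ?f t = e * (k \<phi> + r)"
        using a c s1 d cont by (intro IVT') auto
      then show ?thesis using s1 by auto
    next
      assume s1: "w = -1"
      have "\<exists>t\<ge>\<tau>0 \<phi> - d. t \<le> \<tau>0 \<phi> \<and> ?f t = e * (k \<phi> + r)"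
        using a c s1 d cont by (intro IVT2') auto
      then show ?thesis using s1 by auto
    qed
    then obtain t where t: "0 \<le> w * (t - \<tau>0 \<phi>)" "\<bar>t - \<tau>0 \<phi>\<bar> \<le> d" "?f t = e * (k \<phi> + r)" by blast
    have "t \<noteq> \<tau>0 \<phi>" "t \<noteq> \<tau>0 \<phi> + w * d" using t(3) a c by auto
    then show ?thesis using t s e by (intro exI[of _ t]) (auto simp: abs_if split: if_splits)
  qed
  \<comment> \<open>The level guaranteed at distance b/2 from \<tau>0, which still lies in the
    window because \<tau>0 is within b/2 of \<open>t0\<close>.\<close>
  define \<delta> where "\<delta> = min \<delta>1 (m / 2 * (b / 2)\<^sup>2)"
  have \<delta>: "0 < \<delta>" "\<delta> \<le> \<delta>1" "\<delta> \<le> m / 2 * (b / 2)\<^sup>2" using pos by (auto simp: \<delta>_def)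
  define \<tau> where "\<tau> = (\<lambda>r \<phi>. THE t. \<bar>t - t0\<bar> < b \<and> 0 < w * (t - \<tau>0 \<phi>) \<and> T t \<phi> = k \<phi> + r)"
  have \<tau>: "\<bar>\<tau> r \<phi> - t0\<bar> < b" "0 < w * (\<tau> r \<phi> - \<tau>0 \<phi>)" "T (\<tau> r \<phi>) \<phi> = k \<phi> + r" "\<bar>\<tau> r \<phi> - \<tau>0 \<phi>\<bar> < d"
    if d: "0 < d" "d \<le> b / 2" and \<phi>: "\<phi> \<in> J" and r: "0 < e * r" "\<bar>r\<bar> < m / 2 * d\<^sup>2" for d \<phi> r
  proof -
    obtain t where t: "0 < w * (t - \<tau>0 \<phi>)" "\<bar>t - \<tau>0 \<phi>\<bar> < d" "T t \<phi> = k \<phi> + r" using ex[OF d \<phi> r] by auto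
    have tb: "\<bar>t - t0\<bar> < b" using t(2) d(2) \<tau>0(1)[of \<phi>] \<phi> unfolding inJ by linarith
    have "\<tau> r \<phi> = t"
      unfolding \<tau>_def
    proof (rule the_equality)
      show "\<bar>t - t0\<bar> < b \<and> 0 < w * (t - \<tau>0 \<phi>) \<and> T t \<phi> = k \<phi> + r" using t tb by simp
      show "t' = t" if "\<bar>t' - t0\<bar> < b \<and> 0 < w * (t' - \<tau>0 \<phi>) \<and> T t' \<phi> = k \<phi> + r" for t'
        using uniq[of t' \<phi> t] that t tb \<phi> by simp
    qed
    with t tb show "\<bar>\<tau> r \<phi> - t0\<bar> < b" "0 < w * (\<tau> r \<phi> - \<tau>0 \<phi>)" "T (\<tau> r \<phi>) \<phi> = k \<phi> + r" "\<bar>\<tau> r \<phi> - \<tau>0 \<phi>\<bar> < d"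
      by auto
  qed
  let ?J = "{\<phi>0 - \<delta><..<\<phi>0 + \<delta>}" and ?I = "{r. 0 < e * r \<and> \<bar>r\<bar> < \<delta>}"
  have JJ: "?J \<subseteq> J" using \<delta> by (auto simp: J_def)
  have props: "\<bar>\<tau> r \<phi> - t0\<bar> < b" "0 < w * (\<tau> r \<phi> - \<tau>0 \<phi>)" "T (\<tau> r \<phi>) \<phi> = k \<phi> + r"
    if "r \<in> ?I" "\<phi> \<in> ?J" for r \<phi>
    using \<tau>[of "b/2" \<phi> r] that \<delta> pos JJ by auto
  have root: "T t \<phi> = k \<phi> + r \<longleftrightarrow> t = \<tau> r \<phi>"
    if "r \<in> ?I" "\<phi> \<in> ?J" "\<bar>t - t0\<bar> < b" "0 < w * (t - \<tau>0 \<phi>)" for r \<phi> t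
    using props[OF that(1,2)] uniq[of t \<phi> "\<tau> r \<phi>"] that JJ by auto
  have d\<tau>0: "(\<tau>0 has_field_derivative deriv \<tau>0 \<phi>) (at \<phi>)" if "\<phi> \<in> J" for \<phi>
    using tame_DERIV[OF tame0, of "()" \<phi>] that by (auto simp: J_def)
  \<comment> \<open>The envelope relation: the contribution of the moving tangency parameter carries
    the factor T1 (\<tau>0 \<phi>) \<phi> = 0.\<close>
  have dk: "(k has_field_derivative N (\<tau>0 \<phi>) \<phi>) (at \<phi>)" if "\<phi> \<in> J" for \<phi>
  proof -
    have "(k has_field_derivative deriv \<tau>0 \<phi> * T1 (\<tau>0 \<phi>) \<phi> + N (\<tau>0 \<phi>) \<phi>) (at \<phi>)"
      unfolding k_def T_def T1_def N_def
      by (rule derivative_eq_intros DERIV_chain2[OF smooth1_DERIV[OF g(1)] d\<tau>0[OF that]]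
          DERIV_chain2[OF smooth1_DERIV[OF g(2)] d\<tau>0[OF that]] refl)+ (simp add: algebra_simps)
    then show ?thesis using \<tau>0(2) that by (simp add: inJ)
  qed
  define H where "H = (\<lambda>f r \<phi>. integral {0..1} (\<lambda>t. 1 * deriv f (\<tau>0 \<phi> + t * (\<tau> r \<phi> - \<tau>0 \<phi>))) :: real)"
  have quot: "(N (\<tau>0 \<phi>) \<phi> - N (\<tau> r \<phi>) \<phi>) / T1 (\<tau> r \<phi>) \<phi> =
      - ((H g2 r \<phi> * cos \<phi> - H g1 r \<phi> * sin \<phi>) / (H (deriv g1) r \<phi> * cos \<phi> + H (deriv g2) r \<phi> * sin \<phi>))"
    "m \<le> \<bar>H (deriv g1) r \<phi> * cos \<phi> + H (deriv g2) r \<phi> * sin \<phi>\<bar>"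
    if r: "r \<in> ?I" and \<phi>: "\<phi> \<in> ?J" for r \<phi>
  proof -
    let ?D = "\<tau> r \<phi> - \<tau>0 \<phi>"
    have D: "?D \<noteq> 0" using props(2)[OF r \<phi>] by auto
    have H: "f (\<tau> r \<phi>) - f (\<tau>0 \<phi>) = ?D * H f r \<phi>" if "smooth1 f" for f
      unfolding H_def by (rule Hadamard_quotient[OF that])
    have 1: "N (\<tau>0 \<phi>) \<phi> - N (\<tau> r \<phi>) \<phi> = - (?D * (H g2 r \<phi> * cos \<phi> - H g1 r \<phi> * sin \<phi>))"
      using H[OF g(1)] H[OF g(2)] unfolding N_def
      by (simp add: algebra_simps) algebra
    have "T1 (\<tau> r \<phi>) \<phi> - T1 (\<tau>0 \<phi>) \<phi> = ?D * (H (deriv g1) r \<phi> * cos \<phi> + H (deriv g2) r \<phi> * sin \<phi>)"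
      using H[OF g'(1)] H[OF g'(2)] unfolding T1_def
      by (simp add: algebra_simps) algebra
    then have 2: "T1 (\<tau> r \<phi>) \<phi> = ?D * (H (deriv g1) r \<phi> * cos \<phi> + H (deriv g2) r \<phi> * sin \<phi>)"
      using \<tau>0(2)[of \<phi>] JJ \<phi> by (auto simp: inJ)
    show "(N (\<tau>0 \<phi>) \<phi> - N (\<tau> r \<phi>) \<phi>) / T1 (\<tau> r \<phi>) \<phi> =
      - ((H g2 r \<phi> * cos \<phi> - H g1 r \<phi> * sin \<phi>) / (H (deriv g1) r \<phi> * cos \<phi> + H (deriv g2) r \<phi> * sin \<phi>))"
      unfolding 1 2 using D by simp
    \<comment> \<open>The slope bound survives division by the common factor, so the new denominator
      stays at least \<open>m\<close> however small r is.\<close>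
    have "m * \<bar>?D\<bar> \<le> \<bar>T1 (\<tau> r \<phi>) \<phi>\<bar>"
      using T1_bd[OF less_imp_le[OF props(1)[OF r \<phi>]] subsetD[OF JJ \<phi>]] D e
      by (cases "\<tau>0 \<phi> < \<tau> r \<phi>") (auto simp: abs_if algebra_simps not_less split: if_splits)
    then have "m * \<bar>?D\<bar> \<le> \<bar>H (deriv g1) r \<phi> * cos \<phi> + H (deriv g2) r \<phi> * sin \<phi>\<bar> * \<bar>?D\<bar>"
      unfolding 2 abs_mult by (simp add: mult.commute)
    then show "m \<le> \<bar>H (deriv g1) r \<phi> * cos \<phi> + H (deriv g2) r \<phi> * sin \<phi>\<bar>"
      using D by (simp add: mult_le_cancel_right)
  qed
  have D: "(\<tau> r has_field_derivative
      - ((H g2 r \<phi> * cos \<phi> - H g1 r \<phi> * sin \<phi>) / (H (deriv g1) r \<phi> * cos \<phi> + H (deriv g2) r \<phi> * sin \<phi>))) (at \<phi>)"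
    if r: "r \<in> ?I" and \<phi>: "\<phi> \<in> ?J" for r \<phi>
  proof -
    note pr = props[OF r \<phi>]
    have \<phi>J: "\<phi> \<in> J" using \<phi> JJ by auto
    \<comment> \<open>Besides staying in the window, t must stay on its side of the moving \<tau>0:
      half of the gap is left to t and the other half to \<tau>0.\<close>
    define d where "d = min (b - \<bar>\<tau> r \<phi> - t0\<bar>) (\<bar>\<tau> r \<phi> - \<tau>0 \<phi>\<bar> / 2)"
    have gap: "\<bar>\<tau> r \<phi> - \<tau>0 \<phi>\<bar> / 2 > 0" using pr(2) by auto
    have "(\<tau> r has_field_derivative (N (\<tau>0 \<phi>) \<phi> - (g2 (\<tau> r \<phi>) * cos \<phi> - g1 (\<tau> r \<phi>) * sin \<phi>)) /
        (deriv g1 (\<tau> r \<phi>) * cos \<phi> + deriv g2 (\<tau> r \<phi>) * sin \<phi>)) (at \<phi>)"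
    proof (rule implicit_root_DERIV[where k="\<lambda>\<phi>. k \<phi> + r" and d=d, OF g])
      show "((\<lambda>\<phi>. k \<phi> + r) has_real_derivative N (\<tau>0 \<phi>) \<phi>) (at \<phi>)"
        using dk[OF \<phi>J] by (auto intro!: derivative_eq_intros)
      show "0 < d" using pr(1) gap by (simp add: d_def)
      show "g1 (\<tau> r \<phi>) * cos \<phi> + g2 (\<tau> r \<phi>) * sin \<phi> - (k \<phi> + r) = 0"
        using pr(3) by (simp add: T_def)
      show "deriv g1 (\<tau> r \<phi>) * cos \<phi> + deriv g2 (\<tau> r \<phi>) * sin \<phi> \<noteq> 0"
        using T1_nz[of "\<tau> r \<phi>" \<phi>] pr \<phi>J gap by (auto simp: T1_def)
      have "eventually (\<lambda>\<phi>. \<phi> \<in> ?J) (nhds \<phi>)"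
        using \<phi> by (intro eventually_nhds_in_open) auto
      moreover have "eventually (\<lambda>x. \<bar>\<tau>0 x - \<tau>0 \<phi>\<bar> < \<bar>\<tau> r \<phi> - \<tau>0 \<phi>\<bar> / 2) (nhds \<phi>)"
      proof -
        have "(\<tau>0 \<longlongrightarrow> \<tau>0 \<phi>) (nhds \<phi>)"
          using DERIV_isCont[OF d\<tau>0[OF \<phi>J]] by (simp add: continuous_within tendsto_nhds_iff)
        from tendstoD[OF this gap] show ?thesis by (simp add: dist_real_def)
      qed
      ultimately show "\<forall>\<^sub>F x in nhds \<phi>. \<forall>t. \<bar>t - \<tau> r \<phi>\<bar> < d \<and> g1 t * cos x + g2 t * sin x - (k x + r) = 0 \<longrightarrow> t = \<tau> r x"
      proof eventually_elim
        case (elim x)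
        show ?case
        proof (intro allI impI)
          fix t assume t: "\<bar>t - \<tau> r \<phi>\<bar> < d \<and> g1 t * cos x + g2 t * sin x - (k x + r) = 0"
          then have "\<bar>t - t0\<bar> < b" by (auto simp: d_def)
          moreover have "0 < w * (t - \<tau>0 x)"
            using t elim(2) pr(2) s by (auto simp: d_def abs_if split: if_splits)
          ultimately show "t = \<tau> r x" using root[OF r elim(1), of t] t by (auto simp: T_def)
        qed
      qed
    qed
    then show ?thesis using quot(1)[OF r \<phi>] by (simp add: N_def T1_def)
  qed
  have tame: "tame n ?J ?I \<tau>" for n
  proof (induction n)
    case 0
    show ?case
    proof (rule tame_0I[where C="\<bar>t0\<bar> + b"])
      show "continuous_on ?J (\<tau> r)" if "r \<in> ?I" for r
        using D[OF that] by (meson DERIV_isCont continuous_at_imp_continuous_on)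
      show "\<bar>\<tau> r \<phi>\<bar> \<le> \<bar>t0\<bar> + b" if "r \<in> ?I" "\<phi> \<in> ?J" for r \<phi>
        using props(1)[OF that] by auto
    qed
  next
    case (Suc n)
    have t0: "tame n ?J ?I (\<lambda>_. \<tau>0)"
      using tame_subset[OF tame_reindex[OF tame0[of n], of ?I "\<lambda>_. ()"] _ subset_refl, of ?J] JJ by (auto simp: J_def)
    have tH: "tame n ?J ?I (H f)" if "smooth1 f" for f
      unfolding H_def using tame_Hadamard[OF _ _ t0 Suc smooth1_deriv[OF that], of "\<lambda>_. 1"] by simp
    note tc = smooth1_tame[OF smooth1_cos] smooth1_tame[OF smooth1_sin] tH[OF g(1)] tH[OF g(2)] tH[OF g'(1)] tH[OF g'(2)]
    have "tame n ?J ?I (\<lambda>r \<phi>. - ((H g2 r \<phi> * cos \<phi> - H g1 r \<phi> * sin \<phi>) / (H (deriv g1) r \<phi> * cos \<phi> + H (deriv g2) r \<phi> * sin \<phi>)))"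
      by (intro tame_minus tame_divide[OF pos(3) quot(2)] tame_diff tame_add tame_mult tc; (assumption | simp)?)
    from tame_SucI[OF D this Suc] show ?case .
  qed
  have small: "\<exists>\<delta>'>0. \<forall>r \<phi>. 0 < e * r \<longrightarrow> \<bar>r\<bar> < \<delta>' \<longrightarrow> \<bar>\<phi> - \<phi>0\<bar> < \<delta>' \<longrightarrow> \<bar>\<tau> r \<phi> - t0\<bar> < e'" if "e' > 0" for e'
  proof -
    define d where "d = min (e' / 2) (b / 2)"
    have d: "0 < d" "d \<le> b / 2" "d \<le> e' / 2" using that pos by (auto simp: d_def)
    have "isCont \<tau>0 \<phi>0" using d\<tau>0[of \<phi>0] pos by (auto simp: J_def intro: DERIV_isCont)
    then obtain s where s: "s > 0" "\<And>\<phi>. \<bar>\<phi> - \<phi>0\<bar> < s \<Longrightarrow> \<bar>\<tau>0 \<phi> - t0\<bar> < e' / 2"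
      using \<tau>0(3) half_gt_zero[OF \<open>e' > 0\<close>] unfolding continuous_at_eps_delta dist_real_def by metis
    show ?thesis
    proof (intro exI[of _ "min (min s \<delta>1) (m / 2 * d\<^sup>2)"] conjI allI impI)
      show "0 < min (min s \<delta>1) (m / 2 * d\<^sup>2)" using s pos d by simp
      fix r \<phi> assume h: "0 < e * r" "\<bar>r\<bar> < min (min s \<delta>1) (m / 2 * d\<^sup>2)" "\<bar>\<phi> - \<phi>0\<bar> < min (min s \<delta>1) (m / 2 * d\<^sup>2)"
      have "\<bar>\<tau> r \<phi> - \<tau>0 \<phi>\<bar> < d" using h by (intro \<tau>(4)[OF d(1,2)]) (auto simp: inJ)
      moreover have "\<bar>\<tau>0 \<phi> - t0\<bar> < e' / 2" using s(2)[of \<phi>] h by simp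
      ultimately show "\<bar>\<tau> r \<phi> - t0\<bar> < e'" using d(3) by linarith
    qed
  qed
  show ?thesis
  proof (rule that[of \<delta> \<tau>])
    show "m / 2 * (t - \<tau>0 \<phi>)\<^sup>2 \<le> e * (T t \<phi> - T (\<tau>0 \<phi>) \<phi>)" if "\<bar>t - t0\<bar> \<le> b" "\<bar>\<phi> - \<phi>0\<bar> < \<delta>1" for t \<phi>
      using quad[of t \<phi>] that by (simp add: inJ)
    show "T t \<phi> = T (\<tau>0 \<phi>) \<phi> + r \<longleftrightarrow> t = \<tau> r \<phi>"
      if "0 < e * r" "\<bar>r\<bar> < \<delta>" "\<bar>\<phi> - \<phi>0\<bar> < \<delta>" "\<bar>t - t0\<bar> < b" "0 < w * (t - \<tau>0 \<phi>)" for r \<phi> t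
      using root[of r \<phi> t] that by (auto simp: abs_less_iff k_def)
    show "\<bar>\<tau> r \<phi> - t0\<bar> < b \<and> 0 < w * (\<tau> r \<phi> - \<tau>0 \<phi>)"
      if "0 < e * r" "\<bar>r\<bar> < \<delta>" "\<bar>\<phi> - \<phi>0\<bar> < \<delta>" for r \<phi>
      using props[of r \<phi>] that by (auto simp: abs_less_iff)
  qed (use \<delta> small tame in auto)
qed

section \<open>Chords along a family of lines\<close>

text \<open>Rotated coordinates of the plane: s is the signed distance of the line from the origin
  and u the arc length along it.\<close>

definition line_point :: "real \<Rightarrow> real \<Rightarrow> real \<Rightarrow> real^2" where
  "line_point \<phi> s u = s *\<^sub>R dir \<phi> + u *\<^sub>R perp (dir \<phi>)"

lemma dir_nth [simp]: "dir \<phi> $ 1 = cos \<phi>" "dir \<phi> $ 2 = sin \<phi>"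
  by (simp_all add: dir_def)

lemma perp_nth [simp]: "perp v $ 1 = - (v $ 2)" "perp v $ 2 = v $ 1"
  by (simp_all add: perp_def)

lemma inner_dir: "p \<bullet> dir \<phi> = p $ 1 * cos \<phi> + p $ 2 * sin \<phi>"
  by (simp add: inner_vec_def sum_2)

lemma inner_perp_dir: "p \<bullet> perp (dir \<phi>) = p $ 2 * cos \<phi> - p $ 1 * sin \<phi>"
  by (simp add: inner_vec_def sum_2)

lemma line_point_nth:
  "line_point \<phi> s u $ 1 = s * cos \<phi> - u * sin \<phi>" "line_point \<phi> s u $ 2 = s * sin \<phi> + u * cos \<phi>"
  by (simp_all add: line_point_def)

lemma eq_line_point_iff: "p = line_point \<phi> s u \<longleftrightarrow> p \<bullet> dir \<phi> = s \<and> p \<bullet> perp (dir \<phi>) = u"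
proof -
  have sc: "x * (cos \<phi>)\<^sup>2 + x * (sin \<phi>)\<^sup>2 = x" for x
    by (metis distrib_left mult.right_neutral sin_cos_squared_add2)
  have "line_point \<phi> s u \<bullet> dir \<phi> = s" "line_point \<phi> s u \<bullet> perp (dir \<phi>) = u"
    using sc[of s] sc[of u] by (simp_all add: inner_dir inner_perp_dir line_point_nth algebra_simps power2_eq_square)
  moreover have "line_point \<phi> (p \<bullet> dir \<phi>) (p \<bullet> perp (dir \<phi>)) = p"
    using sc[of "p $ 1"] sc[of "p $ 2"]
    by (simp add: vec_eq_iff forall_2 inner_dir inner_perp_dir line_point_nth algebra_simps power2_eq_square)
  ultimately show ?thesis by auto
qed

lemma line_point_inner [simp]:
  "line_point \<phi> s u \<bullet> dir \<phi> = s" "line_point \<phi> s u \<bullet> perp (dir \<phi>) = u"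
  using eq_line_point_iff[of "line_point \<phi> s u" \<phi> s u] by auto

lemma norm_dir [simp]: "norm (dir \<phi>) = 1"
  by (simp add: norm_eq_1 inner_dir flip: power2_eq_square)

lemma norm_perp_dir [simp]: "norm (perp (dir \<phi>)) = 1"
  by (simp add: norm_eq_1 inner_perp_dir flip: power2_eq_square)

lemma abs_le_norm_line_point: "\<bar>u\<bar> \<le> norm (line_point \<phi> s u)" "\<bar>s\<bar> \<le> norm (line_point \<phi> s u)"
  using Cauchy_Schwarz_ineq2[of "line_point \<phi> s u" "perp (dir \<phi>)"]
    Cauchy_Schwarz_ineq2[of "line_point \<phi> s u" "dir \<phi>"] by simp_all

lemma continuous_on_vec2:
  fixes f :: "'a::topological_space \<Rightarrow> real^2"
  assumes "continuous_on A (\<lambda>x. f x $ 1)" "continuous_on A (\<lambda>x. f x $ 2)"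
  shows "continuous_on A f"
proof -
  have "f = (\<lambda>x. \<chi> i. f x $ i)" by simp
  moreover have "continuous_on A (\<lambda>x. \<chi> i. f x $ i)"
  proof (rule continuous_on_vec_lambda)
    show "continuous_on A (\<lambda>x. f x $ i)" for i
      using assms exhaust_2[of i] by auto
  qed
  ultimately show ?thesis by simp
qed

lemma continuous_on_line_point [continuous_intros]:
  fixes f g h :: "'a::t2_space \<Rightarrow> real"
  assumes "continuous_on A f" "continuous_on A g" "continuous_on A h"
  shows "continuous_on A (\<lambda>x. line_point (f x) (g x) (h x))"
proof (rule continuous_on_vec2)
  show "continuous_on A (\<lambda>x. line_point (f x) (g x) (h x) $ 1)"
    unfolding line_point_nth by (intro continuous_intros continuous_on_cos continuous_on_sin assms)
  show "continuous_on A (\<lambda>x. line_point (f x) (g x) (h x) $ 2)"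
    unfolding line_point_nth by (intro continuous_intros continuous_on_cos continuous_on_sin assms)
qed

lemma continuous_on_dir [continuous_intros]:
  fixes f :: "'a::t2_space \<Rightarrow> real"
  assumes "continuous_on A f"
  shows "continuous_on A (\<lambda>x. dir (f x))" "continuous_on A (\<lambda>x. perp (dir (f x)))"
  using continuous_on_line_point[OF assms continuous_on_const[of _ 1] continuous_on_const[of _ 0]]
    continuous_on_line_point[OF assms continuous_on_const[of _ 0] continuous_on_const[of _ 1]]
  by (simp_all add: line_point_def)

text \<open>The compact segment keeps a positive distance from the complement of \<open>S\<close>,
  and a nearby line moves its points by less than that, uniformly for bounded u.\<close>

lemma line_point_tube:
  assumes "open S" "\<And>u. u \<in> {v..w} \<Longrightarrow> line_point \<phi>0 (h \<phi>0) u \<in> S" "isCont h \<phi>0"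
  obtains \<delta> where "\<delta> > 0"
    "\<And>r \<phi> u. \<bar>r\<bar> < \<delta> \<Longrightarrow> \<bar>\<phi> - \<phi>0\<bar> < \<delta> \<Longrightarrow> u \<in> {v..w} \<Longrightarrow> line_point \<phi> (h \<phi> + r) u \<in> S"
proof -
  let ?K = "line_point \<phi>0 (h \<phi>0) ` {v..w}"
  have "compact ?K" by (intro compact_continuous_image continuous_intros) auto
  moreover have "?K \<subseteq> S" using assms(2) by auto
  ultimately obtain e where e: "e > 0" "(\<Union>x\<in>?K. ball x e) \<subseteq> S"
    using compact_subset_open_imp_ball_epsilon_subset[OF _ assms(1)] by metis
  define M where "M = \<bar>v\<bar> + \<bar>w\<bar>"
  \<comment> \<open>Bounds the displacement caused by changing \<phi>; the shift r adds at most
    |r|.\<close>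
  define F where "F \<phi> = norm (h \<phi> *\<^sub>R dir \<phi> - h \<phi>0 *\<^sub>R dir \<phi>0) + M * norm (perp (dir \<phi>) - perp (dir \<phi>0))" for \<phi>
  have "isCont dir \<phi>0" "isCont (\<lambda>\<phi>. perp (dir \<phi>)) \<phi>0"
    using continuous_on_dir[OF continuous_on_id, of UNIV] by (simp_all add: continuous_on_eq_continuous_at)
  then have "isCont F \<phi>0" unfolding F_def by (intro continuous_intros assms(3))
  moreover have "F \<phi>0 = 0" by (simp add: F_def)
  moreover have "e / 2 > 0" using e by simp
  ultimately obtain s where s: "s > 0" "\<And>\<phi>. \<bar>\<phi> - \<phi>0\<bar> < s \<Longrightarrow> \<bar>F \<phi>\<bar> < e / 2"
    unfolding continuous_at_eps_delta dist_real_def by (metis diff_0_right)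
  show ?thesis
  proof (rule that[of "min s (e / 2)"])
    show "0 < min s (e / 2)" using s e by simp
    fix r \<phi> u assume h: "\<bar>r\<bar> < min s (e / 2)" "\<bar>\<phi> - \<phi>0\<bar> < min s (e / 2)" "u \<in> {v..w}"
    have "line_point \<phi> (h \<phi> + r) u - line_point \<phi>0 (h \<phi>0) u =
        (h \<phi> *\<^sub>R dir \<phi> - h \<phi>0 *\<^sub>R dir \<phi>0) + r *\<^sub>R dir \<phi> + u *\<^sub>R (perp (dir \<phi>) - perp (dir \<phi>0))"
      by (simp add: line_point_def algebra_simps)
    also have "norm \<dots> \<le> norm (h \<phi> *\<^sub>R dir \<phi> - h \<phi>0 *\<^sub>R dir \<phi>0) + norm (r *\<^sub>R dir \<phi>) + norm (u *\<^sub>R (perp (dir \<phi>) - perp (dir \<phi>0)))"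
      by (intro order_trans[OF norm_triangle_ineq] add_mono order_refl)
    also have "\<dots> \<le> F \<phi> + \<bar>r\<bar>"
    proof -
      have "\<bar>u\<bar> \<le> M" using h(3) by (auto simp: M_def)
      then show ?thesis by (simp add: F_def mult_right_mono)
    qed
    also have "\<dots> < e" using s(2)[of \<phi>] h by linarith
    finally have "line_point \<phi> (h \<phi> + r) u \<in> ball (line_point \<phi>0 (h \<phi>0) u) e"
      by (simp add: dist_norm norm_minus_commute)
    then show "line_point \<phi> (h \<phi> + r) u \<in> S" using e(2) h(3) by blast
  qed
qed

text \<open>The length of D inside a piece of each line, smooth in \<phi> with bounds uniform in r.
  No regularity in r is claimed, because the square root singularity sits there. The ends of the
  piece may move with the line, so that boundary points can serve as ends.\<close>

definition tame_chord ::
  "(real^2) set \<Rightarrow> real set \<Rightarrow> real set \<Rightarrow> (real \<Rightarrow> real) \<Rightarrow> (real \<Rightarrow> real \<Rightarrow> real) \<Rightarrow> (real \<Rightarrow> real \<Rightarrow> real) \<Rightarrow> bool" where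
  "tame_chord D J R h A B \<longleftrightarrow> (\<exists>L. (\<forall>n. tame n J R L) \<and>
     (\<forall>r\<in>R. \<forall>\<phi>\<in>J. ((\<lambda>u. indicator D (line_point \<phi> (h \<phi> + r) u) :: real) has_integral L r \<phi>) {A r \<phi>..B r \<phi>}))"

text \<open>Segments free of boundary points sweep out a connected set as \<phi> varies at fixed r,
  hence lie all inside or all outside D. The length is then B - A or 0, and the choice depends on r
  only.\<close>

lemma tame_chord_segment:
  assumes J: "connected J" and h: "continuous_on J h"
    and A: "\<And>n. tame n J R A" and B: "\<And>n. tame n J R B"
    and less: "\<And>r \<phi>. r \<in> R \<Longrightarrow> \<phi> \<in> J \<Longrightarrow> A r \<phi> < B r \<phi>"
    and avoid: "\<And>r \<phi> u. r \<in> R \<Longrightarrow> \<phi> \<in> J \<Longrightarrow> A r \<phi> < u \<Longrightarrow> u < B r \<phi> \<Longrightarrow> line_point \<phi> (h \<phi> + r) u \<notin> frontier D"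
  shows "tame_chord D J R h A B"
proof -
  have "\<exists>\<epsilon>::real. \<bar>\<epsilon>\<bar> \<le> 1 \<and> (\<forall>\<phi>\<in>J. \<forall>u. A r \<phi> < u \<longrightarrow> u < B r \<phi> \<longrightarrow> indicator D (line_point \<phi> (h \<phi> + r) u) = \<epsilon>)"
    if r: "r \<in> R" for r
  proof -
    \<comment> \<open>The curve of midpoints links the segments of different \<phi>.\<close>
    define M where "M \<phi> = line_point \<phi> (h \<phi> + r) ((A r \<phi> + B r \<phi>) / 2)" for \<phi>
    have seg: "line_point \<phi> (h \<phi> + r) u \<in> D \<longleftrightarrow> M \<phi> \<in> D" if \<phi>: "\<phi> \<in> J" and u: "A r \<phi> < u" "u < B r \<phi>" for \<phi> u
    proof -
      let ?S = "line_point \<phi> (h \<phi> + r) ` {A r \<phi><..<B r \<phi>}"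
      have "connected ?S" by (intro connected_continuous_image continuous_intros) auto
      moreover have "?S \<inter> frontier D = {}" using avoid[OF r \<phi>] by auto
      ultimately have "?S \<inter> D = {} \<or> ?S - D = {}" using connected_Int_frontier by blast
      moreover have "M \<phi> \<in> ?S" unfolding M_def using less[OF r \<phi>] by (intro imageI) auto
      moreover have "line_point \<phi> (h \<phi> + r) u \<in> ?S" using u by auto
      ultimately show ?thesis by blast
    qed
    have "connected (M ` J)"
      unfolding M_def by (intro connected_continuous_image J continuous_intros h
          tame_continuous[OF A[of 0] r] tame_continuous[OF B[of 0] r]) auto
    moreover have "M ` J \<inter> frontier D = {}" using avoid[OF r] less[OF r] by (auto simp: M_def)
    ultimately have "M ` J \<inter> D = {} \<or> M ` J - D = {}" using connected_Int_frontier by blast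
    then show ?thesis
    proof
      assume "M ` J \<inter> D = {}"
      then show ?thesis using seg by (intro exI[of _ 0]) (auto simp: indicator_def)
    next
      assume "M ` J - D = {}"
      then show ?thesis using seg by (intro exI[of _ 1]) (auto simp: indicator_def)
    qed
  qed
  then obtain \<epsilon> where \<epsilon>: "\<And>r. r \<in> R \<Longrightarrow> \<bar>\<epsilon> r\<bar> \<le> 1"
    "\<And>r \<phi> u. r \<in> R \<Longrightarrow> \<phi> \<in> J \<Longrightarrow> A r \<phi> < u \<Longrightarrow> u < B r \<phi> \<Longrightarrow> indicator D (line_point \<phi> (h \<phi> + r) u) = (\<epsilon> r :: real)"
    by metis
  show ?thesis
    unfolding tame_chord_def
  proof (intro exI[of _ "\<lambda>r \<phi>. \<epsilon> r * (B r \<phi> - A r \<phi>)"] conjI allI ballI)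
    show "tame n J R (\<lambda>r \<phi>. \<epsilon> r * (B r \<phi> - A r \<phi>))" for n
      by (intro tame_mult tame_const[where C=1] tame_diff A B \<epsilon>(1))
    fix r \<phi> assume r: "r \<in> R" and \<phi>: "\<phi> \<in> J"
    have "((\<lambda>_. \<epsilon> r) has_integral (B r \<phi> - A r \<phi>) *\<^sub>R \<epsilon> r) (cbox (A r \<phi>) (B r \<phi>))"
      using has_integral_const_real[of "\<epsilon> r" "A r \<phi>" "B r \<phi>"] less[OF r \<phi>] by simp
    from has_integral_spike_interior[OF this]
    show "((\<lambda>u. indicator D (line_point \<phi> (h \<phi> + r) u)) has_integral \<epsilon> r * (B r \<phi> - A r \<phi>)) {A r \<phi>..B r \<phi>}"
      using \<epsilon>(2)[OF r \<phi>] by (simp add: mult.commute)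
  qed
qed

lemma tame_chord_combine:
  assumes "tame_chord D J R h A B" "tame_chord D J R h B C"
    and "\<And>r \<phi>. r \<in> R \<Longrightarrow> \<phi> \<in> J \<Longrightarrow> A r \<phi> \<le> B r \<phi>" "\<And>r \<phi>. r \<in> R \<Longrightarrow> \<phi> \<in> J \<Longrightarrow> B r \<phi> \<le> C r \<phi>"
  shows "tame_chord D J R h A C"
proof -
  obtain L1 where L1: "\<And>n. tame n J R L1" "\<And>r \<phi>. r \<in> R \<Longrightarrow> \<phi> \<in> J \<Longrightarrow>
      ((\<lambda>u. indicator D (line_point \<phi> (h \<phi> + r) u) :: real) has_integral L1 r \<phi>) {A r \<phi>..B r \<phi>}"
    using assms(1) unfolding tame_chord_def by metis
  obtain L2 where L2: "\<And>n. tame n J R L2" "\<And>r \<phi>. r \<in> R \<Longrightarrow> \<phi> \<in> J \<Longrightarrow>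
      ((\<lambda>u. indicator D (line_point \<phi> (h \<phi> + r) u) :: real) has_integral L2 r \<phi>) {B r \<phi>..C r \<phi>}"
    using assms(2) unfolding tame_chord_def by metis
  show ?thesis
    unfolding tame_chord_def
    by (intro exI[of _ "\<lambda>r \<phi>. L1 r \<phi> + L2 r \<phi>"] conjI allI ballI tame_add L1(1) L2(1)
        has_integral_combine[OF assms(3,4) L1(2) L2(2)])
qed

lemma tame_chord_Un:
  assumes "tame_chord D J R h A B" "tame_chord D J R' h A B"
  shows "tame_chord D J (R \<union> R') h A B"
proof -
  obtain L1 where L1: "\<And>n. tame n J R L1" "\<And>r \<phi>. r \<in> R \<Longrightarrow> \<phi> \<in> J \<Longrightarrow>
      ((\<lambda>u. indicator D (line_point \<phi> (h \<phi> + r) u) :: real) has_integral L1 r \<phi>) {A r \<phi>..B r \<phi>}"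
    using assms(1) unfolding tame_chord_def by metis
  obtain L2 where L2: "\<And>n. tame n J R' L2" "\<And>r \<phi>. r \<in> R' \<Longrightarrow> \<phi> \<in> J \<Longrightarrow>
      ((\<lambda>u. indicator D (line_point \<phi> (h \<phi> + r) u) :: real) has_integral L2 r \<phi>) {A r \<phi>..B r \<phi>}"
    using assms(2) unfolding tame_chord_def by metis
  show ?thesis
    unfolding tame_chord_def
    by (rule exI[of _ "\<lambda>r. if r \<in> R then L1 r else L2 r"])
      (use L1(2) L2(2) tame_if[OF L1(1) L2(1)] in auto)
qed

lemma tame_chord_subset:
  "tame_chord D J R h A B \<Longrightarrow> J' \<subseteq> J \<Longrightarrow> R' \<subseteq> R \<Longrightarrow> tame_chord D J' R' h A B"
  unfolding tame_chord_def by (meson subsetD tame_subset)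

text \<open>Leaves out r = 0, where the lines may be tangent. Such lines form a null set in r, so
  integrals do not see them.\<close>

definition tame_chord_near :: "(real^2) set \<Rightarrow> real \<Rightarrow> (real \<Rightarrow> real) \<Rightarrow> real \<Rightarrow> real \<Rightarrow> bool" where
  "tame_chord_near D \<phi>0 h v w \<longleftrightarrow>
     (\<exists>\<delta>>0. tame_chord D {\<phi>0 - \<delta><..<\<phi>0 + \<delta>} {r. 0 < \<bar>r\<bar> \<and> \<bar>r\<bar> < \<delta>} h (\<lambda>_ _. v) (\<lambda>_ _. w))"

lemma tame_chord_near_combine:
  assumes "tame_chord_near D \<phi>0 h v w" "tame_chord_near D \<phi>0 h w z" "v \<le> w" "w \<le> z"
  shows "tame_chord_near D \<phi>0 h v z"
proof -
  obtain \<delta>1 where 1: "\<delta>1 > 0" "tame_chord D {\<phi>0 - \<delta>1<..<\<phi>0 + \<delta>1} {r. 0 < \<bar>r\<bar> \<and> \<bar>r\<bar> < \<delta>1} h (\<lambda>_ _. v) (\<lambda>_ _. w)"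
    using assms(1) unfolding tame_chord_near_def by blast
  obtain \<delta>2 where 2: "\<delta>2 > 0" "tame_chord D {\<phi>0 - \<delta>2<..<\<phi>0 + \<delta>2} {r. 0 < \<bar>r\<bar> \<and> \<bar>r\<bar> < \<delta>2} h (\<lambda>_ _. w) (\<lambda>_ _. z)"
    using assms(2) unfolding tame_chord_near_def by blast
  let ?d = "min \<delta>1 \<delta>2"
  have "tame_chord D {\<phi>0 - ?d<..<\<phi>0 + ?d} {r. 0 < \<bar>r\<bar> \<and> \<bar>r\<bar> < ?d} h (\<lambda>_ _. v) (\<lambda>_ _. z)"
    by (rule tame_chord_combine[OF tame_chord_subset[OF 1(2)] tame_chord_subset[OF 2(2)]]) (use assms in auto)
  then show ?thesis using 1 2 unfolding tame_chord_near_def by (intro exI[of _ ?d]) auto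
qed

lemma tame_chord_near_empty:
  assumes "v < w" "isCont h \<phi>0" "\<delta>0 > 0" "continuous_on {\<phi>0 - \<delta>0<..<\<phi>0 + \<delta>0} h"
    and "\<And>u. u \<in> {v..w} \<Longrightarrow> line_point \<phi>0 (h \<phi>0) u \<notin> frontier D"
  shows "tame_chord_near D \<phi>0 h v w"
proof -
  have "open (- frontier D)" using frontier_closed open_Compl by blast
  then obtain \<delta> where \<delta>: "\<delta> > 0"
    "\<And>r \<phi> u. \<bar>r\<bar> < \<delta> \<Longrightarrow> \<bar>\<phi> - \<phi>0\<bar> < \<delta> \<Longrightarrow> u \<in> {v..w} \<Longrightarrow> line_point \<phi> (h \<phi> + r) u \<in> - frontier D"
    by (rule line_point_tube[OF _ _ assms(2)]) (use assms(5) in auto)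
  let ?d = "min \<delta>0 \<delta>"
  have "tame_chord D {\<phi>0 - ?d<..<\<phi>0 + ?d} {r. 0 < \<bar>r\<bar> \<and> \<bar>r\<bar> < ?d} h (\<lambda>_ _. v) (\<lambda>_ _. w)"
  proof (rule tame_chord_segment)
    show "line_point \<phi> (h \<phi> + r) u \<notin> frontier D"
      if "r \<in> {r. 0 < \<bar>r\<bar> \<and> \<bar>r\<bar> < ?d}" "\<phi> \<in> {\<phi>0 - ?d<..<\<phi>0 + ?d}" "v < u" "u < w" for r \<phi> u
    proof -
      have "\<bar>r\<bar> < \<delta>" "\<bar>\<phi> - \<phi>0\<bar> < \<delta>" using that by (auto simp: abs_less_iff)
      then show ?thesis using \<delta>(2)[of r \<phi> u] that by auto
    qed
    show "continuous_on {\<phi>0 - ?d<..<\<phi>0 + ?d} h"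
      by (rule continuous_on_subset[OF assms(4)]) auto
  qed (use assms in \<open>auto intro: tame_const[where C="\<bar>v\<bar>"] tame_const[where C="\<bar>w\<bar>"]\<close>)
  then show ?thesis using \<delta> assms(3) unfolding tame_chord_near_def by (intro exI[of _ ?d]) auto
qed

text \<open>Induction on the number of boundary points of the base line in \<open>{v..w}\<close>:
  cut out a window around one of them and treat the two remaining intervals, which contain fewer.
  Windows are available at every small width, so one fits between the ends.\<close>

lemma tame_chord_near_finite:
  fixes D :: "(real^2) set" and h :: "real \<Rightarrow> real"
  assumes h: "isCont h \<phi>0" "\<delta>0 > 0" "continuous_on {\<phi>0 - \<delta>0<..<\<phi>0 + \<delta>0} h"
  defines "Z \<equiv> {u. line_point \<phi>0 (h \<phi>0) u \<in> frontier D}"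
  assumes window: "\<And>u. u \<in> Z \<Longrightarrow> \<exists>a0>0. \<forall>a. 0 < a \<longrightarrow> a < a0 \<longrightarrow> tame_chord_near D \<phi>0 h (u - a) (u + a) \<and> Z \<inter> {u - a..u + a} = {u}"
    and "finite (Z \<inter> {v..w})"
  shows "v < w \<Longrightarrow> v \<notin> Z \<Longrightarrow> w \<notin> Z \<Longrightarrow> tame_chord_near D \<phi>0 h v w"
  using assms(6)
proof (induction "card (Z \<inter> {v..w})" arbitrary: v w rule: less_induct)
  case less
  show ?case
  proof (cases "Z \<inter> {v..w} = {}")
    case True
    then show ?thesis using less(2) by (intro tame_chord_near_empty[OF _ h]) (auto simp: Z_def)
  next
    case False
    then obtain u where u: "u \<in> Z" "v \<le> u" "u \<le> w" by auto
    then have vuw: "v < u" "u < w" using less(3,4) by (auto simp: le_less)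
    obtain a0 where a0: "a0 > 0" "\<And>a. 0 < a \<Longrightarrow> a < a0 \<Longrightarrow> tame_chord_near D \<phi>0 h (u - a) (u + a) \<and> Z \<inter> {u - a..u + a} = {u}"
      using window[OF u(1)] by blast
    define a where "a = min a0 (min (u - v) (w - u)) / 2"
    have a: "0 < a" "a < a0" "v < u - a" "u + a < w" using a0(1) vuw by (auto simp: a_def min_def field_simps)
    note w = a0(2)[OF a(1,2)]
    have notin: "u - a \<notin> Z" "u + a \<notin> Z"
    proof -
      have "u - a \<in> {u - a..u + a}" "u + a \<in> {u - a..u + a}" "u - a \<noteq> u" "u + a \<noteq> u" using a(1) by auto
      then show "u - a \<notin> Z" "u + a \<notin> Z" using w by blast+
    qed
    have "card (Z \<inter> {v..u - a}) < card (Z \<inter> {v..w})" "card (Z \<inter> {u + a..w}) < card (Z \<inter> {v..w})"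
    proof -
      have n: "u \<in> Z \<inter> {v..w}" "u \<notin> Z \<inter> {v..u - a}" "u \<notin> Z \<inter> {u + a..w}" using u a by auto
      have s: "Z \<inter> {v..u - a} \<subseteq> Z \<inter> {v..w}" "Z \<inter> {u + a..w} \<subseteq> Z \<inter> {v..w}" using a by auto
      have "Z \<inter> {v..u - a} \<subset> Z \<inter> {v..w}" "Z \<inter> {u + a..w} \<subset> Z \<inter> {v..w}"
        using n s by (metis psubsetI)+
      then show "card (Z \<inter> {v..u - a}) < card (Z \<inter> {v..w})" "card (Z \<inter> {u + a..w}) < card (Z \<inter> {v..w})"
        by (simp_all add: psubset_card_mono[OF less(5)])
    qed
    moreover have "finite (Z \<inter> {v..u - a})" "finite (Z \<inter> {u + a..w})"
      using less(5) a by (auto elim!: rev_finite_subset)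
    ultimately have "tame_chord_near D \<phi>0 h v (u - a)" "tame_chord_near D \<phi>0 h (u + a) w"
      using less(1)[of v "u - a"] less(1)[of "u + a" w] notin less(3,4) a by auto
    then have "tame_chord_near D \<phi>0 h v (u + a)"
      using w a by (intro tame_chord_near_combine[of D \<phi>0 h v "u - a" "u + a"]) auto
    then show ?thesis
      using \<open>tame_chord_near D \<phi>0 h (u + a) w\<close> a vuw
      by (intro tame_chord_near_combine[of D \<phi>0 h v "u + a" w]) auto
  qed
qed

section \<open>Coordinate functions of a smooth plane curve\<close>

lemma smooth_on_UNIV_velocity:
  fixes g :: "real \<Rightarrow> real^2"
  assumes "smooth_on UNIV g"
  shows "(g has_vector_derivative velocity g t) (at t)" "smooth_on UNIV (velocity g)"
proof -
  have "cdiff_on (Suc k) UNIV g" for k using assms unfolding smooth_on_def by blast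
  then have d: "g differentiable (at x)" and s: "cdiff_on k UNIV (\<lambda>x. frechet_derivative g (at x) v)" for x k v
    by auto
  show v: "(g has_vector_derivative velocity g t) (at t)" for t
    using d vector_derivative_works by blast
  have "frechet_derivative g (at t) 1 = velocity g t" for t
    using frechet_derivative_at[OF v[of t, unfolded has_vector_derivative_def]] by (metis scaleR_one)
  then show "smooth_on UNIV (velocity g)"
    using s[of _ 1] by (simp add: smooth_on_def)
qed

lemma has_vector_derivative_vec_nth:
  assumes "(g has_vector_derivative v) (at t)"
  shows "((\<lambda>t. g t $ i :: real) has_real_derivative v $ i) (at t)"
  using bounded_linear.has_vector_derivative[OF bounded_linear_vec_nth assms, of i]
  by (simp add: has_real_derivative_iff_has_vector_derivative)

lemma smooth1_vec_nth:
  fixes g :: "real \<Rightarrow> real^2"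
  assumes "smooth_on UNIV g"
  shows "smooth1 (\<lambda>t. g t $ i)" "deriv (\<lambda>t. g t $ i) = (\<lambda>t. velocity g t $ i)"
proof -
  note D = has_vector_derivative_vec_nth[OF smooth_on_UNIV_velocity(1)]
  show "smooth1 (\<lambda>t. g t $ i)"
    by (rule smooth1_coinduct[of "\<lambda>f. \<exists>g :: real \<Rightarrow> real^2. smooth_on UNIV g \<and> f = (\<lambda>t. g t $ i)"])
      (use assms D smooth_on_UNIV_velocity(2) in blast)+
  show "deriv (\<lambda>t. g t $ i) = (\<lambda>t. velocity g t $ i)"
    using DERIV_imp_deriv[OF D[OF assms]] by auto
qed

section \<open>Crossings of a line with the boundary curve\<close>

lemma trig_combination_near:
  fixes f g :: "real \<Rightarrow> real"
  assumes "isCont f t0" "isCont g t0" "e > 0"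
  obtains d where "d > 0" "\<And>t \<phi>. \<bar>t - t0\<bar> < d \<Longrightarrow> \<bar>\<phi> - \<phi>0\<bar> < d \<Longrightarrow>
    \<bar>(f t * cos \<phi> + g t * sin \<phi>) - (f t0 * cos \<phi>0 + g t0 * sin \<phi>0)\<bar> < e"
proof -
  have "isCont (\<lambda>p. f (fst p) * cos (snd p) + g (fst p) * sin (snd p)) (t0, \<phi>0)"
    by (intro continuous_intros isCont_o2[where g=f and f=fst] isCont_o2[where g=g and f=fst]) (use assms in auto)
  then obtain s where s: "s > 0" "\<And>t \<phi>. dist (t, \<phi>) (t0, \<phi>0) < s \<Longrightarrow>
      \<bar>(f t * cos \<phi> + g t * sin \<phi>) - (f t0 * cos \<phi>0 + g t0 * sin \<phi>0)\<bar> < e"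
    using assms unfolding continuous_at_eps_delta by (metis dist_real_def fst_conv snd_conv)
  show ?thesis
  proof (rule that[of "s / 2"])
    fix t \<phi> assume h: "\<bar>t - t0\<bar> < s / 2" "\<bar>\<phi> - \<phi>0\<bar> < s / 2"
    have "dist (t, \<phi>) (t0, \<phi>0) \<le> \<bar>t - t0\<bar> + \<bar>\<phi> - \<phi>0\<bar>"
      by (simp add: dist_prod_def dist_real_def sqrt_sum_squares_le_sum_abs)
    then show "\<bar>(f t * cos \<phi> + g t * sin \<phi>) - (f t0 * cos \<phi>0 + g t0 * sin \<phi>0)\<bar> < e"
      using h by (intro s(2)) auto
  qed (use s in auto)
qed

locale boundary_curve =
  fixes D :: "(real^2) set" and c :: "real \<Rightarrow> real^2" and l :: real
  assumes curve: "smooth_simple_closed_curve c l" and boundary: "frontier D = range c"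
begin

definition cx where "cx t = c t $ 1"
definition cy where "cy t = c t $ 2"

lemma smooth_c: "smooth_on UNIV c" and l_pos: "l > 0" and velocity_nz: "velocity c t \<noteq> 0"
  and inj_c: "inj_on c {0..<l}"
  using curve unfolding smooth_simple_closed_curve_def by auto

lemma smooth1_c: "smooth1 cx" "smooth1 cy"
  using smooth1_vec_nth(1)[OF smooth_c] by (auto simp: cx_def[abs_def] cy_def[abs_def])

lemma deriv_c: "deriv cx t = velocity c t $ 1" "deriv cy t = velocity c t $ 2"
  using smooth1_vec_nth(2)[OF smooth_c] by (auto simp: cx_def[abs_def] cy_def[abs_def] fun_eq_iff)

lemma deriv2_c: "deriv (deriv cx) t = velocity (velocity c) t $ 1" "deriv (deriv cy) t = velocity (velocity c) t $ 2"
proof -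
  have e: "deriv cx = (\<lambda>t. velocity c t $ 1)" "deriv cy = (\<lambda>t. velocity c t $ 2)"
    by (auto simp: deriv_c)
  show "deriv (deriv cx) t = velocity (velocity c) t $ 1" "deriv (deriv cy) t = velocity (velocity c) t $ 2"
    unfolding e smooth1_vec_nth(2)[OF smooth_on_UNIV_velocity(2)[OF smooth_c]] by (rule refl)+
qed

lemma c_inner_dir: "c t \<bullet> dir \<phi> = cx t * cos \<phi> + cy t * sin \<phi>"
  and c_inner_perp: "c t \<bullet> perp (dir \<phi>) = cy t * cos \<phi> - cx t * sin \<phi>"
  by (simp_all add: inner_dir inner_perp_dir cx_def cy_def)

lemma continuous_c: "continuous_on A c"
  by (rule continuous_on_vec2) (use smooth1_c in \<open>auto simp: cx_def[abs_def] cy_def[abs_def] intro: smooth1_continuous_on\<close>)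

lemma c_periodic_int: "c (t + of_int k * l) = c t"
proof -
  have per: "c (t + l) = c t" for t using curve unfolding smooth_simple_closed_curve_def by auto
  have n: "c (t + real n * l) = c t" for n t
  proof (induction n)
    case (Suc n)
    then show ?case using per[of "t + real n * l"] by (simp add: algebra_simps)
  qed simp
  show ?thesis
  proof (cases "k \<ge> 0")
    case True
    then show ?thesis using n[of t "nat k"] by simp
  next
    case False
    then show ?thesis using n[of "t + of_int k * l" "nat (- k)"] by simp
  qed
qed

lemma shift_into_period:
  obtains k :: int where "t + of_int k * l \<in> {a..<a + l}"
proof
  define m where "m = \<lfloor>(t - a) / l\<rfloor>"
  have "of_int m \<le> (t - a) / l" "(t - a) / l < of_int m + 1"
    unfolding m_def by linarith+
  then have "of_int m * l \<le> t - a" "t - a < (of_int m + 1) * l"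
    using l_pos by (simp_all add: field_simps)
  then show "t + of_int (- m) * l \<in> {a..<a + l}" by (auto simp: algebra_simps)
qed

lemma inj_on_period: "inj_on c {a..<a + l}"
proof (rule inj_onI)
  fix s t assume st: "s \<in> {a..<a + l}" "t \<in> {a..<a + l}" "c s = c t"
  obtain i where i: "s + of_int i * l \<in> {0..<0 + l}" by (rule shift_into_period)
  obtain j where j: "t + of_int j * l \<in> {0..<0 + l}" by (rule shift_into_period)
  have "s + of_int i * l = t + of_int j * l"
    using inj_onD[OF inj_c, of "s + of_int i * l" "t + of_int j * l"] i j st(3) by (simp add: c_periodic_int)
  then have e: "s - t = of_int (j - i) * l" by (simp add: algebra_simps)
  have "\<bar>s - t\<bar> < l" using st by auto
  then have "\<bar>of_int (j - i)\<bar> * l < 1 * l" unfolding e abs_mult using l_pos by simp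
  then have "\<bar>of_int (j - i) :: real\<bar> < 1" using l_pos by (simp only: mult_less_cancel_right)
  then have "j - i = 0" by linarith
  with e show "s = t" by simp
qed

text \<open>Outside the window the curve is, over one period, a compact arc that misses
  \<open>c t0\<close> by injectivity and so keeps a positive distance from it. A curve point close
  to \<open>c t0\<close> in the plane therefore has a parameter close to \<open>t0\<close>.\<close>

lemma local_injectivity:
  assumes "b > 0"
  obtains \<rho> where "\<rho> > 0" "\<And>t. dist (c t) (c t0) < \<rho> \<Longrightarrow> \<exists>t'. \<bar>t' - t0\<bar> < b \<and> c t' = c t"
proof -
  define b' where "b' = min b (l / 2)"
  have b': "0 < b'" "b' \<le> b" "b' \<le> l / 2" using assms l_pos by (auto simp: b'_def)
  let ?K = "c ` {t0 + b'..t0 + l - b'}"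
  have "closed ?K" by (intro compact_imp_closed compact_continuous_image continuous_c) auto
  moreover have "c t0 \<notin> ?K"
  proof
    assume "c t0 \<in> ?K"
    then obtain s where "s \<in> {t0 + b'..t0 + l - b'}" "c s = c t0" by auto
    then show False using inj_onD[OF inj_on_period[of t0], of s t0] b' l_pos by auto
  qed
  ultimately obtain \<rho> where \<rho>: "\<rho> > 0" "ball (c t0) \<rho> \<subseteq> - ?K"
    by (metis ComplI open_Compl open_contains_ball)
  show ?thesis
  proof (rule that[OF \<rho>(1)])
    fix t assume d: "dist (c t) (c t0) < \<rho>"
    obtain k where k: "t + of_int k * l \<in> {t0..<t0 + l}" by (rule shift_into_period)
    let ?s = "t + of_int k * l"
    have cs: "c ?s = c t" by (rule c_periodic_int)
    have "c t \<in> ball (c t0) \<rho>" using d by (simp add: dist_commute)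
    then have "c t \<notin> ?K" using \<rho>(2) by blast
    then have "?s \<notin> {t0 + b'..t0 + l - b'}" using cs by (metis imageI)
    then consider "?s < t0 + b'" | "?s > t0 + l - b'" by fastforce
    then show "\<exists>t'. \<bar>t' - t0\<bar> < b \<and> c t' = c t"
    proof cases
      case 1
      then show ?thesis using k b' cs by (intro exI[of _ ?s]) auto
    next
      case 2
      have "c (?s - l) = c t" using c_periodic_int[of "?s" "-1"] cs by simp
      then show ?thesis using 2 k b' by (intro exI[of _ "?s - l"]) auto
    qed
  qed
qed

lemma smooth1_tame_offset:
  assumes "\<And>n. tame n J R (\<tau> :: real \<Rightarrow> real \<Rightarrow> real)" "bounded J"
  shows "tame n J R (\<lambda>r \<phi>. cy (\<tau> r \<phi>) * cos \<phi> - cx (\<tau> r \<phi>) * sin \<phi>)"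
  by (intro tame_diff tame_mult tame_compose[OF assms(1)] smooth1_c
      smooth1_tame[OF smooth1_cos assms(2)] smooth1_tame[OF smooth1_sin assms(2)])

lemma offset_near:
  assumes "e > 0"
  obtains d where "d > 0" "\<And>t \<phi>. \<bar>t - t0\<bar> < d \<Longrightarrow> \<bar>\<phi> - \<phi>0\<bar> < d \<Longrightarrow>
    \<bar>(cy t * cos \<phi> - cx t * sin \<phi>) - (cy t0 * cos \<phi>0 - cx t0 * sin \<phi>0)\<bar> < e"
proof -
  have "isCont cy t0" "isCont (\<lambda>t. - cx t) t0"
    by (intro continuous_intros smooth1_isCont smooth1_c)+
  from trig_combination_near[OF this assms, of \<phi>0] that show ?thesis by simp metis
qed

text \<open>Translates membership in the boundary into an equation for the curve parameter in a
  fixed window, where the root lemmas decide it. Points of nearby lines at offsets near u0 lie close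
  to \<open>c t0\<close>, so \<open>local_injectivity\<close> applies.\<close>

lemma boundary_hits:
  assumes "b > 0" "isCont h \<phi>0" and u0: "line_point \<phi>0 (h \<phi>0) u0 = c t0"
  obtains \<rho> where "\<rho> > 0"
    "\<And>a. 0 < a \<Longrightarrow> a < \<rho> \<Longrightarrow> \<exists>\<delta>>0. \<forall>r \<phi> u. \<bar>r\<bar> < \<delta> \<longrightarrow> \<bar>\<phi> - \<phi>0\<bar> < \<delta> \<longrightarrow> \<bar>u - u0\<bar> \<le> a \<longrightarrow>
        line_point \<phi> (h \<phi> + r) u \<in> frontier D \<longrightarrow>
        (\<exists>t. \<bar>t - t0\<bar> < b \<and> cx t * cos \<phi> + cy t * sin \<phi> = h \<phi> + r \<and> cy t * cos \<phi> - cx t * sin \<phi> = u)"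
proof -
  obtain \<rho> where \<rho>: "\<rho> > 0" "\<And>t. dist (c t) (c t0) < \<rho> \<Longrightarrow> \<exists>t'. \<bar>t' - t0\<bar> < b \<and> c t' = c t"
    using local_injectivity[OF assms(1), of t0] by metis
  show ?thesis
  proof (rule that[OF \<rho>(1)])
    fix a :: real assume a: "0 < a" "a < \<rho>"
    have tube: "line_point \<phi>0 (h \<phi>0) u \<in> ball (c t0) \<rho>" if "u \<in> {u0 - a..u0 + a}" for u
    proof -
      have "c t0 - line_point \<phi>0 (h \<phi>0) u = (u0 - u) *\<^sub>R perp (dir \<phi>0)"
        unfolding u0[symmetric] by (simp add: line_point_def algebra_simps)
      then have "dist (c t0) (line_point \<phi>0 (h \<phi>0) u) = \<bar>u0 - u\<bar>" by (simp add: dist_norm)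
      then show ?thesis using that a by (auto simp: abs_le_iff)
    qed
    from line_point_tube[OF open_ball tube assms(2)] obtain \<delta> where \<delta>: "\<delta> > 0"
      "\<And>r \<phi> u. \<bar>r\<bar> < \<delta> \<Longrightarrow> \<bar>\<phi> - \<phi>0\<bar> < \<delta> \<Longrightarrow> u \<in> {u0 - a..u0 + a} \<Longrightarrow> line_point \<phi> (h \<phi> + r) u \<in> ball (c t0) \<rho>"
      by metis
    show "\<exists>\<delta>>0. \<forall>r \<phi> u. \<bar>r\<bar> < \<delta> \<longrightarrow> \<bar>\<phi> - \<phi>0\<bar> < \<delta> \<longrightarrow> \<bar>u - u0\<bar> \<le> a \<longrightarrow>
        line_point \<phi> (h \<phi> + r) u \<in> frontier D \<longrightarrow>
        (\<exists>t. \<bar>t - t0\<bar> < b \<and> cx t * cos \<phi> + cy t * sin \<phi> = h \<phi> + r \<and> cy t * cos \<phi> - cx t * sin \<phi> = u)"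
    proof (rule exI[of _ \<delta>], intro conjI allI impI)
      fix r \<phi> u assume h: "\<bar>r\<bar> < \<delta>" "\<bar>\<phi> - \<phi>0\<bar> < \<delta>" "\<bar>u - u0\<bar> \<le> a" "line_point \<phi> (h \<phi> + r) u \<in> frontier D"
      then obtain t where t: "line_point \<phi> (h \<phi> + r) u = c t" using boundary by auto
      have "u \<in> {u0 - a..u0 + a}" using h(3) by (auto simp: abs_le_iff)
      from \<delta>(2)[OF h(1,2) this] have "dist (c t) (c t0) < \<rho>" by (simp add: t dist_commute)
      then obtain t' where t': "\<bar>t' - t0\<bar> < b" "c t' = c t" using \<rho>(2) by blast
      then have "c t' = line_point \<phi> (h \<phi> + r) u" using t by simp
      then have "c t' \<bullet> dir \<phi> = h \<phi> + r" "c t' \<bullet> perp (dir \<phi>) = u" by simp_all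
      then show "\<exists>t. \<bar>t - t0\<bar> < b \<and> cx t * cos \<phi> + cy t * sin \<phi> = h \<phi> + r \<and> cy t * cos \<phi> - cx t * sin \<phi> = u"
        using t'(1) by (intro exI[of _ t']) (simp add: c_inner_dir c_inner_perp)
    qed (fact \<delta>(1))
  qed
qed

text \<open>Each line near a transversal crossing meets the boundary there in a single point, at an
  offset \<open>U\<close> that is smooth in \<phi> uniformly in r. It cuts the window into two
  pieces free of boundary points.\<close>

lemma window_transversal:
  assumes h: "\<delta>0 > 0" "\<And>n. tame n {\<phi>0 - \<delta>0<..<\<phi>0 + \<delta>0} (UNIV :: unit set) (\<lambda>_. h)"
    and u0: "line_point \<phi>0 (h \<phi>0) u0 = c t0"
    and tr: "deriv cx t0 * cos \<phi>0 + deriv cy t0 * sin \<phi>0 \<noteq> 0"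
  shows "\<exists>a0>0. \<forall>a. 0 < a \<longrightarrow> a < a0 \<longrightarrow> tame_chord_near D \<phi>0 h (u0 - a) (u0 + a) \<and>
    {u. line_point \<phi>0 (h \<phi>0) u \<in> frontier D} \<inter> {u0 - a..u0 + a} = {u0}"
proof -
  let ?J0 = "{\<phi>0 - \<delta>0<..<\<phi>0 + \<delta>0}"
  have conth: "continuous_on ?J0 h" using tame_continuous[OF h(2)[of 0], of "()"] by simp
  have isCh: "isCont h \<phi>0" using tame_DERIV[OF h(2), of "()" \<phi>0] h(1) by (auto intro: DERIV_isCont)
  define F where "F = (\<lambda>t \<phi>. cy t * cos \<phi> - cx t * sin \<phi>)"
  have base: "cx t0 * cos \<phi>0 + cy t0 * sin \<phi>0 = h \<phi>0" "F t0 \<phi>0 = u0"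
    using u0[symmetric] unfolding eq_line_point_iff by (simp_all add: c_inner_dir c_inner_perp F_def)
  obtain b \<delta> \<tau> where b: "0 < b" and \<delta>: "0 < \<delta>" "\<delta> \<le> \<delta>0" and
    root: "\<And>r \<phi> t. \<bar>r\<bar> < \<delta> \<Longrightarrow> \<bar>\<phi> - \<phi>0\<bar> < \<delta> \<Longrightarrow> \<bar>t - t0\<bar> < b \<Longrightarrow> cx t * cos \<phi> + cy t * sin \<phi> = h \<phi> + r \<longleftrightarrow> t = \<tau> r \<phi>" and
    near: "\<And>r \<phi>. \<bar>r\<bar> < \<delta> \<Longrightarrow> \<bar>\<phi> - \<phi>0\<bar> < \<delta> \<Longrightarrow> \<bar>\<tau> r \<phi> - t0\<bar> < b" and
    small: "\<And>e. e > 0 \<Longrightarrow> \<exists>\<delta>'>0. \<forall>r \<phi>. \<bar>r\<bar> < \<delta>' \<longrightarrow> \<bar>\<phi> - \<phi>0\<bar> < \<delta>' \<longrightarrow> \<bar>\<tau> r \<phi> - t0\<bar> < e" and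
    tame: "\<And>n. tame n {\<phi>0 - \<delta><..<\<phi>0 + \<delta>} {r. \<bar>r\<bar> < \<delta>} \<tau>"
    by (rule transversal_root[OF smooth1_c h(2) h(1) zero_less_one base(1) tr]) blast
  obtain \<rho> where \<rho>: "\<rho> > 0" and hits:
    "\<And>a. 0 < a \<Longrightarrow> a < \<rho> \<Longrightarrow> \<exists>\<delta>>0. \<forall>r \<phi> u. \<bar>r\<bar> < \<delta> \<longrightarrow> \<bar>\<phi> - \<phi>0\<bar> < \<delta> \<longrightarrow> \<bar>u - u0\<bar> \<le> a \<longrightarrow>
        line_point \<phi> (h \<phi> + r) u \<in> frontier D \<longrightarrow>
        (\<exists>t. \<bar>t - t0\<bar> < b \<and> cx t * cos \<phi> + cy t * sin \<phi> = h \<phi> + r \<and> cy t * cos \<phi> - cx t * sin \<phi> = u)"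
    using boundary_hits[OF b isCh u0] by metis
  define U where "U = (\<lambda>r \<phi>. F (\<tau> r \<phi>) \<phi>)"
  have win: "tame_chord_near D \<phi>0 h (u0 - a) (u0 + a) \<and>
    {u. line_point \<phi>0 (h \<phi>0) u \<in> frontier D} \<inter> {u0 - a..u0 + a} = {u0}" if a: "0 < a" "a < \<rho>" for a
  proof -
    from hits[OF a] obtain \<delta>1 where \<delta>1: "\<delta>1 > 0" and hit: "\<And>r \<phi> u. \<bar>r\<bar> < \<delta>1 \<Longrightarrow> \<bar>\<phi> - \<phi>0\<bar> < \<delta>1 \<Longrightarrow> \<bar>u - u0\<bar> \<le> a \<Longrightarrow>
        line_point \<phi> (h \<phi> + r) u \<in> frontier D \<Longrightarrow>
        \<exists>t. \<bar>t - t0\<bar> < b \<and> cx t * cos \<phi> + cy t * sin \<phi> = h \<phi> + r \<and> F t \<phi> = u"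
      unfolding F_def by metis
    obtain d where d: "d > 0" "\<And>t \<phi>. \<bar>t - t0\<bar> < d \<Longrightarrow> \<bar>\<phi> - \<phi>0\<bar> < d \<Longrightarrow> \<bar>F t \<phi> - F t0 \<phi>0\<bar> < a"
      using offset_near[OF a(1)] unfolding F_def by metis
    obtain \<delta>2 where \<delta>2: "\<delta>2 > 0" "\<And>r \<phi>. \<bar>r\<bar> < \<delta>2 \<Longrightarrow> \<bar>\<phi> - \<phi>0\<bar> < \<delta>2 \<Longrightarrow> \<bar>\<tau> r \<phi> - t0\<bar> < d"
      using small[OF d(1)] by blast
    define \<delta>3 where "\<delta>3 = Min {\<delta>, \<delta>1, \<delta>2, d}"
    have \<delta>3: "0 < \<delta>3" "\<delta>3 \<le> \<delta>" "\<delta>3 \<le> \<delta>1" "\<delta>3 \<le> \<delta>2" "\<delta>3 \<le> d"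
      using \<delta> \<delta>1 \<delta>2 d by (auto simp: \<delta>3_def)
    have Ua: "\<bar>U r \<phi> - u0\<bar> < a" if "\<bar>r\<bar> < \<delta>3" "\<bar>\<phi> - \<phi>0\<bar> < \<delta>3" for r \<phi>
      using d(2)[OF \<delta>2(2)[of r \<phi>], of \<phi>] that \<delta>3 base(2) by (auto simp: U_def)
    have onlyU: "u = U r \<phi>" if hu: "\<bar>r\<bar> < \<delta>3" "\<bar>\<phi> - \<phi>0\<bar> < \<delta>3" "\<bar>u - u0\<bar> \<le> a" "line_point \<phi> (h \<phi> + r) u \<in> frontier D" for r \<phi> u
    proof -
      obtain t where t: "\<bar>t - t0\<bar> < b" "cx t * cos \<phi> + cy t * sin \<phi> = h \<phi> + r" "F t \<phi> = u"
        using hit[of r \<phi> u] hu \<delta>3 by auto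
      then have "t = \<tau> r \<phi>" using root[of r \<phi> t] that \<delta>3 by auto
      then show ?thesis using t by (simp add: U_def)
    qed
    let ?J = "{\<phi>0 - \<delta>3<..<\<phi>0 + \<delta>3}" and ?R = "{r. 0 < \<bar>r\<bar> \<and> \<bar>r\<bar> < \<delta>3}"
    have JR: "\<bar>r\<bar> < \<delta>3 \<and> \<bar>\<phi> - \<phi>0\<bar> < \<delta>3" if "r \<in> ?R" "\<phi> \<in> ?J" for r \<phi>
      using that by (auto simp: abs_less_iff)
    have hJ: "continuous_on ?J h" by (rule continuous_on_subset[OF conth]) (use \<delta>3 \<delta> in auto)
    have tU: "tame n ?J ?R U" for n
      unfolding U_def F_def by (intro smooth1_tame_offset tame_subset[OF tame]) (use \<delta>3 in auto)
    have tc: "tame n ?J ?R (\<lambda>_ _. u)" for n u by (rule tame_const[where C="\<bar>u\<bar>"]) auto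
    have "tame_chord D ?J ?R h (\<lambda>_ _. u0 - a) U"
    proof (rule tame_chord_segment[OF _ hJ tc tU])
      fix r \<phi> assume r: "r \<in> ?R" "\<phi> \<in> ?J"
      show "u0 - a < U r \<phi>" using Ua[of r \<phi>] JR[OF r] by auto
      show "line_point \<phi> (h \<phi> + r) u \<notin> frontier D" if "u0 - a < u" "u < U r \<phi>" for u
      proof
        assume *: "line_point \<phi> (h \<phi> + r) u \<in> frontier D"
        have rp: "\<bar>r\<bar> < \<delta>3" "\<bar>\<phi> - \<phi>0\<bar> < \<delta>3" using JR[OF r] by auto
        have "\<bar>u - u0\<bar> \<le> a" using Ua[OF rp] that by linarith
        from onlyU[OF rp this *] show False using that by simp
      qed
    qed auto
    moreover have "tame_chord D ?J ?R h U (\<lambda>_ _. u0 + a)"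
    proof (rule tame_chord_segment[OF _ hJ tU tc])
      fix r \<phi> assume r: "r \<in> ?R" "\<phi> \<in> ?J"
      show "U r \<phi> < u0 + a" using Ua[of r \<phi>] JR[OF r] by auto
      show "line_point \<phi> (h \<phi> + r) u \<notin> frontier D" if "U r \<phi> < u" "u < u0 + a" for u
      proof
        assume *: "line_point \<phi> (h \<phi> + r) u \<in> frontier D"
        have rp: "\<bar>r\<bar> < \<delta>3" "\<bar>\<phi> - \<phi>0\<bar> < \<delta>3" using JR[OF r] by auto
        have "\<bar>u - u0\<bar> \<le> a" using Ua[OF rp] that by linarith
        from onlyU[OF rp this *] show False using that by simp
      qed
    qed auto
    ultimately have "tame_chord D ?J ?R h (\<lambda>_ _. u0 - a) (\<lambda>_ _. u0 + a)"
    proof (rule tame_chord_combine)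
      fix r \<phi> assume r: "r \<in> ?R" "\<phi> \<in> ?J"
      show "u0 - a \<le> U r \<phi>" "U r \<phi> \<le> u0 + a" using Ua[of r \<phi>] JR[OF r] by auto
    qed
    then have "tame_chord_near D \<phi>0 h (u0 - a) (u0 + a)" using \<delta>3 unfolding tame_chord_near_def by blast
    \<comment> \<open>The base line is the case r = 0, which the transversal root covers, so u0 is
      isolated.\<close>
    moreover have "u = u0" if "line_point \<phi>0 (h \<phi>0) u \<in> frontier D" "\<bar>u - u0\<bar> \<le> a" for u
    proof -
      have "u0 = U 0 \<phi>0" by (rule onlyU) (use \<delta>3 a u0 boundary in auto)
      moreover have "u = U 0 \<phi>0" by (rule onlyU) (use \<delta>3 that in auto)
      ultimately show ?thesis by simp
    qed
    ultimately show ?thesis using u0 boundary a by (auto simp: abs_le_iff)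
  qed
  then show ?thesis using \<rho> by blast
qed

end

context boundary_curve
begin

lemma velocity_perp_nz:
  assumes "deriv cx t * cos \<phi> + deriv cy t * sin \<phi> = 0"
  shows "deriv cy t * cos \<phi> - deriv cx t * sin \<phi> \<noteq> 0"
proof
  assume "deriv cy t * cos \<phi> - deriv cx t * sin \<phi> = 0"
  then have "velocity c t = line_point \<phi> 0 0"
    unfolding eq_line_point_iff using assms by (simp add: inner_dir inner_perp_dir deriv_c)
  then show False using velocity_nz[of t] by (simp add: line_point_def)
qed

text \<open>On the side towards which the curve bends (e r > 0) a line parallel to a nearby tangent
  line meets the curve in two points of the window, on the other side in none. Both points are
  smooth in \<phi> by \<open>tangent_half_root\<close>, applied once on each side of the tangency
  parameter, and they cut the window into three boundary-free pieces.\<close>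

lemma window_tangent:
  fixes \<tau>0 :: "real \<Rightarrow> real"
  defines "h \<equiv> \<lambda>\<phi>. cx (\<tau>0 \<phi>) * cos \<phi> + cy (\<tau>0 \<phi>) * sin \<phi>"
  assumes \<delta>0: "\<delta>0 > 0" and tame0: "\<And>n. tame n {\<phi>0 - \<delta>0<..<\<phi>0 + \<delta>0} (UNIV :: unit set) (\<lambda>_. \<tau>0)"
    and \<tau>0: "\<And>\<phi>. \<bar>\<phi> - \<phi>0\<bar> < \<delta>0 \<Longrightarrow> deriv cx (\<tau>0 \<phi>) * cos \<phi> + deriv cy (\<tau>0 \<phi>) * sin \<phi> = 0" "\<tau>0 \<phi>0 = t0"
    and T2: "deriv (deriv cx) t0 * cos \<phi>0 + deriv (deriv cy) t0 * sin \<phi>0 \<noteq> 0"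
    and u0: "line_point \<phi>0 (h \<phi>0) u0 = c t0"
  shows "\<exists>a0>0. \<forall>a. 0 < a \<longrightarrow> a < a0 \<longrightarrow> tame_chord_near D \<phi>0 h (u0 - a) (u0 + a) \<and>
    {u. line_point \<phi>0 (h \<phi>0) u \<in> frontier D} \<inter> {u0 - a..u0 + a} = {u0}"
proof -
  let ?J0 = "{\<phi>0 - \<delta>0<..<\<phi>0 + \<delta>0}"
  define T where "T = (\<lambda>t \<phi>. cx t * cos \<phi> + cy t * sin \<phi>)"
  define T1 where "T1 = (\<lambda>t \<phi>. deriv cx t * cos \<phi> + deriv cy t * sin \<phi>)"
  define T2 where "T2 = (\<lambda>t \<phi>. deriv (deriv cx) t * cos \<phi> + deriv (deriv cy) t * sin \<phi>)"
  define F where "F = (\<lambda>t \<phi>. cy t * cos \<phi> - cx t * sin \<phi>)"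
  \<comment> \<open>Derivative of the position along the line. It is nonzero at the tangency, where
    the velocity has no component normal to the line.\<close>
  define F' where "F' = (\<lambda>t \<phi>. deriv cy t * cos \<phi> + (- deriv cx t) * sin \<phi>)"
  note s' = smooth1_c[THEN smooth1_deriv] and s'' = smooth1_c[THEN smooth1_deriv, THEN smooth1_deriv]
  have th: "tame n ?J0 (UNIV :: unit set) (\<lambda>_. h)" for n
    unfolding h_def
    by (intro tame_add tame_mult tame_compose[OF tame0] smooth1_c smooth1_tame[OF smooth1_cos] smooth1_tame[OF smooth1_sin]) auto
  have conth: "continuous_on ?J0 h" using tame_continuous[OF th[of 0], of "()"] by simp
  have isCh: "isCont h \<phi>0" using tame_DERIV[OF th, of "()" \<phi>0] \<delta>0 by (auto intro: DERIV_isCont)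
  have isC\<tau>: "isCont \<tau>0 \<phi>0" using tame_DERIV[OF tame0, of "()" \<phi>0] \<delta>0 by (auto intro: DERIV_isCont)
  have dF: "((\<lambda>t. F t \<phi>) has_field_derivative F' t \<phi>) (at t)" for t \<phi>
    unfolding F_def F'_def by (auto intro!: derivative_eq_intros smooth1_DERIV smooth1_c)
  have F'0: "F' t0 \<phi>0 \<noteq> 0"
    using velocity_perp_nz[of t0 \<phi>0] \<tau>0(1)[of \<phi>0] \<tau>0(2) \<delta>0 by (simp add: F'_def)
  have T20: "T2 t0 \<phi>0 \<noteq> 0" using T2 by (simp add: T2_def)
  define e where "e = sgn (T2 t0 \<phi>0)"
  \<comment> \<open>Orientation of the curve along the line, chosen so that the root with w = e2 has
    the larger offset.\<close>
  define e2 where "e2 = sgn (F' t0 \<phi>0)"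
  define m where "m = \<bar>T2 t0 \<phi>0\<bar> / 2"
  have e: "e = 1 \<or> e = -1" "e2 = 1 \<or> e2 = -1" "- e2 = 1 \<or> - e2 = -1" and m: "m > 0" "\<bar>F' t0 \<phi>0\<bar> > 0"
    using T20 F'0 by (auto simp: e_def e2_def m_def sgn_if)
  obtain d1 where d1: "d1 > 0" "\<And>t \<phi>. \<bar>t - t0\<bar> < d1 \<Longrightarrow> \<bar>\<phi> - \<phi>0\<bar> < d1 \<Longrightarrow> \<bar>T2 t \<phi> - T2 t0 \<phi>0\<bar> < m"
    using trig_combination_near[OF smooth1_isCont[OF s''(1)] smooth1_isCont[OF s''(2)] m(1)] unfolding T2_def by metis
  obtain d2 where d2: "d2 > 0" "\<And>t \<phi>. \<bar>t - t0\<bar> < d2 \<Longrightarrow> \<bar>\<phi> - \<phi>0\<bar> < d2 \<Longrightarrow> \<bar>F' t \<phi> - F' t0 \<phi>0\<bar> < \<bar>F' t0 \<phi>0\<bar>"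
    using trig_combination_near[OF smooth1_isCont[OF s'(2)] continuous_minus[OF smooth1_isCont[OF s'(1)]] m(2)] unfolding F'_def by metis
  define b where "b = min d1 d2 / 2"
  have b: "0 < b" "b < d1" "b < d2" using d1 d2 by (auto simp: b_def)
  have "b / 2 > 0" using b by simp
  then obtain d3 where d3: "d3 > 0" "\<And>\<phi>. \<bar>\<phi> - \<phi>0\<bar> < d3 \<Longrightarrow> \<bar>\<tau>0 \<phi> - t0\<bar> < b / 2"
    using isC\<tau> \<tau>0(2) unfolding continuous_at_eps_delta dist_real_def by metis
  define \<delta>1 where "\<delta>1 = Min {\<delta>0, d1, d2, d3}"
  have \<delta>1: "0 < \<delta>1" "\<delta>1 \<le> \<delta>0" "\<delta>1 \<le> d1" "\<delta>1 \<le> d2" "\<delta>1 \<le> d3" using \<delta>0 d1 d2 d3 by (auto simp: \<delta>1_def)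
  have T2m: "m \<le> e * T2 t \<phi>" if "\<bar>t - t0\<bar> \<le> b" "\<bar>\<phi> - \<phi>0\<bar> < \<delta>1" for t \<phi>
  proof -
    have "\<bar>T2 t \<phi> - T2 t0 \<phi>0\<bar> < m" using d1(2)[of t \<phi>] that b \<delta>1 by auto
    then show ?thesis using T20 unfolding m_def e_def by (auto simp: sgn_if abs_if split: if_splits)
  qed
  have F'e: "0 < e2 * F' t \<phi>" if "\<bar>t - t0\<bar> \<le> b" "\<bar>\<phi> - \<phi>0\<bar> < \<delta>1" for t \<phi>
  proof -
    have "\<bar>F' t \<phi> - F' t0 \<phi>0\<bar> < \<bar>F' t0 \<phi>0\<bar>" using d2(2)[of t \<phi>] that b \<delta>1 by auto
    then show ?thesis using F'0 unfolding e2_def by (auto simp: sgn_if abs_if split: if_splits)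
  qed
  have Fmono: "F t \<phi> < F t' \<phi>" if hF: "0 < e2 * (t' - t)" "\<bar>t - t0\<bar> \<le> b" "\<bar>t' - t0\<bar> \<le> b" "\<bar>\<phi> - \<phi>0\<bar> < \<delta>1" for t t' \<phi>
  proof -
    consider "t < t'" "e2 = 1" | "t' < t" "e2 = -1" using hF(1) e(2) by auto
    then show ?thesis
    proof cases
      case 1
      from MVT2[OF 1(1) dF] obtain z where z: "t < z" "z < t'" "F t' \<phi> - F t \<phi> = (t' - t) * F' z \<phi>" by auto
      then have "0 < F' z \<phi>" using F'e[of z \<phi>] that 1 by (auto simp: abs_le_iff)
      then have "0 < (t' - t) * F' z \<phi>" using 1 by simp
      then show ?thesis using z by simp
    next
      case 2
      from MVT2[OF 2(1) dF] obtain z where z: "t' < z" "z < t" "F t \<phi> - F t' \<phi> = (t - t') * F' z \<phi>" by auto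
      then have "F' z \<phi> < 0" using F'e[of z \<phi>] that 2 by (auto simp: abs_le_iff)
      then have "(t - t') * F' z \<phi> < 0" using 2 by (simp add: mult_pos_neg)
      then show ?thesis using z by simp
    qed
  qed
  have tame1: "tame n {\<phi>0 - \<delta>1<..<\<phi>0 + \<delta>1} (UNIV :: unit set) (\<lambda>_. \<tau>0)" for n
    by (rule tame_subset[OF tame0]) (use \<delta>1 in auto)
  have \<tau>01: "\<bar>\<tau>0 \<phi> - t0\<bar> < b / 2" "T1 (\<tau>0 \<phi>) \<phi> = 0" if "\<bar>\<phi> - \<phi>0\<bar> < \<delta>1" for \<phi>
    using d3(2)[of \<phi>] \<tau>0(1)[of \<phi>] that \<delta>1 by (auto simp: T1_def)
  obtain \<delta>p \<tau>p where
    quad: "\<And>\<phi> t. \<bar>t - t0\<bar> \<le> b \<Longrightarrow> \<bar>\<phi> - \<phi>0\<bar> < \<delta>1 \<Longrightarrow> m / 2 * (t - \<tau>0 \<phi>)\<^sup>2 \<le> e * (T t \<phi> - h \<phi>)" and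
    \<delta>p: "0 < \<delta>p" "\<delta>p \<le> \<delta>1" and
    rootp: "\<And>r \<phi> t. 0 < e * r \<Longrightarrow> \<bar>r\<bar> < \<delta>p \<Longrightarrow> \<bar>\<phi> - \<phi>0\<bar> < \<delta>p \<Longrightarrow> \<bar>t - t0\<bar> < b \<Longrightarrow> 0 < e2 * (t - \<tau>0 \<phi>) \<Longrightarrow> T t \<phi> = h \<phi> + r \<longleftrightarrow> t = \<tau>p r \<phi>" and
    nearp: "\<And>r \<phi>. 0 < e * r \<Longrightarrow> \<bar>r\<bar> < \<delta>p \<Longrightarrow> \<bar>\<phi> - \<phi>0\<bar> < \<delta>p \<Longrightarrow> \<bar>\<tau>p r \<phi> - t0\<bar> < b \<and> 0 < e2 * (\<tau>p r \<phi> - \<tau>0 \<phi>)" and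
    smallp: "\<And>e'. e' > 0 \<Longrightarrow> \<exists>\<delta>'>0. \<forall>r \<phi>. 0 < e * r \<longrightarrow> \<bar>r\<bar> < \<delta>' \<longrightarrow> \<bar>\<phi> - \<phi>0\<bar> < \<delta>' \<longrightarrow> \<bar>\<tau>p r \<phi> - t0\<bar> < e'" and
    tamep: "\<And>n. tame n {\<phi>0 - \<delta>p<..<\<phi>0 + \<delta>p} {r. 0 < e * r \<and> \<bar>r\<bar> < \<delta>p} \<tau>p"
    unfolding T_def h_def
    by (rule tangent_half_root[OF smooth1_c b(1) \<delta>1(1) m(1) e(1) e(2) T2m[unfolded T2_def] tame1 \<tau>01[unfolded T1_def] \<tau>0(2)]) blast+
  obtain \<delta>m \<tau>m where
    \<delta>m: "0 < \<delta>m" "\<delta>m \<le> \<delta>1" and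
    rootm: "\<And>r \<phi> t. 0 < e * r \<Longrightarrow> \<bar>r\<bar> < \<delta>m \<Longrightarrow> \<bar>\<phi> - \<phi>0\<bar> < \<delta>m \<Longrightarrow> \<bar>t - t0\<bar> < b \<Longrightarrow> 0 < - e2 * (t - \<tau>0 \<phi>) \<Longrightarrow> T t \<phi> = h \<phi> + r \<longleftrightarrow> t = \<tau>m r \<phi>" and
    nearm: "\<And>r \<phi>. 0 < e * r \<Longrightarrow> \<bar>r\<bar> < \<delta>m \<Longrightarrow> \<bar>\<phi> - \<phi>0\<bar> < \<delta>m \<Longrightarrow> \<bar>\<tau>m r \<phi> - t0\<bar> < b \<and> 0 < - e2 * (\<tau>m r \<phi> - \<tau>0 \<phi>)" and
    smallm: "\<And>e'. e' > 0 \<Longrightarrow> \<exists>\<delta>'>0. \<forall>r \<phi>. 0 < e * r \<longrightarrow> \<bar>r\<bar> < \<delta>' \<longrightarrow> \<bar>\<phi> - \<phi>0\<bar> < \<delta>' \<longrightarrow> \<bar>\<tau>m r \<phi> - t0\<bar> < e'" and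
    tamem: "\<And>n. tame n {\<phi>0 - \<delta>m<..<\<phi>0 + \<delta>m} {r. 0 < e * r \<and> \<bar>r\<bar> < \<delta>m} \<tau>m"
    unfolding T_def h_def
    by (rule tangent_half_root[OF smooth1_c b(1) \<delta>1(1) m(1) e(1) e(3) T2m[unfolded T2_def] tame1 \<tau>01[unfolded T1_def] \<tau>0(2)]) blast+
  obtain \<rho> where \<rho>: "\<rho> > 0" and hits:
    "\<And>a. 0 < a \<Longrightarrow> a < \<rho> \<Longrightarrow> \<exists>\<delta>>0. \<forall>r \<phi> u. \<bar>r\<bar> < \<delta> \<longrightarrow> \<bar>\<phi> - \<phi>0\<bar> < \<delta> \<longrightarrow> \<bar>u - u0\<bar> \<le> a \<longrightarrow>
        line_point \<phi> (h \<phi> + r) u \<in> frontier D \<longrightarrow>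
        (\<exists>t. \<bar>t - t0\<bar> < b \<and> cx t * cos \<phi> + cy t * sin \<phi> = h \<phi> + r \<and> cy t * cos \<phi> - cx t * sin \<phi> = u)"
    using boundary_hits[OF b(1) isCh u0] by metis
  have Fu0: "F t0 \<phi>0 = u0"
    using u0[symmetric] unfolding eq_line_point_iff by (simp add: c_inner_perp F_def)
  define Up where "Up = (\<lambda>r \<phi>. F (\<tau>p r \<phi>) \<phi>)"
  define Um where "Um = (\<lambda>r \<phi>. F (\<tau>m r \<phi>) \<phi>)"
  have win: "tame_chord_near D \<phi>0 h (u0 - a) (u0 + a) \<and>
    {u. line_point \<phi>0 (h \<phi>0) u \<in> frontier D} \<inter> {u0 - a..u0 + a} = {u0}" if a: "0 < a" "a < \<rho>" for a
  proof -
    from hits[OF a] obtain \<delta>2 where \<delta>2: "\<delta>2 > 0" and hit: "\<And>r \<phi> u. \<bar>r\<bar> < \<delta>2 \<Longrightarrow> \<bar>\<phi> - \<phi>0\<bar> < \<delta>2 \<Longrightarrow> \<bar>u - u0\<bar> \<le> a \<Longrightarrow>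
        line_point \<phi> (h \<phi> + r) u \<in> frontier D \<Longrightarrow>
        \<exists>t. \<bar>t - t0\<bar> < b \<and> T t \<phi> = h \<phi> + r \<and> F t \<phi> = u"
      unfolding F_def T_def by metis
    obtain d where d: "d > 0" "\<And>t \<phi>. \<bar>t - t0\<bar> < d \<Longrightarrow> \<bar>\<phi> - \<phi>0\<bar> < d \<Longrightarrow> \<bar>F t \<phi> - F t0 \<phi>0\<bar> < a"
      using offset_near[OF a(1)] unfolding F_def by metis
    obtain \<delta>4 where \<delta>4: "\<delta>4 > 0" "\<And>r \<phi>. 0 < e * r \<Longrightarrow> \<bar>r\<bar> < \<delta>4 \<Longrightarrow> \<bar>\<phi> - \<phi>0\<bar> < \<delta>4 \<Longrightarrow> \<bar>\<tau>p r \<phi> - t0\<bar> < d"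
      using smallp[OF d(1)] by blast
    obtain \<delta>5 where \<delta>5: "\<delta>5 > 0" "\<And>r \<phi>. 0 < e * r \<Longrightarrow> \<bar>r\<bar> < \<delta>5 \<Longrightarrow> \<bar>\<phi> - \<phi>0\<bar> < \<delta>5 \<Longrightarrow> \<bar>\<tau>m r \<phi> - t0\<bar> < d"
      using smallm[OF d(1)] by blast
    define \<delta>3 where "\<delta>3 = Min {\<delta>p, \<delta>m, \<delta>2, \<delta>4, \<delta>5, d}"
    have \<delta>3: "0 < \<delta>3" "\<delta>3 \<le> \<delta>p" "\<delta>3 \<le> \<delta>m" "\<delta>3 \<le> \<delta>2" "\<delta>3 \<le> \<delta>4" "\<delta>3 \<le> \<delta>5" "\<delta>3 \<le> d" "\<delta>3 \<le> \<delta>1"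
      using \<delta>p \<delta>m \<delta>2 \<delta>4 \<delta>5 d by (auto simp: \<delta>3_def)
    let ?J = "{\<phi>0 - \<delta>3<..<\<phi>0 + \<delta>3}"
    let ?Rp = "{r. 0 < e * r \<and> \<bar>r\<bar> < \<delta>3}" and ?Rm = "{r. e * r < 0 \<and> \<bar>r\<bar> < \<delta>3}"
    have \<phi>J: "\<bar>\<phi> - \<phi>0\<bar> < \<delta>3" if "\<phi> \<in> ?J" for \<phi>
      using that by (auto simp: abs_less_iff)
    have Ua: "\<bar>Up r \<phi> - u0\<bar> < a" "\<bar>Um r \<phi> - u0\<bar> < a" "Um r \<phi> < Up r \<phi>"
      if r: "r \<in> ?Rp" "\<phi> \<in> ?J" for r \<phi>
    proof -
      note j = \<phi>J[OF r(2)]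
      show "\<bar>Up r \<phi> - u0\<bar> < a" "\<bar>Um r \<phi> - u0\<bar> < a"
        using d(2)[OF \<delta>4(2)[of r \<phi>], of \<phi>] d(2)[OF \<delta>5(2)[of r \<phi>], of \<phi>] r(1) j \<delta>3 Fu0 by (auto simp: Up_def Um_def)
      have p: "\<bar>\<tau>p r \<phi> - t0\<bar> < b" "0 < e2 * (\<tau>p r \<phi> - \<tau>0 \<phi>)" using nearp[of r \<phi>] r(1) j \<delta>3 by auto
      have m: "\<bar>\<tau>m r \<phi> - t0\<bar> < b" "0 < - e2 * (\<tau>m r \<phi> - \<tau>0 \<phi>)" using nearm[of r \<phi>] r(1) j \<delta>3 by auto
      have "0 < e2 * (\<tau>p r \<phi> - \<tau>m r \<phi>)" using p(2) m(2) by (simp add: algebra_simps)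
      then show "Um r \<phi> < Up r \<phi>" unfolding Um_def Up_def by (rule Fmono) (use p m j \<delta>3 in auto)
    qed
    have only: "u = Um r \<phi> \<or> u = Up r \<phi>" if r: "r \<in> ?Rp" "\<phi> \<in> ?J" and u: "\<bar>u - u0\<bar> \<le> a" "line_point \<phi> (h \<phi> + r) u \<in> frontier D" for r \<phi> u
    proof -
      note j = \<phi>J[OF r(2)]
      obtain t where t: "\<bar>t - t0\<bar> < b" "T t \<phi> = h \<phi> + r" "F t \<phi> = u"
        using hit[of r \<phi> u] r(1) j u \<delta>3 by auto
      have "t \<noteq> \<tau>0 \<phi>" using t(2) r(1) e by (auto simp: T_def h_def)
      then consider "0 < e2 * (t - \<tau>0 \<phi>)" | "0 < - e2 * (t - \<tau>0 \<phi>)" using e(2) by fastforce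
      then show ?thesis
      proof cases
        case 1
        then have "t = \<tau>p r \<phi>" using rootp[of r \<phi> t] r(1) j t \<delta>3 by auto
        then show ?thesis using t by (simp add: Up_def)
      next
        case 2
        then have "t = \<tau>m r \<phi>" using rootm[of r \<phi> t] r(1) j t \<delta>3 by auto
        then show ?thesis using t by (simp add: Um_def)
      qed
    qed
    \<comment> \<open>By \<open>quad\<close> the curve stays, within the window, on the side e r
      \<ge> 0 of its tangent lines.\<close>
    have none: "line_point \<phi> (h \<phi> + r) u \<notin> frontier D" if r: "r \<in> ?Rm" "\<phi> \<in> ?J" and u: "\<bar>u - u0\<bar> \<le> a" for r \<phi> u
    proof
      assume fr: "line_point \<phi> (h \<phi> + r) u \<in> frontier D"
      note j = \<phi>J[OF r(2)]
      obtain t where t: "\<bar>t - t0\<bar> < b" "T t \<phi> = h \<phi> + r"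
        using hit[of r \<phi> u] r(1) j u fr \<delta>3 by auto
      have "m / 2 * (t - \<tau>0 \<phi>)\<^sup>2 \<le> e * (T t \<phi> - h \<phi>)" using quad[of t \<phi>] t(1) j \<delta>3 by auto
      also have "\<dots> < 0" using t(2) r by simp
      finally show False using m(1) by (simp add: mult_less_0_iff)
    qed
    have hJ: "continuous_on ?J h" by (rule continuous_on_subset[OF conth]) (use \<delta>3 \<delta>1 in auto)
    have tc: "tame n ?J R (\<lambda>_ _. u)" for n u and R :: "real set" by (rule tame_const[where C="\<bar>u\<bar>"]) auto
    have tUp: "tame n ?J ?Rp Up" and tUm: "tame n ?J ?Rp Um" for n
      unfolding Up_def Um_def F_def
      by (rule smooth1_tame_offset tame_subset[OF tamep] tame_subset[OF tamem]; (use \<delta>3 in auto)?)+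
    have 1: "tame_chord D ?J ?Rp h (\<lambda>_ _. u0 - a) Um"
    proof (rule tame_chord_segment[OF _ hJ tc tUm])
      fix r \<phi> assume r: "r \<in> ?Rp" "\<phi> \<in> ?J"
      show "u0 - a < Um r \<phi>" using Ua(2)[OF r] by linarith
      show "line_point \<phi> (h \<phi> + r) u \<notin> frontier D" if u: "u0 - a < u" "u < Um r \<phi>" for u
      proof
        have "\<bar>u - u0\<bar> \<le> a" using Ua(2)[OF r] u by linarith
        moreover assume "line_point \<phi> (h \<phi> + r) u \<in> frontier D"
        ultimately show False using only[OF r, of u] Ua(3)[OF r] u by auto
      qed
    qed auto
    have 2: "tame_chord D ?J ?Rp h Um Up"
    proof (rule tame_chord_segment[OF _ hJ tUm tUp])
      fix r \<phi> assume r: "r \<in> ?Rp" "\<phi> \<in> ?J"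
      show "Um r \<phi> < Up r \<phi>" by (rule Ua(3)[OF r])
      show "line_point \<phi> (h \<phi> + r) u \<notin> frontier D" if u: "Um r \<phi> < u" "u < Up r \<phi>" for u
      proof
        have "\<bar>u - u0\<bar> \<le> a" using Ua(1,2)[OF r] u by linarith
        moreover assume "line_point \<phi> (h \<phi> + r) u \<in> frontier D"
        ultimately show False using only[OF r, of u] u by auto
      qed
    qed auto
    have 3: "tame_chord D ?J ?Rp h Up (\<lambda>_ _. u0 + a)"
    proof (rule tame_chord_segment[OF _ hJ tUp tc])
      fix r \<phi> assume r: "r \<in> ?Rp" "\<phi> \<in> ?J"
      show "Up r \<phi> < u0 + a" using Ua(1)[OF r] by linarith
      show "line_point \<phi> (h \<phi> + r) u \<notin> frontier D" if u: "Up r \<phi> < u" "u < u0 + a" for u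
      proof
        have "\<bar>u - u0\<bar> \<le> a" using Ua(1)[OF r] u by linarith
        moreover assume "line_point \<phi> (h \<phi> + r) u \<in> frontier D"
        ultimately show False using only[OF r, of u] Ua(3)[OF r] u by auto
      qed
    qed auto
    have 4: "tame_chord D ?J ?Rm h (\<lambda>_ _. u0 - a) (\<lambda>_ _. u0 + a)"
    proof (rule tame_chord_segment[OF _ hJ tc tc])
      show "line_point \<phi> (h \<phi> + r) u \<notin> frontier D" if "r \<in> ?Rm" "\<phi> \<in> ?J" "u0 - a < u" "u < u0 + a" for r \<phi> u
        by (rule none[OF that(1,2)]) (use that in linarith)
    qed (use a in auto)
    have 12: "tame_chord D ?J ?Rp h (\<lambda>_ _. u0 - a) Up"
      by (rule tame_chord_combine[OF 1 2]) (use Ua in \<open>force+\<close>)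
    have "tame_chord D ?J ?Rp h (\<lambda>_ _. u0 - a) (\<lambda>_ _. u0 + a)"
      by (rule tame_chord_combine[OF 12 3]) (use Ua in \<open>force+\<close>)
    from tame_chord_Un[OF this 4] have "tame_chord D ?J {r. 0 < \<bar>r\<bar> \<and> \<bar>r\<bar> < \<delta>3} h (\<lambda>_ _. u0 - a) (\<lambda>_ _. u0 + a)"
      by (rule tame_chord_subset) (use e in auto)
    then have "tame_chord_near D \<phi>0 h (u0 - a) (u0 + a)" using \<delta>3 unfolding tame_chord_near_def by blast
    \<comment> \<open>On the tangent line itself \<open>quad\<close> leaves only t = t0.\<close>
    moreover have "u = u0" if u: "line_point \<phi>0 (h \<phi>0) u \<in> frontier D" "\<bar>u - u0\<bar> \<le> a" for u
    proof -
      obtain t where t: "\<bar>t - t0\<bar> < b" "T t \<phi>0 = h \<phi>0" "F t \<phi>0 = u"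
        using hit[of 0 \<phi>0 u] u \<delta>3 by auto
      have "m / 2 * (t - t0)\<^sup>2 \<le> 0" using quad[of t \<phi>0] t \<delta>1 \<tau>0(2) by auto
      then have "(t - t0)\<^sup>2 \<le> 0" using m(1) by (simp add: mult_le_0_iff)
      then have "t = t0" by simp
      then show ?thesis using t Fu0 by simp
    qed
    ultimately show ?thesis using u0 boundary a by (auto simp: abs_le_iff)
  qed
  then show ?thesis using \<rho> by blast
qed

text \<open>Boundary points on the base line are isolated by their windows and lie in a compact set,
  so there are finitely many, and none has |u| \<ge> M.\<close>

lemma tame_chord_line:
  assumes h: "\<delta>0 > 0" "\<And>n. tame n {\<phi>0 - \<delta>0<..<\<phi>0 + \<delta>0} (UNIV :: unit set) (\<lambda>_. h)"
  defines "Z \<equiv> {u. line_point \<phi>0 (h \<phi>0) u \<in> frontier D}"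
  assumes window: "\<And>u. u \<in> Z \<Longrightarrow> \<exists>a0>0. \<forall>a. 0 < a \<longrightarrow> a < a0 \<longrightarrow> tame_chord_near D \<phi>0 h (u - a) (u + a) \<and> Z \<inter> {u - a..u + a} = {u}"
    and M: "frontier D \<subseteq> ball 0 M" "M > 0"
  shows "tame_chord_near D \<phi>0 h (-M) M"
proof -
  have "closed Z"
  proof -
    have "Z = line_point \<phi>0 (h \<phi>0) -` frontier D" by (auto simp: Z_def)
    moreover have "closed (line_point \<phi>0 (h \<phi>0) -` frontier D)"
      by (intro continuous_closed_vimage frontier_closed)
        (use continuous_on_line_point[OF continuous_on_const continuous_on_const continuous_on_id, of UNIV \<phi>0 "h \<phi>0"]
          in \<open>simp add: continuous_on_eq_continuous_at\<close>)
    ultimately show ?thesis by simp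
  qed
  have fin: "finite ({-M..M} \<inter> Z)"
  proof (rule finite_not_islimpt_in_compact)
    fix z show "\<not> z islimpt Z"
    proof
      assume z: "z islimpt Z"
      then have "z \<in> Z" using \<open>closed Z\<close> closed_limpt by blast
      from window[OF this] obtain a0 where a0: "a0 > 0"
        and w: "\<forall>a. 0 < a \<longrightarrow> a < a0 \<longrightarrow> tame_chord_near D \<phi>0 h (z - a) (z + a) \<and> Z \<inter> {z - a..z + a} = {z}"
        by (elim exE conjE)
      from z a0 obtain y where y: "y \<in> Z" "y \<noteq> z" "dist y z < a0 / 2"
        unfolding islimpt_approachable by (metis half_gt_zero)
      have "y \<in> {z - a0 / 2..z + a0 / 2}" using y(3) unfolding dist_real_def atLeastAtMost_iff by linarith
      moreover have "Z \<inter> {z - a0 / 2..z + a0 / 2} = {z}" using a0 w by simp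
      ultimately show False using y(1,2) by blast
    qed
  qed simp
  have end_notin: "u \<notin> Z" if "\<bar>u\<bar> = M" for u
  proof
    assume "u \<in> Z"
    then have "norm (line_point \<phi>0 (h \<phi>0) u) < M" using M by (auto simp: Z_def subset_iff)
    then show False using abs_le_norm_line_point(1)[of u \<phi>0 "h \<phi>0"] that by simp
  qed
  have cont: "continuous_on {\<phi>0 - \<delta>0<..<\<phi>0 + \<delta>0} h" using tame_continuous[OF h(2)[of 0], of "()"] by simp
  have isC: "isCont h \<phi>0" using tame_DERIV[OF h(2), of "()" \<phi>0] h(1) by (auto intro: DERIV_isCont)
  show ?thesis
    by (rule tame_chord_near_finite[OF isC h(1) cont window[unfolded Z_def]])
      (use fin end_notin[of M] end_notin[of "-M"] M(2) in \<open>simp_all add: Z_def Int_commute\<close>)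
qed

end

section \<open>Chord lengths as Radon data, and the choice of the phase\<close>

lemma line_point_measurable [measurable]: "line_point \<phi> s \<in> borel_measurable borel"
  by (intro borel_measurable_continuous_onI continuous_intros)

lemma radon_line_point:
  fixes f :: "real^2 \<Rightarrow> 'b::{banach, second_countable_topology}"
  assumes [measurable]: "f \<in> borel_measurable borel"
  shows "radon f s (dir \<phi>) = (LINT u|lborel. f (line_point \<phi> s u))"
  unfolding radon_def line_measure_def line_point_def[symmetric]
  by (subst integral_distr) auto

text \<open>Passes from the gauge integral over a bounded piece to the Lebesgue integral over the
  whole line, which has left D beyond that piece.\<close>

lemma radon_indicator_has_integral:
  assumes D: "open D" "D \<subseteq> ball 0 M"
    and I: "((\<lambda>u. indicator D (line_point \<phi> s u) :: real) has_integral I) {-M..M}"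
  shows "radon (\<lambda>x. \<alpha> * indicator D x) s (dir \<phi>) = \<alpha> * I"
proof -
  let ?f = "\<lambda>u. indicator D (line_point \<phi> s u) :: real"
  have [measurable]: "D \<in> sets borel" using D by simp
  have z: "?f u = 0" if "u \<notin> {-M..M}" for u
  proof -
    have "M < norm (line_point \<phi> s u)" using that abs_le_norm_line_point(1)[of u \<phi> s] by auto
    then show ?thesis using D(2) by (auto simp: indicator_def)
  qed
  have meas: "?f \<in> borel_measurable lborel" by measurable
  have "integrable lborel (indicat_real {-M..M})"
    by (rule integrable_real_indicator) (auto simp: emeasure_lborel_Icc_eq)
  then have int: "integrable lborel ?f"
  proof (rule Bochner_Integration.integrable_bound)
    show "AE u in lborel. norm (?f u) \<le> norm (indicat_real {-M..M} u)"
      using z by (intro AE_I2) (auto simp: indicator_def)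
  qed (rule meas)
  have "(?f has_integral I) UNIV" by (rule has_integral_on_superset[OF I z]) auto
  then have "(LINT u|lborel. ?f u) = I"
    using has_integral_integral_lborel[OF int] has_integral_unique by blast
  moreover have "radon (\<lambda>x. \<alpha> * indicator D x) s (dir \<phi>) = (LINT u|lborel. \<alpha> * ?f u)"
    by (rule radon_line_point) measurable
  ultimately show ?thesis by simp
qed

context boundary_curve
begin

lemma tangent_line_eq:
  assumes "deriv cx t * cos \<phi> + deriv cy t * sin \<phi> = 0"
  shows "tangent_line c t = {x. x \<bullet> dir \<phi> = c t \<bullet> dir \<phi>}"
proof -
  let ?v = "velocity c t"
  define \<mu> where "\<mu> = ?v \<bullet> perp (dir \<phi>)"
  have v: "?v = \<mu> *\<^sub>R perp (dir \<phi>)"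
    using eq_line_point_iff[of ?v \<phi> 0 \<mu>] assms by (simp add: inner_dir deriv_c line_point_def \<mu>_def)
  have \<mu>: "\<mu> \<noteq> 0" using velocity_perp_nz[OF assms] by (simp add: \<mu>_def inner_perp_dir deriv_c)
  show ?thesis
  proof (intro equalityI subsetI)
    fix x assume "x \<in> tangent_line c t"
    then obtain r where "x = c t + r *\<^sub>R ?v" by (auto simp: tangent_line_def)
    moreover have "?v \<bullet> dir \<phi> = 0" using assms by (simp add: inner_dir deriv_c)
    ultimately show "x \<in> {x. x \<bullet> dir \<phi> = c t \<bullet> dir \<phi>}" by (simp add: inner_add_left)
  next
    fix x assume "x \<in> {x. x \<bullet> dir \<phi> = c t \<bullet> dir \<phi>}"
    then have x: "x \<bullet> dir \<phi> = c t \<bullet> dir \<phi>" by simp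
    define a where "a = x \<bullet> perp (dir \<phi>)"
    define s where "s = c t \<bullet> dir \<phi>"
    define b where "b = c t \<bullet> perp (dir \<phi>)"
    have "x = line_point \<phi> s a" "c t = line_point \<phi> s b"
      by (simp_all add: eq_line_point_iff x s_def a_def b_def)
    then have "x = c t + (a - b) *\<^sub>R perp (dir \<phi>)" by (simp add: line_point_def algebra_simps)
    also have "\<dots> = c t + ((a - b) / \<mu>) *\<^sub>R ?v"
      using \<mu> by (simp add: v)
    finally show "x \<in> tangent_line c t" unfolding tangent_line_def by blast
  qed
qed

text \<open>If velocity and acceleration were both orthogonal to \<open>dir \<phi>\<close>, they
  would be parallel and the determinant in the curvature would vanish.\<close>

lemma curvature_nz_second_derivative:
  assumes "deriv cx t * cos \<phi> + deriv cy t * sin \<phi> = 0" "curvature c t \<noteq> 0"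
  shows "deriv (deriv cx) t * cos \<phi> + deriv (deriv cy) t * sin \<phi> \<noteq> 0"
proof
  assume 0: "deriv (deriv cx) t * cos \<phi> + deriv (deriv cy) t * sin \<phi> = 0"
  let ?d = "deriv cx t * deriv (deriv cy) t - deriv cy t * deriv (deriv cx) t"
  have "?d * cos \<phi> = 0" "?d * sin \<phi> = 0" using 0 assms(1) by algebra+
  then have "?d = 0" using sin_zero_abs_cos_one by force
  moreover have "perp (velocity c t) \<bullet> velocity (velocity c) t = ?d"
    by (simp add: inner_vec_def sum_2 deriv_c deriv2_c)
  ultimately show False using assms(2) by (simp add: curvature_def)
qed

text \<open>The base line passes through x0 with normal direction \<phi>0. As x0 lies on no special
  line, (A2) leaves at most one tangency point, not an inflection point, and (A1) makes its
  curvature nonzero. Hence \<open>window_tangent\<close> applies there and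
  \<open>window_transversal\<close> at all other boundary points of the line. The slope of
  \<open>h\<close> is the offset of the tangency point, which differs from that of x0 because x0 is
  off the boundary.\<close>

lemma local_phase:
  assumes A: "cond_A1 c" "cond_A2 c" and D: "open D" "bounded D"
    and x0: "x0 \<notin> \<Union> (special_lines c)" "x0 \<notin> frontier D"
  obtains h \<delta> where "\<delta> > 0" "\<And>n. tame n {\<phi>0 - \<delta><..<\<phi>0 + \<delta>} (UNIV :: unit set) (\<lambda>_. h)"
    "h \<phi>0 = x0 \<bullet> dir \<phi>0" "deriv h \<phi>0 \<noteq> x0 \<bullet> perp (dir \<phi>0)"
    "\<And>n. tame n {\<phi>0 - \<delta><..<\<phi>0 + \<delta>} {r. 0 < \<bar>r\<bar> \<and> \<bar>r\<bar> < \<delta>}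
       (\<lambda>r \<phi>. P_MA \<epsilon> (\<lambda>x. \<alpha> * indicator D x) (h \<phi> + r) (dir \<phi>))"
proof -
  let ?T = "\<lambda>t \<phi>. cx t * cos \<phi> + cy t * sin \<phi>"
  let ?T1 = "\<lambda>t \<phi>. deriv cx t * cos \<phi> + deriv cy t * sin \<phi>"
  define Z where "Z = (\<lambda>s0. {u. line_point \<phi>0 s0 u \<in> frontier D})"
  have "\<exists>h \<delta>. \<delta> > 0 \<and> (\<forall>n. tame n {\<phi>0 - \<delta><..<\<phi>0 + \<delta>} (UNIV :: unit set) (\<lambda>_. h)) \<and>
      h \<phi>0 = x0 \<bullet> dir \<phi>0 \<and> deriv h \<phi>0 \<noteq> x0 \<bullet> perp (dir \<phi>0) \<and>
      (\<forall>u\<in>Z (h \<phi>0). \<exists>a0>0. \<forall>a. 0 < a \<longrightarrow> a < a0 \<longrightarrow> tame_chord_near D \<phi>0 h (u - a) (u + a) \<and> Z (h \<phi>0) \<inter> {u - a..u + a} = {u})"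
  proof (cases "\<exists>t. c t \<bullet> dir \<phi>0 = x0 \<bullet> dir \<phi>0 \<and> ?T1 t \<phi>0 = 0")
    case False
    \<comment> \<open>The pencil of lines through x0 + perp (dir \<phi>0), the point of the base
      line at offset 1 from x0; this makes the two slopes differ by 1.\<close>
    define h where "h = (\<lambda>\<phi>. (x0 $ 1 - sin \<phi>0) * cos \<phi> + (x0 $ 2 + cos \<phi>0) * sin \<phi>)"
    have "smooth1 h"
      unfolding h_def by (intro smooth1_add smooth1_mult smooth1_const smooth1_sin smooth1_cos)
    then have tame: "tame n J (UNIV :: unit set) (\<lambda>_. h)" if "bounded J" for n J using that by (rule smooth1_tame)
    have h0: "h \<phi>0 = x0 \<bullet> dir \<phi>0" by (simp add: h_def inner_dir algebra_simps)
    have "(h has_field_derivative (x0 \<bullet> perp (dir \<phi>0) + 1)) (at \<phi>0)"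
    proof -
      have "(h has_field_derivative ((x0 $ 1 - sin \<phi>0) * - sin \<phi>0 + (x0 $ 2 + cos \<phi>0) * cos \<phi>0)) (at \<phi>0)"
        unfolding h_def by (auto intro!: derivative_eq_intros)
      moreover have "(x0 $ 1 - sin \<phi>0) * - sin \<phi>0 + (x0 $ 2 + cos \<phi>0) * cos \<phi>0 = x0 \<bullet> perp (dir \<phi>0) + 1"
        using sin_cos_squared_add[of \<phi>0] by (simp add: inner_perp_dir algebra_simps power2_eq_square)
      ultimately show ?thesis by simp
    qed
    then have h': "deriv h \<phi>0 \<noteq> x0 \<bullet> perp (dir \<phi>0)" by (simp add: DERIV_imp_deriv)
    have "\<exists>a0>0. \<forall>a. 0 < a \<longrightarrow> a < a0 \<longrightarrow> tame_chord_near D \<phi>0 h (u - a) (u + a) \<and> Z (h \<phi>0) \<inter> {u - a..u + a} = {u}"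
      if "u \<in> Z (h \<phi>0)" for u
    proof -
      from that obtain t where t: "line_point \<phi>0 (h \<phi>0) u = c t" by (auto simp: Z_def boundary)
      then have "c t \<bullet> dir \<phi>0 = x0 \<bullet> dir \<phi>0" using h0 by (metis line_point_inner(1))
      then have "?T1 t \<phi>0 \<noteq> 0" using False by blast
      from window_transversal[OF zero_less_one tame t this] show ?thesis by (simp add: Z_def)
    qed
    then show ?thesis using tame[of "{\<phi>0 - 1<..<\<phi>0 + 1}"] h0 h' by (intro exI[of _ h] exI[of _ 1]) auto
  next
    case True
    then obtain t0 where t0: "c t0 \<bullet> dir \<phi>0 = x0 \<bullet> dir \<phi>0" "?T1 t0 \<phi>0 = 0" by blast
    define L where "L = {x. x \<bullet> dir \<phi>0 = x0 \<bullet> dir \<phi>0}"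
    have L: "tangent_line c t = L" if "c t \<bullet> dir \<phi>0 = x0 \<bullet> dir \<phi>0" "?T1 t \<phi>0 = 0" for t
      using tangent_line_eq[OF that(2)] that(1) by (simp add: L_def)
    have tp0: "c t0 \<in> tangency_points c L" using L[OF t0] by (auto simp: tangency_points_def)
    have notspecial: "L \<notin> special_lines c" using x0(1) by (auto simp: L_def)
    have "(finite (tangency_points c L) \<and> card (tangency_points c L) \<le> 2 \<and>
           (\<forall>p\<in>tangency_points c L. \<not> inflection_point c p)) \<or>
         (\<exists>p. tangency_points c L = {p} \<and> inflection_point c p)"
      using A(2) tp0 unfolding cond_A2_def by blast
    moreover have "\<not> (\<exists>p. tangency_points c L = {p} \<and> inflection_point c p)"
      using notspecial unfolding special_lines_def by blast
    ultimately have fin: "finite (tangency_points c L)" "card (tangency_points c L) \<le> 2"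
      and noinf: "\<And>p. p \<in> tangency_points c L \<Longrightarrow> \<not> inflection_point c p" by auto
    have single: "q = c t0" if q: "q \<in> tangency_points c L" for q
    proof (rule ccontr)
      assume ne: "q \<noteq> c t0"
      \<comment> \<open>A second tangency point would exhaust the two that are allowed and make L
        special.\<close>
      have sub: "{q, c t0} \<subseteq> tangency_points c L" using q tp0 by auto
      have "card {q, c t0} = 2" using ne by simp
      then have "{q, c t0} = tangency_points c L" using card_seteq[OF fin(1) sub] fin(2) by simp
      then have "L \<in> special_lines c"
        unfolding special_lines_def using ne noinf q tp0 by blast
      with notspecial show False by blast
    qed
    have "\<not> inflection_at c t0" using noinf[OF tp0] by (auto simp: inflection_point_def)
    then have "curvature c t0 \<noteq> 0" using A(1) unfolding cond_A1_def simple_inflection_at_def by blast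
    then have T2: "deriv (deriv cx) t0 * cos \<phi>0 + deriv (deriv cy) t0 * sin \<phi>0 \<noteq> 0"
      by (rule curvature_nz_second_derivative[OF t0(2)])
    have t00: "tame n {\<phi>0 - 1<..<\<phi>0 + 1} (UNIV :: unit set) (\<lambda>_ _. 0)" for n by (rule tame_const[of _ _ 0]) auto
    \<comment> \<open>Finds the parameter whose tangent line has normal direction \<phi>. The
      condition \<open>T2\<close>, that is nonzero curvature, is the transversality of this
      equation.\<close>
    obtain b \<delta> \<tau> where b: "0 < b" and \<delta>: "0 < \<delta>" and
      root: "\<And>r \<phi> t. \<bar>r\<bar> < \<delta> \<Longrightarrow> \<bar>\<phi> - \<phi>0\<bar> < \<delta> \<Longrightarrow> \<bar>t - t0\<bar> < b \<Longrightarrow> ?T1 t \<phi> = 0 + r \<longleftrightarrow> t = \<tau> r \<phi>" and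
      near: "\<And>r \<phi>. \<bar>r\<bar> < \<delta> \<Longrightarrow> \<bar>\<phi> - \<phi>0\<bar> < \<delta> \<Longrightarrow> \<bar>\<tau> r \<phi> - t0\<bar> < b" and
      tame\<tau>: "\<And>n. tame n {\<phi>0 - \<delta><..<\<phi>0 + \<delta>} {r. \<bar>r\<bar> < \<delta>} \<tau>"
      by (rule transversal_root[OF smooth1_c[THEN smooth1_deriv] t00 zero_less_one zero_less_one t0(2) T2]) blast
    define \<tau>0 where "\<tau>0 = \<tau> 0"
    have tame0: "tame n {\<phi>0 - \<delta><..<\<phi>0 + \<delta>} (UNIV :: unit set) (\<lambda>_. \<tau>0)" for n
      unfolding \<tau>0_def using tame_reindex[OF tame\<tau>[of n], of UNIV "\<lambda>_. 0"] \<delta> by simp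
    have \<tau>0: "?T1 (\<tau>0 \<phi>) \<phi> = 0" if "\<bar>\<phi> - \<phi>0\<bar> < \<delta>" for \<phi>
      using root[of 0 \<phi> "\<tau>0 \<phi>"] near[of 0 \<phi>] that \<delta> by (simp add: \<tau>0_def)
    have \<tau>00: "\<tau>0 \<phi>0 = t0" using root[of 0 \<phi>0 t0] t0(2) \<delta> b by (simp add: \<tau>0_def)
    define h where "h = (\<lambda>\<phi>. cx (\<tau>0 \<phi>) * cos \<phi> + cy (\<tau>0 \<phi>) * sin \<phi>)"
    have th: "tame n {\<phi>0 - \<delta><..<\<phi>0 + \<delta>} (UNIV :: unit set) (\<lambda>_. h)" for n
      unfolding h_def
      by (intro tame_add tame_mult tame_compose[OF tame0] smooth1_c smooth1_tame[OF smooth1_cos] smooth1_tame[OF smooth1_sin]) auto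
    have h0: "h \<phi>0 = x0 \<bullet> dir \<phi>0" using t0(1) by (simp add: h_def \<tau>00 c_inner_dir)
    have "(h has_field_derivative (cy t0 * cos \<phi>0 - cx t0 * sin \<phi>0)) (at \<phi>0)"
    proof -
      have d\<tau>: "(\<tau>0 has_field_derivative deriv \<tau>0 \<phi>0) (at \<phi>0)"
        using tame_DERIV[OF tame0, of "()" \<phi>0] \<delta> by simp
      have "(h has_field_derivative deriv \<tau>0 \<phi>0 * ?T1 (\<tau>0 \<phi>0) \<phi>0 + (cy t0 * cos \<phi>0 - cx t0 * sin \<phi>0)) (at \<phi>0)"
        unfolding h_def
        by (rule derivative_eq_intros DERIV_chain2[OF smooth1_DERIV[OF smooth1_c(1)] d\<tau>]
            DERIV_chain2[OF smooth1_DERIV[OF smooth1_c(2)] d\<tau>] refl)+ (simp add: \<tau>00 algebra_simps)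
      then show ?thesis using t0(2) by (simp add: \<tau>00)
    qed
    then have "deriv h \<phi>0 = c t0 \<bullet> perp (dir \<phi>0)" by (simp add: DERIV_imp_deriv c_inner_perp)
    moreover have "c t0 \<bullet> perp (dir \<phi>0) \<noteq> x0 \<bullet> perp (dir \<phi>0)"
    proof
      assume "c t0 \<bullet> perp (dir \<phi>0) = x0 \<bullet> perp (dir \<phi>0)"
      then have "c t0 = x0" using t0(1) eq_line_point_iff by metis
      then show False using x0(2) boundary by auto
    qed
    ultimately have h': "deriv h \<phi>0 \<noteq> x0 \<bullet> perp (dir \<phi>0)" by simp
    have "\<exists>a0>0. \<forall>a. 0 < a \<longrightarrow> a < a0 \<longrightarrow> tame_chord_near D \<phi>0 h (u - a) (u + a) \<and> Z (h \<phi>0) \<inter> {u - a..u + a} = {u}"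
      if "u \<in> Z (h \<phi>0)" for u
    proof -
      from that obtain t where t: "line_point \<phi>0 (h \<phi>0) u = c t" by (auto simp: Z_def boundary)
      then have ct: "c t \<bullet> dir \<phi>0 = x0 \<bullet> dir \<phi>0" using h0 by (metis line_point_inner(1))
      show ?thesis
      proof (cases "?T1 t \<phi>0 = 0")
        case False
        from window_transversal[OF \<delta> th t this] show ?thesis by (simp add: Z_def)
      next
        case True
        \<comment> \<open>The parameters t and \<open>t0\<close> may differ by periods; it is enough
          that they give the same point of the curve.\<close>
        then have "c t \<in> tangency_points c L" using L[OF ct] by (auto simp: tangency_points_def)
        then have t: "line_point \<phi>0 (h \<phi>0) u = c t0" using single t by simp
        from window_tangent[OF \<delta> tame0 \<tau>0 \<tau>00 T2, of u] t show ?thesis by (simp add: Z_def h_def)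
      qed
    qed
    then show ?thesis using \<delta> th h0 h' by (intro exI[of _ h] exI[of _ \<delta>]) auto
  qed
  then obtain h \<delta>0 where h: "\<delta>0 > 0" "\<And>n. tame n {\<phi>0 - \<delta>0<..<\<phi>0 + \<delta>0} (UNIV :: unit set) (\<lambda>_. h)"
    "h \<phi>0 = x0 \<bullet> dir \<phi>0" "deriv h \<phi>0 \<noteq> x0 \<bullet> perp (dir \<phi>0)"
    and win: "\<And>u. u \<in> Z (h \<phi>0) \<Longrightarrow> \<exists>a0>0. \<forall>a. 0 < a \<longrightarrow> a < a0 \<longrightarrow> tame_chord_near D \<phi>0 h (u - a) (u + a) \<and> Z (h \<phi>0) \<inter> {u - a..u + a} = {u}"
    by metis
  obtain M where M: "M > 0" "closure D \<subseteq> ball 0 M"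
    using D(2) bounded_subset_ballD[of "closure D" 0] by auto
  have fM: "frontier D \<subseteq> ball 0 M" "D \<subseteq> ball 0 M"
    using M(2) closure_subset[of D] by (auto simp: frontier_def)
  from tame_chord_line[OF h(1,2) win[unfolded Z_def] fM(1) M(1)]
  obtain \<delta>1 where "\<delta>1 > 0"
    and tc: "tame_chord D {\<phi>0 - \<delta>1<..<\<phi>0 + \<delta>1} {r. 0 < \<bar>r\<bar> \<and> \<bar>r\<bar> < \<delta>1} h (\<lambda>_ _. - M) (\<lambda>_ _. M)"
    unfolding tame_chord_near_def by blast
  from tc obtain Lc where Lc: "\<forall>n. tame n {\<phi>0 - \<delta>1<..<\<phi>0 + \<delta>1} {r. 0 < \<bar>r\<bar> \<and> \<bar>r\<bar> < \<delta>1} Lc"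
    "\<forall>r\<in>{r. 0 < \<bar>r\<bar> \<and> \<bar>r\<bar> < \<delta>1}. \<forall>\<phi>\<in>{\<phi>0 - \<delta>1<..<\<phi>0 + \<delta>1}.
      ((\<lambda>u. indicator D (line_point \<phi> (h \<phi> + r) u) :: real) has_integral Lc r \<phi>) {-M..M}"
    unfolding tame_chord_def by (elim exE conjE)
  have L: "\<delta>1 > 0" "\<And>n. tame n {\<phi>0 - \<delta>1<..<\<phi>0 + \<delta>1} {r. 0 < \<bar>r\<bar> \<and> \<bar>r\<bar> < \<delta>1} Lc"
    "\<And>r \<phi>. 0 < \<bar>r\<bar> \<Longrightarrow> \<bar>r\<bar> < \<delta>1 \<Longrightarrow> \<phi> \<in> {\<phi>0 - \<delta>1<..<\<phi>0 + \<delta>1} \<Longrightarrow>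
      ((\<lambda>u. indicator D (line_point \<phi> (h \<phi> + r) u) :: real) has_integral Lc r \<phi>) {-M..M}"
    using \<open>\<delta>1 > 0\<close> Lc by simp_all
  let ?\<delta> = "min \<delta>0 \<delta>1"
  show ?thesis
  proof (rule that[of ?\<delta> h])
    show "tame n {\<phi>0 - ?\<delta><..<\<phi>0 + ?\<delta>} (UNIV :: unit set) (\<lambda>_. h)" for n
      by (rule tame_subset[OF h(2)]) auto
    show "tame n {\<phi>0 - ?\<delta><..<\<phi>0 + ?\<delta>} {r. 0 < \<bar>r\<bar> \<and> \<bar>r\<bar> < ?\<delta>}
       (\<lambda>r \<phi>. P_MA \<epsilon> (\<lambda>x. \<alpha> * indicator D x) (h \<phi> + r) (dir \<phi>))" for n
    proof -
      have "tame n {\<phi>0 - ?\<delta><..<\<phi>0 + ?\<delta>} {r. 0 < \<bar>r\<bar> \<and> \<bar>r\<bar> < ?\<delta>} Lc"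
        by (rule tame_subset[OF L(2)]) auto
      from tame_compose[OF tame_cmult[OF this] smooth1_log_sinhc]
      have *: "tame n {\<phi>0 - ?\<delta><..<\<phi>0 + ?\<delta>} {r. 0 < \<bar>r\<bar> \<and> \<bar>r\<bar> < ?\<delta>} (\<lambda>r \<phi>. log_sinhc \<epsilon> (\<alpha> * Lc r \<phi>))" .
      have eq: "P_MA \<epsilon> (\<lambda>x. \<alpha> * indicator D x) (h \<phi> + r) (dir \<phi>) = log_sinhc \<epsilon> (\<alpha> * Lc r \<phi>)"
        if "r \<in> {r. 0 < \<bar>r\<bar> \<and> \<bar>r\<bar> < ?\<delta>}" "\<phi> \<in> {\<phi>0 - ?\<delta><..<\<phi>0 + ?\<delta>}" for r \<phi>
        unfolding P_MA_def using that
        by (subst radon_indicator_has_integral[OF D(1) fM(2) L(3)]) auto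
      show ?thesis by (subst tame_cong[OF _ eq]) (use * in auto)
    qed
  qed (use h L in auto)
qed

end

section \<open>Decay of the localized Radon data\<close>

lemma integrable_bounded_support:
  fixes f :: "'a::euclidean_space \<Rightarrow> 'b::{banach, second_countable_topology}"
  assumes "f \<in> borel_measurable borel" "bounded S" "\<And>x. x \<notin> S \<Longrightarrow> f x = 0" "\<And>x. norm (f x) \<le> B"
  shows "integrable lborel f"
proof -
  obtain M where "\<And>x. x \<in> S \<Longrightarrow> norm x \<le> M" using assms(2) unfolding bounded_iff by blast
  then have M: "S \<subseteq> cball 0 M" by auto
  have "integrable lborel (\<lambda>x. B * indicat_real (cball (0::'a) M) x)"
    by (intro integrable_mult_right integrable_real_indicator emeasure_lborel_cball_finite) auto
  then show ?thesis
    by (rule Bochner_Integration.integrable_bound)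
      (use assms M order_trans[OF norm_ge_zero assms(4)] in \<open>auto simp: indicator_def subset_iff abs_mult intro!: AE_I2\<close>)
qed

lemma borel_measurable_fst_snd [measurable]:
  "(fst :: real \<times> real \<Rightarrow> real) \<in> borel_measurable borel" "(snd :: real \<times> real \<Rightarrow> real) \<in> borel_measurable borel"
  by (auto intro!: borel_measurable_continuous_onI continuous_intros)

text \<open>The shear s = h(\<phi>) + r preserves area and allows r to become the outer variable.
  For fixed r \<noteq> 0 the integral over \<phi> falls under \<open>oscillatory_decay\<close>, with
  constants independent of r and x, and the bounded range of r is integrated last. The radius
  \<open>d\<close> is fixed before the cutoffs and the order \<open>N\<close>, and the partition of
  the angles relies on this.\<close>

lemma near_piece:
  fixes P :: "real \<Rightarrow> real \<Rightarrow> real" and h :: "real \<Rightarrow> real" and x0 :: "real^2"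
  assumes \<delta>: "\<delta> > 0" and h: "\<And>n. tame n {\<phi>0 - \<delta><..<\<phi>0 + \<delta>} (UNIV :: unit set) (\<lambda>_. h)"
    "h \<phi>0 = x0 \<bullet> dir \<phi>0" "deriv h \<phi>0 \<noteq> x0 \<bullet> perp (dir \<phi>0)"
    and tameP: "\<And>n. tame n {\<phi>0 - \<delta><..<\<phi>0 + \<delta>} {r. 0 < \<bar>r\<bar> \<and> \<bar>r\<bar> < \<delta>} (\<lambda>r \<phi>. P (h \<phi> + r) \<phi>)"
    and Pm: "(\<lambda>z. P (snd z) (fst z)) \<in> borel_measurable borel" and B: "\<And>s \<phi>. \<bar>P s \<phi>\<bar> \<le> B"
  obtains d where "d > 0"
    "\<And>\<beta> \<eta> N. smooth1 \<beta> \<Longrightarrow> smooth1 \<eta> \<Longrightarrow> (\<And>\<phi>. d < \<bar>\<phi> - \<phi>0\<bar> \<Longrightarrow> \<beta> \<phi> = 0) \<Longrightarrow> (\<And>y. d < \<bar>y\<bar> \<Longrightarrow> \<eta> y = 0) \<Longrightarrow>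
      \<exists>C. \<forall>\<sigma>. \<forall>x\<in>ball x0 d. \<bar>\<sigma>\<bar> ^ N * norm (LINT z|lborel. of_real (\<beta> (fst z) * \<eta> (snd z - x0 \<bullet> dir (fst z)) * P (snd z) (fst z))
        * cis (\<sigma> * (snd z - x \<bullet> dir (fst z)))) \<le> C"
proof -
  let ?J = "{\<phi>0 - \<delta><..<\<phi>0 + \<delta>}"
  \<comment> \<open>The \<phi>-derivative of the phase at \<phi>0 for x = x0.\<close>
  define A where "A = deriv h \<phi>0 - x0 \<bullet> perp (dir \<phi>0)"
  define m where "m = \<bar>A\<bar> / 2"
  have m: "m > 0" using h(3) by (simp add: m_def A_def)
  have th': "tame n ?J (UNIV :: unit set) (\<lambda>_. deriv h)" for n
    using tame_deriv[OF h(1)[of "Suc n"]] by simp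
  have dh: "(h has_field_derivative deriv h \<phi>) (at \<phi>)" if "\<phi> \<in> ?J" for \<phi>
    using tame_DERIV[OF h(1) UNIV_I that] by simp
  have isC: "isCont h \<phi>0" "isCont (deriv h) \<phi>0"
    using DERIV_isCont[OF dh[of \<phi>0]] DERIV_isCont[OF tame_DERIV[OF th', of "()" \<phi>0]] \<delta> by auto
  have isCd: "isCont (\<lambda>\<phi>. x0 \<bullet> dir \<phi>) \<phi>0" "isCont (\<lambda>\<phi>. x0 \<bullet> perp (dir \<phi>)) \<phi>0"
    by (auto simp: inner_dir inner_perp_dir intro!: continuous_intros)
  have "m / 2 > 0" using m by simp
  then obtain d1 where d1: "d1 > 0" "\<And>\<phi>. \<bar>\<phi> - \<phi>0\<bar> < d1 \<Longrightarrow> \<bar>(deriv h \<phi> - x0 \<bullet> perp (dir \<phi>)) - A\<bar> < m / 2"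
    using continuous_diff[OF isC(2) isCd(2)] unfolding continuous_at_eps_delta dist_real_def A_def by metis
  have "\<delta> / 2 > 0" using \<delta> by simp
  moreover have "h \<phi>0 - x0 \<bullet> dir \<phi>0 = 0" using h(2) by simp
  ultimately obtain d2 where d2: "d2 > 0" "\<And>\<phi>. \<bar>\<phi> - \<phi>0\<bar> < d2 \<Longrightarrow> \<bar>h \<phi> - x0 \<bullet> dir \<phi>\<bar> < \<delta> / 2"
    using continuous_diff[OF isC(1) isCd(1)] unfolding continuous_at_eps_delta dist_real_def by (metis diff_0_right)
  \<comment> \<open>Within 3 d of \<phi>0 the derivative of the phase for x0 is off \<open>A\<close>
    by less than m/2, and moving x by less than \<open>d\<close> changes it by less than m/2 again;
    \<open>m\<close> out of |A| = 2 m remains. The bounds by d2 and \<delta> keep the supports of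
    the cutoffs in |r| < \<delta>.\<close>
  define d where "d = Min {d1 / 3, d2 / 3, \<delta> / 3, m / 2}"
  have d: "0 < d" "3 * d \<le> d1" "3 * d \<le> d2" "3 * d \<le> \<delta>" "2 * d \<le> m"
    using d1 d2 \<delta> m by (auto simp: d_def min_def)
  let ?J' = "{\<phi>0 - 3 * d<..<\<phi>0 + 3 * d}"
  have JJ: "?J' \<subseteq> ?J" using d by auto
  have J'abs: "\<bar>\<phi> - \<phi>0\<bar> < 3 * d" if "\<phi> \<in> ?J'" for \<phi> using that by (auto simp: abs_less_iff)
  let ?I = "ball x0 d \<times> {r. 0 < \<bar>r\<bar> \<and> \<bar>r\<bar> < \<delta>}"
  define y where "y = (\<lambda>i \<phi>. h \<phi> + snd i - fst i \<bullet> dir \<phi>)"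
  define y' where "y' = (\<lambda>(i :: (real^2) \<times> real) \<phi>. deriv h \<phi> - fst i \<bullet> perp (dir \<phi>))"
  have dy: "(y i has_field_derivative y' i \<phi>) (at \<phi>)" if "\<phi> \<in> ?J'" for i \<phi>
    unfolding y_def y'_def inner_dir inner_perp_dir
    using dh[of \<phi>] that JJ by (auto intro!: derivative_eq_intros)
  have y'm: "m \<le> \<bar>y' i \<phi>\<bar>" if "i \<in> ?I" "\<phi> \<in> ?J'" for i \<phi>
  proof -
    have "\<bar>(x0 - fst i) \<bullet> perp (dir \<phi>)\<bar> \<le> norm (x0 - fst i)"
      using Cauchy_Schwarz_ineq2[of "x0 - fst i" "perp (dir \<phi>)"] by simp
    also have "\<dots> < d" using that(1) by (auto simp: dist_norm)
    finally have 1: "\<bar>(x0 - fst i) \<bullet> perp (dir \<phi>)\<bar> < m / 2" using d by simp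
    have 2: "\<bar>(deriv h \<phi> - x0 \<bullet> perp (dir \<phi>)) - A\<bar> < m / 2" using d1(2)[of \<phi>] J'abs[OF that(2)] d by simp
    have "y' i \<phi> = (deriv h \<phi> - x0 \<bullet> perp (dir \<phi>)) + (x0 - fst i) \<bullet> perp (dir \<phi>)"
      by (simp add: y'_def inner_diff_left)
    then show ?thesis using 1 2 unfolding m_def by linarith
  qed
  have tcs: "tame n ?J' I (\<lambda>_. cos)" "tame n ?J' I (\<lambda>_. sin)" for n and I :: "'i set"
    by (auto intro!: smooth1_tame smooth1_cos smooth1_sin)
  have comp: "\<bar>fst i $ k\<bar> \<le> norm x0 + d" if "i \<in> ?I" for i :: "(real^2) \<times> real" and k
  proof -
    have "\<bar>fst i $ k\<bar> \<le> norm (fst i)" by (rule component_le_norm_cart)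
    also have "\<dots> \<le> norm x0 + norm (fst i - x0)" by (metis norm_triangle_sub)
    finally show ?thesis using that by (auto simp: dist_norm norm_minus_commute)
  qed
  have thI: "tame n ?J' I (\<lambda>_. h)" "tame n ?J' I (\<lambda>_. deriv h)" for n and I :: "((real^2) \<times> real) set"
    using tame_subset[OF tame_reindex[OF h(1)[of n], of I "\<lambda>_. ()"] JJ subset_refl]
      tame_subset[OF tame_reindex[OF th'[of n], of I "\<lambda>_. ()"] JJ subset_refl] by simp_all
  have ty': "tame n ?J' ?I (\<lambda>i \<phi>. 1 / y' i \<phi>)" for n
  proof (rule tame_inverse[OF m y'm])
    show "tame n ?J' ?I y'"
      unfolding y'_def inner_perp_dir
      by (intro tame_diff tame_mult thI tcs tame_const[of ?I _ "norm x0 + d"] comp)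
  qed
  show ?thesis
  proof (rule that[OF d(1)])
    fix \<beta> \<eta> :: "real \<Rightarrow> real" and N
    assume \<beta>: "smooth1 \<beta>" "\<And>\<phi>. d < \<bar>\<phi> - \<phi>0\<bar> \<Longrightarrow> \<beta> \<phi> = 0" and \<eta>: "smooth1 \<eta>" "\<And>y. d < \<bar>y\<bar> \<Longrightarrow> \<eta> y = 0"
    define b where "b = (\<lambda>(i :: (real^2) \<times> real) \<phi>. \<beta> \<phi> * \<eta> (h \<phi> + snd i - x0 \<bullet> dir \<phi>) * P (h \<phi> + snd i) \<phi>)"
    have tb: "tame n ?J' ?I b" for n
    proof -
      have tarea: "tame n ?J' ?I (\<lambda>i \<phi>. h \<phi> + snd i - x0 \<bullet> dir \<phi>)"
        unfolding inner_dir
        by (intro tame_diff tame_add tame_mult thI tcs tame_const[of ?I "\<lambda>_. x0 $ 1" "\<bar>x0 $ 1\<bar>"]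
            tame_const[of ?I "\<lambda>_. x0 $ 2" "\<bar>x0 $ 2\<bar>"] tame_const[of ?I snd \<delta>]) auto
      have "tame n ?J' ?I (\<lambda>i \<phi>. P (h \<phi> + snd i) \<phi>)"
        using tame_subset[OF tame_reindex[OF tameP[of n], of ?I snd] JJ subset_refl] by auto
      then show ?thesis
        unfolding b_def by (intro tame_mult tame_compose[OF tarea \<eta>(1)] smooth1_tame[OF \<beta>(1)]) auto
    qed
    have "\<exists>C. \<forall>i\<in>?I. \<forall>\<sigma>. \<bar>\<sigma>\<bar> ^ N * norm (integral {\<phi>0 - 2 * d..\<phi>0 + 2 * d} (\<lambda>\<phi>. of_real (b i \<phi>) * cis (\<sigma> * y i \<phi>))) \<le> C"
    proof (rule oscillatory_decay[where \<rho>=d and \<delta>="3*d", OF _ _ _ refl dy _ ty' tb])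
      show "y' i x \<noteq> 0" if "i \<in> ?I" "x \<in> ?J'" for i x using y'm[OF that] m by auto
      show "b i x = 0" if "i \<in> ?I" "x \<in> ?J'" "d < \<bar>x - \<phi>0\<bar>" for i x using \<beta>(2)[OF that(3)] by (simp add: b_def)
    qed (use d in auto)
    then obtain C where C: "\<And>i \<sigma>. i \<in> ?I \<Longrightarrow>
      \<bar>\<sigma>\<bar> ^ N * norm (integral {\<phi>0 - 2 * d..\<phi>0 + 2 * d} (\<lambda>\<phi>. of_real (b i \<phi>) * cis (\<sigma> * y i \<phi>))) \<le> C" by blast
    have [measurable]: "\<beta> \<in> borel_measurable borel" "\<eta> \<in> borel_measurable borel"
      using \<beta>(1) \<eta>(1) by (auto intro!: borel_measurable_continuous_onI smooth1_continuous_on)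
    have [measurable]: "dir \<in> borel_measurable borel"
      by (intro borel_measurable_continuous_onI continuous_intros)
    \<comment> \<open>\<open>h\<close> is controlled only near \<phi>0. It is set to 0 elsewhere,
      outside the support of \<beta>, to have a measurable shear on the whole plane.\<close>
    define hh where "hh = (\<lambda>\<phi>. indicator ?J' \<phi> *\<^sub>R h \<phi>)"
    have conth: "continuous_on ?J' h" using tame_continuous[OF thI(1)[of 0 UNIV]] by auto
    then have [measurable]: "hh \<in> borel_measurable borel"
      unfolding hh_def by (intro borel_measurable_continuous_on_indicator) auto
    have \<beta>J: "\<beta> \<phi> = 0" if "\<phi> \<notin> ?J'" for \<phi>
      using that d by (intro \<beta>(2)) (auto simp: abs_if split: if_splits)
    have hhJ: "hh \<phi> = h \<phi>" if "\<phi> \<in> ?J'" for \<phi> using that by (simp add: hh_def)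
    obtain K1 where K1: "\<And>\<phi>. \<phi> \<in> {\<phi>0 - d..\<phi>0 + d} \<Longrightarrow> \<bar>\<beta> \<phi>\<bar> \<le> K1"
      using continuous_bounded_on_interval[OF smooth1_continuous_on[OF \<beta>(1)]] by metis
    obtain K2 where K2: "\<And>y. y \<in> {-d..d} \<Longrightarrow> \<bar>\<eta> y\<bar> \<le> K2"
      using continuous_bounded_on_interval[OF smooth1_continuous_on[OF \<eta>(1)]] by metis
    have \<beta>K: "\<bar>\<beta> \<phi>\<bar> \<le> K1" for \<phi>
      using \<beta>(2)[of \<phi>] K1[of \<phi>] K1[of \<phi>0] d(1) by (cases "d < \<bar>\<phi> - \<phi>0\<bar>") (auto simp: abs_le_iff not_less)
    have \<eta>K: "\<bar>\<eta> y\<bar> \<le> K2" for y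
      using \<eta>(2)[of y] K2[of y] K2[of 0] d(1) by (cases "d < \<bar>y\<bar>") (auto simp: abs_le_iff not_less)
    have Kpos: "0 \<le> K1" "0 \<le> K2" "0 \<le> B" using order_trans[OF abs_ge_zero \<beta>K] order_trans[OF abs_ge_zero \<eta>K] order_trans[OF abs_ge_zero B] by auto
    define amp where "amp = (\<lambda>\<phi> s. \<beta> \<phi> * \<eta> (s - x0 \<bullet> dir \<phi>) * P s \<phi>)"
    have ampK: "\<bar>amp \<phi> s\<bar> \<le> K1 * K2 * B" for \<phi> s
      unfolding amp_def abs_mult by (intro mult_mono \<beta>K \<eta>K B mult_nonneg_nonneg Kpos) auto
    have ampm [measurable]: "(\<lambda>z. amp (fst z) (snd z)) \<in> borel_measurable borel"
      unfolding amp_def by (intro borel_measurable_times Pm) measurable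
    have amp0: "amp \<phi> s = 0" if "d < \<bar>\<phi> - \<phi>0\<bar> \<or> d < \<bar>s - x0 \<bullet> dir \<phi>\<bar>" for \<phi> s
      using that \<beta>(2) \<eta>(2) by (auto simp: amp_def)
    have bound: "\<bar>\<sigma>\<bar> ^ N * norm (LINT z|lborel. of_real (amp (fst z) (snd z)) * cis (\<sigma> * (snd z - x \<bullet> dir (fst z)))) \<le> C * (2 * \<delta>)"
      if x: "x \<in> ball x0 d" for \<sigma> x
    proof -
      define F where "F = (\<lambda>\<phi> s. of_real (amp \<phi> s) * cis (\<sigma> * (s - x \<bullet> dir \<phi>)))"
      define G where "G = (\<lambda>\<phi> r. F \<phi> (hh \<phi> + r))"
      have Fm [measurable]: "(\<lambda>z. F (fst z) (snd z)) \<in> borel_measurable borel"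
      proof -
        have "(\<lambda>z. cis (\<sigma> * (snd z - x \<bullet> dir (fst z)))) \<in> borel_measurable (borel :: (real \<times> real) measure)"
          by (intro borel_measurable_continuous_onI continuous_intros)
        then show ?thesis unfolding F_def using ampm by measurable
      qed
      have "(\<lambda>z. (fst z, hh (fst z) + snd z)) \<in> borel_measurable (borel :: (real \<times> real) measure)"
        by (intro borel_measurable_Pair) measurable
      from measurable_compose[OF this Fm] have Gm [measurable]: "(\<lambda>z. G (fst z) (snd z)) \<in> borel_measurable borel"
        by (simp add: G_def)
      have normF: "norm (F \<phi> s) \<le> K1 * K2 * B" for \<phi> s using ampK by (simp add: F_def norm_mult)
      have dirb: "\<bar>x0 \<bullet> dir \<phi>\<bar> \<le> norm x0" for \<phi> using Cauchy_Schwarz_ineq2[of x0 "dir \<phi>"] by simp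
      have F0: "F \<phi> s = 0" if "\<phi> \<notin> {\<phi>0 - d..\<phi>0 + d} \<or> d < \<bar>s - x0 \<bullet> dir \<phi>\<bar>" for \<phi> s
      proof -
        have "d < \<bar>\<phi> - \<phi>0\<bar> \<or> d < \<bar>s - x0 \<bullet> dir \<phi>\<bar>" using that by (auto simp: abs_if)
        then show ?thesis using amp0 by (simp add: F_def)
      qed
      have intF: "integrable lborel (\<lambda>z. F (fst z) (snd z))"
      proof (rule integrable_bounded_support[OF Fm])
        show "bounded ({\<phi>0 - d..\<phi>0 + d} \<times> {-(norm x0 + d)..norm x0 + d})" by (intro bounded_Times) auto
        show "F (fst z) (snd z) = 0" if "z \<notin> {\<phi>0 - d..\<phi>0 + d} \<times> {-(norm x0 + d)..norm x0 + d}" for z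
        proof (cases "fst z \<in> {\<phi>0 - d..\<phi>0 + d}")
          case True
          then have "snd z \<notin> {-(norm x0 + d)..norm x0 + d}" using that by (cases z) auto
          then have "d < \<bar>snd z - x0 \<bullet> dir (fst z)\<bar>" using dirb[of "fst z"] by auto
          then show ?thesis by (intro F0) auto
        qed (auto intro: F0)
      qed (rule normF)
      \<comment> \<open>On the support, |s - x0 \<bullet> dir \<phi>| \<le> d and |h \<phi> - x0
        \<bullet> dir \<phi>| < \<delta>/2, which forces |r| < \<delta>.\<close>
      have G0: "G \<phi> r = 0" if "\<phi> \<notin> {\<phi>0 - d..\<phi>0 + d} \<or> \<delta> \<le> \<bar>r\<bar>" for \<phi> r
      proof (cases "\<phi> \<in> {\<phi>0 - d..\<phi>0 + d}")
        case True
        then have a: "\<bar>\<phi> - \<phi>0\<bar> \<le> d" by (auto simp: abs_le_iff)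
        then have "\<phi> \<in> ?J'" using d by (auto simp: abs_le_iff)
        moreover have "\<bar>h \<phi> - x0 \<bullet> dir \<phi>\<bar> < \<delta> / 2" using d2(2)[of \<phi>] a d by linarith
        moreover have "d < \<delta> / 2" using d by linarith
        ultimately have "d < \<bar>hh \<phi> + r - x0 \<bullet> dir \<phi>\<bar>" using True that hhJ[of \<phi>] by linarith
        then show ?thesis unfolding G_def by (intro F0) auto
      qed (auto simp: G_def intro: F0)
      have intG: "integrable lborel (\<lambda>z. G (fst z) (snd z))"
      proof (rule integrable_bounded_support[OF Gm])
        show "bounded ({\<phi>0 - d..\<phi>0 + d} \<times> {-\<delta>..\<delta>})" by (intro bounded_Times) auto
        show "G (fst z) (snd z) = 0" if "z \<notin> {\<phi>0 - d..\<phi>0 + d} \<times> {-\<delta>..\<delta>}" for z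
        proof -
          have "fst z \<notin> {\<phi>0 - d..\<phi>0 + d} \<or> \<delta> \<le> \<bar>snd z\<bar>" using that by (cases z) auto
          then show ?thesis by (rule G0)
        qed
        show "norm (G (fst z) (snd z)) \<le> K1 * K2 * B" for z unfolding G_def by (rule normF)
      qed
      have "(LINT z|lborel. F (fst z) (snd z)) = (LINT \<phi>|lborel. LINT s|lborel. F \<phi> s)"
        using lborel_pair.integral_fst'[of "\<lambda>z. F (fst z) (snd z)"] intF by (simp add: lborel_prod)
      also have "\<dots> = (LINT \<phi>|lborel. LINT r|lborel. G \<phi> r)"
      proof (rule Bochner_Integration.integral_cong[OF refl])
        fix \<phi>
        show "(LINT s|lborel. F \<phi> s) = (LINT r|lborel. G \<phi> r)"
          using lborel_integral_real_affine[of 1 "F \<phi>" "hh \<phi>"] by (simp add: G_def)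
      qed
      also have "\<dots> = (LINT r|lborel. LINT \<phi>|lborel. G \<phi> r)"
        using intG by (intro lborel_pair.Fubini_integral[symmetric]) (simp add: lborel_prod case_prod_unfold)
      finally have eq: "(LINT z|lborel. F (fst z) (snd z)) = (LINT r|lborel. LINT \<phi>|lborel. G \<phi> r)" .
      define g where "g = (\<lambda>r. LINT \<phi>|lborel. G \<phi> r)"
      have intg: "integrable lborel g"
        unfolding g_def using intG lborel_pair.integrable_snd[of G] by (simp add: lborel_prod case_prod_unfold)
      have gbound: "\<bar>\<sigma>\<bar> ^ N * norm (g r) \<le> C" if r: "0 < \<bar>r\<bar>" "\<bar>r\<bar> < \<delta>" for r
      proof -
        have i: "(x, r) \<in> ?I" using x r by simp
        let ?S = "{\<phi>0 - 2 * d..\<phi>0 + 2 * d}"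
        have S: "?S \<subseteq> ?J'" using d by auto
        let ?f = "\<lambda>\<phi>. of_real (b (x, r) \<phi>) * cis (\<sigma> * y (x, r) \<phi>)"
        have fG: "G \<phi> r = ?f \<phi>" if "\<phi> \<in> ?S" for \<phi>
          using hhJ[of \<phi>] S that by (auto simp: G_def F_def amp_def b_def y_def)
        have "continuous_on ?S ?f"
          using dy S by (intro continuous_intros continuous_on_subset[OF tame_continuous[OF tb[of 0] i] S])
            (meson DERIV_isCont continuous_at_imp_continuous_on subsetD)
        then have "set_integrable lborel ?S ?f"
          unfolding set_integrable_def by (intro borel_integrable_compact) auto
        then have "(LINT \<phi>:?S|lborel. ?f \<phi>) = integral ?S ?f" by (rule set_borel_integral_eq_integral)
        moreover have "g r = (LINT \<phi>:?S|lborel. ?f \<phi>)"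
          unfolding g_def set_lebesgue_integral_def
        proof (intro Bochner_Integration.integral_cong refl)
          fix \<phi> show "G \<phi> r = indicat_real ?S \<phi> *\<^sub>R ?f \<phi>"
            using fG[of \<phi>] G0[of \<phi> r] d by (cases "\<phi> \<in> ?S") (auto simp: indicator_def)
        qed
        ultimately show ?thesis using C[OF i, of \<sigma>] by simp
      qed
      have "\<bar>\<sigma>\<bar> ^ N * norm (LINT r|lborel. g r) \<le> \<bar>\<sigma>\<bar> ^ N * (LINT r|lborel. norm (g r))"
        by (intro mult_left_mono) auto
      also have "\<dots> = (LINT r|lborel. \<bar>\<sigma>\<bar> ^ N * norm (g r))" by simp
      also have "\<dots> \<le> (LINT r|lborel. C * indicat_real {-\<delta>..\<delta>} r)"
      proof (rule integral_mono_AE)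
        show "integrable lborel (\<lambda>r. C * indicat_real {-\<delta>..\<delta>} r)"
          by (intro integrable_mult_right integrable_real_indicator) (auto simp: emeasure_lborel_Icc_eq)
        \<comment> \<open>The lines r = 0, on which nothing is known, are negligible here.\<close>
        have "AE r in lborel. r \<noteq> (0::real)" by (rule AE_lborel_singleton)
        then show "AE r in lborel. \<bar>\<sigma>\<bar> ^ N * norm (g r) \<le> C * indicat_real {-\<delta>..\<delta>} r"
        proof eventually_elim
          case (elim r)
          show ?case
          proof (cases "\<bar>r\<bar> < \<delta>")
            case True
            then show ?thesis using gbound[of r] elim by (auto simp: indicator_def)
          next
            case False
            then have "g r = 0" unfolding g_def using G0 by (simp add: not_less)
            \<comment> \<open>The bound at a single admissible shift, here \<delta>/2, shows that C
              is nonnegative.\<close>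
            moreover have "0 \<le> C" using gbound[of "\<delta> / 2"] \<delta> by (auto intro: order_trans[rotated])
            ultimately show ?thesis by (simp add: indicator_def)
          qed
        qed
      qed (use intg in auto)
      also have "\<dots> = C * (2 * \<delta>)" using \<delta> by simp
      finally show ?thesis unfolding eq[unfolded F_def] g_def .
    qed
    show "\<exists>C. \<forall>\<sigma>. \<forall>x\<in>ball x0 d. \<bar>\<sigma>\<bar> ^ N * norm (LINT z|lborel. of_real (\<beta> (fst z) * \<eta> (snd z - x0 \<bullet> dir (fst z)) * P (snd z) (fst z))
        * cis (\<sigma> * (snd z - x \<bullet> dir (fst z)))) \<le> C"
      using bound unfolding amp_def by blast
  qed
qed

section \<open>Oscillatory integrals over the space of lines\<close>

definition amplitude :: "(real \<times> real \<Rightarrow> real) \<Rightarrow> bool" where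
  "amplitude A \<longleftrightarrow> A \<in> borel_measurable borel \<and> (\<exists>B. \<forall>z. \<bar>A z\<bar> \<le> B) \<and> bounded {z. A z \<noteq> 0}"

text \<open>The integral J(\<sigma>, x) of the overview. A line is a pair z with the angle first and
  the signed distance second.\<close>

definition osc :: "(real \<times> real \<Rightarrow> real) \<Rightarrow> real \<Rightarrow> real^2 \<Rightarrow> complex" where
  "osc A \<sigma> x = (LINT z|lborel. of_real (A z) * cis (\<sigma> * (snd z - x \<bullet> dir (fst z))))"

lemma amplitude_measurable: "amplitude A \<Longrightarrow> A \<in> borel_measurable borel"
  by (simp add: amplitude_def)

lemma amplitude_integrable: "amplitude A \<Longrightarrow> integrable lborel A"
  unfolding amplitude_def by (elim conjE exE) (rule integrable_bounded_support, auto)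

lemma amplitude_mult:
  assumes "amplitude A" "g \<in> borel_measurable borel" "\<And>S. bounded S \<Longrightarrow> \<exists>B. \<forall>z\<in>S. \<bar>g z\<bar> \<le> B"
  shows "amplitude (\<lambda>z. g z * A z)"
proof -
  obtain B where B: "\<And>z. \<bar>A z\<bar> \<le> B" using assms(1) by (auto simp: amplitude_def)
  have bd: "bounded {z. A z \<noteq> 0}" using assms(1) by (simp add: amplitude_def)
  obtain K where K: "\<And>z. A z \<noteq> 0 \<Longrightarrow> \<bar>g z\<bar> \<le> K" using assms(3)[OF bd] by auto
  have "\<bar>g z * A z\<bar> \<le> \<bar>K\<bar> * B" for z
  proof (cases "A z = 0")
    case True
    then show ?thesis using B[of z] by simp
  next
    case False
    then show ?thesis unfolding abs_mult using K[of z] B[of z] by (intro mult_mono) auto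
  qed
  moreover have "bounded {z. g z * A z \<noteq> 0}" by (rule bounded_subset[OF bd]) auto
  ultimately show ?thesis using assms(1,2) unfolding amplitude_def by auto
qed

lemma amplitude_mult_continuous:
  assumes "amplitude A" "continuous_on UNIV g"
  shows "amplitude (\<lambda>z. g z * A z)"
proof (rule amplitude_mult[OF assms(1)])
  show "g \<in> borel_measurable borel" using assms(2) by (rule borel_measurable_continuous_onI)
  fix S :: "(real \<times> real) set" assume "bounded S"
  then have "compact (closure S)" by simp
  then have "bounded (g ` closure S)"
    by (intro compact_imp_bounded compact_continuous_image continuous_on_subset[OF assms(2)]) auto
  then obtain B where "\<And>z. z \<in> closure S \<Longrightarrow> \<bar>g z\<bar> \<le> B" unfolding bounded_iff by (metis imageI real_norm_def)
  then show "\<exists>B. \<forall>z\<in>S. \<bar>g z\<bar> \<le> B" using closure_subset[of S] by blast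
qed

lemma measurable_cis_phase [measurable]:
  "(\<lambda>z :: real \<times> real. cis (\<sigma> * (snd z - x \<bullet> dir (fst z)))) \<in> borel_measurable borel"
  by (intro borel_measurable_continuous_onI continuous_intros)

lemma osc_integrable:
  assumes "amplitude A"
  shows "integrable lborel (\<lambda>z. of_real (A z) * cis (\<sigma> * (snd z - x \<bullet> dir (fst z))) :: complex)"
proof -
  have [measurable]: "A \<in> borel_measurable borel" by (rule amplitude_measurable[OF assms])
  show ?thesis
    by (rule Bochner_Integration.integrable_bound[OF amplitude_integrable[OF assms]])
      (auto simp: norm_mult intro!: borel_measurable_times)
qed

lemma osc_sum:
  assumes "finite F" "\<And>j. j \<in> F \<Longrightarrow> amplitude (A j)"
  shows "osc (\<lambda>z. \<Sum>j\<in>F. A j z) \<sigma> x = (\<Sum>j\<in>F. osc (A j) \<sigma> x)"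
  unfolding osc_def of_real_sum sum_distrib_right
  by (rule Bochner_Integration.integral_sum[OF osc_integrable]) (rule assms(2))

lemma amplitude_strip:
  assumes Pm: "(\<lambda>z. P (snd z) (fst z)) \<in> borel_measurable borel" and PB: "\<And>s \<phi>. \<bar>P s \<phi>\<bar> \<le> B"
    and Ps: "\<And>s \<phi>. M < \<bar>s\<bar> \<Longrightarrow> P s \<phi> = 0"
  shows "amplitude (\<lambda>z. indicator {a..b} (fst z) * P (snd z) (fst z))"
  unfolding amplitude_def
proof (intro conjI exI allI)
  let ?A = "\<lambda>z. indicator {a..b} (fst z) * P (snd z) (fst z)"
  show "?A \<in> borel_measurable borel" by (intro borel_measurable_times Pm) measurable
  show "\<bar>?A z\<bar> \<le> B" for z using PB[of "snd z" "fst z"] order_trans[OF abs_ge_zero PB] by (auto simp: indicator_def)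
  have "{z. ?A z \<noteq> 0} \<subseteq> {a..b} \<times> {-M..M}"
  proof
    fix z assume z: "z \<in> {z. ?A z \<noteq> 0}"
    then have "fst z \<in> {a..b}" by (auto simp: indicator_def)
    moreover have "\<not> M < \<bar>snd z\<bar>" using z Ps by auto
    ultimately show "z \<in> {a..b} \<times> {-M..M}" by (cases z) auto
  qed
  then show "bounded {z. ?A z \<noteq> 0}" by (rule bounded_subset[rotated]) (intro bounded_Times, auto)
qed

text \<open>Compactness of \<open>{0..pi}\<close> makes the local radii uniform: finitely many
  angles suffice, and a Lebesgue number \<open>e\<close> places every short angular interval in one
  of their balls. Bumps made of differences of translated steps then partition the cutoff. A smooth
  angular weight \<open>w\<close> is carried along because derivatives in x produce such
  weights.\<close>

lemma near_uniform:
  fixes P :: "real \<Rightarrow> real \<Rightarrow> real" and x0 :: "real^2"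
  assumes pieces: "\<And>\<phi>0. \<exists>d>0. \<forall>\<beta> \<eta> N. smooth1 \<beta> \<longrightarrow> smooth1 \<eta> \<longrightarrow> (\<forall>\<phi>. d < \<bar>\<phi> - \<phi>0\<bar> \<longrightarrow> \<beta> \<phi> = 0) \<longrightarrow> (\<forall>y. d < \<bar>y\<bar> \<longrightarrow> \<eta> y = 0) \<longrightarrow>
      (\<exists>C. \<forall>\<sigma>. \<forall>x\<in>ball x0 d. \<bar>\<sigma>\<bar> ^ N * norm (osc (\<lambda>z. \<beta> (fst z) * \<eta> (snd z - x0 \<bullet> dir (fst z)) * P (snd z) (fst z)) \<sigma> x) \<le> C)"
    and Pm: "(\<lambda>z. P (snd z) (fst z)) \<in> borel_measurable borel" and PB: "\<And>s \<phi>. \<bar>P s \<phi>\<bar> \<le> B"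
    and Ps: "\<And>s \<phi>. M < \<bar>s\<bar> \<Longrightarrow> P s \<phi> = 0"
  obtains d \<rho> where "d > 0" "0 < \<rho>" "\<rho> < pi"
    "\<And>w \<eta> N. smooth1 w \<Longrightarrow> smooth1 \<eta> \<Longrightarrow> (\<And>y. d < \<bar>y\<bar> \<Longrightarrow> \<eta> y = 0) \<Longrightarrow>
      \<exists>C. \<forall>\<sigma>. \<forall>x\<in>ball x0 d. \<bar>\<sigma>\<bar> ^ N * norm (osc (\<lambda>z. w (fst z) * (smooth_step \<rho> (fst z) - smooth_step \<rho> (fst z - pi)) *
        \<eta> (snd z - x0 \<bullet> dir (fst z)) * P (snd z) (fst z)) \<sigma> x) \<le> C"
proof -
  define Near where "Near \<phi>0 d \<longleftrightarrow> (\<forall>\<beta> \<eta> N. smooth1 \<beta> \<longrightarrow> smooth1 \<eta> \<longrightarrow> (\<forall>\<phi>. d < \<bar>\<phi> - \<phi>0\<bar> \<longrightarrow> \<beta> \<phi> = 0) \<longrightarrow> (\<forall>y. d < \<bar>y\<bar> \<longrightarrow> \<eta> y = 0) \<longrightarrow>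
      (\<exists>C. \<forall>\<sigma>. \<forall>x\<in>ball x0 d. \<bar>\<sigma>\<bar> ^ N * norm (osc (\<lambda>z. \<beta> (fst z) * \<eta> (snd z - x0 \<bullet> dir (fst z)) * P (snd z) (fst z)) \<sigma> x) \<le> C))" for \<phi>0 d
  have "\<exists>d>0. Near \<phi>0 d" for \<phi>0 unfolding Near_def by (rule pieces)
  then obtain dd where dd: "\<And>\<phi>0. dd \<phi>0 > (0::real)" and Near: "\<And>\<phi>0. Near \<phi>0 (dd \<phi>0)" by metis
  have pc: "\<exists>C. \<forall>\<sigma>. \<forall>x\<in>ball x0 (dd \<phi>0). \<bar>\<sigma>\<bar> ^ N * norm (osc (\<lambda>z. \<beta> (fst z) * \<eta> (snd z - x0 \<bullet> dir (fst z)) * P (snd z) (fst z)) \<sigma> x) \<le> C"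
    if "smooth1 \<beta>" "smooth1 \<eta>" "\<forall>\<phi>. dd \<phi>0 < \<bar>\<phi> - \<phi>0\<bar> \<longrightarrow> \<beta> \<phi> = 0" "\<forall>y. dd \<phi>0 < \<bar>y\<bar> \<longrightarrow> \<eta> y = 0" for \<phi>0 \<beta> \<eta> N
    using Near[of \<phi>0] that unfolding Near_def by simp
  have "{0..pi} \<subseteq> (\<Union>c\<in>{0..pi}. ball c (dd c))" using dd by force
  then obtain F where F: "F \<subseteq> {0..pi}" "finite F" "{0..pi} \<subseteq> (\<Union>c\<in>F. ball c (dd c))"
    by (rule compactE_image[OF compact_Icc, rotated]) auto
  obtain e where e: "0 < e" "\<And>x. x \<in> {0..pi} \<Longrightarrow> \<exists>G\<in>(\<lambda>c. ball c (dd c)) ` F. ball x e \<subseteq> G"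
    by (rule Heine_Borel_lemma[OF compact_Icc F(3)]) auto
  have "F \<noteq> {}" using F(3) by auto
  \<comment> \<open>Halving makes \<open>d\<close> strictly smaller than the Lebesgue number and
    than all radii of the finite cover.\<close>
  define d where "d = Min (insert e (dd ` F)) / 2"
  have dpos: "d > 0" using e(1) dd F(2) by (simp add: d_def)
  have de: "d < e" and dF: "\<And>c. c \<in> F \<Longrightarrow> d < dd c"
  proof -
    have "Min (insert e (dd ` F)) \<le> e" "\<And>c. c \<in> F \<Longrightarrow> Min (insert e (dd ` F)) \<le> dd c"
      using F(2) by (auto intro!: Min_le)
    then show "d < e" "\<And>c. c \<in> F \<Longrightarrow> d < dd c" using dpos unfolding d_def by force+
  qed
  obtain m :: nat where m: "max 2 (pi / d) < m" using reals_Archimedean2 by blast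
  \<comment> \<open>An integer fraction of pi, so that \<open>m\<close> translations by \<rho> lead
    exactly from the step at 0 to the step at pi.\<close>
  define \<rho> where "\<rho> = pi / m"
  have m2: "real m > 2" "real m > pi / d" using m by auto
  have \<rho>: "0 < \<rho>" "\<rho> < pi" "\<rho> < d"
  proof -
    show "0 < \<rho>" using m2 by (simp add: \<rho>_def)
    have "pi / real m < pi / 1" using m2 by (intro divide_strict_left_mono) auto
    then show "\<rho> < pi" by (simp add: \<rho>_def)
    show "\<rho> < d" using m2 dpos by (simp add: \<rho>_def field_simps)
  qed
  have m\<rho>: "real m * \<rho> = pi" using m2 by (simp add: \<rho>_def)
  show ?thesis
  proof (rule that[OF dpos \<rho>(1,2)])
    fix w \<eta> :: "real \<Rightarrow> real" and N
    assume w: "smooth1 w" and \<eta>: "smooth1 \<eta>" "\<And>y. d < \<bar>y\<bar> \<Longrightarrow> \<eta> y = 0"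
    let ?S = "smooth_step \<rho>"
    define b where "b = (\<lambda>j \<phi>. w \<phi> * (?S (\<phi> - real j * \<rho>) - ?S (\<phi> - real (Suc j) * \<rho>)))"
    have sS: "smooth1 (\<lambda>\<phi>. ?S (\<phi> - c))" for c
      using smooth1_compose[OF smooth1_smooth_step[OF \<rho>(1)] smooth1_diff[OF smooth1_ident smooth1_const]] .
    have sb: "smooth1 (b j)" for j unfolding b_def by (intro smooth1_mult smooth1_diff w sS)
    \<comment> \<open>Bump j is the difference of steps rising on
      \<open>[j \<rho>, (j+1) \<rho>]\<close> and on \<open>[(j+1) \<rho>, (j+2) \<rho>]\<close>,
      hence is supported within \<rho> of their common end.\<close>
    have b0: "b j \<phi> = 0" if hb: "\<rho> < \<bar>\<phi> - real (Suc j) * \<rho>\<bar>" for j \<phi>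
    proof -
      consider "\<phi> < real j * \<rho>" | "\<phi> > real (Suc j) * \<rho> + \<rho>" using hb by (auto simp: abs_if algebra_simps split: if_splits)
      then show ?thesis
      proof cases
        case 1
        then have "\<phi> - real j * \<rho> \<le> 0" "\<phi> - real (Suc j) * \<rho> \<le> 0" using \<rho>(1) by (auto simp: algebra_simps)
        then show ?thesis by (simp add: b_def smooth_step_eq_0[OF \<rho>(1)])
      next
        case 2
        then have "\<rho> \<le> \<phi> - real j * \<rho>" "\<rho> \<le> \<phi> - real (Suc j) * \<rho>" using \<rho>(1) by (auto simp: algebra_simps)
        then show ?thesis by (simp add: b_def smooth_step_eq_1[OF \<rho>(1)])
      qed
    qed
    define Aj where "Aj = (\<lambda>j z. b j (fst z) * \<eta> (snd z - x0 \<bullet> dir (fst z)) * P (snd z) (fst z))"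
    have "\<exists>C. \<forall>\<sigma>. \<forall>x\<in>ball x0 d. \<bar>\<sigma>\<bar> ^ N * norm (osc (Aj j) \<sigma> x) \<le> C" if j: "j < m" for j
    proof -
      define \<psi> where "\<psi> = real (Suc j) * \<rho>"
      have "real (Suc j) * \<rho> \<le> real m * \<rho>" using j \<rho>(1) by (intro mult_right_mono) auto
      then have "\<psi> \<in> {0..pi}" using \<rho>(1) m\<rho> by (simp add: \<psi>_def)
      then obtain c where c: "c \<in> F" "ball \<psi> e \<subseteq> ball c (dd c)" using e(2) by blast
      have "\<exists>C. \<forall>\<sigma>. \<forall>x\<in>ball x0 (dd c). \<bar>\<sigma>\<bar> ^ N * norm (osc (Aj j) \<sigma> x) \<le> C"
        unfolding Aj_def
      proof (rule pc[OF sb \<eta>(1)]; intro allI impI)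
        show "b j \<phi> = 0" if "dd c < \<bar>\<phi> - c\<bar>" for \<phi>
        proof (rule b0)
          have "\<phi> \<notin> ball c (dd c)" using that by (auto simp: dist_real_def)
          then have "\<phi> \<notin> ball \<psi> e" using c(2) by blast
          then show "\<rho> < \<bar>\<phi> - real (Suc j) * \<rho>\<bar>" using \<rho>(3) de by (auto simp: dist_real_def \<psi>_def abs_minus_commute)
        qed
        show "\<eta> y = 0" if "dd c < \<bar>y\<bar>" for y using \<eta>(2) that dF[OF c(1)] by simp
      qed
      then show ?thesis using dF[OF c(1)] by (meson ball_subset_cball less_imp_le subset_ball subsetD)
    qed
    then obtain C where C: "\<And>j \<sigma> x. j < m \<Longrightarrow> x \<in> ball x0 d \<Longrightarrow> \<bar>\<sigma>\<bar> ^ N * norm (osc (Aj j) \<sigma> x) \<le> C j" by metis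
    have amp: "amplitude (Aj j)" for j
    proof -
      let ?A = "\<lambda>z. indicator {real (Suc j) * \<rho> - \<rho>..real (Suc j) * \<rho> + \<rho>} (fst z) * P (snd z) (fst z)"
      have "amplitude ?A" by (rule amplitude_strip[OF Pm PB Ps])
      then have "amplitude (\<lambda>z. (b j (fst z) * \<eta> (snd z - x0 \<bullet> dir (fst z))) * ?A z)"
        by (rule amplitude_mult_continuous)
          (intro continuous_intros continuous_on_compose2[OF smooth1_continuous_on[OF sb, of UNIV]]
            continuous_on_compose2[OF smooth1_continuous_on[OF \<eta>(1), of UNIV]]; auto)
      also have "(\<lambda>z. (b j (fst z) * \<eta> (snd z - x0 \<bullet> dir (fst z))) * ?A z) = Aj j"
      proof
        fix z show "(b j (fst z) * \<eta> (snd z - x0 \<bullet> dir (fst z))) * ?A z = Aj j z"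
          using b0[of "fst z" j] by (cases "\<rho> < \<bar>fst z - real (Suc j) * \<rho>\<bar>") (auto simp: Aj_def indicator_def abs_if split: if_splits)
      qed
      finally show ?thesis .
    qed
    have tele: "(\<Sum>j<m. b j \<phi>) = w \<phi> * (?S \<phi> - ?S (\<phi> - pi))" for \<phi>
    proof -
      have "(\<Sum>j<m. ?S (\<phi> - real j * \<rho>) - ?S (\<phi> - real (Suc j) * \<rho>)) = ?S (\<phi> - real 0 * \<rho>) - ?S (\<phi> - real m * \<rho>)"
        by (rule sum_lessThan_telescope')
      then show ?thesis by (simp add: b_def m\<rho> flip: sum_distrib_left)
    qed
    have "(\<lambda>z. w (fst z) * (?S (fst z) - ?S (fst z - pi)) * \<eta> (snd z - x0 \<bullet> dir (fst z)) * P (snd z) (fst z))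
        = (\<lambda>z. \<Sum>j<m. Aj j z)"
      by (simp add: Aj_def tele flip: sum_distrib_right)
    then have eq: "osc (\<lambda>z. w (fst z) * (?S (fst z) - ?S (fst z - pi)) * \<eta> (snd z - x0 \<bullet> dir (fst z)) * P (snd z) (fst z)) \<sigma> x
        = (\<Sum>j<m. osc (Aj j) \<sigma> x)" for \<sigma> x
      using osc_sum[of "{..<m}" Aj \<sigma> x] amp by simp
    show "\<exists>C. \<forall>\<sigma>. \<forall>x\<in>ball x0 d. \<bar>\<sigma>\<bar> ^ N * norm (osc (\<lambda>z. w (fst z) * (?S (fst z) - ?S (fst z - pi)) *
        \<eta> (snd z - x0 \<bullet> dir (fst z)) * P (snd z) (fst z)) \<sigma> x) \<le> C"
      unfolding eq
    proof (intro exI[of _ "\<Sum>j<m. C j"] allI ballI)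
      fix \<sigma> x assume x: "x \<in> ball x0 d"
      have "\<bar>\<sigma>\<bar> ^ N * norm (\<Sum>j<m. osc (Aj j) \<sigma> x) \<le> \<bar>\<sigma>\<bar> ^ N * (\<Sum>j<m. norm (osc (Aj j) \<sigma> x))"
        by (intro mult_left_mono norm_sum) auto
      also have "\<dots> \<le> (\<Sum>j<m. C j)"
        unfolding sum_distrib_left by (intro sum_mono C x) auto
      finally show "\<bar>\<sigma>\<bar> ^ N * norm (\<Sum>j<m. osc (Aj j) \<sigma> x) \<le> (\<Sum>j<m. C j)" .
    qed
  qed
qed

section \<open>Smoothness of parameter integrals\<close>

lemma cdiff_on_cong:
  assumes "open U" "\<And>x. x \<in> U \<Longrightarrow> f x = g x"
  shows "cdiff_on k U f \<longleftrightarrow> cdiff_on k U g"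
proof -
  have *: "cdiff_on k U g" if "cdiff_on k U f" "\<And>x. x \<in> U \<Longrightarrow> f x = g x" for f g :: "'a \<Rightarrow> 'b"
    using that
  proof (induction k arbitrary: f g)
    case 0
    then show ?case by (simp cong: continuous_on_cong)
  next
    case (Suc k)
    have d: "(g has_derivative frechet_derivative f (at x)) (at x)" if "x \<in> U" for x
      using Suc(2) that frechet_derivative_works[of f "at x"] Suc(3)
      by (auto intro: has_derivative_transform_within_open[OF _ assms(1)])
    have "cdiff_on k U (\<lambda>x. frechet_derivative g (at x) v)" for v
      by (rule Suc.IH[of "\<lambda>x. frechet_derivative f (at x) v"])
        (use Suc(2) frechet_derivative_at[OF d] in auto)
    then show ?case using d by (auto simp: differentiable_def)
  qed
  from *[of f g] *[of g f] assms(2) show ?thesis by auto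
qed

lemma cdiff_on_add:
  assumes "open U"
  shows "cdiff_on k U f \<Longrightarrow> cdiff_on k U g \<Longrightarrow> cdiff_on k U (\<lambda>x. f x + g x)"
proof (induction k arbitrary: f g)
  case 0
  then show ?case by (auto intro: continuous_intros)
next
  case (Suc k)
  have d: "((\<lambda>x. f x + g x) has_derivative (\<lambda>v. frechet_derivative f (at x) v + frechet_derivative g (at x) v)) (at x)"
    if "x \<in> U" for x
    using Suc(2,3) that frechet_derivative_works by (auto intro!: has_derivative_add)
  have "cdiff_on k U (\<lambda>x. frechet_derivative (\<lambda>x. f x + g x) (at x) v)" for v
  proof -
    have "cdiff_on k U (\<lambda>x. frechet_derivative f (at x) v + frechet_derivative g (at x) v)"
      using Suc by auto
    then show ?thesis
      by (subst cdiff_on_cong[OF assms]) (use frechet_derivative_at[OF d, symmetric] in auto)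
  qed
  then show ?case using d by (auto simp: differentiable_def)
qed

lemma smooth_on_add:
  "open U \<Longrightarrow> smooth_on U f \<Longrightarrow> smooth_on U g \<Longrightarrow> smooth_on U (\<lambda>x. f x + g x)"
  by (simp add: smooth_on_def cdiff_on_add)

text \<open>Only one majorant per direction v is assumed. Linearity in v bounds the derivative by
  norm v times the sum \<open>G\<close> over the basis directions. The mean value inequality then
  bounds the remainder quotient by 2 G, and dominated convergence along sequences gives the Frechet
  derivative.\<close>

lemma has_derivative_dominated_integral:
  fixes F :: "'a::euclidean_space \<Rightarrow> 'z \<Rightarrow> complex"
  assumes U: "open U" "x \<in> U"
    and F: "\<And>x. x \<in> U \<Longrightarrow> integrable M (F x)"
    and D: "\<And>x z. x \<in> U \<Longrightarrow> z \<in> space M \<Longrightarrow> ((\<lambda>x. F x z) has_derivative (\<lambda>v. F' v x z)) (at x)"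
    and meas: "\<And>v x. x \<in> U \<Longrightarrow> F' v x \<in> borel_measurable M"
    and m: "\<And>v. integrable M (m v)" "\<And>v x z. x \<in> U \<Longrightarrow> z \<in> space M \<Longrightarrow> norm (F' v x z) \<le> m v z"
  shows "((\<lambda>x. \<integral>z. F x z \<partial>M) has_derivative (\<lambda>v. \<integral>z. F' v x z \<partial>M)) (at x)"
proof -
  define G where "G z = (\<Sum>b\<in>Basis. m b z)" for z
  have intG: "integrable M G" unfolding G_def by (intro Bochner_Integration.integrable_sum m)
  have int': "integrable M (F' v x)" if "x \<in> U" for v x
    using m(2)[OF that] order_trans[OF norm_ge_zero m(2)[OF that]] meas[OF that]
    by (intro Bochner_Integration.integrable_bound[OF m(1)]) (auto intro!: AE_I2)
  have lin: "linear (\<lambda>v. F' v x z)" if "x \<in> U" "z \<in> space M" for x z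
    using has_derivative_linear[OF D[OF that]] .
  have F'G: "norm (F' v x z) \<le> norm v * G z" if "x \<in> U" "z \<in> space M" for v x z
  proof -
    interpret linear "\<lambda>v. F' v x z" by (rule lin[OF that])
    have "F' v x z = F' (\<Sum>b\<in>Basis. (v \<bullet> b) *\<^sub>R b) x z" by (simp add: euclidean_representation)
    also have "\<dots> = (\<Sum>b\<in>Basis. (v \<bullet> b) *\<^sub>R F' b x z)" by (simp add: sum scale)
    also have "norm \<dots> \<le> (\<Sum>b\<in>Basis. norm v * m b z)"
    proof (rule sum_norm_le)
      fix b :: 'a assume b: "b \<in> Basis"
      have "\<bar>v \<bullet> b\<bar> * norm (F' b x z) \<le> norm v * m b z"
        using Basis_le_norm[OF b, of v] m(2)[OF that, of b] by (intro mult_mono) auto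
      then show "norm ((v \<bullet> b) *\<^sub>R F' b x z) \<le> norm v * m b z" by simp
    qed
    finally show ?thesis by (simp add: G_def sum_distrib_left)
  qed
  obtain e where e: "e > 0" "ball x e \<subseteq> U" using U open_contains_ball by blast
  have FG: "norm (F y z - F x z) \<le> G z * norm (y - x)" if "y \<in> ball x e" "z \<in> space M" for y z
  proof (rule differentiable_bound[of "ball x e" "\<lambda>y. F y z" "\<lambda>y v. F' v y z"])
    show "((\<lambda>y. F y z) has_derivative (\<lambda>v. F' v y z)) (at y within ball x e)" if "y \<in> ball x e" for y
      by (rule has_derivative_at_withinI[OF D]) (use e \<open>z \<in> space M\<close> that in auto)
    show "onorm (\<lambda>v. F' v y z) \<le> G z" if "y \<in> ball x e" for y
    proof (rule onorm_le)
      show "norm (F' v y z) \<le> G z * norm v" for v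
        using F'G[of y z v] e that \<open>z \<in> space M\<close> by (auto simp: mult.commute)
    qed
  qed (use that e in auto)
  have linI: "linear (\<lambda>v. \<integral>z. F' v x z \<partial>M)"
  proof (rule linearI)
    show "(\<integral>z. F' (v + w) x z \<partial>M) = (\<integral>z. F' v x z \<partial>M) + (\<integral>z. F' w x z \<partial>M)" for v w
      by (subst Bochner_Integration.integral_add[symmetric])
        (auto intro!: int' U Bochner_Integration.integral_cong linear_add[OF lin])
    show "(\<integral>z. F' (r *\<^sub>R v) x z \<partial>M) = r *\<^sub>R (\<integral>z. F' v x z \<partial>M)" for r v
    proof -
      have "(\<integral>z. F' (r *\<^sub>R v) x z \<partial>M) = (\<integral>z. r *\<^sub>R F' v x z \<partial>M)"
        by (intro Bochner_Integration.integral_cong linear_scale[OF lin] U refl)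
      then show ?thesis by simp
    qed
  qed
  have "((\<lambda>y. norm ((\<integral>z. F y z \<partial>M) - (\<integral>z. F x z \<partial>M) - (\<integral>z. F' (y - x) x z \<partial>M)) / norm (y - x)) \<longlongrightarrow> 0) (at x within ball x e)"
    unfolding tendsto_at_iff_sequentially
  proof (intro allI impI)
    fix X assume X: "\<forall>i. X i \<in> ball x e - {x}" "X \<longlonglongrightarrow> x"
    define R where "R i z = (1 / norm (X i - x)) *\<^sub>R (F (X i) z - F x z - F' (X i - x) x z)" for i z
    have XU: "X i \<in> U" for i using X(1) e(2) by blast
    have Xi: "X i \<in> ball x e" "X i \<noteq> x" for i using X(1) by auto
    have intR: "integrable M (R i)" for i
      unfolding R_def
      by (intro integrable_scaleR_right Bochner_Integration.integrable_diff F int' U XU)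
    have eq: "norm ((\<integral>z. F (X i) z \<partial>M) - (\<integral>z. F x z \<partial>M) - (\<integral>z. F' (X i - x) x z \<partial>M)) / norm (X i - x)
        = norm (\<integral>z. R i z \<partial>M)" for i
    proof -
      have "(\<integral>z. R i z \<partial>M) = (1 / norm (X i - x)) *\<^sub>R ((\<integral>z. F (X i) z \<partial>M) - (\<integral>z. F x z \<partial>M) - (\<integral>z. F' (X i - x) x z \<partial>M))"
        unfolding R_def
        by (simp add: Bochner_Integration.integral_diff Bochner_Integration.integrable_diff F int' U XU)
      then show ?thesis by simp
    qed
    have "(\<lambda>i. \<integral>z. R i z \<partial>M) \<longlonglongrightarrow> (\<integral>z. 0 \<partial>M)"
    proof (rule integral_dominated_convergence[where w="\<lambda>z. 2 * G z"])
      show "integrable M (\<lambda>z. 2 * G z)" using intG by simp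
      show "AE z in M. (\<lambda>i. R i z) \<longlonglongrightarrow> 0"
      proof (rule AE_I2)
        fix z assume z: "z \<in> space M"
        have "((\<lambda>y. (1 / norm (y - x)) *\<^sub>R (F y z - F x z - F' (y - x) x z)) \<longlongrightarrow> 0) (at x within ball x e)"
        proof -
          have "((\<lambda>y. norm (F y z - F x z - F' (y - x) x z) / norm (y - x)) \<longlongrightarrow> 0) (at x within ball x e)"
            using has_derivative_at_withinI[OF D[OF U(2) z]] unfolding has_derivative_iff_norm by blast
          then show ?thesis by (subst tendsto_norm_zero_iff[symmetric]) simp
        qed
        then show "(\<lambda>i. R i z) \<longlonglongrightarrow> 0"
          using X unfolding tendsto_at_iff_sequentially R_def o_def by blast
      qed
      show "AE z in M. norm (R i z) \<le> 2 * G z" for i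
      proof (rule AE_I2)
        fix z assume z: "z \<in> space M"
        have p: "norm (X i - x) > 0" using Xi by simp
        have "norm (F (X i) z - F x z - F' (X i - x) x z) \<le> norm (F (X i) z - F x z) + norm (F' (X i - x) x z)"
          by (rule norm_triangle_ineq4)
        also have "\<dots> \<le> 2 * G z * norm (X i - x)"
          using FG[OF Xi(1)[of i] z] F'G[OF U(2) z, of "X i - x"] by (simp add: algebra_simps)
        finally show "norm (R i z) \<le> 2 * G z"
          using p by (simp add: R_def divide_le_eq)
      qed
    qed (use intR in auto)
    then show "((\<lambda>y. norm ((\<integral>z. F y z \<partial>M) - (\<integral>z. F x z \<partial>M) - (\<integral>z. F' (y - x) x z \<partial>M)) / norm (y - x)) \<circ> X) \<longlonglongrightarrow> 0"
      unfolding o_def eq by (simp add: tendsto_norm_zero)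
  qed
  then have "((\<lambda>y. norm ((\<integral>z. F y z \<partial>M) - (\<integral>z. F x z \<partial>M) - (\<integral>z. F' (y - x) x z \<partial>M)) / norm (y - x)) \<longlongrightarrow> 0) (at x)"
    using at_within_open[of x "ball x e"] e by simp
  then show ?thesis
    unfolding has_derivative_iff_norm using linI by (simp add: linear_conv_bounded_linear)
qed

text \<open>The counterpart of \<open>smooth1_coinduct\<close> for parameter integrals: a class of
  dominated integrands that contains the directional derivatives of its members can be
  differentiated under the integral indefinitely. The majorant may change from member to
  member.\<close>

lemma smooth_on_integral_class:
  fixes \<F> :: "('a::euclidean_space \<Rightarrow> 'z \<Rightarrow> complex) set"
  assumes U: "open U"
    and dom: "\<And>F. F \<in> \<F> \<Longrightarrow> \<exists>m. integrable M m \<and> (\<forall>x\<in>U. F x \<in> borel_measurable M \<and> (\<forall>z\<in>space M. norm (F x z) \<le> m z))"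
    and der: "\<And>F. F \<in> \<F> \<Longrightarrow> \<exists>F'. (\<forall>v. F' v \<in> \<F>) \<and> (\<forall>x\<in>U. \<forall>z\<in>space M. ((\<lambda>x. F x z) has_derivative (\<lambda>v. F' v x z)) (at x))"
    and "F \<in> \<F>"
  shows "smooth_on U (\<lambda>x. \<integral>z. F x z \<partial>M)"
proof -
  have int: "integrable M (F x)" if F: "F \<in> \<F>" and x: "x \<in> U" for F x
  proof -
    obtain m where m: "integrable M m" "\<And>z. z \<in> space M \<Longrightarrow> norm (F x z) \<le> m z" "F x \<in> borel_measurable M"
      using dom[OF F] x by blast
    have "norm (F x z) \<le> norm (m z)" if "z \<in> space M" for z using m(2)[OF that] by simp
    then show ?thesis using m by (intro Bochner_Integration.integrable_bound[OF m(1)]) (auto intro!: AE_I2)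
  qed
  have deriv: "\<exists>F'. (\<forall>v. F' v \<in> \<F>) \<and> (\<forall>x\<in>U. ((\<lambda>x. \<integral>z. F x z \<partial>M) has_derivative (\<lambda>v. \<integral>z. F' v x z \<partial>M)) (at x))"
    if F: "F \<in> \<F>" for F
  proof -
    obtain F' where F': "\<And>v. F' v \<in> \<F>" "\<And>x z. x \<in> U \<Longrightarrow> z \<in> space M \<Longrightarrow> ((\<lambda>x. F x z) has_derivative (\<lambda>v. F' v x z)) (at x)"
      using der[OF F] by blast
    have "\<forall>v. \<exists>m. integrable M m \<and> (\<forall>x\<in>U. F' v x \<in> borel_measurable M \<and> (\<forall>z\<in>space M. norm (F' v x z) \<le> m z))"
      using dom[OF F'(1)] by (intro allI)
    from choice[OF this] obtain m where m': "\<forall>v. integrable M (m v) \<and> (\<forall>x\<in>U. F' v x \<in> borel_measurable M \<and> (\<forall>z\<in>space M. norm (F' v x z) \<le> m v z))" ..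
    then have m: "\<And>v. integrable M (m v)" "\<And>v x. x \<in> U \<Longrightarrow> F' v x \<in> borel_measurable M"
      "\<And>v x z. x \<in> U \<Longrightarrow> z \<in> space M \<Longrightarrow> norm (F' v x z) \<le> m v z" by simp_all
    show ?thesis
    proof (rule exI[of _ F'], intro conjI allI ballI)
      show "((\<lambda>x. \<integral>z. F x z \<partial>M) has_derivative (\<lambda>v. \<integral>z. F' v x z \<partial>M)) (at x)" if "x \<in> U" for x
        by (rule has_derivative_dominated_integral[OF U that int[OF F] F'(2) m(2,1,3)])
    qed (rule F'(1))
  qed
  have "cdiff_on k U (\<lambda>x. \<integral>z. F x z \<partial>M)" if "F \<in> \<F>" for k F
    using that
  proof (induction k arbitrary: F)
    case 0
    from deriv[OF 0] obtain F' where
      "\<forall>x\<in>U. ((\<lambda>x. \<integral>z. F x z \<partial>M) has_derivative (\<lambda>v. \<integral>z. F' v x z \<partial>M)) (at x)" by (elim exE conjE)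
    then have "\<forall>x\<in>U. isCont (\<lambda>x. \<integral>z. F x z \<partial>M) x"
      using has_derivative_continuous by blast
    then show ?case by (simp add: continuous_at_imp_continuous_on)
  next
    case (Suc k)
    from deriv[OF Suc(2)] obtain F' where F': "\<forall>v. F' v \<in> \<F>" and
      D': "\<forall>x\<in>U. ((\<lambda>x. \<integral>z. F x z \<partial>M) has_derivative (\<lambda>v. \<integral>z. F' v x z \<partial>M)) (at x)"
      by (elim exE conjE)
    note D = bspec[OF D']
    have "cdiff_on k U (\<lambda>x. frechet_derivative (\<lambda>x. \<integral>z. F x z \<partial>M) (at x) v)" for v
      using Suc.IH[OF spec[OF F', of v]]
      by (subst cdiff_on_cong[OF U]) (use frechet_derivative_at[OF D, symmetric] in auto)
    then show ?case using D by (auto simp: differentiable_def)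
  qed
  then show ?thesis using assms(4) by (simp add: smooth_on_def)
qed

section \<open>The Fourier transform of test functions\<close>

lemma integrable_lborel_prod_dominated:
  fixes f :: "'a::euclidean_space \<Rightarrow> 'b::euclidean_space \<Rightarrow> complex" and g :: "'a \<Rightarrow> real" and h :: "'b \<Rightarrow> real"
  assumes f: "(\<lambda>p. f (fst p) (snd p)) \<in> borel_measurable borel"
    and gh: "integrable lborel g" "integrable lborel h" "\<And>x y. norm (f x y) \<le> g x * h y"
  shows "integrable lborel (\<lambda>p. f (fst p) (snd p))"
proof -
  have [measurable]: "g \<in> borel_measurable borel" "h \<in> borel_measurable borel"
    using gh(1,2) by (auto dest: borel_measurable_integrable)
  have "integrable (lborel \<Otimes>\<^sub>M lborel) (\<lambda>p. g (fst p) * h (snd p))"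
  proof (rule lborel_pair.Fubini_integrable)
    have "(\<lambda>x. \<integral>y. norm (g (fst (x, y)) * h (snd (x, y))) \<partial>lborel) = (\<lambda>x. norm (g x) * (\<integral>y. norm (h y) \<partial>lborel))"
      by (simp add: abs_mult)
    then show "integrable lborel (\<lambda>x. \<integral>y. norm (g (fst (x, y)) * h (snd (x, y))) \<partial>lborel)"
      using gh(1) by simp
    show "AE x in lborel. integrable lborel (\<lambda>y. g (fst (x, y)) * h (snd (x, y)))"
      using gh(2) by simp
  qed measurable
  then have "integrable lborel (\<lambda>p. g (fst p) * h (snd p))" by (simp add: lborel_prod)
  then show ?thesis
    by (rule Bochner_Integration.integrable_bound) (use f gh(3) in \<open>auto intro!: AE_I2 order_trans[OF gh(3)]\<close>)
qed

lemma lborel_Fubini: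
  fixes f :: "'a::euclidean_space \<Rightarrow> 'b::euclidean_space \<Rightarrow> complex"
  assumes "integrable lborel (\<lambda>p. f (fst p) (snd p))"
  shows "(LINT p|lborel. f (fst p) (snd p)) = (LINT x|lborel. LINT y|lborel. f x y)"
    and "(LINT x|lborel. LINT y|lborel. f x y) = (LINT y|lborel. LINT x|lborel. f x y)"
proof -
  show "(LINT p|lborel. f (fst p) (snd p)) = (LINT x|lborel. LINT y|lborel. f x y)"
    using lborel_pair.integral_fst'[of "\<lambda>p. f (fst p) (snd p)"] assms by (simp add: lborel_prod)
  show "(LINT x|lborel. LINT y|lborel. f x y) = (LINT y|lborel. LINT x|lborel. f x y)"
    using assms by (intro lborel_pair.Fubini_integral[symmetric]) (simp add: lborel_prod case_prod_unfold)
qed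

lemma borel_measurable_inner_param:
  fixes f :: "'b::euclidean_space \<Rightarrow> 'a::euclidean_space \<Rightarrow> 'c::{banach, second_countable_topology}"
  assumes "(\<lambda>p. f (fst p) (snd p)) \<in> borel_measurable borel"
  shows "(\<lambda>x. LINT y|lborel. f x y) \<in> borel_measurable borel"
proof (rule lborel.borel_measurable_lebesgue_integral)
  show "(\<lambda>(x, y). f x y) \<in> borel_measurable (borel \<Otimes>\<^sub>M lborel)"
  proof -
    have "sets ((borel :: 'b measure) \<Otimes>\<^sub>M (lborel :: 'a measure)) = sets (borel :: ('b \<times> 'a) measure)"
      by (metis borel_prod sets_lborel sets_pair_measure_cong)
    then show ?thesis using assms by (simp add: case_prod_unfold cong: measurable_cong_sets)
  qed
qed

text \<open>The two-dimensional Fourier transform at the frequency \<sigma> dir \<phi>.\<close>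

definition plane_fourier :: "(real^2 \<Rightarrow> complex) \<Rightarrow> real \<Rightarrow> real \<Rightarrow> complex" where
  "plane_fourier \<psi> \<sigma> \<phi> = (LINT x|lborel. \<psi> x * cis (- (\<sigma> * (x \<bullet> dir \<phi>))))"

lemma test_function_has_derivative:
  assumes "test_function_on UNIV \<psi>"
  shows "(\<psi> has_derivative frechet_derivative \<psi> (at x)) (at x)"
proof -
  have "cdiff_on (Suc 0) UNIV \<psi>" using assms unfolding test_function_on_def smooth_on_def by blast
  then show ?thesis using frechet_derivative_works by auto
qed

lemma test_function_continuous: "test_function_on UNIV \<psi> \<Longrightarrow> continuous_on A \<psi>"
  by (meson continuous_at_imp_continuous_on has_derivative_continuous test_function_has_derivative)

lemma test_function_deriv:
  assumes "test_function_on UNIV \<psi>"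
  shows "test_function_on UNIV (\<lambda>x. frechet_derivative \<psi> (at x) v)"
proof -
  let ?K = "closure {x. \<psi> x \<noteq> 0}" and ?f = "\<lambda>x. frechet_derivative \<psi> (at x) v"
  have "cdiff_on (Suc k) UNIV \<psi>" for k using assms unfolding test_function_on_def smooth_on_def by blast
  then have s: "smooth_on UNIV ?f" by (auto simp: smooth_on_def)
  have z: "?f x = 0" if "x \<notin> ?K" for x
  proof -
    have o: "open (- ?K)" using closed_closure open_Compl by blast
    have "(\<psi> has_derivative (\<lambda>_. 0)) (at x)"
      by (rule has_derivative_transform_within_open[OF has_derivative_const o, of x 0])
        (use that closure_subset[of "{x. \<psi> x \<noteq> 0}"] in auto)
    from frechet_derivative_at[OF this] show ?thesis by (metis (full_types))
  qed
  then have "closure {x. ?f x \<noteq> 0} \<subseteq> ?K" by (intro closure_minimal) auto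
  moreover have "compact ?K" using assms by (simp add: test_function_on_def)
  ultimately have "compact (closure {x. ?f x \<noteq> 0})" 
    using compact_Int_closed[OF _ closed_closure] by (metis inf.absorb2)
  then show ?thesis using s by (simp add: test_function_on_def)
qed

lemma test_function_bounds:
  assumes "test_function_on UNIV \<psi>"
  obtains R B where "\<And>x. R < norm x \<Longrightarrow> \<psi> x = 0" "\<And>x. norm (\<psi> x) \<le> B" "R > 0"
proof -
  let ?K = "closure {x. \<psi> x \<noteq> 0}"
  have K: "compact ?K" using assms by (simp add: test_function_on_def)
  then obtain R where R: "\<And>x. x \<in> ?K \<Longrightarrow> norm x \<le> R" using compact_imp_bounded bounded_iff by metis
  have "bounded (\<psi> ` ?K)"
    by (intro compact_imp_bounded compact_continuous_image test_function_continuous assms K)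
  then obtain B where B: "\<And>x. x \<in> ?K \<Longrightarrow> norm (\<psi> x) \<le> B" unfolding bounded_iff by auto
  have z: "x \<notin> ?K \<Longrightarrow> \<psi> x = 0" for x using closure_subset[of "{x. \<psi> x \<noteq> 0}"] by auto
  show ?thesis
  proof (rule that[of "max R 1" "max B 0"])
    show "\<psi> x = 0" if "max R 1 < norm x" for x using R[of x] that by (intro z) auto
    show "norm (\<psi> x) \<le> max B 0" for x using B[of x] z[of x] by (cases "x \<in> ?K") auto
  qed auto
qed

lemma test_function_measurable: "test_function_on UNIV \<psi> \<Longrightarrow> \<psi> \<in> borel_measurable borel"
  by (intro borel_measurable_continuous_onI test_function_continuous)

lemma test_function_integrable:
  assumes "test_function_on UNIV \<psi>" shows "integrable lborel \<psi>"
proof -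
  obtain R B where RB: "\<And>x. R < norm x \<Longrightarrow> \<psi> x = 0" "\<And>x. norm (\<psi> x) \<le> B"
    using test_function_bounds[OF assms] by metis
  show ?thesis
    by (rule integrable_bounded_support[OF test_function_measurable[OF assms] bounded_cball[of 0 R]])
      (use RB in auto)
qed

lemma integrable_times_cis:
  assumes "integrable M f" "g \<in> borel_measurable M"
  shows "integrable M (\<lambda>x. f x * cis (g x))"
proof -
  have "cis \<in> borel_measurable borel" by (intro borel_measurable_continuous_onI continuous_intros)
  then have "(\<lambda>x. cis (g x)) \<in> borel_measurable M" using assms(2) by measurable
  then show ?thesis using assms by (intro Bochner_Integration.integrable_bound[OF assms(1)]) (auto simp: norm_mult)
qed

lemma plane_fourier_integrable:
  "test_function_on UNIV \<psi> \<Longrightarrow> integrable lborel (\<lambda>x. \<psi> x * cis (- (\<sigma> * (x \<bullet> dir \<phi>))))"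
  by (intro integrable_times_cis test_function_integrable) measurable

lemma plane_fourier_bound:
  assumes "test_function_on UNIV \<psi>"
  shows "norm (plane_fourier \<psi> \<sigma> \<phi>) \<le> (LINT x|lborel. norm (\<psi> x))"
  unfolding plane_fourier_def using integral_norm_bound[of lborel "\<lambda>x. \<psi> x * cis (- (\<sigma> * (x \<bullet> dir \<phi>)))"]
  by (simp add: norm_mult)

text \<open>The transform of a translate is the original transform times a phase. Differentiating
  this identity at translation 0, once under the integral and once in the phase, replaces
  integration by parts in the plane.\<close>

lemma plane_fourier_deriv:
  assumes \<psi>: "test_function_on UNIV \<psi>"
  shows "plane_fourier (\<lambda>x. frechet_derivative \<psi> (at x) v) \<sigma> \<phi> = \<i> * of_real (\<sigma> * (v \<bullet> dir \<phi>)) * plane_fourier \<psi> \<sigma> \<phi>"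
proof -
  let ?d = "\<lambda>x. frechet_derivative \<psi> (at x) v"
  let ?E = "\<lambda>x. cis (- (\<sigma> * (x \<bullet> dir \<phi>)))"
  have \<psi>d: "test_function_on UNIV ?d" by (rule test_function_deriv[OF \<psi>])
  obtain R B where R: "\<And>x. R < norm x \<Longrightarrow> ?d x = 0" "\<And>x. norm (?d x) \<le> B"
    using test_function_bounds[OF \<psi>d] by metis
  have B: "0 \<le> B" using order_trans[OF norm_ge_zero R(2)] .
  have [measurable]: "?E \<in> borel_measurable borel" by (intro borel_measurable_continuous_onI continuous_intros)
  have [measurable]: "\<psi> \<in> borel_measurable borel" "?d \<in> borel_measurable borel"
    using test_function_measurable[OF \<psi>] test_function_measurable[OF \<psi>d] .
  have shift: "(LINT x|lborel. f (x + c)) = (LINT x|lborel. f x)" if [measurable]: "f \<in> borel_measurable borel" for f :: "real^2 \<Rightarrow> complex" and c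
  proof -
    have "(LINT x|lborel. f x) = (LINT x|distr lborel borel ((+) c). f x)" by (simp add: lborel_distr_plus)
    also have "\<dots> = (LINT x|lborel. f (c + x))" by (rule integral_distr) measurable
    finally show ?thesis by (simp add: add.commute)
  qed
  have shift_int: "integrable lborel (\<lambda>x. f (x + c))" if f: "integrable lborel f" for f :: "real^2 \<Rightarrow> complex" and c
  proof -
    have [measurable]: "f \<in> borel_measurable borel" using f by auto
    have "integrable (distr lborel borel ((+) c)) f" using f by (simp add: lborel_distr_plus)
    then have "integrable lborel (\<lambda>x. f (c + x))" by (subst (asm) integrable_distr_eq) auto
    then show ?thesis by (simp add: add.commute)
  qed
  have "((\<lambda>\<tau>. LINT x|lborel. \<psi> (x + \<tau> *\<^sub>R v) * ?E x) has_derivative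
      (\<lambda>h. LINT x|lborel. h *\<^sub>R (?d (x + 0 *\<^sub>R v) * ?E x))) (at (0::real))"
  \<comment> \<open>For shifts |\<tau>| < 1 the translated derivatives are all supported in one
    ball, of radius |R| + norm v.\<close>
  proof (rule has_derivative_dominated_integral[where U="ball 0 1" and m="\<lambda>h x. \<bar>h\<bar> * (B * indicat_real (cball 0 (\<bar>R\<bar> + norm v)) x)"])
    show "integrable lborel (\<lambda>x. \<psi> (x + \<tau> *\<^sub>R v) * ?E x)" for \<tau>
      by (intro integrable_times_cis shift_int test_function_integrable \<psi>) measurable
    show "((\<lambda>\<tau>. \<psi> (x + \<tau> *\<^sub>R v) * ?E x) has_derivative (\<lambda>h. h *\<^sub>R (?d (x + \<tau> *\<^sub>R v) * ?E x))) (at \<tau>)" for \<tau> x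
    proof -
      have 1: "((\<lambda>\<tau>. x + \<tau> *\<^sub>R v) has_derivative (\<lambda>h. h *\<^sub>R v)) (at \<tau>)" by (auto intro!: derivative_eq_intros)
      have "((\<lambda>\<tau>. \<psi> (x + \<tau> *\<^sub>R v)) has_derivative (\<lambda>h. frechet_derivative \<psi> (at (x + \<tau> *\<^sub>R v)) (h *\<^sub>R v))) (at \<tau>)"
        by (rule has_derivative_compose[OF 1 test_function_has_derivative[OF \<psi>]])
      moreover have "frechet_derivative \<psi> (at y) (h *\<^sub>R v) = h *\<^sub>R ?d y" for y h
        using linear_scale[OF has_derivative_linear[OF test_function_has_derivative[OF \<psi>]]] .
      ultimately have "((\<lambda>\<tau>. \<psi> (x + \<tau> *\<^sub>R v)) has_derivative (\<lambda>h. h *\<^sub>R ?d (x + \<tau> *\<^sub>R v))) (at \<tau>)" by simp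
      from has_derivative_mult_left[OF this, of "?E x"] show ?thesis by simp
    qed
    show "norm (h *\<^sub>R (?d (x + \<tau> *\<^sub>R v) * ?E x)) \<le> \<bar>h\<bar> * (B * indicat_real (cball 0 (\<bar>R\<bar> + norm v)) x)"
      if "\<tau> \<in> ball 0 1" for h \<tau> x
    proof (cases "norm x \<le> \<bar>R\<bar> + norm v")
      case True
      then show ?thesis using R(2) by (simp add: norm_mult mult_left_mono)
    next
      case False
      have "norm (\<tau> *\<^sub>R v) \<le> norm v" using that by (simp add: mult_left_le_one_le)
      moreover have "norm x \<le> norm (x + \<tau> *\<^sub>R v) + norm (\<tau> *\<^sub>R v)" by (metis add_diff_cancel norm_triangle_ineq4)
      ultimately have "R < norm (x + \<tau> *\<^sub>R v)" using False by linarith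
      then show ?thesis using R(1) B by simp
    qed
    show "integrable lborel (\<lambda>x. \<bar>h\<bar> * (B * indicat_real (cball 0 (\<bar>R\<bar> + norm v)) x))" for h
      by (intro integrable_mult_right integrable_real_indicator emeasure_lborel_cball_finite) auto
  qed (auto intro!: borel_measurable_scaleR borel_measurable_times)
  moreover have "(\<lambda>h. LINT x|lborel. h *\<^sub>R (?d (x + 0 *\<^sub>R v) * ?E x)) = (\<lambda>h. h *\<^sub>R plane_fourier ?d \<sigma> \<phi>)"
    by (simp add: plane_fourier_def)
  ultimately have 1: "((\<lambda>\<tau>. LINT x|lborel. \<psi> (x + \<tau> *\<^sub>R v) * ?E x) has_vector_derivative plane_fourier ?d \<sigma> \<phi>) (at 0)"
    by (simp add: has_vector_derivative_def)
  have eq: "(LINT x|lborel. \<psi> (x + \<tau> *\<^sub>R v) * ?E x) = cis (\<sigma> * \<tau> * (v \<bullet> dir \<phi>)) * plane_fourier \<psi> \<sigma> \<phi>" for \<tau>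
  proof -
    have "(LINT x|lborel. \<psi> (x + \<tau> *\<^sub>R v) * ?E x) = (LINT x|lborel. \<psi> (x + \<tau> *\<^sub>R v) * ?E ((x + \<tau> *\<^sub>R v) - \<tau> *\<^sub>R v))"
      by simp
    also have "\<dots> = (LINT x|lborel. \<psi> x * ?E (x - \<tau> *\<^sub>R v))"
      by (rule shift) measurable
    also have "\<dots> = (LINT x|lborel. cis (\<sigma> * \<tau> * (v \<bullet> dir \<phi>)) * (\<psi> x * ?E x))"
      by (intro Bochner_Integration.integral_cong) (auto simp: inner_diff_left cis_mult algebra_simps)
    finally show ?thesis by (simp add: plane_fourier_def)
  qed
  have "((\<lambda>\<tau>. cis (\<sigma> * \<tau> * (v \<bullet> dir \<phi>)) * plane_fourier \<psi> \<sigma> \<phi>) has_vector_derivative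
      (\<i> * of_real (\<sigma> * (v \<bullet> dir \<phi>))) * plane_fourier \<psi> \<sigma> \<phi>) (at 0)"
  proof -
    have "((\<lambda>\<tau>::real. \<i> * complex_of_real (\<sigma> * (v \<bullet> dir \<phi>) * \<tau>)) has_vector_derivative \<i> * of_real (\<sigma> * (v \<bullet> dir \<phi>))) (at 0)"
      by (intro has_vector_derivative_mult_right has_vector_derivative_of_real) (auto intro!: derivative_eq_intros)
    from field_vector_diff_chain_at[OF this DERIV_exp]
    have "((\<lambda>\<tau>::real. cis (\<sigma> * \<tau> * (v \<bullet> dir \<phi>))) has_vector_derivative \<i> * of_real (\<sigma> * (v \<bullet> dir \<phi>))) (at 0)"
      by (simp add: o_def cis_conv_exp mult_ac)
    from has_vector_derivative_mult_left[OF this] show ?thesis .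
  qed
  from vector_derivative_unique_at[OF 1[unfolded eq] this] show ?thesis .
qed

text \<open>Applying the Laplacian twice multiplies the transform by \<sigma>^4, whatever the angle,
  because cos^2 + sin^2 = 1. Order four is enough for |\<sigma>| times the transform to be
  integrable.\<close>

lemma plane_fourier_decay:
  assumes \<psi>: "test_function_on UNIV \<psi>"
  obtains C where "C > 0" "\<And>\<sigma> \<phi>. (1 + \<sigma> ^ 4) * norm (plane_fourier \<psi> \<sigma> \<phi>) \<le> C"
proof -
  \<comment> \<open>\<open>lap f v\<close> is a single second directional derivative; the Laplacian
    is its sum over e1 and e2.\<close>
  define lap where "lap f = (\<lambda>v x. frechet_derivative (\<lambda>x. frechet_derivative f (at x) v) (at x) v)" for f :: "real^2 \<Rightarrow> complex"
  define e1 e2 :: "real^2" where "e1 = axis 1 1" and "e2 = axis 2 1"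
  have e: "e1 \<bullet> dir \<phi> = cos \<phi>" "e2 \<bullet> dir \<phi> = sin \<phi>" for \<phi> by (simp_all add: e1_def e2_def inner_axis')
  have tl: "test_function_on UNIV (lap f v)" if "test_function_on UNIV f" for f v
    unfolding lap_def by (intro test_function_deriv that)
  have lap: "plane_fourier (lap f e1) \<sigma> \<phi> + plane_fourier (lap f e2) \<sigma> \<phi> = - of_real (\<sigma>\<^sup>2) * plane_fourier f \<sigma> \<phi>"
    if f: "test_function_on UNIV f" for f \<sigma> \<phi>
  proof -
    have "plane_fourier (lap f v) \<sigma> \<phi> = (\<i> * of_real (\<sigma> * (v \<bullet> dir \<phi>)))\<^sup>2 * plane_fourier f \<sigma> \<phi>" for v
      unfolding lap_def by (simp add: plane_fourier_deriv test_function_deriv f power2_eq_square)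
    from this[of e1] this[of e2]
    have "plane_fourier (lap f e1) \<sigma> \<phi> = - (of_real (cos \<phi>))\<^sup>2 * of_real (\<sigma>\<^sup>2) * plane_fourier f \<sigma> \<phi>"
      "plane_fourier (lap f e2) \<sigma> \<phi> = - (of_real (sin \<phi>))\<^sup>2 * of_real (\<sigma>\<^sup>2) * plane_fourier f \<sigma> \<phi>"
      by (simp_all add: e power_mult_distrib)
    moreover have "(complex_of_real (cos \<phi>))\<^sup>2 + (complex_of_real (sin \<phi>))\<^sup>2 = 1"
      by (simp flip: of_real_power of_real_add)
    ultimately show ?thesis by algebra
  qed
  define N where "N f = (LINT x|lborel. norm (f x))" for f :: "real^2 \<Rightarrow> complex"
  have N: "norm (plane_fourier f \<sigma> \<phi>) \<le> N f" if "test_function_on UNIV f" for f \<sigma> \<phi>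
    using plane_fourier_bound[OF that] by (simp add: N_def)
  have N0: "N f \<ge> 0" for f by (simp add: N_def)
  have 2: "\<sigma>\<^sup>2 * norm (plane_fourier f \<sigma> \<phi>) \<le> N (lap f e1) + N (lap f e2)" if f: "test_function_on UNIV f" for f \<sigma> \<phi>
  proof -
    have "\<sigma>\<^sup>2 * norm (plane_fourier f \<sigma> \<phi>) = norm (- of_real (\<sigma>\<^sup>2) * plane_fourier f \<sigma> \<phi>)" by (simp add: norm_mult norm_power)
    also have "\<dots> \<le> norm (plane_fourier (lap f e1) \<sigma> \<phi>) + norm (plane_fourier (lap f e2) \<sigma> \<phi>)"
      unfolding lap[OF f, symmetric] by (rule norm_triangle_ineq)
    also have "\<dots> \<le> N (lap f e1) + N (lap f e2)" by (intro add_mono N tl f)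
    finally show ?thesis .
  qed
  define C where "C = 1 + N \<psi> + (N (lap (lap \<psi> e1) e1) + N (lap (lap \<psi> e1) e2)) + (N (lap (lap \<psi> e2) e1) + N (lap (lap \<psi> e2) e2))"
  show ?thesis
  proof (rule that[of C])
    show "C > 0" unfolding C_def using N0 by (smt (verit))
    fix \<sigma> \<phi>
    have "\<sigma> ^ 4 * norm (plane_fourier \<psi> \<sigma> \<phi>) = \<sigma>\<^sup>2 * norm (- of_real (\<sigma>\<^sup>2) * plane_fourier \<psi> \<sigma> \<phi>)"
      by (simp add: norm_mult norm_power flip: power_add mult.assoc)
    also have "\<dots> \<le> \<sigma>\<^sup>2 * (norm (plane_fourier (lap \<psi> e1) \<sigma> \<phi>) + norm (plane_fourier (lap \<psi> e2) \<sigma> \<phi>))"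
      unfolding lap[OF \<psi>, symmetric] by (intro mult_left_mono norm_triangle_ineq) auto
    also have "\<dots> \<le> (N (lap (lap \<psi> e1) e1) + N (lap (lap \<psi> e1) e2)) + (N (lap (lap \<psi> e2) e1) + N (lap (lap \<psi> e2) e2))"
      unfolding distrib_left by (intro add_mono[OF 2 2] tl \<psi>)
    finally show "(1 + \<sigma> ^ 4) * norm (plane_fourier \<psi> \<sigma> \<phi>) \<le> C"
      using N[OF \<psi>, of \<sigma> \<phi>] by (simp add: C_def algebra_simps)
  qed
qed

lemma integral_line_coordinates:
  fixes f :: "real^2 \<Rightarrow> complex"
  assumes f: "integrable lborel f"
  shows "(LINT x|lborel. f x) = (LINT s|lborel. LINT u|lborel. f (line_point \<phi> s u))"
proof -
  let ?T = "\<lambda>p. line_point \<phi> (fst p) (snd p)"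
  have T: "distr lborel borel ?T = lborel"
    using line_coordinates_measure[OF norm_dir[of \<phi>]] by (simp add: case_prod_unfold line_point_def)
  have [measurable]: "?T \<in> borel_measurable borel"
    by (intro borel_measurable_continuous_onI continuous_intros)
  have [measurable]: "f \<in> borel_measurable borel" using f by auto
  have "integrable (distr lborel borel ?T) f" using f T by simp
  then have int: "integrable lborel (\<lambda>p. f (?T p))" by (subst (asm) integrable_distr_eq) auto
  have "(LINT x|lborel. f x) = (LINT x|distr lborel borel ?T. f x)" by (simp add: T)
  also have "\<dots> = (LINT p|lborel. f (?T p))" by (rule integral_distr) auto
  also have "\<dots> = (LINT s|lborel. LINT u|lborel. f (line_point \<phi> s u))"
    by (rule lborel_Fubini(1)[OF int])
  finally show ?thesis .
qed

text \<open>The Fourier slice theorem: in rotated coordinates the oscillating factor depends on s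
  alone.\<close>

lemma fourier_radon:
  assumes \<psi>: "test_function_on UNIV \<psi>"
  shows "fourier (\<lambda>r. radon \<psi> r (dir \<phi>)) \<sigma> = plane_fourier \<psi> \<sigma> \<phi>"
proof -
  have "plane_fourier \<psi> \<sigma> \<phi> = (LINT s|lborel. LINT u|lborel. \<psi> (line_point \<phi> s u) * cis (- (\<sigma> * s)))"
    unfolding plane_fourier_def by (subst integral_line_coordinates[OF plane_fourier_integrable[OF \<psi>], of _ _ \<phi>]) simp
  also have "\<dots> = (LINT s|lborel. cis (- (\<sigma> * s)) * radon \<psi> s (dir \<phi>))"
    by (simp add: radon_line_point[OF test_function_measurable[OF \<psi>]] mult.commute)
  finally show ?thesis by (simp add: fourier_def)
qed

section \<open>The Riesz operator on Radon transforms of test functions\<close>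

definition riesz_radon :: "(real^2 \<Rightarrow> complex) \<Rightarrow> real \<Rightarrow> real \<Rightarrow> complex" where
  "riesz_radon \<psi> s \<phi> = (LINT \<sigma>|lborel. of_real \<bar>\<sigma>\<bar> * plane_fourier \<psi> \<sigma> \<phi> * cis (\<sigma> * s))"

text \<open>One factor 1 / (2 pi) comes from the inverse Fourier transform, the other from the
  normalisation of \<open>riesz\<close>.\<close>

lemma riesz_radon_eq:
  "test_function_on UNIV \<psi> \<Longrightarrow> riesz (radon \<psi>) s (dir \<phi>) = of_real (1 / (4 * pi\<^sup>2)) * riesz_radon \<psi> s \<phi>"
  by (simp add: riesz_def fourier_multiplier_def riesz_radon_def fourier_radon power2_eq_square)

lemma integrable_inverse_1_plus_square: "integrable lborel (\<lambda>x::real. 1 / (1 + x\<^sup>2))"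
proof -
  have nz: "1 + x\<^sup>2 \<noteq> (0::real)" for x by (metis add_nonneg_eq_0_iff zero_le_one zero_le_power2 zero_neq_one)
  have "set_integrable lborel (einterval (-\<infinity>) \<infinity>) (\<lambda>x::real. 1 / (1 + x\<^sup>2))"
  proof (rule interval_integral_FTC_nonneg(1)[where F=arctan])
    show "DERIV arctan x :> 1 / (1 + x\<^sup>2)" for x by (auto intro!: derivative_eq_intros simp: divide_inverse)
    show "isCont (\<lambda>x. 1 / (1 + x\<^sup>2)) x" for x :: real by (intro continuous_intros) (rule nz)
    show "((arctan \<circ> real_of_ereal) \<longlongrightarrow> - (pi / 2)) (at_right (-\<infinity>))"
      unfolding ereal_tendsto_simps by (rule tendsto_arctan_at_bot)
    show "((arctan \<circ> real_of_ereal) \<longlongrightarrow> pi / 2) (at_left \<infinity>)"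
      unfolding ereal_tendsto_simps by (rule tendsto_arctan_at_top)
  qed auto
  then show ?thesis by (simp add: set_integrable_def)
qed

text \<open>Two spare powers of decay buy the integrable majorant 1 / (1 + t^2). In the applications
  n counts the powers produced by derivatives, and the extra one is the |\<sigma>| of the
  filter.\<close>

lemma power_ratio_le:
  fixes t :: real assumes "t \<ge> 0"
  shows "t ^ (n + 1) / (1 + t ^ (n + 3)) \<le> 2 / (1 + t\<^sup>2)"
proof -
  have "t ^ (n + 1) \<le> 1 + t ^ (n + 3)"
  proof (cases "t \<le> 1")
    case True
    then have "t ^ (n + 1) \<le> 1" using assms by (intro power_le_one) auto
    then show ?thesis using assms by (simp add: add_increasing2)
  next
    case False
    then have "t ^ (n + 1) \<le> t ^ (n + 3)" by (intro power_increasing) auto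
    then show ?thesis by simp
  qed
  moreover have "t ^ (n + 1) * t\<^sup>2 = t ^ (n + 3)" by (simp add: power_add power2_eq_square power3_eq_cube)
  ultimately have "t ^ (n + 1) * (1 + t\<^sup>2) \<le> 2 * (1 + t ^ (n + 3))" by (simp add: algebra_simps)
  moreover have "1 + t ^ (n + 3) > 0" "1 + t\<^sup>2 > 0" using assms by (simp_all add: add_pos_nonneg)
  ultimately show ?thesis by (simp add: divide_le_eq pos_le_divide_eq)
qed

lemma plane_fourier_measurable:
  assumes "test_function_on UNIV \<psi>"
  shows "(\<lambda>p. plane_fourier \<psi> (fst p) (snd p)) \<in> borel_measurable borel"
  unfolding plane_fourier_def
proof (rule borel_measurable_inner_param[where f="\<lambda>p x. \<psi> x * cis (- (fst p * (x \<bullet> dir (snd p))))"])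
  show "(\<lambda>q. \<psi> (snd q) * cis (- (fst (fst q) * (snd q \<bullet> dir (snd (fst q)))))) \<in> borel_measurable borel"
    by (intro borel_measurable_continuous_onI continuous_intros
        continuous_on_compose2[OF test_function_continuous[OF assms, of UNIV]]) auto
qed

lemma riesz_radon_dominated:
  assumes "test_function_on UNIV \<psi>"
  obtains C where "C > 0" "\<And>\<sigma> \<phi>. \<bar>\<sigma>\<bar> * norm (plane_fourier \<psi> \<sigma> \<phi>) \<le> C * (1 / (1 + \<sigma>\<^sup>2))"
proof -
  obtain C where C: "C > 0" "\<And>\<sigma> \<phi>. (1 + \<sigma> ^ 4) * norm (plane_fourier \<psi> \<sigma> \<phi>) \<le> C"
    using plane_fourier_decay[OF assms] by metis
  show ?thesis
  proof (rule that[of "2 * (2 * C)"])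
    fix \<sigma> \<phi> :: real
    have "0 \<le> \<sigma> ^ 4" by (rule zero_le_even_power) simp
    then have p: "1 + \<sigma> ^ 4 > 0" by linarith
    have "norm (plane_fourier \<psi> \<sigma> \<phi>) \<le> C / (1 + \<sigma> ^ 4)"
      using C(2)[of \<sigma> \<phi>] p by (simp add: pos_le_divide_eq mult.commute)
    \<comment> \<open>Fourth order decay is weakened to third order, the exponent of
      \<open>power_ratio_le\<close> at n = 0.\<close>
    also have "\<dots> \<le> 2 * C / (1 + \<bar>\<sigma>\<bar> ^ 3)"
    proof -
      have "\<bar>\<sigma>\<bar> ^ 3 \<le> 1 + \<sigma> ^ 4"
      proof (cases "\<bar>\<sigma>\<bar> \<le> 1")
        case True
        then have "\<bar>\<sigma>\<bar> ^ 3 \<le> 1" by (intro power_le_one) auto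
        then show ?thesis by (simp add: add_increasing2)
      next
        case False
        then have "\<bar>\<sigma>\<bar> ^ 3 \<le> \<bar>\<sigma>\<bar> ^ 4" by (intro power_increasing) auto
        then show ?thesis by simp
      qed
      moreover have "1 + a \<le> 2 * (1 + b)" if "a \<le> 1 + b" "0 \<le> b" for a b :: real using that by simp
      ultimately have "1 + \<bar>\<sigma>\<bar> ^ 3 \<le> 2 * (1 + \<sigma> ^ 4)" using \<open>0 \<le> \<sigma> ^ 4\<close> by blast
      then have "C * (1 + \<bar>\<sigma>\<bar> ^ 3) \<le> C * (2 * (1 + \<sigma> ^ 4))" using C(1) by (intro mult_left_mono) auto
      moreover have "1 + \<bar>\<sigma>\<bar> ^ 3 > 0" by (simp add: add_pos_nonneg)
      ultimately show ?thesis using p by (simp add: pos_divide_le_eq pos_le_divide_eq mult_ac)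
    qed
    finally have "\<bar>\<sigma>\<bar> * norm (plane_fourier \<psi> \<sigma> \<phi>) \<le> \<bar>\<sigma>\<bar> * (2 * C / (1 + \<bar>\<sigma>\<bar> ^ 3))"
      by (intro mult_left_mono) auto
    also have "\<dots> = 2 * C * (\<bar>\<sigma>\<bar> ^ (0 + 1) / (1 + \<bar>\<sigma>\<bar> ^ (0 + 3)))" by simp
    also have "\<dots> \<le> 2 * C * (2 / (1 + \<bar>\<sigma>\<bar>\<^sup>2))" using C(1) by (intro mult_left_mono power_ratio_le) auto
    finally show "\<bar>\<sigma>\<bar> * norm (plane_fourier \<psi> \<sigma> \<phi>) \<le> 2 * (2 * C) * (1 / (1 + \<sigma>\<^sup>2))" by simp
  qed (use C in auto)
qed

lemma riesz_radon_integrable: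
  assumes "test_function_on UNIV \<psi>"
  shows "integrable lborel (\<lambda>\<sigma>. of_real \<bar>\<sigma>\<bar> * plane_fourier \<psi> \<sigma> \<phi> * cis (\<sigma> * s))"
proof -
  obtain C where C: "C > 0" "\<And>\<sigma> \<phi>. \<bar>\<sigma>\<bar> * norm (plane_fourier \<psi> \<sigma> \<phi>) \<le> C * (1 / (1 + \<sigma>\<^sup>2))"
    using riesz_radon_dominated[OF assms] by metis
  have [measurable]: "(\<lambda>\<sigma>. plane_fourier \<psi> \<sigma> \<phi>) \<in> borel_measurable borel"
    using measurable_compose[OF _ plane_fourier_measurable[OF assms], of "\<lambda>\<sigma>. (\<sigma>, \<phi>)" borel] by simp
  have "integrable lborel (\<lambda>\<sigma>. of_real \<bar>\<sigma>\<bar> * plane_fourier \<psi> \<sigma> \<phi>)"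
    by (rule Bochner_Integration.integrable_bound[OF integrable_mult_right[OF integrable_inverse_1_plus_square, of C]])
      (use C in \<open>auto simp: norm_mult intro!: AE_I2 order_trans[OF C(2)] borel_measurable_times\<close>)
  then show ?thesis by (rule integrable_times_cis) measurable
qed

section \<open>The kernel of the Riesz operator away from the diagonal\<close>

text \<open>The Fourier integral of |\<sigma>| exp(-\<kappa> |\<sigma>|), that is, of the filter
  with an Abel convergence factor. As \<kappa> tends to 0 it tends to -2 / y^2 for y \<noteq>
  0.\<close>

definition abel_kernel :: "real \<Rightarrow> real \<Rightarrow> real" where
  "abel_kernel \<kappa> y = 2 * (\<kappa>\<^sup>2 - y\<^sup>2) / (\<kappa>\<^sup>2 + y\<^sup>2)\<^sup>2"

text \<open>With z = -\<kappa> + i y the integrand on the half line is \<sigma> exp(\<sigma> z),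
  which has the antiderivative (\<sigma>/z - 1/z^2) exp(\<sigma> z).\<close>

lemma integral_abel_half:
  fixes \<kappa> y :: real
  assumes "\<kappa> > 0"
  shows "integrable lborel (\<lambda>\<sigma>. indicat_real {0<..} \<sigma> *\<^sub>R (\<sigma> * exp (- \<kappa> * \<sigma>)))"
    and "integrable lborel (\<lambda>\<sigma>. indicat_real {0<..} \<sigma> *\<^sub>R (of_real (\<sigma> * exp (- \<kappa> * \<sigma>)) * cis (\<sigma> * y)))"
    and "(LINT \<sigma>|lborel. indicat_real {0<..} \<sigma> *\<^sub>R (of_real (\<sigma> * exp (- \<kappa> * \<sigma>)) * cis (\<sigma> * y))) = 1 / (Complex (-\<kappa>) y)\<^sup>2"
proof -
  have I: "einterval 0 \<infinity> = {0::real<..}" by (auto simp: einterval_def)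
  have "set_integrable lborel (einterval 0 \<infinity>) (\<lambda>\<sigma>. \<sigma> * exp (- \<kappa> * \<sigma>))"
  proof (rule interval_integral_FTC_nonneg(1)[where F="\<lambda>\<sigma>. - (\<sigma> / \<kappa> + 1 / \<kappa>\<^sup>2) * exp (- \<kappa> * \<sigma>)"])
    show "DERIV (\<lambda>\<sigma>. - (\<sigma> / \<kappa> + 1 / \<kappa>\<^sup>2) * exp (- \<kappa> * \<sigma>)) x :> x * exp (- \<kappa> * x)" for x
      using assms by (auto intro!: derivative_eq_intros simp: field_simps power2_eq_square)
    show "(((\<lambda>\<sigma>. - (\<sigma> / \<kappa> + 1 / \<kappa>\<^sup>2) * exp (- \<kappa> * \<sigma>)) \<circ> real_of_ereal) \<longlongrightarrow> - (1 / \<kappa>\<^sup>2)) (at_right 0)"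
      using assms unfolding zero_ereal_def ereal_tendsto_simps by (auto intro!: tendsto_eq_intros)
    show "(((\<lambda>\<sigma>. - (\<sigma> / \<kappa> + 1 / \<kappa>\<^sup>2) * exp (- \<kappa> * \<sigma>)) \<circ> real_of_ereal) \<longlongrightarrow> 0) (at_left \<infinity>)"
      using assms unfolding ereal_tendsto_simps by real_asymp
  qed (auto intro!: continuous_intros AE_I2)
  then show 1: "integrable lborel (\<lambda>\<sigma>. indicat_real {0<..} \<sigma> *\<^sub>R (\<sigma> * exp (- \<kappa> * \<sigma>)))"
    by (simp add: set_integrable_def I)
  have "integrable lborel (\<lambda>\<sigma>. (of_real (indicat_real {0<..} \<sigma> *\<^sub>R (\<sigma> * exp (- \<kappa> * \<sigma>))) :: complex) * cis (\<sigma> * y))"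
    by (intro integrable_times_cis integrable_of_real 1) measurable
  then show 2: "integrable lborel (\<lambda>\<sigma>. indicat_real {0<..} \<sigma> *\<^sub>R (of_real (\<sigma> * exp (- \<kappa> * \<sigma>)) * cis (\<sigma> * y)))"
    by (simp add: scaleR_conv_of_real mult_ac)
  define z where "z = Complex (-\<kappa>) y"
  have z: "z \<noteq> 0" using assms by (auto simp: z_def complex_eq_iff)
  have ez: "of_real (\<sigma> * exp (- \<kappa> * \<sigma>)) * cis (\<sigma> * y) = of_real \<sigma> * exp (of_real \<sigma> * z)" for \<sigma>
  proof -
    have "of_real \<sigma> * z = of_real (- \<kappa> * \<sigma>) + \<i> * of_real (\<sigma> * y)" by (simp add: z_def complex_eq_iff)
    then have "exp (of_real \<sigma> * z) = exp (of_real (- \<kappa> * \<sigma>)) * cis (\<sigma> * y)" by (simp only: exp_add cis_conv_exp)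
    also have "exp (complex_of_real (- \<kappa> * \<sigma>)) = of_real (exp (- \<kappa> * \<sigma>))" by (rule exp_of_real)
    finally show ?thesis by (simp only: of_real_mult mult.assoc)
  qed
  let ?F = "\<lambda>\<sigma>. (of_real \<sigma> / z - 1 / z\<^sup>2) * exp (of_real \<sigma> * z)"
  have DF: "(?F has_vector_derivative of_real x * exp (of_real x * z)) (at x)" for x
  proof -
    have "((\<lambda>w. (w / z - 1 / z\<^sup>2) * exp (w * z)) has_field_derivative of_real x * exp (of_real x * z)) (at (of_real x))"
      using z by (auto intro!: derivative_eq_intros simp: field_simps power2_eq_square)
    from has_vector_derivative_real_field[OF this] show ?thesis by simp
  qed
  have lim: "(?F \<longlongrightarrow> 0) at_top"
  proof (rule tendsto_norm_zero_cancel, rule Lim_null_comparison)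
    show "eventually (\<lambda>\<sigma>. norm (norm (?F \<sigma>)) \<le> (\<bar>\<sigma>\<bar> * norm (1 / z) + norm (1 / z\<^sup>2)) * exp (- \<kappa> * \<sigma>)) at_top"
    proof (rule always_eventually, rule allI)
      fix \<sigma>
      have "norm (?F \<sigma>) = norm (of_real \<sigma> / z - 1 / z\<^sup>2) * exp (- \<kappa> * \<sigma>)" by (simp add: norm_mult z_def mult.commute)
      also have "\<dots> \<le> (\<bar>\<sigma>\<bar> * norm (1 / z) + norm (1 / z\<^sup>2)) * exp (- \<kappa> * \<sigma>)"
        by (intro mult_right_mono order_trans[OF norm_triangle_ineq4]) (auto simp: norm_divide)
      finally show "norm (norm (?F \<sigma>)) \<le> (\<bar>\<sigma>\<bar> * norm (1 / z) + norm (1 / z\<^sup>2)) * exp (- \<kappa> * \<sigma>)" by simp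
    qed
    show "((\<lambda>\<sigma>. (\<bar>\<sigma>\<bar> * norm (1 / z) + norm (1 / z\<^sup>2)) * exp (- \<kappa> * \<sigma>)) \<longlongrightarrow> 0) at_top"
      using assms by real_asymp
  qed
  have "(LBINT \<sigma>=0..\<infinity>. of_real \<sigma> * exp (of_real \<sigma> * z)) = 0 - (- 1 / z\<^sup>2)"
  proof (rule interval_integral_FTC_integrable[where F="?F"])
    show "(?F has_vector_derivative of_real x * exp (of_real x * z)) (at x)" for x by (rule DF)
    show "isCont (\<lambda>\<sigma>. of_real \<sigma> * exp (of_real \<sigma> * z)) x" for x by (intro continuous_intros)
    show "set_integrable lborel (einterval 0 \<infinity>) (\<lambda>\<sigma>. of_real \<sigma> * exp (of_real \<sigma> * z))"
      using 2 by (simp only: set_integrable_def I ez)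
    have "isCont ?F 0" using DF has_vector_derivative_continuous by blast
    then have "(?F \<longlongrightarrow> ?F 0) (at_right 0)" by (simp add: continuous_within filterlim_at_split)
    then show "((?F \<circ> real_of_ereal) \<longlongrightarrow> - 1 / z\<^sup>2) (at_right 0)"
      unfolding zero_ereal_def ereal_tendsto_simps by simp
    show "((?F \<circ> real_of_ereal) \<longlongrightarrow> 0) (at_left \<infinity>)"
      unfolding ereal_tendsto_simps by (rule lim)
  qed auto
  then show "(LINT \<sigma>|lborel. indicat_real {0<..} \<sigma> *\<^sub>R (of_real (\<sigma> * exp (- \<kappa> * \<sigma>)) * cis (\<sigma> * y))) = 1 / (Complex (-\<kappa>) y)\<^sup>2"
    by (simp only: ez) (simp add: interval_lebesgue_integral_def set_lebesgue_integral_def I z_def)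
qed

text \<open>The two half lines contribute 1/z^2 and its complex conjugate.\<close>

lemma integral_abel_kernel:
  assumes "\<kappa> > 0"
  shows "integrable lborel (\<lambda>\<sigma>. \<bar>\<sigma>\<bar> * exp (- \<kappa> * \<bar>\<sigma>\<bar>))"
    and "(LINT \<sigma>|lborel. of_real (\<bar>\<sigma>\<bar> * exp (- \<kappa> * \<bar>\<sigma>\<bar>)) * cis (\<sigma> * y)) = of_real (abel_kernel \<kappa> y)"
proof -
  let ?p = "\<lambda>\<sigma>. indicat_real {0<..} \<sigma> *\<^sub>R (\<sigma> * exp (- \<kappa> * \<sigma>))"
  let ?h = "\<lambda>y \<sigma>. indicat_real {0<..} \<sigma> *\<^sub>R (of_real (\<sigma> * exp (- \<kappa> * \<sigma>)) * cis (\<sigma> * y))"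
  have "(\<lambda>\<sigma>. \<bar>\<sigma>\<bar> * exp (- \<kappa> * \<bar>\<sigma>\<bar>)) = (\<lambda>\<sigma>. ?p \<sigma> + ?p (0 + (-1) * \<sigma>))"
    by (auto simp: fun_eq_iff indicator_def abs_if)
  then show "integrable lborel (\<lambda>\<sigma>. \<bar>\<sigma>\<bar> * exp (- \<kappa> * \<bar>\<sigma>\<bar>))"
    using integral_abel_half(1)[OF assms] lborel_integrable_real_affine[OF integral_abel_half(1)[OF assms], of "-1" 0]
    by simp
  have "(\<lambda>\<sigma>. of_real (\<bar>\<sigma>\<bar> * exp (- \<kappa> * \<bar>\<sigma>\<bar>)) * cis (\<sigma> * y)) = (\<lambda>\<sigma>. ?h y \<sigma> + ?h (-y) (0 + (-1) * \<sigma>))"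
    by (auto simp: fun_eq_iff indicator_def abs_if)
  moreover have "integrable lborel (\<lambda>\<sigma>. ?h (-y) (0 + (-1) * \<sigma>))"
    by (rule lborel_integrable_real_affine[OF integral_abel_half(2)[OF assms]]) simp
  ultimately have "(LINT \<sigma>|lborel. of_real (\<bar>\<sigma>\<bar> * exp (- \<kappa> * \<bar>\<sigma>\<bar>)) * cis (\<sigma> * y))
      = (LINT \<sigma>|lborel. ?h y \<sigma>) + (LINT \<sigma>|lborel. ?h (-y) (0 + (-1) * \<sigma>))"
    using Bochner_Integration.integral_add[OF integral_abel_half(2)[OF assms]] by (simp only:)
  also have "(LINT \<sigma>|lborel. ?h (-y) (0 + (-1) * \<sigma>)) = (LINT \<sigma>|lborel. ?h (-y) \<sigma>)"
    using lborel_integral_real_affine[of "-1" "?h (-y)" 0] by simp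
  also have "(LINT \<sigma>|lborel. ?h y \<sigma>) + (LINT \<sigma>|lborel. ?h (-y) \<sigma>) = 1 / (Complex (-\<kappa>) y)\<^sup>2 + 1 / (Complex (-\<kappa>) (-y))\<^sup>2"
    by (simp only: integral_abel_half(3)[OF assms])
  also have "\<dots> = of_real (abel_kernel \<kappa> y)"
  proof -
    let ?z = "Complex (-\<kappa>) y" and ?w = "Complex (-\<kappa>) (-y)"
    have nz: "?z \<noteq> 0" "?w \<noteq> 0" using assms by (auto simp: complex_eq_iff)
    have 1: "?z * ?w = of_real (\<kappa>\<^sup>2 + y\<^sup>2)" by (simp add: complex_eq_iff power2_eq_square)
    have 2: "?z\<^sup>2 + ?w\<^sup>2 = of_real (2 * (\<kappa>\<^sup>2 - y\<^sup>2))" by (simp add: complex_eq_iff power2_eq_square)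
    have "1 / ?z\<^sup>2 + 1 / ?w\<^sup>2 = (?z\<^sup>2 + ?w\<^sup>2) / (?z * ?w)\<^sup>2"
      using nz by (simp add: field_simps)
    then show ?thesis unfolding 1 2 abel_kernel_def by simp
  qed
  finally show "(LINT \<sigma>|lborel. of_real (\<bar>\<sigma>\<bar> * exp (- \<kappa> * \<bar>\<sigma>\<bar>)) * cis (\<sigma> * y)) = of_real (abel_kernel \<kappa> y)" .
qed

text \<open>The multiplier |\<sigma>| is not integrable, so Fubini is applied with the Abel factor,
  which is then removed on both sides. On the frequency side the decay of the transform dominates;
  on the kernel side the gap \<delta> bounds the kernel by 2 / \<delta>^2.\<close>

lemma riesz_radon_far:
  assumes \<psi>: "test_function_on UNIV \<psi>" and \<delta>: "\<delta> > 0" "\<And>x. \<psi> x \<noteq> 0 \<Longrightarrow> \<delta> \<le> \<bar>s - x \<bullet> dir \<phi>\<bar>"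
  shows "riesz_radon \<psi> s \<phi> = (LINT x|lborel. of_real (- 2 / (s - x \<bullet> dir \<phi>)\<^sup>2) * \<psi> x)"
proof -
  define \<kappa> where "\<kappa> n = 1 / real (Suc n)" for n
  have \<kappa>: "\<kappa> n > 0" for n by (simp add: \<kappa>_def)
  have \<kappa>0: "\<kappa> \<longlonglongrightarrow> 0" unfolding \<kappa>_def using LIMSEQ_inverse_real_of_nat by (simp add: inverse_eq_divide)
  define A where "A n = (LINT \<sigma>|lborel. of_real (exp (- \<kappa> n * \<bar>\<sigma>\<bar>)) * (of_real \<bar>\<sigma>\<bar> * plane_fourier \<psi> \<sigma> \<phi> * cis (\<sigma> * s)))" for n
  note intR = riesz_radon_integrable[OF \<psi>, of \<phi> s]
  have [measurable]: "\<psi> \<in> borel_measurable borel" by (rule test_function_measurable[OF \<psi>])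
  have "A \<longlonglongrightarrow> riesz_radon \<psi> s \<phi>"
    unfolding A_def riesz_radon_def
  proof (rule integral_dominated_convergence[where w="\<lambda>\<sigma>. norm (of_real \<bar>\<sigma>\<bar> * plane_fourier \<psi> \<sigma> \<phi> * cis (\<sigma> * s))"])
    have m: "(\<lambda>\<sigma>. of_real \<bar>\<sigma>\<bar> * plane_fourier \<psi> \<sigma> \<phi> * cis (\<sigma> * s)) \<in> borel_measurable lborel"
      using intR by (rule borel_measurable_integrable)
    then show "(\<lambda>\<sigma>. of_real \<bar>\<sigma>\<bar> * plane_fourier \<psi> \<sigma> \<phi> * cis (\<sigma> * s)) \<in> borel_measurable lborel" .
    show "(\<lambda>\<sigma>. of_real (exp (- \<kappa> n * \<bar>\<sigma>\<bar>)) * (of_real \<bar>\<sigma>\<bar> * plane_fourier \<psi> \<sigma> \<phi> * cis (\<sigma> * s))) \<in> borel_measurable lborel" for n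
      by (intro borel_measurable_times m) measurable
    show "integrable lborel (\<lambda>\<sigma>. norm (of_real \<bar>\<sigma>\<bar> * plane_fourier \<psi> \<sigma> \<phi> * cis (\<sigma> * s)))"
      using intR by (rule integrable_norm)
    show "AE \<sigma> in lborel. (\<lambda>n. of_real (exp (- \<kappa> n * \<bar>\<sigma>\<bar>)) * (of_real \<bar>\<sigma>\<bar> * plane_fourier \<psi> \<sigma> \<phi> * cis (\<sigma> * s))) \<longlonglongrightarrow> of_real \<bar>\<sigma>\<bar> * plane_fourier \<psi> \<sigma> \<phi> * cis (\<sigma> * s)"
    proof (rule AE_I2)
      fix \<sigma> :: real
      have "(\<lambda>n. complex_of_real (exp (- \<kappa> n * \<bar>\<sigma>\<bar>))) \<longlonglongrightarrow> of_real (exp (- 0 * \<bar>\<sigma>\<bar>))"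
        by (intro tendsto_intros \<kappa>0)
      from tendsto_mult_right[OF this]
      show "(\<lambda>n. of_real (exp (- \<kappa> n * \<bar>\<sigma>\<bar>)) * (of_real \<bar>\<sigma>\<bar> * plane_fourier \<psi> \<sigma> \<phi> * cis (\<sigma> * s))) \<longlonglongrightarrow> of_real \<bar>\<sigma>\<bar> * plane_fourier \<psi> \<sigma> \<phi> * cis (\<sigma> * s)"
        by simp
    qed
    show "AE \<sigma> in lborel. norm (of_real (exp (- \<kappa> n * \<bar>\<sigma>\<bar>)) * (of_real \<bar>\<sigma>\<bar> * plane_fourier \<psi> \<sigma> \<phi> * cis (\<sigma> * s))) \<le> norm (of_real \<bar>\<sigma>\<bar> * plane_fourier \<psi> \<sigma> \<phi> * cis (\<sigma> * s))" for n
    proof (rule AE_I2)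
      fix \<sigma> :: real
      have "exp (- \<kappa> n * \<bar>\<sigma>\<bar>) \<le> 1" using \<kappa>[of n] by (simp add: mult_nonneg_nonneg)
      then show "norm (of_real (exp (- \<kappa> n * \<bar>\<sigma>\<bar>)) * (of_real \<bar>\<sigma>\<bar> * plane_fourier \<psi> \<sigma> \<phi> * cis (\<sigma> * s))) \<le> norm (of_real \<bar>\<sigma>\<bar> * plane_fourier \<psi> \<sigma> \<phi> * cis (\<sigma> * s))"
        by (simp only: norm_mult) (intro mult_left_le_one_le, auto)
    qed
  qed
  moreover have "A = (\<lambda>n. LINT x|lborel. of_real (abel_kernel (\<kappa> n) (s - x \<bullet> dir \<phi>)) * \<psi> x)"
  proof (rule ext)
    fix n
    let ?g = "\<lambda>\<sigma>. \<bar>\<sigma>\<bar> * exp (- \<kappa> n * \<bar>\<sigma>\<bar>)"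
    let ?f = "\<lambda>\<sigma> x. of_real (?g \<sigma>) * \<psi> x * cis (\<sigma> * (s - x \<bullet> dir \<phi>))"
    have int: "integrable lborel (\<lambda>p. ?f (fst p) (snd p))"
    proof (rule integrable_lborel_prod_dominated[where g="?g" and h="\<lambda>x. norm (\<psi> x)"])
      show "(\<lambda>p. ?f (fst p) (snd p)) \<in> borel_measurable borel"
        by (intro borel_measurable_continuous_onI continuous_intros
            continuous_on_compose2[OF test_function_continuous[OF \<psi>, of UNIV]]) auto
      show "integrable lborel ?g" by (rule integral_abel_kernel(1)[OF \<kappa>])
      show "integrable lborel (\<lambda>x. norm (\<psi> x))" using test_function_integrable[OF \<psi>] by (rule integrable_norm)
      show "norm (?f \<sigma> x) \<le> ?g \<sigma> * norm (\<psi> x)" for \<sigma> x by (simp add: norm_mult)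
    qed
    have "A n = (LINT \<sigma>|lborel. LINT x|lborel. ?f \<sigma> x)"
      unfolding A_def plane_fourier_def
    proof (rule Bochner_Integration.integral_cong[OF refl])
      fix \<sigma> :: real
      have "(LINT x|lborel. ?f \<sigma> x) = (LINT x|lborel. (of_real (?g \<sigma>) * cis (\<sigma> * s)) * (\<psi> x * cis (- (\<sigma> * (x \<bullet> dir \<phi>)))))"
        by (intro Bochner_Integration.integral_cong refl) (simp add: cis_mult algebra_simps)
      also have "\<dots> = (of_real (?g \<sigma>) * cis (\<sigma> * s)) * (LINT x|lborel. \<psi> x * cis (- (\<sigma> * (x \<bullet> dir \<phi>))))"
        by (rule integral_mult_right_zero)
      finally show "of_real (exp (- \<kappa> n * \<bar>\<sigma>\<bar>)) * (of_real \<bar>\<sigma>\<bar> * (LINT x|lborel. \<psi> x * cis (- (\<sigma> * (x \<bullet> dir \<phi>)))) * cis (\<sigma> * s))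
          = (LINT x|lborel. ?f \<sigma> x)"
        by (simp add: mult_ac)
    qed
    also have "\<dots> = (LINT x|lborel. LINT \<sigma>|lborel. ?f \<sigma> x)" by (rule lborel_Fubini(2)[OF int])
    also have "\<dots> = (LINT x|lborel. of_real (abel_kernel (\<kappa> n) (s - x \<bullet> dir \<phi>)) * \<psi> x)"
    proof (rule Bochner_Integration.integral_cong[OF refl])
      fix x
      have "(LINT \<sigma>|lborel. ?f \<sigma> x) = (LINT \<sigma>|lborel. (of_real (?g \<sigma>) * cis (\<sigma> * (s - x \<bullet> dir \<phi>))) * \<psi> x)"
        by (intro Bochner_Integration.integral_cong refl) (simp add: mult_ac)
      then show "(LINT \<sigma>|lborel. ?f \<sigma> x) = of_real (abel_kernel (\<kappa> n) (s - x \<bullet> dir \<phi>)) * \<psi> x"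
        by (simp only: integral_mult_left_zero integral_abel_kernel(2)[OF \<kappa>])
    qed
    finally show "A n = (LINT x|lborel. of_real (abel_kernel (\<kappa> n) (s - x \<bullet> dir \<phi>)) * \<psi> x)" .
  qed
  ultimately have lim1: "(\<lambda>n. LINT x|lborel. of_real (abel_kernel (\<kappa> n) (s - x \<bullet> dir \<phi>)) * \<psi> x) \<longlonglongrightarrow> riesz_radon \<psi> s \<phi>"
    by simp
  have lim2: "(\<lambda>n. LINT x|lborel. of_real (abel_kernel (\<kappa> n) (s - x \<bullet> dir \<phi>)) * \<psi> x)
      \<longlonglongrightarrow> (LINT x|lborel. of_real (- 2 / (s - x \<bullet> dir \<phi>)\<^sup>2) * \<psi> x)"
  proof (rule integral_dominated_convergence[where w="\<lambda>x. (2 / \<delta>\<^sup>2) * norm (\<psi> x)"])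
    show "integrable lborel (\<lambda>x. (2 / \<delta>\<^sup>2) * norm (\<psi> x))" using test_function_integrable[OF \<psi>] by simp
    show "(\<lambda>x. of_real (- 2 / (s - x \<bullet> dir \<phi>)\<^sup>2) * \<psi> x) \<in> borel_measurable lborel" by measurable
    show "(\<lambda>x. of_real (abel_kernel (\<kappa> n) (s - x \<bullet> dir \<phi>)) * \<psi> x) \<in> borel_measurable lborel" for n
      unfolding abel_kernel_def by measurable
    show "AE x in lborel. (\<lambda>n. of_real (abel_kernel (\<kappa> n) (s - x \<bullet> dir \<phi>)) * \<psi> x) \<longlonglongrightarrow> of_real (- 2 / (s - x \<bullet> dir \<phi>)\<^sup>2) * \<psi> x"
    proof (rule AE_I2)
      fix x
      show "(\<lambda>n. of_real (abel_kernel (\<kappa> n) (s - x \<bullet> dir \<phi>)) * \<psi> x) \<longlonglongrightarrow> of_real (- 2 / (s - x \<bullet> dir \<phi>)\<^sup>2) * \<psi> x"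
      proof (cases "\<psi> x = 0")
        case False
        let ?y = "s - x \<bullet> dir \<phi>"
        have y: "?y \<noteq> 0" using \<delta>(2)[OF False] \<delta>(1) by auto
        have "(\<lambda>n. abel_kernel (\<kappa> n) ?y) \<longlonglongrightarrow> 2 * (0\<^sup>2 - ?y\<^sup>2) / (0\<^sup>2 + ?y\<^sup>2)\<^sup>2"
          unfolding abel_kernel_def by (intro tendsto_intros \<kappa>0) (use y in auto)
        also have "2 * (0\<^sup>2 - ?y\<^sup>2) / (0\<^sup>2 + ?y\<^sup>2)\<^sup>2 = - 2 / ?y\<^sup>2"
        proof -
          have "2 * (0\<^sup>2 - w\<^sup>2) / (0\<^sup>2 + w\<^sup>2)\<^sup>2 = - 2 / w\<^sup>2" if "w \<noteq> 0" for w :: real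
            using that by (simp add: power2_eq_square)
          then show ?thesis using y by blast
        qed
        finally show ?thesis by (intro tendsto_mult tendsto_of_real tendsto_const)
      qed simp
    qed
    show "AE x in lborel. norm (of_real (abel_kernel (\<kappa> n) (s - x \<bullet> dir \<phi>)) * \<psi> x) \<le> (2 / \<delta>\<^sup>2) * norm (\<psi> x)" for n
    proof (rule AE_I2)
      fix x
      show "norm (of_real (abel_kernel (\<kappa> n) (s - x \<bullet> dir \<phi>)) * \<psi> x) \<le> (2 / \<delta>\<^sup>2) * norm (\<psi> x)"
      proof (cases "\<psi> x = 0")
        case False
        let ?y = "s - x \<bullet> dir \<phi>" and ?k = "\<kappa> n"
        have y: "\<delta> \<le> \<bar>?y\<bar>" by (rule \<delta>(2)[OF False])
        then have y2: "\<delta>\<^sup>2 \<le> ?y\<^sup>2" using \<delta>(1) by (metis abs_le_square_iff abs_of_pos)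
        have p: "0 < ?k\<^sup>2 + ?y\<^sup>2" using \<kappa>[of n] by (simp add: add_pos_nonneg)
        have "\<bar>abel_kernel ?k ?y\<bar> = 2 * \<bar>?k\<^sup>2 - ?y\<^sup>2\<bar> / (?k\<^sup>2 + ?y\<^sup>2)\<^sup>2"
          by (simp only: abel_kernel_def abs_divide abs_mult abs_numeral abs_power2)
        also have "\<dots> \<le> 2 * (?k\<^sup>2 + ?y\<^sup>2) / (?k\<^sup>2 + ?y\<^sup>2)\<^sup>2"
          by (intro divide_right_mono mult_left_mono) (auto simp: abs_if)
        also have "\<dots> = 2 / (?k\<^sup>2 + ?y\<^sup>2)"
        proof -
          have "2 * w / w\<^sup>2 = 2 / w" if "w > 0" for w :: real using that by (simp add: power2_eq_square)
          then show ?thesis using p by blast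
        qed
        also have "\<dots> \<le> 2 / \<delta>\<^sup>2" using y2 \<delta>(1) p by (intro divide_left_mono) (auto simp: add_increasing)
        finally have "\<bar>abel_kernel ?k ?y\<bar> \<le> 2 / \<delta>\<^sup>2" .
        from mult_right_mono[OF this norm_ge_zero[of "\<psi> x"]] show ?thesis
          by (simp only: norm_mult norm_of_real)
      qed simp
    qed
  qed
  show ?thesis by (rule LIMSEQ_unique[OF lim1 lim2])
qed

section \<open>Contribution of the lines near and away from the point\<close>

lemma osc_measurable:
  assumes "amplitude A"
  shows "(\<lambda>p. osc A (fst p) (snd p)) \<in> borel_measurable borel"
  unfolding osc_def
proof (rule borel_measurable_inner_param[where f="\<lambda>p z. of_real (A z) * cis (fst p * (snd z - snd p \<bullet> dir (fst z)))"])
  have "(\<lambda>q. A (snd q)) \<in> borel_measurable (borel :: ((real \<times> (real^2)) \<times> real \<times> real) measure)"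
    by (rule measurable_compose[OF _ amplitude_measurable[OF assms]])
      (intro borel_measurable_continuous_onI continuous_intros)
  moreover have "(\<lambda>q. cis (fst (fst q) * (snd (snd q) - snd (fst q) \<bullet> dir (fst (snd q))))) \<in> borel_measurable (borel :: ((real \<times> (real^2)) \<times> real \<times> real) measure)"
    by (intro borel_measurable_continuous_onI continuous_intros)
  ultimately show "(\<lambda>q. of_real (A (snd q)) * cis (fst (fst q) * (snd (snd q) - snd (fst q) \<bullet> dir (fst (snd q))))) \<in> borel_measurable (borel :: ((real \<times> (real^2)) \<times> real \<times> real) measure)"
    by (intro borel_measurable_times) measurable
qed

text \<open>A derivative in x brings down - i \<sigma> and the weight v \<bullet> dir \<phi>, which
  is bounded on the support and is absorbed in the amplitude.\<close>

lemma osc_has_derivative: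
  assumes A: "amplitude A"
  shows "(osc A \<sigma> has_derivative (\<lambda>v. - \<i> * of_real \<sigma> * osc (\<lambda>z. (v \<bullet> dir (fst z)) * A z) \<sigma> x)) (at x)"
proof -
  let ?e = "\<lambda>x z. cis (\<sigma> * (snd z - x \<bullet> dir (fst z)))"
  let ?F' = "\<lambda>v x z. (- \<i> * of_real \<sigma>) * (of_real ((v \<bullet> dir (fst z)) * A z) * ?e x z)"
  have Av: "amplitude (\<lambda>z. (v \<bullet> dir (fst z)) * A z)" for v
    by (rule amplitude_mult_continuous[OF A]) (intro continuous_intros)
  have D: "((\<lambda>x. of_real (A z) * ?e x z) has_derivative (\<lambda>v. ?F' v x z)) (at x)" for x z
  proof -
    have g: "((\<lambda>x. \<sigma> * (snd z - x \<bullet> dir (fst z))) has_derivative (\<lambda>v. - \<sigma> * (v \<bullet> dir (fst z)))) (at x)"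
      by (auto intro!: derivative_eq_intros)
    have c: "(cis has_vector_derivative \<i> * cis y) (at y)" for y
    proof -
      have "((\<lambda>y::real. \<i> * complex_of_real y) has_vector_derivative \<i> * of_real 1) (at y)"
        by (intro has_vector_derivative_mult_right has_vector_derivative_of_real) (auto intro!: derivative_eq_intros)
      from field_vector_diff_chain_at[OF this DERIV_exp]
      show ?thesis by (simp add: o_def cis_conv_exp[abs_def])
    qed
    from has_derivative_compose[OF g c[unfolded has_vector_derivative_def]]
    have "((\<lambda>x. ?e x z) has_derivative (\<lambda>v. (- \<sigma> * (v \<bullet> dir (fst z))) *\<^sub>R (\<i> * ?e x z))) (at x)" .
    from has_derivative_mult_right[OF this, of "of_real (A z)"]
    show ?thesis by (simp add: scaleR_conv_of_real mult_ac)
  qed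
  have "((\<lambda>x. LINT z|lborel. of_real (A z) * ?e x z) has_derivative (\<lambda>v. LINT z|lborel. ?F' v x z)) (at x)"
  proof (rule has_derivative_dominated_integral[OF open_UNIV UNIV_I _ D, where m="\<lambda>v z. \<bar>\<sigma>\<bar> * \<bar>(v \<bullet> dir (fst z)) * A z\<bar>"])
    show "integrable lborel (\<lambda>z. of_real (A z) * ?e x z)" for x by (rule osc_integrable[OF A])
    show "?F' v x \<in> borel_measurable lborel" for v x
      using osc_integrable[OF Av] by (intro borel_measurable_times borel_measurable_integrable) auto
    show "integrable lborel (\<lambda>z. \<bar>\<sigma>\<bar> * \<bar>(v \<bullet> dir (fst z)) * A z\<bar>)" for v
      using amplitude_integrable[OF Av, of v] by (intro integrable_mult_right integrable_abs)
    show "norm (?F' v x z) \<le> \<bar>\<sigma>\<bar> * \<bar>(v \<bullet> dir (fst z)) * A z\<bar>" for v x z by (simp add: norm_mult abs_mult)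
  qed
  then show ?thesis unfolding osc_def[abs_def] by simp
qed

definition rapidly_decaying :: "(real^2) set \<Rightarrow> (real \<times> real \<Rightarrow> real) \<Rightarrow> bool" where
  "rapidly_decaying U A \<longleftrightarrow> (\<forall>N. \<exists>C. \<forall>\<sigma>. \<forall>x\<in>U. \<bar>\<sigma>\<bar> ^ N * norm (osc A \<sigma> x) \<le> C)"

text \<open>The estimates of orders 0 and n + 3 add up to one with the factor 1 + |\<sigma>|^(n+3),
  from which \<open>power_ratio_le\<close> yields an integrable majorant.\<close>

lemma rapidly_decaying_bound:
  assumes "rapidly_decaying U A"
  obtains C where "C \<ge> 0" "\<And>\<sigma> x. x \<in> U \<Longrightarrow> \<bar>\<sigma>\<bar> ^ (n + 1) * norm (osc A \<sigma> x) \<le> C * (1 / (1 + \<sigma>\<^sup>2))"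
proof -
  obtain C0 where C0: "\<And>\<sigma> x. x \<in> U \<Longrightarrow> \<bar>\<sigma>\<bar> ^ 0 * norm (osc A \<sigma> x) \<le> C0"
    using assms unfolding rapidly_decaying_def by blast
  obtain C1 where C1: "\<And>\<sigma> x. x \<in> U \<Longrightarrow> \<bar>\<sigma>\<bar> ^ (n + 3) * norm (osc A \<sigma> x) \<le> C1"
    using assms unfolding rapidly_decaying_def by blast
  define C where "C = max 0 (C0 + C1)"
  show ?thesis
  proof (rule that[of "C * 2"])
    fix \<sigma> :: real and x assume x: "x \<in> U"
    have "0 \<le> \<bar>\<sigma>\<bar> ^ (n + 3)" by (rule zero_le_power) simp
    then have p: "1 + \<bar>\<sigma>\<bar> ^ (n + 3) > 0" by linarith
    have "(1 + \<bar>\<sigma>\<bar> ^ (n + 3)) * norm (osc A \<sigma> x) \<le> C"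
      using C0[OF x, of \<sigma>] C1[OF x, of \<sigma>] by (simp add: C_def algebra_simps)
    then have "norm (osc A \<sigma> x) \<le> C / (1 + \<bar>\<sigma>\<bar> ^ (n + 3))" using p by (simp add: pos_le_divide_eq mult.commute)
    then have "\<bar>\<sigma>\<bar> ^ (n + 1) * norm (osc A \<sigma> x) \<le> \<bar>\<sigma>\<bar> ^ (n + 1) * (C / (1 + \<bar>\<sigma>\<bar> ^ (n + 3)))"
      by (intro mult_left_mono) auto
    also have "\<dots> = C * (\<bar>\<sigma>\<bar> ^ (n + 1) / (1 + \<bar>\<sigma>\<bar> ^ (n + 3)))" by simp
    also have "\<dots> \<le> C * (2 / (1 + \<bar>\<sigma>\<bar>\<^sup>2))" by (intro mult_left_mono power_ratio_le) (auto simp: C_def)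
    finally show "\<bar>\<sigma>\<bar> ^ (n + 1) * norm (osc A \<sigma> x) \<le> C * 2 * (1 / (1 + \<sigma>\<^sup>2))" by simp
  qed (auto simp: C_def)
qed

text \<open>Each derivative in x adds a power of \<sigma> and a smooth angular weight to the
  integrand; rapid decay for every weight dominates the whole class so obtained. This is why weights
  are carried through the decay estimates.\<close>

lemma near_smooth:
  assumes U: "open U" and A: "amplitude A"
    and rapid: "\<And>w. smooth1 w \<Longrightarrow> rapidly_decaying U (\<lambda>z. w (fst z) * A z)"
  shows "smooth_on U (\<lambda>x. LINT \<sigma>|lborel. of_real \<bar>\<sigma>\<bar> * osc A \<sigma> x)"
proof -
  define \<F> where "\<F> = {F. \<exists>k n w. smooth1 w \<and>
    F = (\<lambda>x \<sigma>. of_real \<bar>\<sigma>\<bar> * (k * of_real (\<sigma> ^ n)) * osc (\<lambda>z. w (fst z) * A z) \<sigma> x)}"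
  have amp: "amplitude (\<lambda>z. w (fst z) * A z)" if "smooth1 w" for w
    by (rule amplitude_mult_continuous[OF A])
      (intro continuous_on_compose2[OF smooth1_continuous_on[OF that, of UNIV]] continuous_intros, auto)
  have "smooth_on U (\<lambda>x. LINT \<sigma>|lborel. of_real \<bar>\<sigma>\<bar> * (1 * of_real (\<sigma> ^ 0)) * osc (\<lambda>z. 1 * A z) \<sigma> x)"
  proof (rule smooth_on_integral_class[where \<F>="\<F>", OF U])
    show "(\<lambda>x \<sigma>. of_real \<bar>\<sigma>\<bar> * (1 * of_real (\<sigma> ^ 0)) * osc (\<lambda>z. 1 * A z) \<sigma> x) \<in> \<F>"
      unfolding \<F>_def using smooth1_const[of 1] by blast
  next
    fix F assume "F \<in> \<F>"
    then obtain k n w where w: "smooth1 w"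
      and F: "F = (\<lambda>x \<sigma>. of_real \<bar>\<sigma>\<bar> * (k * of_real (\<sigma> ^ n)) * osc (\<lambda>z. w (fst z) * A z) \<sigma> x)"
      unfolding \<F>_def by blast
    obtain C where C: "C \<ge> 0" "\<And>\<sigma> x. x \<in> U \<Longrightarrow> \<bar>\<sigma>\<bar> ^ (n + 1) * norm (osc (\<lambda>z. w (fst z) * A z) \<sigma> x) \<le> C * (1 / (1 + \<sigma>\<^sup>2))"
      using rapidly_decaying_bound[OF rapid[OF w]] by metis
    show "\<exists>m. integrable lborel m \<and> (\<forall>x\<in>U. F x \<in> borel_measurable lborel \<and> (\<forall>z\<in>space lborel. norm (F x z) \<le> m z))"
    proof (intro exI[of _ "\<lambda>\<sigma>. norm k * (C * (1 / (1 + \<sigma>\<^sup>2)))"] conjI ballI)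
      show "integrable lborel (\<lambda>\<sigma>. norm k * (C * (1 / (1 + \<sigma>\<^sup>2))))"
        by (intro integrable_mult_right integrable_inverse_1_plus_square)
      fix x assume x: "x \<in> U"
      have "(\<lambda>\<sigma>. osc (\<lambda>z. w (fst z) * A z) \<sigma> x) \<in> borel_measurable borel"
        using measurable_compose[OF _ osc_measurable[OF amp[OF w]], of "\<lambda>\<sigma>. (\<sigma>, x)" borel] by simp
      then show "F x \<in> borel_measurable lborel"
        unfolding F by (intro borel_measurable_times) auto
      show "norm (F x \<sigma>) \<le> norm k * (C * (1 / (1 + \<sigma>\<^sup>2)))" for \<sigma>
      proof -
        have eq: "norm (F x \<sigma>) = norm k * (\<bar>\<sigma>\<bar> ^ (n + 1) * norm (osc (\<lambda>z. w (fst z) * A z) \<sigma> x))"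
          by (simp add: F norm_mult norm_power mult_ac)
        show ?thesis unfolding eq by (intro mult_left_mono C(2)[OF x]) simp
      qed
    qed
    show "\<exists>F'. (\<forall>v. F' v \<in> \<F>) \<and> (\<forall>x\<in>U. \<forall>z\<in>space lborel. ((\<lambda>x. F x z) has_derivative (\<lambda>v. F' v x z)) (at x))"
    proof (rule exI[of _ "\<lambda>v x \<sigma>. of_real \<bar>\<sigma>\<bar> * ((- \<i> * k) * of_real (\<sigma> ^ Suc n)) * osc (\<lambda>z. ((v \<bullet> dir (fst z)) * w (fst z)) * A z) \<sigma> x"],
        intro conjI allI ballI)
      fix v :: "real^2"
      have "smooth1 (\<lambda>\<phi>. v $ 1 * cos \<phi> + v $ 2 * sin \<phi>)"
        by (intro smooth1_add smooth1_mult smooth1_const smooth1_cos smooth1_sin)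
      then have "smooth1 (\<lambda>\<phi>. (v \<bullet> dir \<phi>) * w \<phi>)" unfolding inner_dir[abs_def] by (intro smooth1_mult w)
      then show "(\<lambda>x \<sigma>. of_real \<bar>\<sigma>\<bar> * ((- \<i> * k) * of_real (\<sigma> ^ Suc n)) * osc (\<lambda>z. ((v \<bullet> dir (fst z)) * w (fst z)) * A z) \<sigma> x) \<in> \<F>"
        unfolding \<F>_def by blast
    next
      fix x \<sigma>
      from has_derivative_mult_right[OF osc_has_derivative[OF amp[OF w], of \<sigma> x], of "of_real \<bar>\<sigma>\<bar> * (k * of_real (\<sigma> ^ n))"]
      show "((\<lambda>x. F x \<sigma>) has_derivative
          (\<lambda>v. of_real \<bar>\<sigma>\<bar> * ((- \<i> * k) * of_real (\<sigma> ^ Suc n)) * osc (\<lambda>z. ((v \<bullet> dir (fst z)) * w (fst z)) * A z) \<sigma> x)) (at x)"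
        by (simp add: F mult_ac)
    qed
  qed
  then show ?thesis by simp
qed

text \<open>The triple integral over z, \<sigma> and x does not converge absolutely in general, so
  the order is changed in three moves with different majorants: the decay of the transform of \<psi>
  for z and \<sigma>, plain integrability at fixed \<sigma> for z and x, and the decay of
  \<open>osc\<close> on the support of \<psi> for \<sigma> and x.\<close>

lemma near_pairing:
  assumes \<psi>: "test_function_on UNIV \<psi>" and supp: "\<And>x. \<psi> x \<noteq> 0 \<Longrightarrow> x \<in> U"
    and A: "amplitude A" and rapid: "rapidly_decaying U A"
  shows "(LINT z|lborel. of_real (A z) * riesz_radon \<psi> (snd z) (fst z))
    = (LINT x|lborel. (LINT \<sigma>|lborel. of_real \<bar>\<sigma>\<bar> * osc A \<sigma> x) * \<psi> x)"
proof -
  obtain C where C: "C > 0" "\<And>\<sigma> \<phi>. \<bar>\<sigma>\<bar> * norm (plane_fourier \<psi> \<sigma> \<phi>) \<le> C * (1 / (1 + \<sigma>\<^sup>2))"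
    using riesz_radon_dominated[OF \<psi>] by metis
  have A_abs: "integrable lborel (\<lambda>z. \<bar>A z\<bar>)" using amplitude_integrable[OF A] by (rule integrable_abs)
  have \<psi>_abs: "integrable lborel (\<lambda>x. norm (\<psi> x))" using test_function_integrable[OF \<psi>] by (rule integrable_norm)
  have Am: "(\<lambda>p. A (f p)) \<in> borel_measurable M" if "f \<in> measurable M borel" for f and M :: "'x measure"
    by (rule measurable_compose[OF that amplitude_measurable[OF A]])
  let ?f1 = "\<lambda>z \<sigma>. of_real (A z) * (of_real \<bar>\<sigma>\<bar> * plane_fourier \<psi> \<sigma> (fst z) * cis (\<sigma> * snd z))"
  have int1: "integrable lborel (\<lambda>p. ?f1 (fst p) (snd p))"
  proof (rule integrable_lborel_prod_dominated[where g="\<lambda>z. \<bar>A z\<bar>" and h="\<lambda>\<sigma>. C * (1 / (1 + \<sigma>\<^sup>2))"])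
    have 1: "(\<lambda>p. A (fst p)) \<in> borel_measurable (borel :: ((real \<times> real) \<times> real) measure)"
      by (rule Am) (intro borel_measurable_continuous_onI continuous_intros)
    have 2: "(\<lambda>p. plane_fourier \<psi> (snd p) (fst (fst p))) \<in> borel_measurable (borel :: ((real \<times> real) \<times> real) measure)"
      using measurable_compose[OF _ plane_fourier_measurable[OF \<psi>], of "\<lambda>p. (snd p, fst (fst p))" "borel :: ((real \<times> real) \<times> real) measure"]
      by (simp add: borel_measurable_continuous_onI continuous_intros)
    have 3: "(\<lambda>p. cis (snd p * snd (fst p))) \<in> borel_measurable (borel :: ((real \<times> real) \<times> real) measure)"
      "(\<lambda>p. complex_of_real \<bar>snd p\<bar>) \<in> borel_measurable (borel :: ((real \<times> real) \<times> real) measure)"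
      by (intro borel_measurable_continuous_onI continuous_intros)+
    show "(\<lambda>p. ?f1 (fst p) (snd p)) \<in> borel_measurable borel"
      using 1 by (intro borel_measurable_times 2 3) measurable
    show "norm (?f1 z \<sigma>) \<le> \<bar>A z\<bar> * (C * (1 / (1 + \<sigma>\<^sup>2)))" for z \<sigma>
      using mult_left_mono[OF C(2)[of \<sigma> "fst z"] abs_ge_zero[of "A z"]] by (simp add: norm_mult)
    show "integrable lborel (\<lambda>\<sigma>. C * (1 / (1 + \<sigma>\<^sup>2)))" by (intro integrable_mult_right integrable_inverse_1_plus_square)
  qed (rule A_abs)
  let ?f2 = "\<lambda>\<sigma> z x. of_real (A z) * \<psi> x * cis (\<sigma> * (snd z - x \<bullet> dir (fst z)))"
  have int2: "integrable lborel (\<lambda>p. ?f2 \<sigma> (fst p) (snd p))" for \<sigma>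
  proof (rule integrable_lborel_prod_dominated[where g="\<lambda>z. \<bar>A z\<bar>" and h="\<lambda>x. norm (\<psi> x)"])
    have 1: "(\<lambda>p. A (fst p)) \<in> borel_measurable (borel :: ((real \<times> real) \<times> (real^2)) measure)"
      by (rule Am) (intro borel_measurable_continuous_onI continuous_intros)
    have 2: "(\<lambda>p. \<psi> (snd p)) \<in> borel_measurable (borel :: ((real \<times> real) \<times> (real^2)) measure)"
      by (intro borel_measurable_continuous_onI continuous_intros continuous_on_compose2[OF test_function_continuous[OF \<psi>, of UNIV]]) auto
    have 3: "(\<lambda>p. cis (\<sigma> * (snd (fst p) - snd p \<bullet> dir (fst (fst p))))) \<in> borel_measurable (borel :: ((real \<times> real) \<times> (real^2)) measure)"
      by (intro borel_measurable_continuous_onI continuous_intros)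
    show "(\<lambda>p. ?f2 \<sigma> (fst p) (snd p)) \<in> borel_measurable borel"
      using 1 by (intro borel_measurable_times 2 3) measurable
    show "norm (?f2 \<sigma> z x) \<le> \<bar>A z\<bar> * norm (\<psi> x)" for z x by (simp add: norm_mult)
  qed (rule A_abs \<psi>_abs)+
  obtain C' where C': "C' \<ge> 0" "\<And>\<sigma> x. x \<in> U \<Longrightarrow> \<bar>\<sigma>\<bar> ^ (0 + 1) * norm (osc A \<sigma> x) \<le> C' * (1 / (1 + \<sigma>\<^sup>2))"
    using rapidly_decaying_bound[OF rapid] by metis
  let ?f3 = "\<lambda>\<sigma> x. of_real \<bar>\<sigma>\<bar> * osc A \<sigma> x * \<psi> x"
  have int3: "integrable lborel (\<lambda>p. ?f3 (fst p) (snd p))"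
  proof (rule integrable_lborel_prod_dominated[where g="\<lambda>\<sigma>. C' * (1 / (1 + \<sigma>\<^sup>2))" and h="\<lambda>x. norm (\<psi> x)"])
    have 2: "(\<lambda>p. \<psi> (snd p)) \<in> borel_measurable (borel :: (real \<times> (real^2)) measure)"
      by (intro borel_measurable_continuous_onI continuous_intros continuous_on_compose2[OF test_function_continuous[OF \<psi>, of UNIV]]) auto
    have 3: "(\<lambda>p. complex_of_real \<bar>fst p\<bar>) \<in> borel_measurable (borel :: (real \<times> (real^2)) measure)"
      by (intro borel_measurable_continuous_onI continuous_intros)
    show "(\<lambda>p. ?f3 (fst p) (snd p)) \<in> borel_measurable borel"
      by (intro borel_measurable_times 2 3 osc_measurable[OF A])
    show "norm (?f3 \<sigma> x) \<le> C' * (1 / (1 + \<sigma>\<^sup>2)) * norm (\<psi> x)" for \<sigma> x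
    proof (cases "\<psi> x = 0")
      case False
      from mult_right_mono[OF C'(2)[OF supp[OF False], of \<sigma>] norm_ge_zero[of "\<psi> x"]]
      show ?thesis by (simp add: norm_mult)
    qed simp
    show "integrable lborel (\<lambda>\<sigma>. C' * (1 / (1 + \<sigma>\<^sup>2)))" by (intro integrable_mult_right integrable_inverse_1_plus_square)
  qed (rule \<psi>_abs)
  have inner: "(LINT z|lborel. ?f1 z \<sigma>) = (LINT x|lborel. ?f3 \<sigma> x)" for \<sigma>
  proof -
    have "(LINT z|lborel. ?f1 z \<sigma>) = (LINT z|lborel. of_real \<bar>\<sigma>\<bar> * (LINT x|lborel. ?f2 \<sigma> z x))"
    proof (rule Bochner_Integration.integral_cong[OF refl])
      fix z
      have "(LINT x|lborel. ?f2 \<sigma> z x) = (LINT x|lborel. (of_real (A z) * cis (\<sigma> * snd z)) * (\<psi> x * cis (- (\<sigma> * (x \<bullet> dir (fst z))))))"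
        by (intro Bochner_Integration.integral_cong refl) (simp add: cis_mult algebra_simps)
      also have "\<dots> = (of_real (A z) * cis (\<sigma> * snd z)) * plane_fourier \<psi> \<sigma> (fst z)"
        unfolding plane_fourier_def by (rule integral_mult_right_zero)
      finally show "?f1 z \<sigma> = of_real \<bar>\<sigma>\<bar> * (LINT x|lborel. ?f2 \<sigma> z x)" by (simp add: mult_ac)
    qed
    also have "\<dots> = of_real \<bar>\<sigma>\<bar> * (LINT z|lborel. LINT x|lborel. ?f2 \<sigma> z x)" by (rule integral_mult_right_zero)
    also have "(LINT z|lborel. LINT x|lborel. ?f2 \<sigma> z x) = (LINT x|lborel. LINT z|lborel. ?f2 \<sigma> z x)"
      by (rule lborel_Fubini(2)[OF int2])
    also have "\<dots> = (LINT x|lborel. osc A \<sigma> x * \<psi> x)"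
    proof (rule Bochner_Integration.integral_cong[OF refl])
      fix x
      have "(LINT z|lborel. ?f2 \<sigma> z x) = (LINT z|lborel. (of_real (A z) * cis (\<sigma> * (snd z - x \<bullet> dir (fst z)))) * \<psi> x)"
        by (intro Bochner_Integration.integral_cong refl) (simp add: mult_ac)
      then show "(LINT z|lborel. ?f2 \<sigma> z x) = osc A \<sigma> x * \<psi> x"
        unfolding osc_def by (simp only: integral_mult_left_zero)
    qed
    also have "of_real \<bar>\<sigma>\<bar> * (LINT x|lborel. osc A \<sigma> x * \<psi> x) = (LINT x|lborel. ?f3 \<sigma> x)"
      by (subst integral_mult_right_zero[symmetric]) (simp add: mult.assoc)
    finally show ?thesis .
  qed
  have "(LINT z|lborel. of_real (A z) * riesz_radon \<psi> (snd z) (fst z)) = (LINT z|lborel. LINT \<sigma>|lborel. ?f1 z \<sigma>)"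
    unfolding riesz_radon_def by (intro Bochner_Integration.integral_cong refl integral_mult_right_zero[symmetric])
  also have "\<dots> = (LINT \<sigma>|lborel. LINT z|lborel. ?f1 z \<sigma>)" by (rule lborel_Fubini(2)[OF int1])
  also have "\<dots> = (LINT \<sigma>|lborel. LINT x|lborel. ?f3 \<sigma> x)" by (simp only: inner)
  also have "\<dots> = (LINT x|lborel. LINT \<sigma>|lborel. ?f3 \<sigma> x)" by (rule lborel_Fubini(2)[OF int3])
  also have "\<dots> = (LINT x|lborel. (LINT \<sigma>|lborel. of_real \<bar>\<sigma>\<bar> * osc A \<sigma> x) * \<psi> x)"
    by (simp only: integral_mult_left_zero)
  finally show ?thesis .
qed

lemma far_gap:
  assumes "\<delta> \<le> \<bar>s - x0 \<bullet> dir \<phi>\<bar>" "x \<in> ball x0 (\<delta> / 2)"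
  shows "\<delta> / 2 \<le> \<bar>s - x \<bullet> dir \<phi>\<bar>"
proof -
  have "\<bar>(x - x0) \<bullet> dir \<phi>\<bar> \<le> norm (x - x0)"
    using Cauchy_Schwarz_ineq2[of "x - x0" "dir \<phi>"] by simp
  also have "\<dots> < \<delta> / 2" using assms(2) by (simp add: dist_norm norm_minus_commute)
  finally have "\<bar>x \<bullet> dir \<phi> - x0 \<bullet> dir \<phi>\<bar> < \<delta> / 2" by (simp add: inner_diff_left)
  then show ?thesis using assms(1) by linarith
qed

text \<open>The quotients B / (s - x \<bullet> dir \<phi>)^n with B supported off the diagonal form
  a class closed under differentiation in x, and on the smaller ball the base of the power stays at
  least \<delta>/2 in modulus.\<close>

lemma far_smooth:
  assumes \<delta>: "\<delta> > 0" and A: "amplitude A" "\<And>z. A z \<noteq> 0 \<Longrightarrow> \<delta> \<le> \<bar>snd z - x0 \<bullet> dir (fst z)\<bar>"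
  shows "smooth_on (ball x0 (\<delta> / 2)) (\<lambda>x. LINT z|lborel. complex_of_real (- 2 / (snd z - x \<bullet> dir (fst z))\<^sup>2 * A z))"
proof -
  define \<F> where "\<F> = {F. \<exists>B n. amplitude B \<and> (\<forall>z. B z \<noteq> 0 \<longrightarrow> \<delta> \<le> \<bar>snd z - x0 \<bullet> dir (fst z)\<bar>) \<and>
    F = (\<lambda>x z. complex_of_real (B z / (snd z - x \<bullet> dir (fst z)) ^ n))}"
  let ?U = "ball x0 (\<delta> / 2)"
  have "smooth_on ?U (\<lambda>x. LINT z|lborel. complex_of_real ((- 2 * A z) / (snd z - x \<bullet> dir (fst z))\<^sup>2))"
  proof (rule smooth_on_integral_class[where \<F>="\<F>", OF open_ball])
    show "(\<lambda>x z. complex_of_real ((- 2 * A z) / (snd z - x \<bullet> dir (fst z))\<^sup>2)) \<in> \<F>"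
      unfolding \<F>_def mem_Collect_eq
      by (rule exI[of _ "\<lambda>z. - 2 * A z"], rule exI[of _ 2])
        (use A(2) amplitude_mult_continuous[OF A(1) continuous_on_const, of "-2"] in auto)
  next
    fix F assume "F \<in> \<F>"
    then obtain B n where B: "amplitude B" "\<And>z. B z \<noteq> 0 \<Longrightarrow> \<delta> \<le> \<bar>snd z - x0 \<bullet> dir (fst z)\<bar>"
      and F: "F = (\<lambda>x z. complex_of_real (B z / (snd z - x \<bullet> dir (fst z)) ^ n))"
      unfolding \<F>_def by blast
    have Bm: "B \<in> borel_measurable borel" by (rule amplitude_measurable[OF B(1)])
    have gap: "\<delta> / 2 \<le> \<bar>snd z - x \<bullet> dir (fst z)\<bar>" if "B z \<noteq> 0" "x \<in> ?U" for z x
      by (rule far_gap[OF B(2)[OF that(1)] that(2)])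
    show "\<exists>m. integrable lborel m \<and> (\<forall>x\<in>?U. F x \<in> borel_measurable lborel \<and> (\<forall>z\<in>space lborel. norm (F x z) \<le> m z))"
    proof (intro exI[of _ "\<lambda>z. \<bar>B z\<bar> / (\<delta> / 2) ^ n"] conjI ballI)
      show "integrable lborel (\<lambda>z. \<bar>B z\<bar> / (\<delta> / 2) ^ n)"
        using amplitude_integrable[OF B(1)] by (intro integrable_divide integrable_abs)
      fix x assume x: "x \<in> ?U"
      have "(\<lambda>z. snd z - x \<bullet> dir (fst z)) \<in> borel_measurable (borel :: (real \<times> real) measure)"
        by (intro borel_measurable_continuous_onI continuous_intros)
      then show "F x \<in> borel_measurable lborel" unfolding F using Bm by measurable
      show "norm (F x z) \<le> \<bar>B z\<bar> / (\<delta> / 2) ^ n" for z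
      proof (cases "B z = 0")
        case False
        have "(\<delta> / 2) ^ n \<le> \<bar>snd z - x \<bullet> dir (fst z)\<bar> ^ n" using gap[OF False x] \<delta> by (intro power_mono) auto
        moreover have "(\<delta> / 2) ^ n > 0" using \<delta> by simp
        ultimately have "\<bar>B z\<bar> / \<bar>snd z - x \<bullet> dir (fst z)\<bar> ^ n \<le> \<bar>B z\<bar> / (\<delta> / 2) ^ n"
          by (intro frac_le) auto
        then show ?thesis by (simp only: F norm_of_real abs_divide power_abs)
      qed (simp add: F)
    qed
    show "\<exists>F'. (\<forall>v. F' v \<in> \<F>) \<and> (\<forall>x\<in>?U. \<forall>z\<in>space lborel. ((\<lambda>x. F x z) has_derivative (\<lambda>v. F' v x z)) (at x))"
    proof (rule exI[of _ "\<lambda>v x z. complex_of_real ((real n * (v \<bullet> dir (fst z)) * B z) / (snd z - x \<bullet> dir (fst z)) ^ Suc n)"],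
        intro conjI allI ballI)
      fix v :: "real^2"
      have "amplitude (\<lambda>z. real n * (v \<bullet> dir (fst z)) * B z)"
        by (rule amplitude_mult_continuous[OF B(1)]) (intro continuous_intros)
      then show "(\<lambda>x z. complex_of_real ((real n * (v \<bullet> dir (fst z)) * B z) / (snd z - x \<bullet> dir (fst z)) ^ Suc n)) \<in> \<F>"
        unfolding \<F>_def mem_Collect_eq using B(2)
        by (intro exI[of _ "\<lambda>z. real n * (v \<bullet> dir (fst z)) * B z"] exI[of _ "Suc n"]) auto
    next
      fix x z assume x: "x \<in> ?U"
      show "((\<lambda>x. F x z) has_derivative (\<lambda>v. complex_of_real ((real n * (v \<bullet> dir (fst z)) * B z) / (snd z - x \<bullet> dir (fst z)) ^ Suc n))) (at x)"
      proof (cases "B z = 0")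
        case False
        let ?y = "snd z - x \<bullet> dir (fst z)"
        have y: "?y \<noteq> 0" using gap[OF False x] \<delta> by auto
        have d: "DERIV (\<lambda>y. B z / y ^ n) y :> - (real n * B z) / y ^ Suc n" if "y \<noteq> 0" for y
        proof (cases n)
          case (Suc m)
          have "((\<lambda>y. y ^ Suc m) has_real_derivative (1 + real m) * y ^ m) (at y)"
            using DERIV_pow[of "Suc m" y] by simp
          from DERIV_divide[OF DERIV_const this, of "B z"] that
          have "((\<lambda>y. B z / y ^ Suc m) has_real_derivative
              (0 * y ^ Suc m - B z * ((1 + real m) * y ^ m)) / (y ^ Suc m * y ^ Suc m)) (at y)" by simp
          also have "(0 * y ^ Suc m - B z * ((1 + real m) * y ^ m)) / (y ^ Suc m * y ^ Suc m) = - (real n * B z) / y ^ Suc n"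
            using that by (simp add: Suc field_simps)
          finally show ?thesis by (simp only: Suc)
        qed (auto intro!: derivative_eq_intros)
        have "((\<lambda>x. snd z - x \<bullet> dir (fst z)) has_derivative (\<lambda>v. - (v \<bullet> dir (fst z)))) (at x)"
          by (auto intro!: derivative_eq_intros)
        from DERIV_compose_FDERIV[OF d[OF y] this]
        have "((\<lambda>x. B z / (snd z - x \<bullet> dir (fst z)) ^ n) has_derivative
            (\<lambda>v. (real n * (v \<bullet> dir (fst z)) * B z) / (snd z - x \<bullet> dir (fst z)) ^ Suc n)) (at x)"
          by (simp add: mult_ac)
        then show ?thesis unfolding F by (rule has_derivative_of_real)
      qed (simp add: F)
    qed
  qed
  then show ?thesis by (simp only: times_divide_eq_left)
qed

text \<open>By \<open>riesz_radon_far\<close> the kernel is explicit and bounded on the supports, so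
  a single exchange of integrals suffices.\<close>

lemma far_pairing:
  assumes \<delta>: "\<delta> > 0" and A: "amplitude A" "\<And>z. A z \<noteq> 0 \<Longrightarrow> \<delta> \<le> \<bar>snd z - x0 \<bullet> dir (fst z)\<bar>"
    and \<psi>: "test_function_on UNIV \<psi>" and supp: "\<And>x. \<psi> x \<noteq> 0 \<Longrightarrow> x \<in> ball x0 (\<delta> / 2)"
  shows "(LINT z|lborel. of_real (A z) * riesz_radon \<psi> (snd z) (fst z))
    = (LINT x|lborel. (LINT z|lborel. of_real (- 2 / (snd z - x \<bullet> dir (fst z))\<^sup>2 * A z)) * \<psi> x)"
proof -
  let ?f = "\<lambda>z x. complex_of_real (- 2 / (snd z - x \<bullet> dir (fst z))\<^sup>2 * A z) * \<psi> x"
  have gap: "\<delta> / 2 \<le> \<bar>snd z - x \<bullet> dir (fst z)\<bar>" if "A z \<noteq> 0" "\<psi> x \<noteq> 0" for z x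
    by (rule far_gap[OF A(2)[OF that(1)] supp[OF that(2)]])
  have int: "integrable lborel (\<lambda>p. ?f (fst p) (snd p))"
  proof (rule integrable_lborel_prod_dominated[where g="\<lambda>z. 2 / (\<delta> / 2)\<^sup>2 * \<bar>A z\<bar>" and h="\<lambda>x. norm (\<psi> x)"])
    have [measurable]: "(\<lambda>p. A (fst p)) \<in> borel_measurable (borel :: ((real \<times> real) \<times> (real^2)) measure)"
      by (rule measurable_compose[OF _ amplitude_measurable[OF A(1)]]) (intro borel_measurable_continuous_onI continuous_intros)
    have [measurable]: "(\<lambda>p. \<psi> (snd p)) \<in> borel_measurable (borel :: ((real \<times> real) \<times> (real^2)) measure)"
      by (intro borel_measurable_continuous_onI continuous_intros continuous_on_compose2[OF test_function_continuous[OF \<psi>, of UNIV]]) auto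
    have [measurable]: "(\<lambda>p. snd (fst p) - snd p \<bullet> dir (fst (fst p))) \<in> borel_measurable (borel :: ((real \<times> real) \<times> (real^2)) measure)"
      by (intro borel_measurable_continuous_onI continuous_intros)
    show "(\<lambda>p. ?f (fst p) (snd p)) \<in> borel_measurable borel" by measurable
    show "integrable lborel (\<lambda>z. 2 / (\<delta> / 2)\<^sup>2 * \<bar>A z\<bar>)"
      using amplitude_integrable[OF A(1)] by (intro integrable_mult_right integrable_abs)
    show "integrable lborel (\<lambda>x. norm (\<psi> x))" using test_function_integrable[OF \<psi>] by (rule integrable_norm)
    show "norm (?f z x) \<le> 2 / (\<delta> / 2)\<^sup>2 * \<bar>A z\<bar> * norm (\<psi> x)" for z x
    proof (cases "A z = 0 \<or> \<psi> x = 0")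
      case False
      let ?y = "snd z - x \<bullet> dir (fst z)"
      have g: "\<delta> / 2 \<le> \<bar>?y\<bar>" using gap False by auto
      have "(\<delta> / 2)\<^sup>2 \<le> \<bar>?y\<bar>\<^sup>2" by (rule power_mono[OF g]) (use \<delta> in auto)
      moreover have "(\<delta> / 2)\<^sup>2 > 0" using \<delta> by simp
      ultimately have "2 / \<bar>?y\<bar>\<^sup>2 \<le> 2 / (\<delta> / 2)\<^sup>2" by (intro frac_le) auto
      then have "2 / \<bar>?y\<bar>\<^sup>2 * \<bar>A z\<bar> * norm (\<psi> x) \<le> 2 / (\<delta> / 2)\<^sup>2 * \<bar>A z\<bar> * norm (\<psi> x)"
        by (intro mult_right_mono) auto
      moreover have "norm (?f z x) = 2 / \<bar>?y\<bar>\<^sup>2 * \<bar>A z\<bar> * norm (\<psi> x)"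
        by (simp only: norm_mult norm_of_real abs_mult abs_divide abs_minus_cancel abs_numeral power2_abs abs_power2)
      ultimately show ?thesis by simp
    qed auto
  qed
  have "(LINT z|lborel. of_real (A z) * riesz_radon \<psi> (snd z) (fst z)) = (LINT z|lborel. LINT x|lborel. ?f z x)"
  proof (rule Bochner_Integration.integral_cong[OF refl])
    fix z
    show "of_real (A z) * riesz_radon \<psi> (snd z) (fst z) = (LINT x|lborel. ?f z x)"
    proof (cases "A z = 0")
      case False
      have "riesz_radon \<psi> (snd z) (fst z) = (LINT x|lborel. of_real (- 2 / (snd z - x \<bullet> dir (fst z))\<^sup>2) * \<psi> x)"
        by (rule riesz_radon_far[OF \<psi>, where \<delta>="\<delta> / 2"]) (use \<delta> gap[OF False] in auto)
      then have "of_real (A z) * riesz_radon \<psi> (snd z) (fst z) = (LINT x|lborel. of_real (A z) * (of_real (- 2 / (snd z - x \<bullet> dir (fst z))\<^sup>2) * \<psi> x))"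
        by (simp only: integral_mult_right_zero)
      also have "\<dots> = (LINT x|lborel. ?f z x)"
        by (intro Bochner_Integration.integral_cong refl) (simp add: mult_ac)
      finally show ?thesis .
    qed simp
  qed
  also have "\<dots> = (LINT x|lborel. LINT z|lborel. ?f z x)" by (rule lborel_Fubini(2)[OF int])
  also have "\<dots> = (LINT x|lborel. (LINT z|lborel. of_real (- 2 / (snd z - x \<bullet> dir (fst z))\<^sup>2 * A z)) * \<psi> x)"
    by (simp only: integral_mult_left_zero)
  finally show ?thesis .
qed

section \<open>The metal artifact\<close>

lemma dir_add_pi: "dir (\<phi> + pi) = - dir \<phi>"
  by (simp add: vec_eq_iff forall_2)

lemma line_point_add_pi: "line_point (\<phi> + pi) (- s) u = line_point \<phi> s (- u)"
  by (simp add: vec_eq_iff forall_2 line_point_nth)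

lemma integral_reflect:
  fixes f :: "real \<Rightarrow> 'b::{banach, second_countable_topology}"
  shows "(LINT u|lborel. f (- u)) = (LINT u|lborel. f u)"
  using lborel_integral_real_affine[of "-1" f 0] by simp

lemma radon_add_pi:
  fixes f :: "real^2 \<Rightarrow> 'b::{banach, second_countable_topology}"
  assumes "f \<in> borel_measurable borel"
  shows "radon f (- s) (dir (\<phi> + pi)) = radon f s (dir \<phi>)"
  unfolding radon_line_point[OF assms] line_point_add_pi by (rule integral_reflect)

text \<open>The two descriptions of a line agree: turning the angle by pi negates the frequency, and
  |\<sigma>| is even.\<close>

lemma riesz_radon_add_pi: "riesz_radon \<psi> (- s) (\<phi> + pi) = riesz_radon \<psi> s \<phi>"
proof -
  have "plane_fourier \<psi> \<sigma> (\<phi> + pi) = plane_fourier \<psi> (- \<sigma>) \<phi>" for \<sigma>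
    by (simp add: plane_fourier_def dir_add_pi)
  then have "riesz_radon \<psi> (- s) (\<phi> + pi)
      = (LINT \<sigma>|lborel. of_real \<bar>- \<sigma>\<bar> * plane_fourier \<psi> (- \<sigma>) \<phi> * cis (- \<sigma> * s))"
    by (simp add: riesz_radon_def)
  also have "\<dots> = riesz_radon \<psi> s \<phi>"
    unfolding riesz_radon_def by (rule integral_reflect)
  finally show ?thesis .
qed

lemma riesz_radon_measurable:
  assumes "test_function_on UNIV \<psi>"
  shows "(\<lambda>z. riesz_radon \<psi> (snd z) (fst z)) \<in> borel_measurable borel"
  unfolding riesz_radon_def
proof (rule borel_measurable_inner_param[where f="\<lambda>z \<sigma>. of_real \<bar>\<sigma>\<bar> * plane_fourier \<psi> \<sigma> (fst z) * cis (\<sigma> * snd z)"])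
  have "(\<lambda>p. plane_fourier \<psi> (snd p) (fst (fst p))) \<in> borel_measurable (borel :: ((real \<times> real) \<times> real) measure)"
    using measurable_compose[OF _ plane_fourier_measurable[OF assms], of "\<lambda>p. (snd p, fst (fst p))" "borel :: ((real \<times> real) \<times> real) measure"]
    by (simp add: borel_measurable_continuous_onI continuous_intros)
  moreover have "(\<lambda>p. cis (snd p * snd (fst p))) \<in> borel_measurable (borel :: ((real \<times> real) \<times> real) measure)"
    "(\<lambda>p. complex_of_real \<bar>snd p\<bar>) \<in> borel_measurable (borel :: ((real \<times> real) \<times> real) measure)"
    by (intro borel_measurable_continuous_onI continuous_intros)+
  ultimately show "(\<lambda>p. of_real \<bar>snd p\<bar> * plane_fourier \<psi> (snd p) (fst (fst p)) * cis (snd p * snd (fst p)))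
      \<in> borel_measurable (borel :: ((real \<times> real) \<times> real) measure)"
    by (intro borel_measurable_times)
qed

lemma riesz_radon_bounded:
  assumes "test_function_on UNIV \<psi>"
  obtains C where "\<And>s \<phi>. norm (riesz_radon \<psi> s \<phi>) \<le> C"
proof -
  obtain C where C: "C > 0" "\<And>\<sigma> \<phi>. \<bar>\<sigma>\<bar> * norm (plane_fourier \<psi> \<sigma> \<phi>) \<le> C * (1 / (1 + \<sigma>\<^sup>2))"
    using riesz_radon_dominated[OF assms] by metis
  have "norm (riesz_radon \<psi> s \<phi>) \<le> (LINT \<sigma>|lborel. C * (1 / (1 + \<sigma>\<^sup>2)))" for s \<phi>
    unfolding riesz_radon_def
  proof (rule order_trans[OF integral_norm_bound], rule integral_mono)
    show "integrable lborel (\<lambda>\<sigma>. norm (of_real \<bar>\<sigma>\<bar> * plane_fourier \<psi> \<sigma> \<phi> * cis (\<sigma> * s)))"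
      by (rule integrable_norm[OF riesz_radon_integrable[OF assms]])
    show "integrable lborel (\<lambda>\<sigma>. C * (1 / (1 + \<sigma>\<^sup>2)))"
      by (intro integrable_mult_right integrable_inverse_1_plus_square)
    show "norm (of_real \<bar>\<sigma>\<bar> * plane_fourier \<psi> \<sigma> \<phi> * cis (\<sigma> * s)) \<le> C * (1 / (1 + \<sigma>\<^sup>2))" for \<sigma>
      using C(2)[of \<sigma> \<phi>] by (simp add: norm_mult)
  qed
  then show ?thesis by (rule that)
qed

text \<open>
  The translates of the cutoff by multiples of \<open>\<pi>\<close> sum to one.
\<close>

lemma integral_period_smooth_cutoff:
  fixes K :: "real \<Rightarrow> complex"
  assumes \<rho>: "0 < \<rho>" "\<rho> < pi" and Km: "K \<in> borel_measurable borel" and KB: "\<And>\<phi>. norm (K \<phi>) \<le> B"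
    and per: "\<And>\<phi>. K (\<phi> + pi) = K \<phi>"
  shows "(LINT \<phi>:{0..pi}|lborel. K \<phi>) = (LINT \<phi>|lborel. of_real (smooth_step \<rho> \<phi> - smooth_step \<rho> (\<phi> - pi)) * K \<phi>)"
proof -
  \<comment> \<open>Smooth minus sharp step, supported in \<open>{0..\<rho>}\<close>. The smooth
    cutoff minus the indicator of \<open>{0..<pi}\<close> is E(\<phi>) - E(\<phi> - pi), and by
    periodicity of K its two terms have equal integrals against K.\<close>
  define E where "E \<phi> = smooth_step \<rho> \<phi> - indicat_real {0..} \<phi>" for \<phi>
  have Sm [measurable]: "smooth_step \<rho> \<in> borel_measurable borel"
    by (intro borel_measurable_continuous_onI smooth1_continuous_on smooth1_smooth_step \<rho>)
  have Em [measurable]: "E \<in> borel_measurable borel" unfolding E_def by measurable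
  note Km [measurable]
  have E0: "E \<phi> = 0" if "\<phi> \<notin> {0..\<rho>}" for \<phi>
    using that smooth_step_eq_0[OF \<rho>(1), of \<phi>] smooth_step_eq_1[OF \<rho>(1), of \<phi>] by (auto simp: E_def indicator_def)
  have E2: "\<bar>E \<phi>\<bar> \<le> 2" for \<phi>
    using smooth_step_bounded[OF \<rho>(1), of \<phi>] by (auto simp: E_def indicator_def)
  have intEK: "integrable lborel (\<lambda>\<phi>. of_real (E \<phi>) * K \<phi>)"
  proof (rule integrable_bounded_support[of _ "{0..\<rho>}"])
    show "norm (of_real (E \<phi>) * K \<phi>) \<le> 2 * B" for \<phi>
      using E2[of \<phi>] KB[of \<phi>] by (simp add: norm_mult mult_mono)
  qed (use E0 in auto)
  have shift: "(\<lambda>\<phi>. of_real (E (\<phi> - pi)) * K \<phi>) = (\<lambda>\<phi>. (\<lambda>\<phi>. of_real (E \<phi>) * K \<phi>) (- pi + 1 * \<phi>))"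
    using per[of "_ - pi"] by (auto simp: fun_eq_iff)
  have intEK': "integrable lborel (\<lambda>\<phi>. of_real (E (\<phi> - pi)) * K \<phi>)"
    unfolding shift by (rule lborel_integrable_real_affine[OF intEK]) simp
  have eqEK: "(LINT \<phi>|lborel. of_real (E (\<phi> - pi)) * K \<phi>) = (LINT \<phi>|lborel. of_real (E \<phi>) * K \<phi>)"
    unfolding shift using lborel_integral_real_affine[of 1 "\<lambda>\<phi>. of_real (E \<phi>) * K \<phi>" "- pi"] by simp
  have int0: "integrable lborel (\<lambda>\<phi>. of_real (indicat_real {0..<pi} \<phi>) * K \<phi>)"
  proof (rule integrable_bounded_support[of _ "{0..pi}"])
    show "norm (of_real (indicat_real {0..<pi} \<phi>) * K \<phi>) \<le> B" for \<phi>
      using KB[of \<phi>] order_trans[OF norm_ge_zero KB] by (auto simp: indicator_def)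
  qed auto
  have "(LINT \<phi>|lborel. of_real (smooth_step \<rho> \<phi> - smooth_step \<rho> (\<phi> - pi)) * K \<phi>)
      = (LINT \<phi>|lborel. of_real (indicat_real {0..<pi} \<phi>) * K \<phi> + (of_real (E \<phi>) * K \<phi> - of_real (E (\<phi> - pi)) * K \<phi>))"
    using pi_gt_zero by (intro Bochner_Integration.integral_cong refl) (auto simp: E_def indicator_def algebra_simps simp del: pi_gt_zero)
  also have "\<dots> = (LINT \<phi>|lborel. of_real (indicat_real {0..<pi} \<phi>) * K \<phi>)"
    by (simp add: Bochner_Integration.integral_add Bochner_Integration.integral_diff int0 intEK intEK' eqEK)
  also have "\<dots> = (LINT \<phi>:{0..pi}|lborel. K \<phi>)"
    unfolding set_lebesgue_integral_def
  proof (rule integral_cong_AE)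
    have "AE \<phi> in lborel. \<phi> \<noteq> pi" by (rule AE_lborel_singleton)
    then show "AE \<phi> in lborel. of_real (indicat_real {0..<pi} \<phi>) * K \<phi> = indicat_real {0..pi} \<phi> *\<^sub>R K \<phi>"
      by eventually_elim (auto simp: indicator_def)
  qed auto
  finally show ?thesis by simp
qed

lemma smooth_on_times_test_function_integrable:
  assumes g: "smooth_on U g" and \<psi>: "test_function_on U \<psi>"
  shows "integrable lborel (\<lambda>x. g x * \<psi> x :: complex)"
proof -
  let ?K = "closure {x. \<psi> x \<noteq> 0}"
  have K: "compact ?K" "?K \<subseteq> U" using \<psi> by (auto simp: test_function_on_def)
  have "cdiff_on 0 U g" using g unfolding smooth_on_def by blast
  then have "continuous_on ?K g" using K(2) by (auto intro: continuous_on_subset)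
  moreover have "continuous_on ?K \<psi>"
    by (rule test_function_continuous) (use \<psi> in \<open>auto simp: test_function_on_def\<close>)
  ultimately have "integrable lborel (\<lambda>x. indicator ?K x *\<^sub>R (g x * \<psi> x))"
    by (intro borel_integrable_compact K continuous_intros)
  also have "(\<lambda>x. indicator ?K x *\<^sub>R (g x * \<psi> x)) = (\<lambda>x. g x * \<psi> x)"
    using closure_subset[of "{x. \<psi> x \<noteq> 0}"] by (auto simp: fun_eq_iff indicator_def)
  finally show ?thesis .
qed

text \<open>D lies in a ball of radius M about the origin, so the chord length is at most 2 M and
  lines with |s| > M miss D; there the value is \<open>log_sinhc \<epsilon> 0 = 0\<close>.\<close>

lemma P_MA_props:
  fixes D :: "(real^2) set" and \<alpha> \<epsilon> :: real
  assumes D: "open D" "bounded D"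
  defines "P \<equiv> \<lambda>s \<phi>. P_MA \<epsilon> (\<lambda>x. \<alpha> * indicator D x) s (dir \<phi>)"
  obtains B M where "(\<lambda>z. P (snd z) (fst z)) \<in> borel_measurable borel" "\<And>s \<phi>. \<bar>P s \<phi>\<bar> \<le> B"
    "\<And>s \<phi>. M < \<bar>s\<bar> \<Longrightarrow> P s \<phi> = 0" "\<And>s \<phi>. P (- s) (\<phi> + pi) = P s \<phi>"
proof -
  obtain M where M: "M > 0" "D \<subseteq> ball 0 M" using D(2) bounded_subset_ballD[of D 0] by auto
  have [measurable]: "D \<in> sets borel" using D by simp
  have fm: "(\<lambda>x. \<alpha> * indicat_real D x) \<in> borel_measurable borel" by measurable
  define r where "r s \<phi> = (LINT u|lborel. \<alpha> * indicat_real D (line_point \<phi> s u))" for s \<phi>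
  have P: "P s \<phi> = log_sinhc \<epsilon> (r s \<phi>)" for s \<phi>
    by (simp add: P_def P_MA_def radon_line_point[OF fm] r_def)
  have out: "line_point \<phi> s u \<notin> D" if "M < \<bar>s\<bar> \<or> M < \<bar>u\<bar>" for \<phi> s u
    using that abs_le_norm_line_point[of u \<phi> s] abs_le_norm_line_point(2)[of s \<phi> u] M(2) by (force simp: subset_iff)
  have rm: "(\<lambda>z. r (snd z) (fst z)) \<in> borel_measurable borel"
    unfolding r_def
  proof (rule borel_measurable_inner_param[where f="\<lambda>z u. \<alpha> * indicat_real D (line_point (fst z) (snd z) u)"])
    have "(\<lambda>p. line_point (fst (fst p)) (snd (fst p)) (snd p)) \<in> borel_measurable (borel :: ((real \<times> real) \<times> real) measure)"
      by (intro borel_measurable_continuous_onI continuous_intros)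
    from measurable_compose[OF this fm]
    show "(\<lambda>p. \<alpha> * indicat_real D (line_point (fst (fst p)) (snd (fst p)) (snd p))) \<in> borel_measurable (borel :: ((real \<times> real) \<times> real) measure)" .
  qed
  have rb: "\<bar>r s \<phi>\<bar> \<le> \<bar>\<alpha>\<bar> * (2 * M)" for s \<phi>
  proof -
    have "norm (r s \<phi>) \<le> (LINT u|lborel. norm (\<alpha> * indicat_real D (line_point \<phi> s u)))"
      unfolding r_def by (rule integral_norm_bound)
    also have "\<dots> \<le> (LINT u|lborel. \<bar>\<alpha>\<bar> * indicat_real {-M..M} u)"
    proof (rule integral_mono)
      show "integrable lborel (\<lambda>u. \<bar>\<alpha>\<bar> * indicat_real {-M..M} u)"
        by (intro integrable_mult_right integrable_real_indicator) (auto simp: emeasure_lborel_Icc_eq)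
      then show "integrable lborel (\<lambda>u. norm (\<alpha> * indicat_real D (line_point \<phi> s u)))"
      proof (rule Bochner_Integration.integrable_bound)
        show "AE u in lborel. norm (norm (\<alpha> * indicat_real D (line_point \<phi> s u))) \<le> norm (\<bar>\<alpha>\<bar> * indicat_real {-M..M} u)"
          using out[of s _ \<phi>] by (intro AE_I2) (force simp: indicator_def abs_mult not_le abs_le_iff)
      qed measurable
      show "norm (\<alpha> * indicat_real D (line_point \<phi> s u)) \<le> \<bar>\<alpha>\<bar> * indicat_real {-M..M} u" for u
        using out[of s u \<phi>] by (force simp: indicator_def abs_mult not_le abs_le_iff)
    qed
    also have "\<dots> = \<bar>\<alpha>\<bar> * (2 * M)" using M(1) by simp
    finally show ?thesis by simp
  qed
  obtain B where B: "\<And>x. x \<in> {- (\<bar>\<alpha>\<bar> * (2 * M))..\<bar>\<alpha>\<bar> * (2 * M)} \<Longrightarrow> \<bar>log_sinhc \<epsilon> x\<bar> \<le> B"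
    using continuous_bounded_on_interval[OF smooth1_continuous_on[OF smooth1_log_sinhc]] by metis
  show ?thesis
  proof (rule that[of B M])
    have "log_sinhc \<epsilon> \<in> borel_measurable borel"
      by (intro borel_measurable_continuous_onI smooth1_continuous_on smooth1_log_sinhc)
    from measurable_compose[OF rm this] show "(\<lambda>z. P (snd z) (fst z)) \<in> borel_measurable borel" by (simp add: P)
    show "\<bar>P s \<phi>\<bar> \<le> B" for s \<phi> unfolding P using rb[of s \<phi>] by (intro B) (auto simp: abs_le_iff)
    show "P s \<phi> = 0" if "M < \<bar>s\<bar>" for s \<phi>
    proof -
      have "r s \<phi> = 0" unfolding r_def using out that by simp
      then show ?thesis by (simp add: P log_sinhc_def)
    qed
    show "P (- s) (\<phi> + pi) = P s \<phi>" for s \<phi>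
      unfolding P_def P_MA_def radon_add_pi[OF fm] ..
  qed
qed

lemma amplitude_P_MA:
  fixes D :: "(real^2) set" and \<alpha> \<epsilon> :: real
  assumes D: "open D" "bounded D" and \<rho>: "0 < \<rho>" "\<rho> < pi"
  defines "P \<equiv> \<lambda>s \<phi>. P_MA \<epsilon> (\<lambda>x. \<alpha> * indicator D x) s (dir \<phi>)"
  defines "A \<equiv> \<lambda>z. 1 / (4 * pi\<^sup>2) * (smooth_step \<rho> (fst z) - smooth_step \<rho> (fst z - pi)) * P (snd z) (fst z)"
  shows "amplitude A"
proof -
  let ?S = "smooth_step \<rho>" and ?k = "1 / (4 * pi\<^sup>2) :: real"
  obtain B M where Pm: "(\<lambda>z. P (snd z) (fst z)) \<in> borel_measurable borel" and PB: "\<And>s \<phi>. \<bar>P s \<phi>\<bar> \<le> B"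
    and PM: "\<And>s \<phi>. M < \<bar>s\<bar> \<Longrightarrow> P s \<phi> = 0"
    unfolding P_def by (rule P_MA_props[OF D]) blast
  have contS: "continuous_on UNIV ?S" by (intro smooth1_continuous_on smooth1_smooth_step \<rho>)
  \<comment> \<open>The cutoff itself vanishes for angles outside \<open>{0..pi + \<rho>}\<close>;
    the inserted indicator only makes the bounded support visible.\<close>
  have "amplitude (\<lambda>z. (?k * (?S (fst z) - ?S (fst z - pi))) * (indicator {0..pi + \<rho>} (fst z) * P (snd z) (fst z)))"
  proof (rule amplitude_mult_continuous[OF amplitude_strip[OF Pm PB, of M]])
    show "P s \<phi> = 0" if "M < \<bar>s\<bar>" for s \<phi> using that by (rule PM)
    show "continuous_on UNIV (\<lambda>z::real \<times> real. ?k * (?S (fst z) - ?S (fst z - pi)))"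
      by (intro continuous_intros continuous_on_compose2[OF contS]) auto
  qed
  also have "(\<lambda>z. (?k * (?S (fst z) - ?S (fst z - pi))) * (indicator {0..pi + \<rho>} (fst z) * P (snd z) (fst z))) = A"
  proof
    fix z :: "real \<times> real"
    have "?S (fst z) - ?S (fst z - pi) = 0" if "fst z \<notin> {0..pi + \<rho>}"
      using that smooth_step_eq_0[OF \<rho>(1), of "fst z"] smooth_step_eq_0[OF \<rho>(1), of "fst z - pi"]
        smooth_step_eq_1[OF \<rho>(1), of "fst z"] smooth_step_eq_1[OF \<rho>(1), of "fst z - pi"] \<rho>
      by (cases "fst z < 0") auto
    then show "(?k * (?S (fst z) - ?S (fst z - pi))) * (indicator {0..pi + \<rho>} (fst z) * P (snd z) (fst z)) = A z"
      by (cases "fst z \<in> {0..pi + \<rho>}") (auto simp: A_def)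
  qed
  finally show "amplitude A" .
qed

lemma amplitude_riesz_integrable:
  assumes A: "amplitude A" and \<psi>: "test_function_on UNIV \<psi>"
  shows "integrable lborel (\<lambda>z. of_real (A z) * riesz_radon \<psi> (snd z) (fst z))"
proof -
  obtain C where C: "\<And>s \<phi>. norm (riesz_radon \<psi> s \<phi>) \<le> C" using riesz_radon_bounded[OF \<psi>] by metis
  show ?thesis
  proof (rule Bochner_Integration.integrable_bound)
    show "integrable lborel (\<lambda>z. A z * C)" using amplitude_integrable[OF A] by simp
    show "AE z in lborel. norm (of_real (A z) * riesz_radon \<psi> (snd z) (fst z)) \<le> norm (A z * C)"
      using order_trans[OF C abs_ge_self] by (intro AE_I2) (simp add: norm_mult abs_mult mult_left_mono)
    show "(\<lambda>z. of_real (A z) * riesz_radon \<psi> (snd z) (fst z)) \<in> borel_measurable lborel"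
      using amplitude_measurable[OF A] riesz_radon_measurable[OF \<psi>] by measurable
  qed
qed

text \<open>Both factors are even functions of the line, so the integral \<open>K\<close> over s is
  pi-periodic in the angle, as the exchange of cutoffs requires. The constant 1 / (4 pi^2) of the
  filter is moved into the amplitude.\<close>

lemma f_MA_smooth_cutoff:
  fixes D :: "(real^2) set" and \<alpha> \<epsilon> :: real
  assumes D: "open D" "bounded D" and \<psi>: "test_function_on UNIV \<psi>" and \<rho>: "0 < \<rho>" "\<rho> < pi"
  defines "P \<equiv> \<lambda>s \<phi>. P_MA \<epsilon> (\<lambda>x. \<alpha> * indicator D x) s (dir \<phi>)"
  defines "A \<equiv> \<lambda>z. 1 / (4 * pi\<^sup>2) * (smooth_step \<rho> (fst z) - smooth_step \<rho> (fst z - pi)) * P (snd z) (fst z)"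
  shows "f_MA \<epsilon> (\<lambda>x. \<alpha> * indicator D x) \<psi> = (LINT z|lborel. of_real (A z) * riesz_radon \<psi> (snd z) (fst z))"
proof -
  let ?S = "smooth_step \<rho>" and ?k = "1 / (4 * pi\<^sup>2) :: real"
  obtain B M where Pm: "(\<lambda>z. P (snd z) (fst z)) \<in> borel_measurable borel" and PB: "\<And>s \<phi>. \<bar>P s \<phi>\<bar> \<le> B"
    and PM: "\<And>s \<phi>. M < \<bar>s\<bar> \<Longrightarrow> P s \<phi> = 0" and Ppi: "\<And>s \<phi>. P (- s) (\<phi> + pi) = P s \<phi>"
    unfolding P_def by (rule P_MA_props[OF D]) blast
  obtain C where C: "\<And>s \<phi>. norm (riesz_radon \<psi> s \<phi>) \<le> C" using riesz_radon_bounded[OF \<psi>] by metis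
  have A: "amplitude A" unfolding A_def P_def by (rule amplitude_P_MA[OF D \<rho>])
  define K where "K \<phi> = (LINT s|lborel. of_real (P s \<phi>) * riesz_radon \<psi> s \<phi>)" for \<phi>
  have PRm: "(\<lambda>z. of_real (P (snd z) (fst z)) * riesz_radon \<psi> (snd z) (fst z)) \<in> borel_measurable borel"
    using Pm riesz_radon_measurable[OF \<psi>] by measurable
  have "K \<in> borel_measurable borel"
    unfolding K_def by (rule borel_measurable_inner_param[OF PRm])
  moreover have "norm (K \<phi>) \<le> (LINT s|lborel. (\<bar>B\<bar> * \<bar>C\<bar>) * indicat_real {-M..M} s)" for \<phi>
  \<comment> \<open>If the integrand were not integrable, its Bochner integral would be 0 by
    convention and the bound would still hold.\<close>
  proof (cases "integrable lborel (\<lambda>s. of_real (P s \<phi>) * riesz_radon \<psi> s \<phi>)")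
    case True
    show ?thesis unfolding K_def
    proof (rule order_trans[OF integral_norm_bound], rule integral_mono)
      show "integrable lborel (\<lambda>s. (\<bar>B\<bar> * \<bar>C\<bar>) * indicat_real {-M..M} s)"
        by (intro integrable_mult_right integrable_real_indicator) (auto simp: emeasure_lborel_Icc_eq)
      show "norm (of_real (P s \<phi>) * riesz_radon \<psi> s \<phi>) \<le> (\<bar>B\<bar> * \<bar>C\<bar>) * indicat_real {-M..M} s" for s
      proof (cases "M < \<bar>s\<bar>")
        case False
        then have "s \<in> {-M..M}" by auto
        moreover have "\<bar>P s \<phi>\<bar> * norm (riesz_radon \<psi> s \<phi>) \<le> \<bar>B\<bar> * \<bar>C\<bar>"
          using PB[of s \<phi>] C[of s \<phi>] by (intro mult_mono) auto
        ultimately show ?thesis by (simp add: norm_mult)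
      qed (simp add: PM)
    qed (use True in auto)
  qed (simp add: K_def not_integrable_integral_eq)
  moreover have "K (\<phi> + pi) = K \<phi>" for \<phi>
  proof -
    have "K (\<phi> + pi) = (LINT s|lborel. of_real (P (- s) (\<phi> + pi)) * riesz_radon \<psi> (- s) (\<phi> + pi))"
      unfolding K_def by (rule integral_reflect[symmetric])
    then show ?thesis by (simp only: Ppi riesz_radon_add_pi K_def)
  qed
  ultimately have per: "(LINT \<phi>:{0..pi}|lborel. K \<phi>) = (LINT \<phi>|lborel. of_real (?S \<phi> - ?S (\<phi> - pi)) * K \<phi>)"
    by (rule integral_period_smooth_cutoff[OF \<rho>])
  note int = amplitude_riesz_integrable[OF A \<psi>]
  have "f_MA \<epsilon> (\<lambda>x. \<alpha> * indicator D x) \<psi> = (LINT \<phi>:{0..pi}|lborel. of_real ?k * K \<phi>)"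
  proof -
    have "(LINT s|lborel. of_real (P s \<phi>) * riesz (radon \<psi>) s (dir \<phi>)) = of_real ?k * K \<phi>" for \<phi>
      unfolding riesz_radon_eq[OF \<psi>] K_def
      by (subst integral_mult_right_zero[symmetric]) (simp add: mult_ac)
    then show ?thesis
      by (simp add: f_MA_def backproj_distr_def riesz_distr_def line_distr_def P_def)
  qed
  also have "\<dots> = of_real ?k * (LINT \<phi>:{0..pi}|lborel. K \<phi>)"
    by (rule set_integral_mult_right)
  also have "\<dots> = (LINT \<phi>|lborel. of_real ?k * (of_real (?S \<phi> - ?S (\<phi> - pi)) * K \<phi>))"
    unfolding per by (rule integral_mult_right_zero[symmetric])
  also have "\<dots> = (LINT \<phi>|lborel. LINT s|lborel. of_real (A (\<phi>, s)) * riesz_radon \<psi> s \<phi>)"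
  proof (rule Bochner_Integration.integral_cong[OF refl])
    fix \<phi>
    have "(LINT s|lborel. of_real (A (\<phi>, s)) * riesz_radon \<psi> s \<phi>)
        = (LINT s|lborel. of_real (?k * (?S \<phi> - ?S (\<phi> - pi))) * (of_real (P s \<phi>) * riesz_radon \<psi> s \<phi>))"
      by (intro Bochner_Integration.integral_cong refl) (simp add: A_def mult_ac)
    also have "\<dots> = of_real (?k * (?S \<phi> - ?S (\<phi> - pi))) * K \<phi>"
      unfolding K_def by (rule integral_mult_right_zero)
    finally show "of_real ?k * (of_real (?S \<phi> - ?S (\<phi> - pi)) * K \<phi>) = (LINT s|lborel. of_real (A (\<phi>, s)) * riesz_radon \<psi> s \<phi>)"
      by (simp only: of_real_mult mult.assoc)
  qed
  also have "\<dots> = (LINT z|lborel. of_real (A z) * riesz_radon \<psi> (snd z) (fst z))"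
    using lborel_Fubini(1)[of "\<lambda>\<phi> s. of_real (A (\<phi>, s)) * riesz_radon \<psi> s \<phi>"] int by simp
  finally show "f_MA \<epsilon> (\<lambda>x. \<alpha> * indicator D x) \<psi> = (LINT z|lborel. of_real (A z) * riesz_radon \<psi> (snd z) (fst z))" .
qed

theorem theorem1p1:
  fixes D :: "(real^2) set" and \<gamma> :: "real \<Rightarrow> real^2" and l \<alpha> \<epsilon> :: real
  assumes "open D" and "bounded D" and "D \<noteq> {}" and "simply_connected D"
    and "smooth_simple_closed_curve \<gamma> l" and "frontier D = range \<gamma>"
    and "cond_A1 \<gamma>" and "cond_A2 \<gamma>"
    and "\<alpha> > 0" and "\<epsilon> > 0"
  shows "sing_supp (f_MA \<epsilon> (\<lambda>x. \<alpha> * indicator D x)) \<subseteq> \<Union> (special_lines \<gamma>) \<union> frontier D"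
proof (rule subsetI, rule ccontr)
  fix x0 assume sing: "x0 \<in> sing_supp (f_MA \<epsilon> (\<lambda>x. \<alpha> * indicator D x))"
    and "x0 \<notin> \<Union> (special_lines \<gamma>) \<union> frontier D"
  then have x0: "x0 \<notin> \<Union> (special_lines \<gamma>)" "x0 \<notin> frontier D" by auto
  interpret boundary_curve D \<gamma> l by unfold_locales (use assms in auto)
  define P where "P s \<phi> = P_MA \<epsilon> (\<lambda>x. \<alpha> * indicator D x) s (dir \<phi>)" for s \<phi>
  obtain B M where Pm: "(\<lambda>z. P (snd z) (fst z)) \<in> borel_measurable borel" and PB: "\<And>s \<phi>. \<bar>P s \<phi>\<bar> \<le> B"
    and PM: "\<And>s \<phi>. M < \<bar>s\<bar> \<Longrightarrow> P s \<phi> = 0"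
    unfolding P_def by (rule P_MA_props[OF assms(1,2)]) blast
  have pieces: "\<exists>d>0. \<forall>\<beta> \<eta> N. smooth1 \<beta> \<longrightarrow> smooth1 \<eta> \<longrightarrow> (\<forall>\<phi>. d < \<bar>\<phi> - \<phi>0\<bar> \<longrightarrow> \<beta> \<phi> = 0) \<longrightarrow> (\<forall>y. d < \<bar>y\<bar> \<longrightarrow> \<eta> y = 0) \<longrightarrow>
      (\<exists>C. \<forall>\<sigma>. \<forall>x\<in>ball x0 d. \<bar>\<sigma>\<bar> ^ N * norm (osc (\<lambda>z. \<beta> (fst z) * \<eta> (snd z - x0 \<bullet> dir (fst z)) * P (snd z) (fst z)) \<sigma> x) \<le> C)"
    for \<phi>0
  proof -
    obtain h \<delta> where h: "\<delta> > 0" "\<And>n. tame n {\<phi>0 - \<delta><..<\<phi>0 + \<delta>} (UNIV :: unit set) (\<lambda>_. h)"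
      "h \<phi>0 = x0 \<bullet> dir \<phi>0" "deriv h \<phi>0 \<noteq> x0 \<bullet> perp (dir \<phi>0)"
      "\<And>n. tame n {\<phi>0 - \<delta><..<\<phi>0 + \<delta>} {r. 0 < \<bar>r\<bar> \<and> \<bar>r\<bar> < \<delta>} (\<lambda>r \<phi>. P (h \<phi> + r) \<phi>)"
      unfolding P_def by (rule local_phase[OF assms(7,8,1,2) x0]) blast
    obtain d where d: "d > 0"
      "\<And>\<beta> \<eta> N. smooth1 \<beta> \<Longrightarrow> smooth1 \<eta> \<Longrightarrow> (\<And>\<phi>. d < \<bar>\<phi> - \<phi>0\<bar> \<Longrightarrow> \<beta> \<phi> = 0) \<Longrightarrow> (\<And>y. d < \<bar>y\<bar> \<Longrightarrow> \<eta> y = 0) \<Longrightarrow>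
      \<exists>C. \<forall>\<sigma>. \<forall>x\<in>ball x0 d. \<bar>\<sigma>\<bar> ^ N * norm (osc (\<lambda>z. \<beta> (fst z) * \<eta> (snd z - x0 \<bullet> dir (fst z)) * P (snd z) (fst z)) \<sigma> x) \<le> C"
      unfolding osc_def by (rule near_piece[OF h Pm PB]) blast
    then show ?thesis by (intro exI[of _ d]) simp
  qed
  obtain d \<rho> where d: "d > 0" and \<rho>: "0 < \<rho>" "\<rho> < pi" and near:
    "\<And>w \<eta> N. smooth1 w \<Longrightarrow> smooth1 \<eta> \<Longrightarrow> (\<And>y. d < \<bar>y\<bar> \<Longrightarrow> \<eta> y = 0) \<Longrightarrow>
      \<exists>C. \<forall>\<sigma>. \<forall>x\<in>ball x0 d. \<bar>\<sigma>\<bar> ^ N * norm (osc (\<lambda>z. w (fst z) * (smooth_step \<rho> (fst z) - smooth_step \<rho> (fst z - pi)) *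
        \<eta> (snd z - x0 \<bullet> dir (fst z)) * P (snd z) (fst z)) \<sigma> x) \<le> C"
    apply (rule near_uniform[OF pieces Pm PB, of M])
     apply (erule PM)
    subgoal premises prems for d \<rho> by (rule prems(1)[OF prems(2-5)])
    done
  \<comment> \<open>The far part has gap \<delta> = d/2, and its smoothness is available on the ball
    of radius \<delta>/2.\<close>
  let ?U = "ball x0 (d / 2 / 2)"
  \<comment> \<open>The step in d^2 - y^2 is a smooth bump: its argument is at most 0 for |y| \<ge>
    d and at least 3/4 d^2 for |y| \<le> d/2.\<close>
  define \<eta> where "\<eta> y = smooth_step (3 / 4 * d\<^sup>2) (d\<^sup>2 - y * y)" for y
  have d2: "3 / 4 * d\<^sup>2 > 0" using d by simp
  have s\<eta>: "smooth1 \<eta>"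
    unfolding \<eta>_def
    by (rule smooth1_compose[OF smooth1_smooth_step[OF d2] smooth1_diff[OF smooth1_const smooth1_mult[OF smooth1_ident smooth1_ident]]])
  have \<eta>0: "\<eta> y = 0" if "d < \<bar>y\<bar>" for y
  proof -
    have "d * d \<le> \<bar>y\<bar> * \<bar>y\<bar>" using that d by (intro mult_mono) auto
    then show ?thesis unfolding \<eta>_def by (intro smooth_step_eq_0[OF d2]) (simp add: power2_eq_square)
  qed
  have \<eta>1: "\<eta> y = 1" if "\<bar>y\<bar> < d / 2" for y
  proof -
    have "\<bar>y\<bar> * \<bar>y\<bar> \<le> d / 2 * (d / 2)" using that d by (intro mult_mono) auto
    then show ?thesis unfolding \<eta>_def by (intro smooth_step_eq_1[OF d2]) (simp add: power2_eq_square)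
  qed
  define A where "A z = 1 / (4 * pi\<^sup>2) * (smooth_step \<rho> (fst z) - smooth_step \<rho> (fst z - pi)) * P (snd z) (fst z)" for z
  \<comment> \<open>\<open>An\<close> keeps lines at distance at most d from x0, \<open>Af\<close>
    lines at distance at least d/2.\<close>
  define An where "An z = \<eta> (snd z - x0 \<bullet> dir (fst z)) * A z" for z
  define Af where "Af z = (1 - \<eta> (snd z - x0 \<bullet> dir (fst z))) * A z" for z
  have A: "amplitude A"
    using amplitude_P_MA[OF assms(1,2) \<rho>] unfolding A_def[abs_def] P_def .
  have c\<eta>: "continuous_on UNIV (\<lambda>z. \<eta> (snd z - x0 \<bullet> dir (fst z)))"
    by (intro continuous_intros continuous_on_compose2[OF smooth1_continuous_on[OF s\<eta>, of UNIV]]) auto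
  have An: "amplitude An" and Af: "amplitude Af"
    unfolding An_def Af_def by (intro amplitude_mult_continuous A c\<eta> continuous_intros)+
  have far: "d / 2 \<le> \<bar>snd z - x0 \<bullet> dir (fst z)\<bar>" if "Af z \<noteq> 0" for z
    using \<eta>1[of "snd z - x0 \<bullet> dir (fst z)"] that by (force simp: Af_def not_le[symmetric])
  have rapid: "rapidly_decaying ?U (\<lambda>z. w (fst z) * An z)" if w: "smooth1 w" for w
    unfolding rapidly_decaying_def
  proof
    fix N
    \<comment> \<open>The constant of the filter is absorbed in the angular weight.\<close>
    have "smooth1 (\<lambda>\<phi>. w \<phi> * (1 / (4 * pi\<^sup>2)))" by (intro smooth1_mult w smooth1_const)
    from near[OF this s\<eta> \<eta>0, of N] obtain C where C: "\<And>\<sigma> x. x \<in> ball x0 d \<Longrightarrow>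
      \<bar>\<sigma>\<bar> ^ N * norm (osc (\<lambda>z. (w (fst z) * (1 / (4 * pi\<^sup>2))) * (smooth_step \<rho> (fst z) - smooth_step \<rho> (fst z - pi)) *
        \<eta> (snd z - x0 \<bullet> dir (fst z)) * P (snd z) (fst z)) \<sigma> x) \<le> C" by blast
    have "(\<lambda>z. (w (fst z) * (1 / (4 * pi\<^sup>2))) * (smooth_step \<rho> (fst z) - smooth_step \<rho> (fst z - pi)) *
        \<eta> (snd z - x0 \<bullet> dir (fst z)) * P (snd z) (fst z)) = (\<lambda>z. w (fst z) * An z)"
      by (simp add: An_def A_def mult_ac)
    then show "\<exists>C. \<forall>\<sigma>. \<forall>x\<in>?U. \<bar>\<sigma>\<bar> ^ N * norm (osc (\<lambda>z. w (fst z) * An z) \<sigma> x) \<le> C"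
      using C d by (intro exI[of _ C] allI ballI) auto
  qed
  \<comment> \<open>The smooth densities of the near and the far lines; their sum represents
    \<open>f_MA\<close> near x0, against the choice of x0 in the singular support.\<close>
  define gn where "gn x = (LINT \<sigma>|lborel. of_real \<bar>\<sigma>\<bar> * osc An \<sigma> x)" for x
  define gf where "gf x = (LINT z|lborel. complex_of_real (- 2 / (snd z - x \<bullet> dir (fst z))\<^sup>2 * Af z))" for x
  have gn: "smooth_on ?U gn" unfolding gn_def by (rule near_smooth[OF open_ball An rapid])
  have gf: "smooth_on ?U gf" unfolding gf_def using far_smooth[OF _ Af far] d by simp
  have "\<forall>\<psi>. test_function_on ?U \<psi> \<longrightarrow> f_MA \<epsilon> (\<lambda>x. \<alpha> * indicator D x) \<psi> = (LINT x|lborel. (gn x + gf x) * \<psi> x)"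
  proof (intro allI impI)
    fix \<psi> :: "real^2 \<Rightarrow> complex" assume \<psi>U: "test_function_on ?U \<psi>"
    then have \<psi>: "test_function_on UNIV \<psi>" by (simp add: test_function_on_def)
    have supp: "x \<in> ?U" if "\<psi> x \<noteq> 0" for x
      using \<psi>U that closure_subset[of "{x. \<psi> x \<noteq> 0}"] by (auto simp: test_function_on_def)
    note int = amplitude_riesz_integrable[OF _ \<psi>]
    have "f_MA \<epsilon> (\<lambda>x. \<alpha> * indicator D x) \<psi> = (LINT z|lborel. of_real (A z) * riesz_radon \<psi> (snd z) (fst z))"
      using f_MA_smooth_cutoff[OF assms(1,2) \<psi> \<rho>] unfolding A_def[abs_def] P_def .
    also have "\<dots> = (LINT z|lborel. of_real (An z) * riesz_radon \<psi> (snd z) (fst z) + of_real (Af z) * riesz_radon \<psi> (snd z) (fst z))"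
      by (intro Bochner_Integration.integral_cong refl) (simp add: An_def Af_def algebra_simps)
    also have "\<dots> = (LINT z|lborel. of_real (An z) * riesz_radon \<psi> (snd z) (fst z)) + (LINT z|lborel. of_real (Af z) * riesz_radon \<psi> (snd z) (fst z))"
      by (rule Bochner_Integration.integral_add[OF int[OF An] int[OF Af]])
    also have "(LINT z|lborel. of_real (An z) * riesz_radon \<psi> (snd z) (fst z)) = (LINT x|lborel. gn x * \<psi> x)"
      unfolding gn_def by (rule near_pairing[OF \<psi> supp An]) (use rapid[OF smooth1_const[of 1]] in auto)
    also have "(LINT z|lborel. of_real (Af z) * riesz_radon \<psi> (snd z) (fst z)) = (LINT x|lborel. gf x * \<psi> x)"
      unfolding gf_def by (rule far_pairing[OF _ Af far \<psi> supp]) (use d in auto)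
    also have "(LINT x|lborel. gn x * \<psi> x) + (LINT x|lborel. gf x * \<psi> x) = (LINT x|lborel. (gn x + gf x) * \<psi> x)"
      unfolding distrib_right
      by (rule Bochner_Integration.integral_add[symmetric]) (intro smooth_on_times_test_function_integrable[OF _ \<psi>U] gn gf)+
    finally show "f_MA \<epsilon> (\<lambda>x. \<alpha> * indicator D x) \<psi> = (LINT x|lborel. (gn x + gf x) * \<psi> x)" .
  qed
  moreover have "smooth_on ?U (\<lambda>x. gn x + gf x)" by (rule smooth_on_add[OF open_ball gn gf])
  moreover have "x0 \<in> ?U" using d by simp
  ultimately have "x0 \<notin> sing_supp (f_MA \<epsilon> (\<lambda>x. \<alpha> * indicator D x))"
    unfolding sing_supp_def using open_ball by blast
  with sing show False by simp
qed

end
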